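(* Let $K$ be the Galois closure of the extension $F|H$, where $F=\mathbb{K}(x,y)$ with $y^q+y=x^m+x^{-m}$, and $H=\mathbb{K}(x^{m(q-1)})$. Then $$\mathrm{Aut}_{\mathbb{K}}(K)=\Delta\rtimes(C_{m(q-1)}\rtimes\langle\xi\rangle),$$ where $\Delta$ is an elementary abelian normal subgroup of order $q^2$, $C_{m(q-1)}$ is a cyclic subgroup of order $m(q-1)$, and $\xi$ is an involution.
   Context: Here $p$ is an odd prime, $q=p^h$ with $h\ge 1$, $\mathbb{K}$ is the algebraic closure of $\mathbb{F}_q$, $m\ge 1$ is an integer prime to $p$, and $x$ is transcendental over $\mathbb{K}$. $\mathrm{Aut}_{\mathbb{K}}(K)$ is the group of field automorphisms of $K$ fixing $\mathbb{K}$ elementwise. The paper represents $K$ as $K=\mathbb{K}(x,y,z)$ with $y^q+y=x^m+x^{-m}$ and $z^q+z=x^m$; putting $s=y-z$ one has $K=\mathbb{K}(x,s,z)$ with $s^q+s=x^{-m}$ and $z^q+z=x^m$. In these coordinates $\Delta$ is the group of all $\mathbb{K}$-automorphisms $(x,s,z)\mapsto(x,s+\alpha,z+\beta)$ with $\alpha,\beta\in\mathbb{K}$, $\alpha^q+\alpha=\beta^q+\beta=0$, and $\xi$ is the $\mathbb{K}$-automorphism $(x,s,z)\mapsto(1/x,z,s)$.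
   Formalization: The case q=3 is excluded: there F|H is already Galois, so K=F, which contains no z with z^q+z=x^m and admits no group of order 9; the existence of z and the structure of the automorphism group are proved for all other q. *)

theory Defs
  imports "HOL-Algebra.Algebra"
begin

text \<open>
  Normality: the minimal polynomial over \<open>H\<close> of every element of \<open>L\<close> splits in \<open>L\<close>.
  Separability: these minimal polynomials have simple roots only. Since they split in \<open>L\<close>,
  it is enough to look at roots in \<open>L\<close>.
\<close>

definition galois_extension :: "('a, 'b) ring_scheme \<Rightarrow> 'a set \<Rightarrow> bool" where
  "galois_extension L H \<longleftrightarrow>
     field L \<and> subfield H L \<and>
     (\<forall>a\<in>carrier L. ring.algebraic L H a \<and>
        ring.splitted L (ring.Irr L H a) \<and>
        (\<forall>b\<in>carrier L. ring.alg_mult L (ring.Irr L H a) b \<le> 1))"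

definition galois_closure :: "('a, 'b) ring_scheme \<Rightarrow> 'a set \<Rightarrow> 'a set \<Rightarrow> bool" where
  "galois_closure L F H \<longleftrightarrow>
     galois_extension L H \<and> subfield F L \<and> H \<subseteq> F \<and>
     (\<forall>M. subfield M L \<and> F \<subseteq> M \<and> galois_extension (L\<lparr>carrier := M\<rparr>) H \<longrightarrow> M = carrier L)"

text \<open>As for the automorphism group of a group in the library, automorphisms are extensional
  functions, so that distinct elements differ at some point of the carrier.\<close>

definition field_aut_group :: "('a, 'b) ring_scheme \<Rightarrow> 'a set \<Rightarrow> ('a \<Rightarrow> 'a) monoid" where
  "field_aut_group L k =
     BijGroup (carrier L)\<lparr>carrier :=
       {\<sigma> \<in> ring_hom L L \<inter> Bij (carrier L). \<forall>a\<in>k. \<sigma> a = a}\<rparr>"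

definition internal_semidirect :: "('g, 'b) monoid_scheme \<Rightarrow> 'g set \<Rightarrow> 'g set \<Rightarrow> bool" where
  "internal_semidirect G N U \<longleftrightarrow>
     N \<lhd> G \<and> subgroup U G \<and> N \<inter> U = {\<one>\<^bsub>G\<^esub>} \<and> N <#>\<^bsub>G\<^esub> U = carrier G"

definition elementary_abelian :: "nat \<Rightarrow> ('g, 'b) monoid_scheme \<Rightarrow> bool" where
  "elementary_abelian p G \<longleftrightarrow> Factorial_Ring.prime p \<and> comm_group G \<and> (\<forall>g\<in>carrier G. g [^]\<^bsub>G\<^esub> p = \<one>\<^bsub>G\<^esub>)"

definition translation_group ::
  "('a, 'b) ring_scheme \<Rightarrow> 'a set \<Rightarrow> nat \<Rightarrow> 'a \<Rightarrow> 'a \<Rightarrow> 'a \<Rightarrow> ('a \<Rightarrow> 'a) set" where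
  "translation_group L k q x s z =
     {\<sigma> \<in> carrier (field_aut_group L k). \<exists>\<alpha>\<in>k. \<exists>\<beta>\<in>k.
        \<alpha> [^]\<^bsub>L\<^esub> q \<oplus>\<^bsub>L\<^esub> \<alpha> = \<zero>\<^bsub>L\<^esub> \<and> \<beta> [^]\<^bsub>L\<^esub> q \<oplus>\<^bsub>L\<^esub> \<beta> = \<zero>\<^bsub>L\<^esub> \<and>
        \<sigma> x = x \<and> \<sigma> s = s \<oplus>\<^bsub>L\<^esub> \<alpha> \<and> \<sigma> z = z \<oplus>\<^bsub>L\<^esub> \<beta>}"

end

theory Submission
  imports Defs "HOL-Library.Countable_Set"
begin

text \<open>
  Put n = m (q - 1) and s = y - z, so that s^q + s = x^(-m) and z^q + z = x^m. Translations of
  s and z by roots of t^q + t, the maps (c x, c^(-m) s, c^m z) with c^n = 1 and the exchange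
  (1/x, z, s) are automorphisms of k(x, s, z) (aut_exists). Those of the first two kinds generate a
  group Gal with fixed field k(x^n), so k(x, y, z) is Galois over k(x^n) (galois_polynomial) and
  minimality makes it the Galois closure.

  Existence of z (split_off_root): with w = x^n the element a = y x^m satisfies
  a^q + w a - w = w x^(2m), hence it is a root of (T^q + w T - w)^((q-1)/2) - w^((q+1)/2) over k(x^n). Its value at a
  pole of x shows that it has at least q (q - 1) / 2 conjugates, more than q if q \<noteq> 3. So some
  conjugate b violates the first equation, and z is a constant multiple of (b - a) / x^m.

  The main point is that there are no other automorphisms (classification). An automorphism f acts on
  differentials g dx/x by g \<mapsto> f(g) dd(f x) / f x with dd = x d/dx. This action preserves the regular
  differentials and commutes with the Cartier operator, so it preserves the union Vs of the finite sets of
  regular differentials on which that operator acts as a permutation. Regular differentials are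
  combinations of x^i s^a z^b with a, b < q, and its iterates kill the terms with i \<noteq> 0 or move them to i = 0; hence
  Vs lies in the span of the s^a z^b. It contains these monomials for a, b \<le> q - 2. Looking at the
  places above x = \<infinity> one sees that the coefficient of z^(q-1) vanishes for elements of Vs, which says
  that the sum of their images under the translations of z vanishes (Vs_trace). Applied to the images of
  s^a z^b under an automorphism f, this is a system of linear relations between the translates of
  the point (f s, f z), strong enough to put them all on one horizontal or vertical line (moments_line).
  So f s or f z is invariant under the translations of z, and by symmetry the same holds for the
  translations of s. Invariance of the same element under both is excluded by counting (not_both);
  in the remaining cases f or its product with the exchange sends s to a polynomial in s, which the equation
  forces to be of the known form (typ1_if_fixed).

  The arithmetic of function fields is developed for fields whose carrier is a whole type. The field of the
  theorem is countable, being algebraic over k(x^n) with k algebraic over a finite field, and an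
  enumeration of it carries the results over.
\<close>

section \<open>Subrings, polynomial functions and integer powers\<close>

context Fields.field begin

text \<open>Subrings and subfields are subsets of a type that is itself a field.\<close>

definition sring :: "'a set => bool" where
 "sring A \<longleftrightarrow> 0 \<in> A \<and> 1 \<in> A \<and> (\<forall>a\<in>A. \<forall>b\<in>A. a + b \<in> A) \<and> (\<forall>a\<in>A. - a \<in> A) \<and> (\<forall>a\<in>A. \<forall>b\<in>A. a * b \<in> A)"

definition sfield :: "'a set => bool" where
 "sfield A \<longleftrightarrow> sring A \<and> (\<forall>a\<in>A. inverse a \<in> A)"

definition rgen :: "'a set => 'a set" where "rgen S = \<Inter>{A. sring A \<and> S \<subseteq> A}"

definition fgen :: "'a set => 'a set" where "fgen S = \<Inter>{A. sfield A \<and> S \<subseteq> A}"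

lemma sringI:
 assumes "0 \<in> A" "1 \<in> A" "\<And>a b. a \<in> A ==> b \<in> A ==> a + b \<in> A" "\<And>a. a \<in> A ==> - a \<in> A"
  "\<And>a b. a \<in> A ==> b \<in> A ==> a * b \<in> A"
 shows "sring A"
 using assms by (auto simp: sring_def)

lemma sfieldI: "sring A ==> (\<And>a. a \<in> A ==> a \<noteq> 0 ==> inverse a \<in> A) ==> sfield A"
 unfolding sfield_def by (metis inverse_zero sring_def)

lemma sringD:
 assumes "sring A"
 shows "0 \<in> A" "1 \<in> A" "a \<in> A ==> b \<in> A ==> a + b \<in> A" "a \<in> A ==> - a \<in> A"
  "a \<in> A ==> b \<in> A ==> a * b \<in> A" "a \<in> A ==> b \<in> A ==> a - b \<in> A"
 using assms unfolding sring_def by (auto simp: diff_conv_add_uminus simp del: add_uminus_conv_diff)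

lemma sring_power: "sring A ==> a \<in> A ==> a ^ n \<in> A"
 by (induction n) (auto simp: sringD)

lemma sring_of_nat: "sring A ==> of_nat n \<in> A"
 by (induction n) (auto simp: sringD)

lemma sring_sum: "sring A ==> (\<And>i. i \<in> I ==> f i \<in> A) ==> sum f I \<in> A"
 by (induction I rule: infinite_finite_induct) (auto simp: sringD)

lemma sfield_sring: "sfield A ==> sring A" by (simp add: sfield_def)

lemma sfield_inverse: "sfield A ==> a \<in> A ==> inverse a \<in> A" by (simp add: sfield_def)

lemma sfield_divide: "sfield A ==> a \<in> A ==> b \<in> A ==> a / b \<in> A"
 by (simp add: sfield_inverse sringD(5) sfield_sring field_divide_inverse)

lemma sring_UNIV: "sring UNIV" by (simp add: sring_def)

lemma sring_rgen: "sring (rgen S)"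
 unfolding rgen_def by (rule sringI) (auto simp: sringD)

lemma rgen_incl: "S \<subseteq> rgen S" by (auto simp: rgen_def)

lemma rgen_least: "sring A ==> S \<subseteq> A ==> rgen S \<subseteq> A" by (auto simp: rgen_def)

lemma sfield_fgen: "sfield (fgen S)"
 unfolding sfield_def fgen_def
 by (intro conjI sringI ballI) (auto simp: sringD sfield_inverse sfield_sring)

lemma fgen_incl: "S \<subseteq> fgen S" by (auto simp: fgen_def)

lemma fgen_least: "sfield A ==> S \<subseteq> A ==> fgen S \<subseteq> A" by (auto simp: fgen_def)

lemma rgen_fgen: "rgen S \<subseteq> fgen S"
 by (rule rgen_least[OF sfield_sring[OF sfield_fgen] fgen_incl])

lemma fraction_sfield:
 assumes R: "sring R"
 shows "sfield {a / b |a b. a \<in> R \<and> b \<in> R}"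
proof (rule sfieldI)
 show "sring {a / b |a b. a \<in> R \<and> b \<in> R}"
 proof (rule sringI)
  show "0 \<in> {a / b |a b. a \<in> R \<and> b \<in> R}" "1 \<in> {a / b |a b. a \<in> R \<and> b \<in> R}"
   using sringD(1,2)[OF R] by (force intro: exI[of _ 0] exI[of _ 1])+
  fix u v assume "u \<in> {a / b |a b. a \<in> R \<and> b \<in> R}" "v \<in> {a / b |a b. a \<in> R \<and> b \<in> R}"
  then obtain a b c d where u: "u = a / b" "a \<in> R" "b \<in> R" and v: "v = c / d" "c \<in> R" "d \<in> R" by auto
  show "u * v \<in> {a / b |a b. a \<in> R \<and> b \<in> R}"
   using u v sringD(5)[OF R, of a c] sringD(5)[OF R, of b d] times_divide_times_eq[of a b c d] by blast
  show "u + v \<in> {a / b |a b. a \<in> R \<and> b \<in> R}"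
  proof (cases "b = 0 \<or> d = 0")
   case True then have "u + v = a / b \<or> u + v = c / d" using u v by auto
   then show ?thesis using u v by blast
  next
   case False
   then have "u + v = (a * d + c * b) / (b * d)" using u v by (simp add: add_frac_eq)
   then show ?thesis using u v sringD(3,5)[OF R] by blast
  qed
 next
  fix u assume "u \<in> {a / b |a b. a \<in> R \<and> b \<in> R}"
  then obtain a b where u: "u = a / b" "a \<in> R" "b \<in> R" by auto
  then have "- u = (- a) / b" by simp
  then show "- u \<in> {a / b |a b. a \<in> R \<and> b \<in> R}" using u sringD(4)[OF R] by blast
 qed
next
 fix u assume "u \<in> {a / b |a b. a \<in> R \<and> b \<in> R}"
 then obtain a b where u: "u = a / b" "a \<in> R" "b \<in> R" by auto
 then have "inverse u = b / a" by simp
 then show "inverse u \<in> {a / b |a b. a \<in> R \<and> b \<in> R}" using u by blast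
qed

lemma fgen_fraction: "fgen S = {a / b |a b. a \<in> rgen S \<and> b \<in> rgen S}"
proof
 show "fgen S \<subseteq> {a / b |a b. a \<in> rgen S \<and> b \<in> rgen S}"
 proof (rule fgen_least[OF fraction_sfield[OF sring_rgen]], rule subsetI)
  fix a assume "a \<in> S"
  then have "a \<in> rgen S" "1 \<in> rgen S" "a = a / 1" using rgen_incl sringD(2)[OF sring_rgen] by auto
  then show "a \<in> {a / b |a b. a \<in> rgen S \<and> b \<in> rgen S}" by blast
 qed
 show "{a / b |a b. a \<in> rgen S \<and> b \<in> rgen S} \<subseteq> fgen S"
  using subsetD[OF rgen_fgen] sfield_divide[OF sfield_fgen] by auto
qed

text \<open>Polynomials are lists of coefficients, the constant coefficient first.\<close>

primrec peval :: "'a list => 'a => 'a" where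
 "peval [] t = 0"
| "peval (a # as) t = a + t * peval as t"

definition polys :: "'a set => ('a => 'a) set" where
 "polys A = {f. \<exists>as. set as \<subseteq> A \<and> f = peval as}"

lemma peval_append: "peval (as @ bs) t = peval as t + t ^ length as * peval bs t"
 by (induction as) (auto simp: algebra_simps)

lemma peval_map: "peval (map c [0..<n]) t = (\<Sum>i<n. c i * t ^ i)"
 by (induction n) (auto simp: peval_append algebra_simps)

lemma peval_sum: "peval as t = (\<Sum>i<length as. as ! i * t ^ i)"
 using peval_map[of "(!) as" "length as" t] by (simp add: map_nth)

lemma peval_in: "sring A ==> set as \<subseteq> A ==> t \<in> A ==> peval as t \<in> A"
 by (induction as) (auto simp: sringD)

lemma polysI: "set as \<subseteq> A ==> peval as \<in> polys A" by (auto simp: polys_def)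

lemma polys_const: "a \<in> A ==> (%t. a) \<in> polys A"
 unfolding polys_def by (auto intro!: exI[of _ "[a]"])

lemma polys_id: "sring A ==> (%t. t) \<in> polys A"
 unfolding polys_def by (auto intro!: exI[of _ "[0, 1]"] simp: sringD)

lemma polys_add:
 assumes A: "sring A" and "f \<in> polys A" "g \<in> polys A"
 shows "(%t. f t + g t) \<in> polys A"
proof -
 have "\<exists>cs. set cs \<subseteq> A \<and> (\<forall>t. peval as t + peval bs t = peval cs t)"
  if "set as \<subseteq> A" "set bs \<subseteq> A" for as bs
  using that
 proof (induction as arbitrary: bs)
  case (Cons a as)
  show ?case
  proof (cases bs)
   case Nil then show ?thesis using Cons.prems by (intro exI[of _ "a # as"]) auto
  next
   case (Cons b bs')
   with Cons.IH[of bs'] Cons.prems obtain cs where "set cs \<subseteq> A" "\<forall>t. peval as t + peval bs' t = peval cs t" by auto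
   moreover have "peval (a # as) t + peval bs t = (a + b) + t * (peval as t + peval bs' t)" for t
    using Cons by (simp add: distrib_left add.assoc add.left_commute)
   ultimately have "\<forall>t. peval (a # as) t + peval bs t = peval ((a + b) # cs) t" by simp
   moreover have "set ((a + b) # cs) \<subseteq> A" using \<open>set cs \<subseteq> A\<close> Cons Cons.prems sringD(3)[OF A] by simp
   ultimately show ?thesis by blast
  qed
 qed auto
 moreover obtain as bs where "set as \<subseteq> A" "f = peval as" "set bs \<subseteq> A" "g = peval bs"
  using assms(2,3) by (auto simp: polys_def)
 ultimately obtain cs where "set cs \<subseteq> A" "\<And>t. f t + g t = peval cs t" by meson
 then show ?thesis unfolding polys_def by auto
qed

lemma polys_scale:
 assumes A: "sring A" and "c \<in> A" "f \<in> polys A" shows "(%t. c * f t) \<in> polys A"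
proof -
 obtain as where as: "set as \<subseteq> A" "f = peval as" using assms by (auto simp: polys_def)
 have "c * peval as t = peval (map (%a. c * a) as) t" for t
 proof (induction as)
  case (Cons a as)
  have "c * peval (a # as) t = c * a + t * (c * peval as t)" by (simp add: algebra_simps)
  then show ?case using Cons by simp
 qed simp
 moreover have "set (map (%a. c * a) as) \<subseteq> A" using as(1) assms(2) sringD(5)[OF A] by auto
 ultimately show ?thesis using as(2) unfolding polys_def by blast
qed

lemma polys_mult:
 assumes A: "sring A" and "f \<in> polys A" and g: "g \<in> polys A"
 shows "(%t. f t * g t) \<in> polys A"
proof -
 have "(%t. peval as t * g t) \<in> polys A" if "set as \<subseteq> A" for as
  using that
 proof (induction as)
  case Nil then show ?case using polys_const[OF sringD(1)[OF A]] by simp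
 next
  case (Cons a as)
  have sh: "(%t. t * f t) \<in> polys A" if f: "f \<in> polys A" for f
  proof -
   obtain bs where bs: "set bs \<subseteq> A" "f = peval bs" using f by (auto simp: polys_def)
   show ?thesis unfolding polys_def using bs sringD(1)[OF A] by (auto intro!: exI[of _ "0 # bs"])
  qed
  have "(%t. a * g t + t * (peval as t * g t)) \<in> polys A"
   using Cons by (intro polys_add[OF A] polys_scale[OF A] g sh) auto
  then show ?case by (simp add: algebra_simps)
 qed
 then show ?thesis using assms(2) by (auto simp: polys_def)
qed

lemma polys_uminus: "sring A ==> f \<in> polys A ==> (%t. - f t) \<in> polys A"
 using polys_scale[of A "-1" f] by (simp add: sringD)

lemma polys_diff: "sring A ==> f \<in> polys A ==> g \<in> polys A ==> (%t. f t - g t) \<in> polys A"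
 using polys_add[of A f "%t. - g t"] polys_uminus[of A g] by simp

lemma polys_power: "sring A ==> f \<in> polys A ==> (%t. f t ^ n) \<in> polys A"
 by (induction n) (auto intro: polys_mult polys_const simp: sringD)

lemma rgen_insert:
 assumes A: "sring A"
 shows "rgen (insert t A) = {f t |f. f \<in> polys A}"
proof
 have mem: "f t \<in> {f t |f. f \<in> polys A}" if "f \<in> polys A" for f using that by auto
 have "sring {f t |f. f \<in> polys A}"
 proof (rule sringI)
  show "0 \<in> {f t |f. f \<in> polys A}" by (rule mem[OF polys_const[OF sringD(1)[OF A]]])
  show "1 \<in> {f t |f. f \<in> polys A}" by (rule mem[OF polys_const[OF sringD(2)[OF A]]])
  fix u v assume "u \<in> {f t |f. f \<in> polys A}" "v \<in> {f t |f. f \<in> polys A}"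
  then obtain f g where fg: "f \<in> polys A" "g \<in> polys A" "u = f t" "v = g t" by auto
  show "u + v \<in> {f t |f. f \<in> polys A}" using mem[OF polys_add[OF A fg(1,2)]] fg(3,4) by simp
  show "u * v \<in> {f t |f. f \<in> polys A}" using mem[OF polys_mult[OF A fg(1,2)]] fg(3,4) by simp
 next
  fix u assume "u \<in> {f t |f. f \<in> polys A}"
  then obtain f where f: "f \<in> polys A" "u = f t" by auto
  show "- u \<in> {f t |f. f \<in> polys A}" using mem[OF polys_uminus[OF A f(1)]] f(2) by simp
 qed
 moreover have "insert t A \<subseteq> {f t |f. f \<in> polys A}"
  using mem[OF polys_id[OF A]] mem[OF polys_const] by auto
 ultimately show "rgen (insert t A) \<subseteq> {f t |f. f \<in> polys A}" by (rule rgen_least)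
 have "peval as t \<in> rgen (insert t A)" if "set as \<subseteq> A" for as
  using that rgen_incl[of "insert t A"] by (intro peval_in[OF sring_rgen]) auto
 then show "{f t |f. f \<in> polys A} \<subseteq> rgen (insert t A)" by (auto simp: polys_def)
qed

text \<open>Synthetic division by T - c.\<close>

primrec sdiv :: "'a => 'a list => 'a list" where
 "sdiv c [] = []"
| "sdiv c (a # as) = (if as = [] then [] else peval as c # sdiv c as)"

lemma length_sdiv: "length (sdiv c as) = length as - 1"
 by (induction as) auto

lemma sdiv: "peval as t = (t - c) * peval (sdiv c as) t + peval as c"
proof (induction as)
 case (Cons a as)
 show ?case
 proof (cases "as = []")
  case False
  have "peval (a # as) t = a + t * ((t - c) * peval (sdiv c as) t + peval as c)" using Cons by simp
  also have "... = (t - c) * peval (sdiv c (a # as)) t + peval (a # as) c"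
   using False by (simp add: algebra_simps)
  finally show ?thesis .
 qed simp
qed simp

lemma sdiv_in: "sring A ==> set as \<subseteq> A ==> c \<in> A ==> set (sdiv c as) \<subseteq> A"
 by (induction as) (auto simp: peval_in)

lemma sdiv_zero: "set (sdiv c as) \<subseteq> {0} ==> peval as c = 0 ==> set as \<subseteq> {0}"
 by (induction as) (auto split: if_splits)

lemma poly_zero_if_many_roots:
 assumes "finite T" "length as \<le> card T" "\<And>t. t \<in> T ==> peval as t = 0"
 shows "set as \<subseteq> {0}"
 using assms
proof (induction "length as" arbitrary: as T)
 case (Suc n)
 then obtain c where c: "c \<in> T" by (metis card.empty ex_in_conv not_less_eq_eq zero_le)
 have "peval (sdiv c as) t = 0" if t: "t \<in> T - {c}" for t
  using sdiv[of as t c] Suc.prems(3)[of t] Suc.prems(3)[OF c] t by simp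
 moreover have "n = length (sdiv c as)" using Suc.hyps(2) by (simp add: length_sdiv)
 moreover have "length (sdiv c as) \<le> card (T - {c})"
  using Suc.prems(1,2) c by (simp add: length_sdiv)
 ultimately have "set (sdiv c as) \<subseteq> {0}" using Suc.hyps(1)[of "sdiv c as" "T - {c}"] Suc.prems(1) by auto
 then show ?case using sdiv_zero Suc.prems(3)[OF c] by blast
qed simp

lemma coeffs_zero_if_many_roots:
 assumes "finite T" "n \<le> card T" "\<And>t. t \<in> T ==> (\<Sum>i<n. c i * t ^ i) = 0" "i < n"
 shows "c i = 0"
 using poly_zero_if_many_roots[of T "map c [0..<n]"] assms by (auto simp: peval_map subset_iff)

lemma coeffs_const_if_many_values:
 assumes "finite T" "n \<le> card T" "\<And>t. t \<in> T ==> (\<Sum>i<n. c i * t ^ i) = a" "0 < n"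
 shows "c 0 = a" "\<And>i. 0 < i ==> i < n ==> c i = 0"
proof -
 let ?d = "%i. if i = 0 then c 0 - a else c i"
 have "(\<Sum>i<n. ?d i * t ^ i) = 0" if "t \<in> T" for t
 proof -
  obtain n' where n: "n = Suc n'" using assms(4) gr0_implies_Suc by blast
  have "c 0 + (\<Sum>i<n'. c (Suc i) * (t * t ^ i)) = a"
   using assms(3)[OF that] unfolding n by (simp add: sum.lessThan_Suc_shift del: sum.lessThan_Suc)
  then have "(c 0 - a) + (\<Sum>i<n'. c (Suc i) * (t * t ^ i)) = 0"
   by (metis add.commute add_diff_eq diff_self)
  then show ?thesis unfolding n by (simp add: sum.lessThan_Suc_shift del: sum.lessThan_Suc)
 qed
 from coeffs_zero_if_many_roots[OF assms(1,2) this]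
 have z: "?d i = 0" if "i < n" for i using that by blast
 show "c 0 = a" using z[OF assms(4)] by simp
 show "c i = 0" if "0 < i" "i < n" for i using z[OF that(2)] that(1) by simp
qed

lemma monic_roots_le:
 assumes "finite T" "\<And>t. t \<in> T ==> peval (as @ [1]) t = 0"
 shows "card T \<le> length as"
proof (rule ccontr)
 assume "\<not> ?thesis"
 then have "length (as @ [1]) \<le> card T" by simp
 from poly_zero_if_many_roots[OF assms(1) this assms(2)] show False by simp
qed

lemma frobenius_add_prime:
 assumes "Factorial_Ring.prime p" "of_nat p = (0::'a)"
 shows "((a::'a) + b) ^ p = a ^ p + b ^ p"
proof -
 obtain r where p: "p = Suc r" using assms(1) by (metis not0_implies_Suc not_prime_0)
 have "of_nat (p choose i) * a ^ i * b ^ (p - i) = 0" if "i \<in> {1..r}" for i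
 proof -
  have "p dvd (p choose i)" using assms(1) that p by (intro dvd_choose_prime) auto
  then have "of_nat (p choose i) = (0::'a)" using assms(2) by (auto elim!: dvdE)
  then show ?thesis by simp
 qed
 then have "(\<Sum>i=1..r. of_nat (p choose i) * a ^ i * b ^ (p - i)) = 0" by (rule sum.neutral[rule_format])
 moreover have "{..p} = insert 0 (insert p {1..r})" using p by auto
 ultimately show ?thesis using p by (simp add: binomial_ring algebra_simps del: power_Suc)
qed

lemma frobenius_add:
 assumes "Factorial_Ring.prime p" "of_nat p = (0::'a)"
 shows "((a::'a) + b) ^ (p ^ n) = a ^ (p ^ n) + b ^ (p ^ n)"
 by (induction n arbitrary: a b) (simp_all add: frobenius_add_prime[OF assms] power_mult)

lemma frobenius_uminus:
 assumes "odd n" shows "(- (a::'a)) ^ n = - (a ^ n)"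
 using assms by (simp add: power_minus_odd)

lemma frobenius_diff:
 assumes "Factorial_Ring.prime p" "of_nat p = (0::'a)" "odd p"
 shows "((a::'a) - b) ^ (p ^ n) = a ^ (p ^ n) - b ^ (p ^ n)"
 using frobenius_add[OF assms(1,2), of a "-b" n] assms(3) by (simp add: power_minus_odd)

text \<open>Integer exponents, since the values of functions at a place are integers.\<close>

definition zp :: "'a => int => 'a" where
 "zp a i = (if i \<ge> 0 then a ^ nat i else inverse a ^ nat (- i))"

lemma zp_nat [simp]: "zp a (int n) = a ^ n" by (simp add: zp_def)

lemma zp_0 [simp]: "zp a 0 = 1" by (simp add: zp_def)
lemma zp_1 [simp]: "zp a 1 = a" by (simp add: zp_def)

lemma zp_minus: "zp a (- i) = inverse (zp a i)"
 by (auto simp: zp_def power_inverse)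

lemma zp_nonzero: "a \<noteq> 0 ==> zp a i \<noteq> 0" by (simp add: zp_def)

lemma zp_diff_nat:
 assumes "a \<noteq> 0" shows "zp a (int m - int n) = a ^ m / a ^ n"
proof (cases "n \<le> m")
 case True
 then have "nat (int m - int n) = m - n" by simp
 then show ?thesis using True assms by (simp add: zp_def power_diff)
next
 case False
 then have "nat (- (int m - int n)) = n - m" by simp
 then show ?thesis using False assms by (simp add: zp_def power_diff power_inverse)
qed

lemma zp_add: assumes "a \<noteq> 0" shows "zp a (i + j) = zp a i * zp a j"
proof -
 obtain m n where i: "i = int m - int n" by (rule int_diff_cases)
 obtain m' n' where j: "j = int m' - int n'" by (rule int_diff_cases)
 have "i + j = int (m + m') - int (n + n')" using i j by simp
 then have "zp a (i + j) = a ^ (m + m') / a ^ (n + n')" using zp_diff_nat[OF assms] by metis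
 also have "... = zp a i * zp a j" unfolding i j zp_diff_nat[OF assms] by (simp add: power_add)
 finally show ?thesis .
qed

lemma zp_mult_nat: "a \<noteq> 0 ==> zp a (i * int n) = zp a i ^ n"
 by (induction n) (simp_all add: distrib_left zp_add algebra_simps)

lemma zp_diff: "a \<noteq> 0 ==> zp a (i - j) = zp a i / zp a j"
 using zp_add[of a i "-j"] by (simp add: zp_minus divide_inverse)

lemma zp_inverse_base: "zp (inverse a) i = zp a (- i)"
 by (auto simp: zp_def)

end

section \<open>Algebraic elements and valuation rings\<close>

context Fields.field begin

text \<open>The field as a ring record with full carrier, to which the theory of algebraic elements
 applies.\<close>

definition Rg :: "'a ring" where
 "Rg = \<lparr>carrier = UNIV, monoid.mult = (*), one = 1, ring.zero = 0, ring.add = (+)\<rparr>"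

lemma Rg_simps: "carrier Rg = UNIV" "monoid.mult Rg = (*)" "\<one>\<^bsub>Rg\<^esub> = 1" "\<zero>\<^bsub>Rg\<^esub> = 0" "ring.add Rg = (+)"
 by (simp_all add: Rg_def)

lemma Rg_field: "Ring.field Rg"
proof -
 have "cring Rg"
 proof (rule cringI)
  show "abelian_group Rg"
   by (rule abelian_groupI) (auto simp: Rg_simps algebra_simps intro: exI[of _ "- _"] ab_left_minus)
  show "Group.comm_monoid Rg"
   by (rule comm_monoidI) (auto simp: Rg_simps algebra_simps)
 qed (auto simp: Rg_simps algebra_simps)
 then show ?thesis
 proof (rule cring.cring_fieldI2)
  show "\<exists>b\<in>carrier Rg. a \<otimes>\<^bsub>Rg\<^esub> b = \<one>\<^bsub>Rg\<^esub>" if "a \<in> carrier Rg" "a \<noteq> \<zero>\<^bsub>Rg\<^esub>" for a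
   using that by (auto simp: Rg_simps intro!: exI[of _ "inverse a"])
 qed (simp add: Rg_simps)
qed

lemma Rg_a_inv: "\<ominus>\<^bsub>Rg\<^esub> a = - a"
proof -
 interpret Rg: Ring.field Rg by (rule Rg_field)
 show ?thesis using Rg.minus_equality[of "-a" a] by (simp add: Rg_simps)
qed

lemma Rg_m_inv: "a \<noteq> 0 ==> inv\<^bsub>Rg\<^esub> a = inverse a"
proof -
 interpret Rg: Ring.field Rg by (rule Rg_field)
 assume "a \<noteq> 0"
 then show ?thesis using Rg.comm_inv_char[of a "inverse a"] by (simp add: Rg_simps)
qed

lemma Rg_eval: "ring.eval Rg as t = peval (rev as) t"
proof -
 interpret Rg: Ring.field Rg by (rule Rg_field)
 have pw: "t [^]\<^bsub>Rg\<^esub> n = t ^ n" for n :: nat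
  by (induction n) (simp_all add: Rg_simps power_commutes)
 show ?thesis by (induction as) (simp_all add: pw Rg_simps peval_append algebra_simps)
qed

lemma Rg_subfield: "sfield K \<longleftrightarrow> subfield K Rg"
proof
 interpret Rg: Ring.field Rg by (rule Rg_field)
 show "subfield K Rg" if K: "sfield K"
 proof (rule Rg.subfieldI')
  show "subring K Rg"
   using sringD[OF sfield_sring[OF K]] by (intro Rg.subringI) (auto simp: Rg_simps Rg_a_inv)
  show "inv\<^bsub>Rg\<^esub> a \<in> K" if "a \<in> K - {\<zero>\<^bsub>Rg\<^esub>}" for a
   using that sfield_inverse[OF K, of a] by (simp add: Rg_simps Rg_m_inv)
 qed
 show "sfield K" if K: "subfield K Rg"
 proof (rule sfieldI)
  show "sring K" using subringE[OF subfieldE(1)[OF K]] by (intro sringI) (auto simp: Rg_simps Rg_a_inv)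
  show "inverse a \<in> K" if "a \<in> K" "a \<noteq> 0" for a
   using Rg.subfield_m_inv(1)[OF K, of a] that by (simp add: Rg_simps Rg_m_inv)
 qed
qed

definition alg :: "'a set => 'a => bool" where
 "alg K a \<longleftrightarrow> (\<exists>as. set as \<subseteq> K \<and> \<not> set as \<subseteq> {0} \<and> peval as a = 0)"

lemma Rg_algebraic:
 assumes K: "sfield K"
 shows "alg K a \<longleftrightarrow> ring.algebraic Rg K a"
proof
 interpret Rg: Ring.field Rg by (rule Rg_field)
 have sub: "subring K Rg" using K Rg_subfield subfieldE(1) by blast
 show "ring.algebraic Rg K a" if al: "alg K a"
 proof -
  obtain as where as: "set as \<subseteq> K" "\<not> set as \<subseteq> {0}" "peval as a = 0" using al by (auto simp: alg_def)
  let ?f = "Rg.normalize (rev as)"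
  have ne: "Rg.normalize bs = [] ==> set bs \<subseteq> {0}" for bs
   by (induction bs) (auto simp: Rg_simps split: if_splits)
  have "?f \<in> carrier (K[X]\<^bsub>Rg\<^esub>)"
   using Rg.normalize_gives_polynomial[of "rev as" K] as(1) by (simp add: univ_poly_carrier[symmetric])
  moreover have "?f \<noteq> []" using ne[of "rev as"] as(2) by auto
  moreover have "Rg.eval ?f a = \<zero>\<^bsub>Rg\<^esub>"
   using Rg.eval_normalize[of "rev as" a] as(3) by (simp add: Rg_simps Rg_eval)
  ultimately show ?thesis using Rg.algebraicI[of ?f K a] by (simp add: over_def)
 qed
 show "alg K a" if al: "ring.algebraic Rg K a"
 proof -
  obtain f where f: "f \<in> carrier (K[X]\<^bsub>Rg\<^esub>)" "f \<noteq> []" "Rg.eval f a = \<zero>\<^bsub>Rg\<^esub>"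
   using Rg.algebraicE[OF sub, of a] al by (auto simp: over_def Rg_simps)
  then have "set f \<subseteq> K" "hd f \<noteq> 0"
   using f(1,2) by (auto simp: univ_poly_carrier[symmetric] polynomial_def Rg_simps)
  moreover have "\<not> set (rev f) \<subseteq> {0}" using f(2) \<open>hd f \<noteq> 0\<close> by (cases f) auto
  ultimately show ?thesis using f(3) unfolding alg_def
   by (intro exI[of _ "rev f"]) (auto simp: Rg_eval Rg_simps)
 qed
qed

text \<open>The algebraic elements form a subfield of the ring record.\<close>

lemma alg_sfield: assumes "sfield K" shows "sfield {a. alg K a}"
proof -
 interpret Rg: Ring.field Rg by (rule Rg_field)
 have "{a. alg K a} = {a \<in> carrier Rg. (Rg.algebraic over K) a}"
  using Rg_algebraic[OF assms] by (simp add: over_def Rg_simps)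
 then show ?thesis using Rg.subfield_of_algebraics[of K] assms by (simp add: Rg_subfield)
qed

lemma alg_self: "sfield K ==> a \<in> K ==> alg K a"
 unfolding alg_def by (intro exI[of _ "[-a, 1]"]) (auto simp: sringD sfield_sring)

text \<open>The inverse of an algebraic element is a polynomial in it.\<close>

lemma algebraic_ring_sfield:
 assumes K: "sfield K" and R: "sring R" "K \<subseteq> R" and al: "\<And>b. b \<in> R ==> alg K b"
 shows "sfield R"
proof (rule sfieldI[OF R(1)])
 fix b assume b: "b \<in> R" "b \<noteq> 0"
 have "inverse b \<in> R" if "set as \<subseteq> K" "\<not> set as \<subseteq> {0}" "peval as b = 0" for as
  using that
 proof (induction as)
  case (Cons a as)
  have pin: "peval as b \<in> R" using Cons.prems(1) R by (intro peval_in b(1)) auto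
  show ?case
  proof (cases "a = 0")
   case True then show ?thesis using Cons b by auto
  next
   case False
   have "b * peval as b = - a" using Cons.prems(3) by (simp add: eq_neg_iff_add_eq_0 add.commute)
   then have "b * (peval as b * inverse (- a)) = 1" using False by (simp add: mult.assoc[symmetric])
   then have "inverse b = peval as b * inverse (- a)" by (rule inverse_unique)
   moreover have "inverse (- a) \<in> R"
    using sfield_inverse[OF K, of "-a"] Cons.prems(1) R(2) sringD(4)[OF sfield_sring[OF K], of a] by auto
   ultimately show ?thesis using sringD(5)[OF R(1) pin] by metis
  qed
 qed simp
 then show "inverse b \<in> R" using al[OF b(1)] unfolding alg_def by blast
qed

end

class ffield = Fields.field +
 fixes kf :: "'a set" and chp :: "'a itself => nat"
 assumes kf: "sfield kf"
  and prime_chp: "Factorial_Ring.prime (chp TYPE('a))"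
  and char_chp: "of_nat (chp TYPE('a)) = 0"
  and root_ex: "as \<noteq> [] ==> set as \<subseteq> kf ==> \<exists>r\<in>kf. peval (as @ [1]) r = 0"
begin

definition valring :: "'a set => bool" where
 "valring V \<longleftrightarrow> sring V \<and> kf \<subseteq> V \<and> (\<forall>a. a \<in> V \<or> inverse a \<in> V)"

definition mx :: "'a set => 'a set" where "mx V = {a. a = 0 \<or> inverse a \<notin> V}"

text \<open>Equality of values, for which no value group has to be constructed.\<close>

definition veq :: "'a set => 'a => 'a => bool" where
 "veq V a b \<longleftrightarrow> a \<noteq> 0 \<and> b \<noteq> 0 \<and> a / b \<in> V \<and> b / a \<in> V"

lemma kf_ring: "sring kf" by (rule sfield_sring[OF kf])
lemmas kfD = sringD[OF kf_ring]

context
 fixes V assumes V: "valring V"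
begin

lemma V_ring: "sring V" using V by (simp add: valring_def)
lemmas VD = sringD[OF V_ring]
lemma V_kf: "c \<in> kf ==> c \<in> V" using V by (auto simp: valring_def)
lemma V_dich: "a \<notin> V ==> inverse a \<in> V" using V by (auto simp: valring_def)

lemma mx_in: "a \<in> mx V ==> a \<in> V" using V_dich[of a] VD(1) by (auto simp: mx_def)
lemma notin_mx: "a \<notin> V ==> inverse a \<in> mx V" by (simp add: mx_def)
lemma unitD: "a \<in> V ==> a \<notin> mx V ==> a \<noteq> 0" "a \<in> V ==> a \<notin> mx V ==> inverse a \<in> V" by (auto simp: mx_def)
lemma mx_0: "0 \<in> mx V" by (simp add: mx_def)
lemma one_notin_mx: "1 \<notin> mx V" using VD(2) by (simp add: mx_def)
lemma inverse_mx: "a \<in> mx V ==> a \<noteq> 0 ==> inverse a \<notin> V" by (simp add: mx_def)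

lemma mx_mult: assumes "a \<in> mx V" "b \<in> V" shows "a * b \<in> mx V"
proof (rule ccontr)
 assume n: "a * b \<notin> mx V"
 then have ab: "a * b \<noteq> 0" "inverse (a * b) \<in> V" by (auto simp: mx_def)
 then have "b * inverse (a * b) \<in> V" using VD(5) assms(2) by blast
 moreover have "b * inverse (a * b) = inverse a" using ab(1) by (simp add: field_simps)
 ultimately show False using assms(1) ab(1) by (auto simp: mx_def)
qed

lemma mx_mult': "a \<in> V ==> b \<in> mx V ==> a * b \<in> mx V" using mx_mult[of b a] by (simp add: mult.commute)

lemma mx_prime: assumes "a \<in> V" "b \<in> V" "a * b \<in> mx V" shows "a \<in> mx V \<or> b \<in> mx V"
proof (rule ccontr)
 assume "\<not> ?thesis"
 then have "a \<noteq> 0" "b \<noteq> 0" "inverse a \<in> V" "inverse b \<in> V" by (auto simp: mx_def)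
 then show False using assms(3) VD(5)[of "inverse a" "inverse b"] by (simp add: mx_def)
qed

lemma mx_minus: "a \<in> mx V ==> - a \<in> mx V" using VD(4)[of "inverse (-a)"] by (auto simp: mx_def)

lemma mx_add: assumes "a \<in> mx V" "b \<in> mx V" shows "a + b \<in> mx V"
proof -
 have *: "a + b \<in> mx V" if a: "a \<in> mx V" and b: "b \<in> mx V" and ab: "a / b \<in> V" "b \<noteq> 0" for a b
 proof -
  have "a + b = b * (a / b + 1)" using ab(2) by (simp add: field_simps)
  moreover have "a / b + 1 \<in> V" using ab VD by blast
  ultimately show ?thesis using mx_mult[OF b] by metis
 qed
 show ?thesis
 proof (cases "a = 0 \<or> b = 0")
  case False
  then have "inverse (a / b) = b / a" by simp
  then have "a / b \<in> V \<or> b / a \<in> V" using V_dich[of "a / b"] by auto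
  then show ?thesis using * assms False by (metis add.commute)
 qed (use assms in auto)
qed

lemma mx_diff: "a \<in> mx V ==> b \<in> mx V ==> a - b \<in> mx V"
 using mx_add[of a "- b"] mx_minus[of b] by simp

lemma unit_add_mx: "a \<in> V ==> a \<notin> mx V ==> b \<in> mx V ==> a + b \<notin> mx V"
 using mx_diff[of "a + b" b] by auto

lemma power_mx: "a \<in> mx V ==> 0 < n ==> a ^ n \<in> mx V"
 by (cases n) (auto intro: mx_mult sring_power[OF V_ring] mx_in)

lemma V_root: assumes "a ^ n \<in> V" "0 < n" shows "a \<in> V"
proof (rule ccontr)
 assume a: "a \<notin> V"
 then have "a \<noteq> 0" using VD(1) by blast
 have "inverse a ^ n \<in> mx V" using power_mx[OF notin_mx[OF a] assms(2)] .
 then show False using assms(1) \<open>a \<noteq> 0\<close> by (simp add: mx_def power_inverse)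
qed

lemma kf_mx: "c \<in> kf ==> c \<in> mx V ==> c = 0"
 using V_kf[OF sfield_inverse[OF kf, of c]] by (auto simp: mx_def)

lemma veq_refl: "a \<noteq> 0 ==> veq V a a" using VD(2) by (simp add: veq_def)
lemma veq_sym: "veq V a b ==> veq V b a" by (auto simp: veq_def)
lemma veq_trans: assumes "veq V a b" "veq V b c" shows "veq V a c"
proof -
 have "a / c = (a / b) * (b / c)" "c / a = (c / b) * (b / a)" using assms by (auto simp: veq_def)
 then show ?thesis using assms VD(5) unfolding veq_def by metis
qed

lemma veq_mult: assumes "veq V a b" "veq V c d" shows "veq V (a * c) (b * d)"
proof -
 have "a * c / (b * d) = (a / b) * (c / d)" "b * d / (a * c) = (b / a) * (d / c)" by simp_all
 then show ?thesis using assms VD(5) unfolding veq_def by (metis mult_eq_0_iff)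
qed

lemma veq_power: "veq V a b ==> veq V (a ^ n) (b ^ n)"
 by (induction n) (auto intro: veq_mult veq_refl)

lemma veq_inverse: "veq V a b ==> veq V (inverse a) (inverse b)"
 by (auto simp: veq_def field_simps)

lemma veq_divide: "veq V a b ==> veq V c d ==> veq V (a / c) (b / d)"
 using veq_mult[OF _ veq_inverse] by (simp add: divide_inverse)

lemma veq_in: "veq V a b ==> a \<in> V ==> b \<in> V"
 using VD(5)[of "b / a" a] by (auto simp: veq_def)

lemma unit_veq_1: "a \<in> V ==> a \<notin> mx V ==> veq V a 1"
 using unitD[of a] by (auto simp: veq_def divide_inverse)

lemma veq_mult_unit: "a \<noteq> 0 ==> u \<in> V ==> u \<notin> mx V ==> veq V (a * u) a"
 using veq_mult[OF veq_refl[of a] unit_veq_1[of u]] by simp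

lemma veq_add: assumes "b \<noteq> 0" "a / b \<in> mx V" shows "veq V (b + a) b"
proof -
 have "b + a = b * (1 + a / b)" using assms(1) by (simp add: field_simps)
 moreover have "1 + a / b \<notin> mx V" "1 + a / b \<in> V"
  using unit_add_mx[OF VD(2) one_notin_mx assms(2)] VD(3)[OF VD(2) mx_in[OF assms(2)]] by auto
 ultimately show ?thesis using veq_mult_unit[OF assms(1)] by metis
qed

lemma not_veq_cases:
 assumes "a \<noteq> 0" "b \<noteq> 0" "\<not> veq V a b" shows "a / b \<in> mx V \<or> b / a \<in> mx V"
proof (rule ccontr)
 assume n: "\<not> ?thesis"
 then have "inverse (a / b) \<in> V" "inverse (b / a) \<in> V" unfolding mx_def by blast+
 then show False using assms by (auto simp: veq_def)
qed

lemma veq_zp_inj: assumes "t \<in> mx V" "t \<noteq> 0" "veq V (zp t i) (zp t j)" shows "i = j"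
proof -
 have *: "\<not> i < j" if "veq V (zp t i) (zp t j)" for i j
 proof
  assume "i < j"
  then obtain n where n: "j - i = int n" "0 < n" by (metis zero_less_imp_eq_int diff_gt_0_iff_gt)
  have "zp t j / zp t i \<in> mx V"
   using power_mx[OF assms(1) n(2)] n(1) by (metis zp_diff[OF assms(2)] zp_nat)
  then have "zp t i / zp t j \<notin> V" using zp_nonzero[OF assms(2)] by (simp add: mx_def)
  then show False using that by (auto simp: veq_def)
 qed
 show ?thesis using *[OF assms(3)] *[OF veq_sym[OF assms(3)]] by auto
qed

text \<open>By induction, a new term either dominates the previous sum or is dominated by
 it.\<close>

lemma dominant_term:
 assumes "finite I" "\<And>i j. i \<in> I ==> j \<in> I ==> i \<noteq> j ==> f i \<noteq> 0 ==> f j \<noteq> 0 ==> \<not> veq V (f i) (f j)"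
  "\<exists>i\<in>I. f i \<noteq> 0"
 obtains i where "i \<in> I" "f i \<noteq> 0" "veq V (sum f I) (f i)" "\<And>j. j \<in> I ==> j \<noteq> i ==> f j / f i \<in> mx V"
proof -
 have "\<exists>i\<in>I. f i \<noteq> 0 \<and> veq V (sum f I) (f i) \<and> (\<forall>j\<in>I. j \<noteq> i --> f j / f i \<in> mx V)"
  using assms
 proof (induction I rule: finite_induct)
  case (insert x I)
  show ?case
  proof (cases "\<exists>i\<in>I. f i \<noteq> 0")
   case False
   then have "sum f I = 0" by simp
   then show ?thesis using False insert by (auto simp: veq_refl mx_0)
  next
   case True
   then obtain i where i: "i \<in> I" "f i \<noteq> 0" "veq V (sum f I) (f i)" "\<forall>j\<in>I. j \<noteq> i --> f j / f i \<in> mx V"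
    using insert.IH insert.prems(1) by blast
   have s: "sum f (insert x I) = f x + sum f I" using insert.hyps by simp
   show ?thesis
   proof (cases "f x = 0")
    case True then show ?thesis using i s by (auto simp: mx_0)
   next
    case False
    have "x \<noteq> i" using i(1) insert.hyps(2) by blast
    then have "\<not> veq V (f x) (f i)" using insert.prems(1)[of x i] i(1,2) False by blast
    then consider "f x / f i \<in> mx V" | "f i / f x \<in> mx V" using not_veq_cases False i(2) by blast
    then show ?thesis
    proof cases
     case 1
     have "f x / sum f I = (f x / f i) * (f i / sum f I)" "f i / sum f I \<in> V" "sum f I \<noteq> 0"
      using i(2,3) by (auto simp: veq_def)
     then have "veq V (sum f I + f x) (sum f I)" using 1 mx_mult veq_add by metis
     then have "veq V (sum f (insert x I)) (f i)" using i(3) veq_trans s by (metis add.commute)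
     then show ?thesis using i 1 by blast
    next
     case 2
     have "sum f I / f x = (f i / f x) * (sum f I / f i)" "sum f I / f i \<in> V"
      using i(2,3) by (auto simp: veq_def)
     then have "veq V (f x + sum f I) (f x)" using 2 mx_mult veq_add False by metis
     moreover have "f j / f x \<in> mx V" if "j \<in> I" for j
     proof (cases "j = i")
      case False
      have "f j / f x = (f j / f i) * (f i / f x)" using i(2) by simp
      then show ?thesis using i(4) False that 2 mx_mult mx_in by metis
     qed (use 2 in simp)
     ultimately show ?thesis using False s by auto
    qed
   qed
  qed
 qed simp
 then show ?thesis using that by blast
qed

end

end

section \<open>Places of function fields\<close>

context ffield begin

text \<open>If t becomes invertible in both A[a] and A[inverse a], the longer of the two relations
 can be shortened by the other one. This is the step of Chevalley's extension theorem.\<close>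

lemma shorten_relation:
 assumes A: "sring A" and a: "a \<noteq> 0"
  and inv: "\<And>e. e \<in> A ==> inverse (1 - t * e) \<in> A \<and> 1 - t * e \<noteq> 0" and t: "t \<in> A"
  and c: "\<And>i. c i \<in> A" "t * (\<Sum>i<Suc n. c i * a ^ i) = 1"
  and d: "\<And>i. d i \<in> A" "t * (\<Sum>i<Suc n'. d i * inverse a ^ i) = 1" and le: "n' \<le> n"
 shows "\<exists>c'. (\<forall>i. c' i \<in> A) \<and> t * (\<Sum>i<n. c' i * a ^ i) = 1"
proof -
 define e where "e = inverse (1 - t * d 0)"
 have e: "e \<in> A" "(1 - t * d 0) * e = 1" using inv[of "d 0"] d(1) by (auto simp: e_def)
 have "t * d 0 + t * (\<Sum>i<n'. d (Suc i) * inverse a ^ Suc i) = 1"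
  using d(2) by (simp add: sum.lessThan_Suc_shift distrib_left del: sum.lessThan_Suc)
 then have "1 - t * d 0 = t * (\<Sum>i<n'. d (Suc i) * inverse a ^ Suc i)"
  by (metis add_diff_cancel_left')
 then have "(1 - t * d 0) * a ^ n = (\<Sum>i<n'. t * d (Suc i) * (inverse a ^ Suc i * a ^ n))"
  by (simp add: sum_distrib_left sum_distrib_right mult.assoc)
 also have "... = (\<Sum>i<n'. t * d (Suc i) * a ^ (n - Suc i))"
 proof (rule sum.cong)
  fix i assume "i \<in> {..<n'}"
  then have "a ^ n = a ^ Suc i * a ^ (n - Suc i)"
   using le by (metis lessThan_iff less_le_trans Suc_leI power_add le_add_diff_inverse)
  moreover have "inverse a ^ Suc i * a ^ Suc i = 1" using a by (metis power_mult_distrib left_inverse power_one)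
  ultimately show "t * d (Suc i) * (inverse a ^ Suc i * a ^ n) = t * d (Suc i) * a ^ (n - Suc i)"
   by (metis mult.assoc mult_1_left)
 qed simp
 finally have an: "(1 - t * d 0) * a ^ n = (\<Sum>i<n'. t * d (Suc i) * a ^ (n - Suc i))" .
 have "a ^ n = ((1 - t * d 0) * e) * a ^ n" using e(2) by simp
 also have "... = e * ((1 - t * d 0) * a ^ n)" by (simp only: ac_simps)
 also have "... = (\<Sum>i<n'. e * t * d (Suc i) * a ^ (n - Suc i))"
  unfolding an by (simp add: sum_distrib_left mult.assoc)
 also have "... = (\<Sum>i<n. (if i < n' then e * t * d (Suc i) * a ^ (n - Suc i) else 0))"
 proof -
  have "{..<n} \<inter> {x. x < n'} = {..<n'}" using le by auto
  then show ?thesis by (simp add: sum.If_cases)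
 qed
 also have "... = (\<Sum>i<n. (if n - Suc i < n' then e * t * d (Suc (n - Suc i)) * a ^ (n - Suc (n - Suc i)) else 0))"
  by (rule sum.nat_diff_reindex[symmetric])
 also have "... = (\<Sum>i<n. (if n - Suc i < n' then e * t * d (n - i) else 0) * a ^ i)"
  by (rule sum.cong) (auto simp: Suc_diff_Suc)
 finally have an': "a ^ n = (\<Sum>i<n. (if n - Suc i < n' then e * t * d (n - i) else 0) * a ^ i)" .
 define c' where "c' i = c i + c n * (if n - Suc i < n' then e * t * d (n - i) else 0)" for i
 have "(\<Sum>i<n. c' i * a ^ i) = (\<Sum>i<n. c i * a ^ i) + c n * a ^ n"
  unfolding c'_def by (subst an') (simp add: sum.distrib distrib_right sum_distrib_left mult.assoc)
 then have "t * (\<Sum>i<n. c' i * a ^ i) = 1" using c(2) by (simp add: add.commute)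
 moreover have "c' i \<in> A" for i using c(1) d(1) e(1) t sringD[OF A] by (auto simp: c'_def)
 ultimately show ?thesis by blast
qed

text \<open>By Zorn's lemma; a ring that is maximal among those in which t is not invertible is a
 valuation ring.\<close>

lemma valring_exists:
 assumes t: "t \<noteq> 0" "inverse t \<notin> rgen (insert t kf)"
 obtains V where "valring V" "t \<in> mx V"
proof -
 define \<A> where "\<A> = {A. sring A \<and> kf \<subseteq> A \<and> t \<in> A \<and> inverse t \<notin> A}"
 have "\<exists>M\<in>\<A>. \<forall>B\<in>\<A>. M \<subseteq> B --> B = M"
 proof (rule subset_Zorn_nonempty)
  have "rgen (insert t kf) \<in> \<A>"
   using t sring_rgen rgen_incl[of "insert t kf"] by (auto simp: \<A>_def)
  then show "\<A> \<noteq> {}" by blast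
  fix \<C> assume ne: "\<C> \<noteq> {}" and ch: "subset.chain \<A> \<C>"
  then have sub: "\<C> \<subseteq> \<A>" and lin: "\<And>A B. A \<in> \<C> ==> B \<in> \<C> ==> A \<subseteq> B \<or> B \<subseteq> A"
   by (auto simp: subset_chain_def)
  have both: "\<exists>C\<in>\<C>. a \<in> C \<and> b \<in> C" if "a \<in> \<Union>\<C>" "b \<in> \<Union>\<C>" for a b
   using that lin by (metis UnionE subsetD)
  have rC: "sring C" if "C \<in> \<C>" for C using that sub by (auto simp: \<A>_def)
  have "sring (\<Union>\<C>)"
  proof (rule sringI)
   show "0 \<in> \<Union>\<C>" "1 \<in> \<Union>\<C>" using ne rC sringD(1,2) by blast+
   show "a + b \<in> \<Union>\<C>" "a * b \<in> \<Union>\<C>" if "a \<in> \<Union>\<C>" "b \<in> \<Union>\<C>" for a b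
    using both[OF that] rC sringD(3,5) by blast+
   show "- a \<in> \<Union>\<C>" if "a \<in> \<Union>\<C>" for a using that rC sringD(4) by blast
  qed
  then show "\<Union>\<C> \<in> \<A>" using ne sub unfolding \<A>_def by blast
 qed
 then obtain M where M: "M \<in> \<A>" and max: "\<And>B. B \<in> \<A> ==> M \<subseteq> B ==> B = M" by blast
 from M have R: "sring M" and kM: "kf \<subseteq> M" and tM: "t \<in> M" and itM: "inverse t \<notin> M" by (auto simp: \<A>_def)
 note MD = sringD[OF R]
 have inv: "inverse (1 - t * e) \<in> M \<and> 1 - t * e \<noteq> 0" if e: "e \<in> M" for e
 proof -
  have no: "1 \<noteq> t * b" if "b \<in> M" for b
   using that itM inverse_unique[of t b] by metis
  have nz: "1 - t * e \<noteq> 0" using no[OF e] by simp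
  have pw: "\<exists>b\<in>M. (1 - t * e) ^ n = 1 - t * b" for n
  proof (induction n)
   case 0 then show ?case using MD(1) by (intro bexI[of _ 0]) auto
  next
   case (Suc n)
   then obtain b where b: "b \<in> M" "(1 - t * e) ^ n = 1 - t * b" by blast
   have "(1 - t * e) ^ Suc n = (1 - t * e) * (1 - t * b)" using b(2) by simp
   also have "... = 1 - t * (b + e - e * t * b)" by (simp add: algebra_simps)
   finally have "(1 - t * e) ^ Suc n = 1 - t * (b + e - e * t * b)" .
   moreover have "b + e - e * t * b \<in> M" by (intro MD(6) MD(3) MD(5) b(1) e tM)
   ultimately show ?case by blast
  qed
  define Y where "Y = {a / (1 - t * e) ^ n |a n. a \<in> M}"
  have XI: "a \<in> M ==> a / (1 - t * e) ^ n \<in> Y" for a n by (auto simp: Y_def)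
  have em: "(1 - t * e) ^ n \<in> M" for n using pw[of n] tM MD by auto
  have MX: "M \<subseteq> Y" using XI[of _ 0] by auto
  have "sring Y"
  proof (rule sringI)
   show "0 \<in> Y" "1 \<in> Y" using MX MD(1,2) by auto
   fix u v assume "u \<in> Y" "v \<in> Y"
   then obtain a b i j where u: "u = a / (1 - t * e) ^ i" "a \<in> M" and v: "v = b / (1 - t * e) ^ j" "b \<in> M"
    by (auto simp: Y_def)
   have "u + v = (a * (1 - t * e) ^ j + b * (1 - t * e) ^ i) / (1 - t * e) ^ (i + j)"
    unfolding u v using nz by (simp add: add_frac_eq power_add)
   then show "u + v \<in> Y" using XI u v em MD(3,5) by metis
   have "u * v = (a * b) / (1 - t * e) ^ (i + j)" unfolding u v by (simp add: power_add)
   then show "u * v \<in> Y" using XI u v MD(5) by metis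
  next
   fix u assume "u \<in> Y"
   then obtain a i where u: "u = a / (1 - t * e) ^ i" "a \<in> M" by (auto simp: Y_def)
   have "- u = (- a) / (1 - t * e) ^ i" unfolding u by simp
   then show "- u \<in> Y" using XI u MD(4) by metis
  qed
  moreover have "inverse t \<notin> Y"
  proof
   assume "inverse t \<in> Y"
   then obtain a n where a: "inverse t = a / (1 - t * e) ^ n" "a \<in> M" by (auto simp: Y_def)
   obtain b where b: "b \<in> M" "(1 - t * e) ^ n = 1 - t * b" using pw by blast
   have "1 - t * b \<noteq> 0" using no[OF b(1)] by simp
   then have "1 - t * b = t * a" using a(1) t(1) unfolding b(2) by (simp add: field_simps)
   then have "1 = t * (a + b)" by (simp add: algebra_simps)
   then show False using no a(2) b(1) MD(3) by blast
  qed
  ultimately have "Y = M" using max[of Y] MX kM tM by (auto simp: \<A>_def)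
  moreover have "inverse (1 - t * e) \<in> Y" using XI[OF MD(2), of 1] by (simp add: divide_inverse)
  ultimately show ?thesis using nz by simp
 qed
 have rel: "\<exists>c n. (\<forall>i. c i \<in> M) \<and> t * (\<Sum>i<n. c i * a ^ i) = 1" if a: "a \<notin> M" for a
 proof -
  have "rgen (insert a M) \<noteq> M" using a rgen_incl[of "insert a M"] by auto
  then have "rgen (insert a M) \<notin> \<A>" using max[of "rgen (insert a M)"] rgen_incl[of "insert a M"] by blast
  then have "inverse t \<in> rgen (insert a M)"
   using sring_rgen[of "insert a M"] rgen_incl[of "insert a M"] kM tM by (auto simp: \<A>_def)
  then obtain as where as: "set as \<subseteq> M" "inverse t = peval as a"
   unfolding rgen_insert[OF R] by (auto simp: polys_def)
  let ?c = "%i. if i < length as then as ! i else 0"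
  have "\<forall>i. ?c i \<in> M" using as(1) MD(1) by auto
  moreover have "t * (\<Sum>i<length as. ?c i * a ^ i) = 1"
  proof -
   have "(\<Sum>i<length as. ?c i * a ^ i) = inverse t" using as(2) peval_sum[of as a] by simp
   then show ?thesis using t(1) by simp
  qed
  ultimately show ?thesis by (intro exI[of _ ?c] exI[of _ "length as"]) blast
 qed
 have no_rel: False if "a \<noteq> 0" "\<forall>i. c i \<in> M" "t * (\<Sum>i<n. c i * a ^ i) = 1"
  "\<forall>i. d i \<in> M" "t * (\<Sum>i<n'. d i * inverse a ^ i) = 1" for a c n d n'
  using that
 proof (induction "n + n'" arbitrary: n n' c d rule: less_induct)
  case less
  obtain r where r: "n = Suc r" using less.prems(3) by (cases n) auto
  obtain r' where r': "n' = Suc r'" using less.prems(5) by (cases n') auto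
  show False
  proof (cases "r' \<le> r")
   case True
   obtain c' where "\<forall>i. c' i \<in> M" "t * (\<Sum>i<r. c' i * a ^ i) = 1"
    using shorten_relation[OF R less.prems(1) inv tM, of c r d r'] less.prems(2-5) r r' True by blast
   then show False using less.hyps[of r n' c' d] less.prems r by auto
  next
   case False
   obtain d' where "\<forall>i. d' i \<in> M" "t * (\<Sum>i<r'. d' i * inverse a ^ i) = 1"
    using shorten_relation[OF R _ inv tM, of "inverse a" d r' c r] less.prems r r' False by auto
   then show False using less.hyps[of n r' c d'] less.prems r' by auto
  qed
 qed
 have "valring M"
  unfolding valring_def
 proof (intro conjI R kM allI)
  fix a show "a \<in> M \<or> inverse a \<in> M"
  proof (rule ccontr)
   assume n: "\<not> (a \<in> M \<or> inverse a \<in> M)"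
   then have "a \<noteq> 0" using MD(1) by blast
   then show False using rel[of a] rel[of "inverse a"] n no_rel by blast
  qed
 qed
 moreover have "t \<in> mx M" using itM by (simp add: mx_def)
 ultimately show ?thesis using that by blast
qed

text \<open>Over an algebraically closed field the value of P(t) is that of its lowest term.\<close>

lemma peval_value:
 assumes V: "valring V" and t: "t \<in> mx V" "t \<noteq> 0" and as: "set as \<subseteq> kf" "\<not> set as \<subseteq> {0}"
 shows "\<exists>n. veq V (peval as t) (t ^ n)"
 using as
proof (induction as)
 case (Cons a as)
 show ?case
 proof (cases "a = 0")
  case True
  then obtain n where "veq V (peval as t) (t ^ n)" using Cons by auto
  then have "veq V (peval (a # as) t) (t ^ Suc n)"
   using True veq_mult[OF V veq_refl[OF V t(2)]] by simp
  then show ?thesis by blast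
 next
  case False
  have "a \<in> V" "a \<notin> mx V" using False Cons.prems(1) kf_mx[OF V, of a] V_kf[OF V, of a] by auto
  moreover have "t * peval as t \<in> mx V"
   using Cons.prems(1) mx_in[OF V t(1)] V_kf[OF V] by (intro mx_mult[OF V t(1)] peval_in[OF V_ring[OF V]]) auto
  ultimately have "peval (a # as) t \<in> V" "peval (a # as) t \<notin> mx V"
   using unit_add_mx[OF V] VD(3)[OF V] mx_in[OF V] by auto
  then have "veq V (peval (a # as) t) (t ^ 0)" using unit_veq_1[OF V] by simp
  then show ?thesis by blast
 qed
qed simp

text \<open>A function field of one variable has no valuation ring of higher rank.\<close>

lemma rational_value:
 assumes V: "valring V" and t: "t \<in> mx V" "t \<noteq> 0" and a: "a \<in> fgen (insert t kf)" "a \<noteq> 0"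
 shows "\<exists>n. veq V a (zp t n)"
proof -
 obtain b c where bc: "a = b / c" "b \<in> rgen (insert t kf)" "c \<in> rgen (insert t kf)"
  using a(1) unfolding fgen_fraction by auto
 have nz: "b \<noteq> 0" "c \<noteq> 0" using a(2) bc(1) by auto
 have *: "\<exists>n. veq V b (t ^ n)" if "b \<in> rgen (insert t kf)" "b \<noteq> 0" for b
 proof -
  obtain as where as: "set as \<subseteq> kf" "b = peval as t"
   using \<open>b \<in> rgen (insert t kf)\<close> unfolding rgen_insert[OF kf_ring] by (auto simp: polys_def)
  have "peval as t = 0" if "set as \<subseteq> {0}" using that by (induction as) auto
  then show ?thesis using peval_value[OF V t as(1)] as(2) that(2) by auto
 qed
 obtain i j where "veq V b (t ^ i)" "veq V c (t ^ j)" using *[OF bc(2) nz(1)] *[OF bc(3) nz(2)] by blast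
 then have "veq V a (zp t (int i - int j))" unfolding bc(1) zp_diff_nat[OF t(2)] by (rule veq_divide[OF V])
 then show ?thesis by blast
qed

text \<open>Two terms of an algebraic relation must have equal value, so some power of a has the
 value of a power of t.\<close>

lemma algebraic_value:
 assumes V: "valring V" and t: "t \<in> mx V" "t \<noteq> 0" and al: "alg (fgen (insert t kf)) a" and a: "a \<noteq> 0"
 shows "\<exists>j>0. \<exists>n. veq V (a ^ j) (zp t n)"
proof -
 obtain as where as: "set as \<subseteq> fgen (insert t kf)" "\<not> set as \<subseteq> {0}" "peval as a = 0"
  using al by (auto simp: alg_def)
 define f where "f i = as ! i * a ^ i" for i
 have s: "sum f {..<length as} = 0" using as(3) by (simp add: peval_sum f_def)
 have nz: "\<exists>i\<in>{..<length as}. f i \<noteq> 0"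
  using as(2) a by (auto simp: f_def in_set_conv_nth subset_iff)
 have "\<exists>i\<in>{..<length as}. \<exists>j\<in>{..<length as}. i \<noteq> j \<and> f i \<noteq> 0 \<and> f j \<noteq> 0 \<and> veq V (f i) (f j)"
 proof (rule ccontr)
  assume "\<not> ?thesis"
  then obtain i where "veq V (sum f {..<length as}) (f i)"
   using dominant_term[OF V, of "{..<length as}" f] nz by (metis finite_lessThan)
  then show False using s by (simp add: veq_def)
 qed
 then obtain i j where ij: "i < length as" "j < length as" "i < j" "f i \<noteq> 0" "f j \<noteq> 0" "veq V (f i) (f j)"
  by (metis lessThan_iff linorder_neqE_nat veq_sym[OF V])
 have "as ! i \<noteq> 0" "as ! j \<noteq> 0" using ij(4,5) by (auto simp: f_def)
 then obtain n n' where n: "veq V (as ! i) (zp t n)" "veq V (as ! j) (zp t n')"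
  using rational_value[OF V t] as(1) ij(1,2) by (meson nth_mem subsetD)
 have "veq V (f i / (as ! j * a ^ i)) (f j / (as ! j * a ^ i))"
  using veq_divide[OF V ij(6) veq_refl[OF V]] \<open>as ! j \<noteq> 0\<close> a by simp
 moreover have "f i / (as ! j * a ^ i) = as ! i / as ! j" using a by (simp add: f_def)
 moreover have "f j / (as ! j * a ^ i) = a ^ (j - i)"
  using \<open>as ! j \<noteq> 0\<close> a ij(3) by (simp add: f_def power_diff)
 ultimately have "veq V (a ^ (j - i)) (as ! i / as ! j)" using veq_sym[OF V] by metis
 then have "veq V (a ^ (j - i)) (zp t (n - n'))"
  using veq_trans[OF V] veq_divide[OF V n] by (simp add: zp_diff[OF t(2)])
 then show ?thesis using ij(3) by (intro exI[of _ "j - i"]) auto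
qed

text \<open>The local ring of a smooth point with local parameter t.\<close>

definition loc :: "'a set => 'a set => 'a set" where
 "loc R V = {a / b |a b. a \<in> R \<and> b \<in> R \<and> b \<notin> mx V}"

context
 fixes V R assumes V: "valring V" and R: "sring R" and RV: "R \<subseteq> V" and kR: "kf \<subseteq> R"
begin

lemma locI: "a \<in> R ==> b \<in> R ==> b \<notin> mx V ==> a / b \<in> loc R V" by (auto simp: loc_def)

lemma loc_ring: "sring (loc R V)"
proof (rule sringI)
 have one: "1 \<in> R" "1 \<notin> mx V" using sringD(2)[OF R] one_notin_mx[OF V] by auto
 show "0 \<in> loc R V" "1 \<in> loc R V" using locI[OF _ one] sringD(1,2)[OF R] by force+
 fix u v assume "u \<in> loc R V" "v \<in> loc R V"
 then obtain a b c d where u: "u = a / b" "a \<in> R" "b \<in> R" "b \<notin> mx V" and v: "v = c / d" "c \<in> R" "d \<in> R" "d \<notin> mx V"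
  by (auto simp: loc_def)
 have nz: "b \<noteq> 0" "d \<noteq> 0" using u v mx_0[OF V] by auto
 have bd: "b * d \<in> R" "b * d \<notin> mx V" using u v sringD(5)[OF R] mx_prime[OF V, of b d] RV by auto
 have "u + v = (a * d + c * b) / (b * d)" "u * v = (a * c) / (b * d)"
  unfolding u v using nz by (simp_all add: add_frac_eq)
 then show "u + v \<in> loc R V" "u * v \<in> loc R V"
  using locI[OF _ bd] u v sringD[OF R] by metis+
next
 fix u assume "u \<in> loc R V"
 then obtain a b where u: "u = a / b" "a \<in> R" "b \<in> R" "b \<notin> mx V" by (auto simp: loc_def)
 have "- u = (- a) / b" unfolding u by simp
 then show "- u \<in> loc R V" using u locI sringD(4)[OF R] by metis
qed

lemma loc_incl: "R \<subseteq> loc R V"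
 using locI[OF _ sringD(2)[OF R] one_notin_mx[OF V]] by auto

lemma loc_V: "loc R V \<subseteq> V"
proof
 fix u assume "u \<in> loc R V"
 then obtain a b where u: "u = a / b" "a \<in> R" "b \<in> R" "b \<notin> mx V" by (auto simp: loc_def)
 then show "u \<in> V" using RV unitD(2)[OF V, of b] VD(5)[OF V, of a "inverse b"] by (auto simp: divide_inverse)
qed

lemma loc_unit: assumes "a \<in> loc R V" "a \<notin> mx V" shows "inverse a \<in> loc R V"
proof -
 obtain b c where b: "a = b / c" "b \<in> R" "c \<in> R" "c \<notin> mx V" using assms(1) by (auto simp: loc_def)
 have "b \<notin> mx V"
  using b mx_mult[OF V, of b "inverse c"] unitD(2)[OF V, of c] assms(2) RV by (auto simp: divide_inverse)
 then show ?thesis using locI[of c b] b by simp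
qed

text \<open>If every residue is constant modulo t, one can divide by t repeatedly; the value of an
 element algebraic over k(t) bounds the number of divisions.\<close>

lemma smooth_point:
 assumes t: "t \<in> R" "t \<in> mx V" "t \<noteq> 0"
  and res: "\<And>a. a \<in> R ==> \<exists>c\<in>kf. \<exists>b\<in>loc R V. a - c = t * b"
  and al: "\<And>a. a \<in> R ==> alg (fgen (insert t kf)) a"
  and a: "a \<in> loc R V" "a \<noteq> 0"
 shows "\<exists>n. \<exists>u\<in>loc R V. u \<notin> mx V \<and> a = t ^ n * u"
proof -
 note LD = sringD[OF loc_ring]
 have tL: "t \<in> loc R V" using t(1) loc_incl by blast
 have res': "\<exists>c\<in>kf. \<exists>b\<in>loc R V. u - c = t * b" if uL: "u \<in> loc R V" for u
 proof -
  obtain b d where u: "u = b / d" "b \<in> R" "d \<in> R" "d \<notin> mx V" using uL by (auto simp: loc_def)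
  obtain c v where c: "c \<in> kf" "v \<in> loc R V" "b - c = t * v" using res u by blast
  obtain c' v' where c': "c' \<in> kf" "v' \<in> loc R V" "d - c' = t * v'" using res u by blast
  have "c' \<noteq> 0"
   using c' u(4) mx_mult[OF V t(2), of v'] loc_V by auto
  have "d \<noteq> 0" using u(4) mx_0[OF V] by auto
  have "inverse d \<in> loc R V" using loc_unit u loc_incl by blast
  have "b = c + t * v" "d = c' + t * v'" using c(3) c'(3) by (simp_all add: algebra_simps)
  then have "b * c' - d * c = t * (v * c' - v' * c)" by (simp add: algebra_simps)
  have "u - c / c' = (b * c' - d * c) / (d * c')" unfolding u(1)
   using \<open>c' \<noteq> 0\<close> \<open>d \<noteq> 0\<close> by (simp add: diff_frac_eq mult.commute)
  also have "... = t * ((v * c' - v' * c) * (inverse d * inverse c'))"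
   unfolding \<open>b * c' - d * c = t * (v * c' - v' * c)\<close>
   by (simp add: divide_inverse mult.assoc)
  finally have eq: "u - c / c' = t * ((v * c' - v' * c) * (inverse d * inverse c'))" .
  have kL: "e \<in> kf ==> e \<in> loc R V" for e using kR loc_incl by blast
  have "(v * c' - v' * c) * (inverse d * inverse c') \<in> loc R V"
   using c c' kL LD(5,6) \<open>inverse d \<in> loc R V\<close> sfield_inverse[OF kf c'(1)] by simp
  then show ?thesis using eq sfield_divide[OF kf c(1) c'(1)] by blast
 qed
 have al': "alg (fgen (insert t kf)) a"
 proof -
  obtain b d where u: "a = b / d" "b \<in> R" "d \<in> R" "d \<notin> mx V" using a(1) by (auto simp: loc_def)
  then show ?thesis using sfield_divide[OF alg_sfield[OF sfield_fgen[of "insert t kf"]], of b d] al by auto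
 qed
 obtain j n where j: "j > 0" and jn: "veq V (a ^ j) (zp t n)"
  using algebraic_value[OF V t(2,3) al' a(2)] by blast
 have bound: "int i * int j \<le> n" if "a = t ^ i * u" "u \<in> loc R V" for i u
 proof (rule ccontr)
  assume "\<not> ?thesis"
  then obtain r where r: "int i * int j - n = int r" "0 < r"
   by (metis diff_gt_0_iff_gt linorder_not_le zero_less_imp_eq_int)
  have "a ^ j = t ^ (i * j) * u ^ j" unfolding that(1) by (simp add: power_mult_distrib power_mult)
  moreover have "t ^ (i * j) = zp t n * t ^ r"
  proof -
   have "int (i * j) = n + int r" using r(1) by simp
   then show ?thesis by (metis zp_add[OF t(3)] zp_nat)
  qed
  ultimately have "a ^ j / zp t n = t ^ r * u ^ j" using zp_nonzero[OF t(3), of n] by (simp add: mult.assoc)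
  moreover have "u ^ j \<in> V" using that(2) loc_V sring_power[OF V_ring[OF V]] by blast
  ultimately have "a ^ j / zp t n \<in> mx V" using mx_mult[OF V power_mx[OF V t(2) r(2)]] by simp
  then show False using jn inverse_mx[OF V, of "a ^ j / zp t n"] by (auto simp: veq_def)
 qed
 define P where "P i \<longleftrightarrow> (\<exists>u\<in>loc R V. a = t ^ i * u)" for i
 have "P 0" using a(1) by (auto simp: P_def)
 have "\<forall>i. P i --> i \<le> nat n"
 proof (intro allI impI)
  fix i assume "P i"
  then have "int i * int j \<le> n" using bound by (auto simp: P_def)
  moreover have "int i \<le> int i * int j"
  proof -
   have "i \<le> i * j" using j by (cases j) simp_all
   then have "int i \<le> int (i * j)" by presburger
   then show ?thesis by (simp only: int_ops(7))
  qed
  ultimately show "i \<le> nat n" by linarith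
 qed
 then obtain i where i: "P i" "\<not> P (Suc i)" using \<open>P 0\<close> by (metis Suc_n_not_le_n nat_induct)
 then obtain u where u: "u \<in> loc R V" "a = t ^ i * u" by (auto simp: P_def)
 have "u \<notin> mx V"
 proof
  assume um: "u \<in> mx V"
  obtain c b where c: "c \<in> kf" "b \<in> loc R V" "u - c = t * b" using res'[OF u(1)] by blast
  have "t * b \<in> mx V" using mx_mult[OF V t(2), of b] loc_V c(2) by blast
  then have "u - t * b \<in> mx V" using um mx_diff[OF V] by blast
  moreover have "u - t * b = c" using c(3) by (simp add: algebra_simps)
  ultimately have "c = 0" using kf_mx[OF V c(1)] by simp
  then have "a = t ^ Suc i * b" using u(2) c(3) by (simp add: mult.assoc[symmetric] power_commutes)
  then show False using i(2) c(2) by (auto simp: P_def)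
 qed
 then show ?thesis using u by blast
qed

end

end

section \<open>The curve \<open>s\<^sup>q + s = x\<^sup>-\<^sup>m\<close>, \<open>z\<^sup>q + z = x\<^sup>m\<close>\<close>

text \<open>Values of c z^j for j < q are distinct because m is prime to q.\<close>

lemma value_congruence:
 fixes n n' M Q :: int and i j :: nat
 assumes "coprime M Q" "n * Q - M * int i = n' * Q - M * int j" "int i < Q" "int j < Q"
 shows "i = j"
proof (rule ccontr)
 assume ne: "i \<noteq> j"
 have "Q * (n - n') = M * (int i - int j)" using assms(2) by (simp add: algebra_simps)
 then have "Q dvd M * (int i - int j)" by (metis dvd_triv_left)
 then have "Q dvd int i - int j" using assms(1) by (simp add: coprime_commute coprime_dvd_mult_right_iff)
 then have "Q dvd \<bar>int i - int j\<bar>" by simp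
 then show False using assms(3,4) ne zdvd_imp_le[of Q "\<bar>int i - int j\<bar>"] by auto
qed

context Fields.field begin

lemma polys_shift: assumes A: "sring A" and f: "f \<in> polys A" and c: "c \<in> A" shows "(%t. f (t - c)) \<in> polys A"
proof -
 have "(%t. peval as (t - c)) \<in> polys A" if "set as \<subseteq> A" for as
  using that
 proof (induction as)
  case Nil then show ?case using polys_const[OF sringD(1)[OF A]] by simp
 next
  case (Cons a as)
  have "(%t. a + (t - c) * peval as (t - c)) \<in> polys A"
   using Cons by (intro polys_add[OF A] polys_mult[OF A] polys_diff[OF A] polys_id[OF A] polys_const c) auto
  then show ?case by simp
 qed
 then show ?thesis using f by (auto simp: polys_def)
qed

lemma power_swap: "(a ^ i) ^ j = (a ^ j) ^ i"
 by (simp only: power_mult[symmetric] ab_semigroup_mult_class.mult.commute)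

lemma sum_minus: "(\<Sum>i\<in>I. f i - g i) = sum f I - (sum g I :: 'a)"
 by (induction I rule: infinite_finite_induct) (simp_all add: algebra_simps)

lemma prod_list_root: "r \<in> set rs ==> prod_list (map (%s. r - s) rs) = 0"
 by (induction rs) auto

lemma sdiv_monic: "as \<noteq> [] ==> \<exists>bs. sdiv c (as @ [1]) = bs @ [1]"
proof (induction as)
 case (Cons a as)
 show ?case
 proof (cases "as = []")
  case False
  then obtain bs where "sdiv c (as @ [1]) = bs @ [1]" using Cons by blast
  then have "sdiv c ((a # as) @ [1]) = (peval (as @ [1]) c # bs) @ [1]" by simp
  then show ?thesis by blast
 qed simp
qed simp

definition span_ext :: "'a set => 'a => nat => 'a set" where
 "span_ext E t n = {\<Sum>i<n. c i * t ^ i |c. \<forall>i. c i \<in> E}"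

lemma span_extI: "(\<And>i. c i \<in> E) ==> (\<Sum>i<n. c i * t ^ i) \<in> span_ext E t n"
 by (auto simp: span_ext_def)

lemma span_ext_ops:
 assumes E: "sring E"
 shows "0 \<in> span_ext E t n"
  "a \<in> span_ext E t n ==> b \<in> span_ext E t n ==> a + b \<in> span_ext E t n"
  "c \<in> E ==> a \<in> span_ext E t n ==> c * a \<in> span_ext E t n"
proof -
 show "0 \<in> span_ext E t n" using span_extI[of "%_. 0" E t n] sringD(1)[OF E] by simp
 show "a + b \<in> span_ext E t n" if ab: "a \<in> span_ext E t n" "b \<in> span_ext E t n"
 proof -
  obtain c d where c: "\<forall>i. c i \<in> E" "a = (\<Sum>i<n. c i * t ^ i)" and d: "\<forall>i. d i \<in> E" "b = (\<Sum>i<n. d i * t ^ i)"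
   using ab by (auto simp: span_ext_def)
  have "a + b = (\<Sum>i<n. (c i + d i) * t ^ i)" unfolding c d by (simp add: sum.distrib distrib_right)
  then show ?thesis using span_extI[of "%i. c i + d i"] c d sringD(3)[OF E] by metis
 qed
 show "e * a \<in> span_ext E t n" if e: "e \<in> E" "a \<in> span_ext E t n" for e
 proof -
  obtain c where c: "\<forall>i. c i \<in> E" "a = (\<Sum>i<n. c i * t ^ i)" using e by (auto simp: span_ext_def)
  have "e * a = (\<Sum>i<n. (e * c i) * t ^ i)" unfolding c by (simp add: sum_distrib_left mult.assoc)
  then show ?thesis using span_extI[of "%i. e * c i"] c e sringD(5)[OF E] by metis
 qed
qed

lemma span_ext_sum:
 assumes E: "sring E" and "\<And>i. i \<in> I ==> f i \<in> span_ext E t n"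
 shows "sum f I \<in> span_ext E t n"
 using assms(2) by (induction I rule: infinite_finite_induct) (auto simp: span_ext_ops[OF E])

lemma span_ext_power:
 assumes E: "sring E" and i: "i < n" shows "t ^ i \<in> span_ext E t n"
proof -
 have "(\<Sum>j<n. (if j = i then 1 else 0) * t ^ j) = (\<Sum>j<n. if j = i then t ^ j else 0)"
  by (rule sum.cong) auto
 also have "... = t ^ i" using i by (simp add: sum.delta)
 finally show ?thesis using span_extI[of "%j. if j = i then 1 else 0" E t n] sringD(1,2)[OF E] by auto
qed

lemma span_ext_ring:
 assumes E: "sring E" and n: "0 < n" and tn: "t ^ n \<in> span_ext E t n"
 shows "sring (span_ext E t n)" "E \<subseteq> span_ext E t n" "t \<in> span_ext E t n"
proof -
 note ops = span_ext_ops[OF E]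
 have one: "1 \<in> span_ext E t n" using span_ext_power[OF E n] by simp
 show "E \<subseteq> span_ext E t n" using ops(3)[OF _ one] by auto
 have shift: "t * a \<in> span_ext E t n" if aS: "a \<in> span_ext E t n" for a
 proof -
  obtain c where c: "\<forall>i. c i \<in> E" "a = (\<Sum>i<n. c i * t ^ i)" using aS by (auto simp: span_ext_def)
  have "t * a = (\<Sum>i<n. c i * t ^ Suc i)" unfolding c(2) by (simp add: sum_distrib_left mult.left_commute)
  moreover have "c i * t ^ Suc i \<in> span_ext E t n" if "i < n" for i
  proof (cases "Suc i < n")
   case True then show ?thesis using ops(3) c(1) span_ext_power[OF E True] by blast
  next
   case False then have "Suc i = n" using that by simp
   then show ?thesis using ops(3) c(1) tn by simp
  qed
  ultimately show ?thesis using span_ext_sum[OF E, of "{..<n}" "%i. c i * t ^ Suc i"] by simp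
 qed
 have shifts: "t ^ i * a \<in> span_ext E t n" if "a \<in> span_ext E t n" for a i
  using that by (induction i) (auto simp: mult.assoc shift)
 show "t \<in> span_ext E t n" using shift[OF one] by simp
 show "sring (span_ext E t n)"
 proof (rule sringI)
  fix a b assume a: "a \<in> span_ext E t n" and b: "b \<in> span_ext E t n"
  obtain c where c: "\<forall>i. c i \<in> E" "a = (\<Sum>i<n. c i * t ^ i)" using a by (auto simp: span_ext_def)
  have "a * b = (\<Sum>i<n. c i * (t ^ i * b))" unfolding c(2) by (simp add: sum_distrib_right mult.assoc)
  then show "a * b \<in> span_ext E t n"
   using span_ext_sum[OF E, of "{..<n}" "%i. c i * (t ^ i * b)"] ops(3) c(1) shifts[OF b] by simp
 next
  fix a assume "a \<in> span_ext E t n"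
  then show "- a \<in> span_ext E t n" using ops(3)[of "-1" a] sringD(2,4)[OF E] by simp
 qed (use ops one in auto)
qed

end

syntax "_char_exponent" :: logic ("\<p>")
translations "\<p>" \<rightharpoonup> "CONST chp (CONST Pure.type)"

context ffield begin

definition trans :: "'a => bool" where
 "trans x \<longleftrightarrow> (\<forall>as. set as \<subseteq> kf --> peval as x = 0 --> set as \<subseteq> {0})"

lemma trans_fun: assumes "trans x" "f \<in> polys kf" "f x = 0" shows "f t = 0"
proof -
 obtain as where as: "set as \<subseteq> kf" "f = peval as" using assms(2) by (auto simp: polys_def)
 then have "set as \<subseteq> {0}" using assms by (auto simp: trans_def)
 then have "peval as t = 0" by (induction as) auto
 then show ?thesis using as by simp
qed

lemma trans_nonzero: "trans x ==> x \<noteq> 0"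
 using trans_fun[of x "%t. t" 1] polys_id[OF kf_ring] by auto

lemma trans_notin: assumes "trans x" shows "x \<notin> kf"
proof
 assume x: "x \<in> kf"
 have "(%t. t - x) \<in> polys kf" by (intro polys_diff polys_id polys_const kf_ring x)
 from trans_fun[OF assms this, of "x + 1"] show False by simp
qed

lemma peval_rev: "x \<noteq> 0 ==> x ^ length as * peval as (inverse x) = x * peval (rev as) x"
proof (induction as)
 case (Cons a as)
 have "x ^ length (a # as) * peval (a # as) (inverse x)
   = x * (x ^ length as * a) + (x * inverse x) * (x ^ length as * peval as (inverse x))"
  by (simp add: algebra_simps)
 also have "... = x * (x ^ length as * a) + x * peval (rev as) x" using Cons by simp
 finally show ?case by (simp add: peval_append algebra_simps)
qed simp

lemma trans_inverse: assumes "trans x" shows "trans (inverse x)"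
 unfolding trans_def
proof (intro allI impI)
 fix as assume as: "set as \<subseteq> kf" "peval as (inverse x) = 0"
 then have "peval (rev as) x = 0" using peval_rev[of x as] trans_nonzero[OF assms] by (metis mult_eq_0_iff)
 then show "set as \<subseteq> {0}" using assms[unfolded trans_def, rule_format, of "rev as"] as(1) by simp
qed

lemma trans_diff: assumes x: "trans x" and c: "c \<in> kf" shows "trans (x - c)"
 unfolding trans_def
proof (intro allI impI)
 fix as assume as: "set as \<subseteq> kf" "peval as (x - c) = 0"
 have "(%t. peval as (t - c)) \<in> polys kf" using polys_shift[OF kf_ring polysI[OF as(1)] c] .
 then have "peval as (t - c) = 0" for t using trans_fun[OF x] as(2) by blast
 from this[of "_ + c"] have z: "peval as t = 0" for t by simp
 have "trans x" by (rule x)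
 then show "set as \<subseteq> {0}" using z as(1) by (auto simp: trans_def)
qed

lemma valring_trans:
 assumes t: "trans t"
 obtains V where "valring V" "t \<in> mx V"
proof (rule valring_exists)
 show "t \<noteq> 0" by (rule trans_nonzero[OF t])
 show "inverse t \<notin> rgen (insert t kf)"
 proof
  assume "inverse t \<in> rgen (insert t kf)"
  then obtain f where f: "f \<in> polys kf" "inverse t = f t" unfolding rgen_insert[OF kf_ring] by auto
  have "(%u. 1 - u * f u) \<in> polys kf"
   by (intro polys_diff polys_mult polys_id polys_const kf_ring f(1) sringD(2)[OF kf_ring])
  moreover have "1 - t * f t = 0" using f(2) trans_nonzero[OF t] by (metis right_inverse diff_self)
  ultimately have "1 - 0 * f 0 = 0" using trans_fun[OF t] by blast
  then show False by simp
 qed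
qed

lemma monic_splits:
 "set as \<subseteq> kf ==> \<exists>rs. set rs \<subseteq> kf \<and> length rs = length as \<and> (\<forall>t. peval (as @ [1]) t = prod_list (map (%r. t - r) rs))"
proof (induction "length as" arbitrary: as)
 case 0 then show ?case by (intro exI[of _ "[]"]) simp
next
 case (Suc n)
 then have ne: "as \<noteq> []" by auto
 obtain r where r: "r \<in> kf" "peval (as @ [1]) r = 0" using root_ex[OF ne Suc.prems] by blast
 obtain bs where bs: "sdiv r (as @ [1]) = bs @ [1]" using sdiv_monic[OF ne] by blast
 have "set (bs @ [1]) \<subseteq> kf"
  unfolding bs[symmetric] using Suc.prems r(1) sringD(2)[OF kf_ring] by (intro sdiv_in[OF kf_ring]) auto
 moreover have len: "length bs = n" using length_sdiv[of r "as @ [1]"] bs Suc.hyps(2) by simp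
 ultimately obtain rs where rs: "set rs \<subseteq> kf" "length rs = length bs"
  "\<And>t. peval (bs @ [1]) t = prod_list (map (%r. t - r) rs)"
  using Suc.hyps(1)[of bs] by auto
 have "peval (as @ [1]) t = prod_list (map (%r. t - r) (r # rs))" for t
  using sdiv[of "as @ [1]" t r] bs r(2) rs(3) by simp
 then show ?case using rs r(1) len Suc.hyps(2) by (intro exI[of _ "r # rs"]) auto
qed

lemma prod_list_mx:
 assumes V: "valring V" and "\<And>r. r \<in> set rs ==> f r \<in> V" "prod_list (map f rs) \<in> mx V"
 shows "\<exists>r\<in>set rs. f r \<in> mx V"
proof -
 have "prod_list (map f rs) \<in> V \<and> (prod_list (map f rs) \<in> mx V --> (\<exists>r\<in>set rs. f r \<in> mx V))"
  using assms(2)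
 proof (induction rs)
  case Nil then show ?case using one_notin_mx[OF V] VD(2)[OF V] by simp
 next
  case (Cons r rs)
  then show ?case using mx_prime[OF V, of "f r" "prod_list (map f rs)"] VD(5)[OF V] by auto
 qed
 then show ?thesis using assms(3) by blast
qed

end

class cfield = ffield +
 fixes xx ss zz :: 'a and hh mm :: "'a itself => nat"
 assumes odd_chr: "odd (chp TYPE('a))"
  and hh_pos: "1 \<le> hh TYPE('a)" and mm_pos: "1 \<le> mm TYPE('a)"
  and coprime_mm: "coprime (mm TYPE('a)) (chp TYPE('a))"
  and card_Fq: "card {a \<in> kf. a ^ (chp TYPE('a) ^ hh TYPE('a)) = a} = chp TYPE('a) ^ hh TYPE('a)"
  and trans_xx: "trans xx"
  and ss_eq: "ss ^ (chp TYPE('a) ^ hh TYPE('a)) + ss = inverse xx ^ mm TYPE('a)"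
  and zz_eq: "zz ^ (chp TYPE('a) ^ hh TYPE('a)) + zz = xx ^ mm TYPE('a)"
  and generates: "fgen (kf \<union> {xx, ss, zz}) = UNIV"

syntax "_q_exponent" :: logic ("\<q>")
syntax "_m_exponent" :: logic ("\<m>")
translations "\<q>" \<rightharpoonup> "CONST chp (CONST Pure.type) ^ CONST hh (CONST Pure.type)"
translations "\<m>" \<rightharpoonup> "CONST mm (CONST Pure.type)"

context cfield begin

lemma xx_nz: "xx \<noteq> 0" using trans_nonzero[OF trans_xx] .

text \<open>The exchange of (x, s, z) with (1/x, z, s): every statement about the place x =
 \<infinity> gives one about x = 0.\<close>

lemma swap: "class.cfield (/) inverse (*) 1 (+) 0 (-) uminus kf chp (inverse xx) zz ss hh mm"
proof -
 have "xx \<in> fgen (kf \<union> {inverse xx, zz, ss})"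
  using sfield_inverse[OF sfield_fgen, of "inverse xx" "kf \<union> {inverse xx, zz, ss}"]
   fgen_incl[of "kf \<union> {inverse xx, zz, ss}"] by auto
 then have "fgen (kf \<union> {xx, ss, zz}) \<subseteq> fgen (kf \<union> {inverse xx, zz, ss})"
  using fgen_incl[of "kf \<union> {inverse xx, zz, ss}"] by (intro fgen_least[OF sfield_fgen]) auto
 then have "fgen (kf \<union> {inverse xx, zz, ss}) = UNIV" using generates by auto
 then show ?thesis
  using odd_chr hh_pos mm_pos coprime_mm card_Fq trans_inverse[OF trans_xx] ss_eq zz_eq
  by unfold_locales auto
qed

lemma chr_ge3: "3 \<le> \<p>"
 using odd_chr prime_chp prime_ge_2_nat[OF prime_chp] by (cases "\<p> = 2") auto

lemma q_ge3: "3 \<le> \<q>"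
proof -
 have "\<p> ^ 1 \<le> \<q>" using chr_ge3 hh_pos by (intro power_increasing) auto
 then show ?thesis using chr_ge3 by simp
qed

lemma odd_q: "odd \<q>" using odd_chr by simp

lemma q_pos: "0 < \<q>" using q_ge3 by linarith

lemma q_Suc: obtains r where "\<q> = Suc (Suc r)" "0 < r"
 using that[of "\<q> - 2"] q_ge3 by linarith

lemma coprime_mq: "coprime (int \<m>) (int \<q>)"
 using coprime_mm by (simp add: coprime_power_right_iff)

lemma frob_add: "(a + b) ^ \<q> = a ^ \<q> + b ^ \<q>" by (rule frobenius_add[OF prime_chp char_chp])
lemma frob_diff: "(a - b) ^ \<q> = a ^ \<q> - b ^ \<q>" by (rule frobenius_diff[OF prime_chp char_chp odd_chr])
lemma frob_minus: "(- a) ^ \<q> = - (a ^ \<q>)" by (rule frobenius_uminus[OF odd_q])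

lemma AS_peval:
 "\<exists>as. set as \<subseteq> {0, 1, - a} \<and> length as = \<q> \<and> (\<forall>t. peval (as @ [1]) t = t ^ \<q> + t - a)"
proof -
 obtain r where r: "\<q> = Suc (Suc r)" by (rule q_Suc)
 define c where "c i = (if i = 0 then - a else if i = 1 then 1 else 0)" for i :: nat
 have S: "(\<Sum>i<\<q>. c i * t ^ i) = - a + t" for t
  unfolding r by (simp add: sum.lessThan_Suc_shift c_def del: sum.lessThan_Suc)
 have "peval (map c [0..<\<q>] @ [1]) t = t ^ \<q> + t - a" for t
 proof -
  have "peval (map c [0..<\<q>] @ [1]) t = (\<Sum>i<\<q>. c i * t ^ i) + t ^ \<q>"
   by (simp add: peval_append peval_map)
  also have "... = t ^ \<q> + t - a" unfolding S by (simp add: algebra_simps)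
  finally show ?thesis .
 qed
 moreover have "set (map c [0..<\<q>]) \<subseteq> {0, 1, - a}" by (auto simp: c_def)
 ultimately show ?thesis by (intro exI[of _ "map c [0..<\<q>]"]) simp
qed

lemma AS_split:
 assumes "a \<in> kf"
 obtains rs where "set rs \<subseteq> kf" "length rs = \<q>" "\<And>t. t ^ \<q> + t - a = prod_list (map (%r. t - r) rs)"
proof -
 obtain as where as: "set as \<subseteq> {0, 1, - a}" "length as = \<q>" "\<forall>t. peval (as @ [1]) t = t ^ \<q> + t - a"
  using AS_peval by blast
 have "set as \<subseteq> kf" using as(1) assms sringD[OF kf_ring] by auto
 from monic_splits[OF this] show ?thesis using as that by metis
qed

lemma AS_alg: assumes K: "sfield K" and w: "w ^ \<q> + w \<in> K" shows "alg K w"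
proof -
 obtain as where as: "set as \<subseteq> {0, 1, - (w ^ \<q> + w)}" "\<forall>t. peval (as @ [1]) t = t ^ \<q> + t - (w ^ \<q> + w)"
  using AS_peval by blast
 show ?thesis unfolding alg_def
 proof (intro exI conjI)
  have "{0, 1, - (w ^ \<q> + w)} \<subseteq> K" using w sringD(1,2,4)[OF sfield_sring[OF K]] by blast
  then show "set (as @ [1]) \<subseteq> K" using as(1) by auto
 qed (use as in auto)
qed

text \<open>The term w^q dominates at a pole.\<close>

lemma AS_value:
 assumes V: "valring V" and w: "w \<notin> V" shows "veq V (w ^ \<q> + w) (w ^ \<q>)"
proof (rule veq_add[OF V])
 have nz: "w \<noteq> 0" using w VD(1)[OF V] by blast
 then show "w ^ \<q> \<noteq> 0" by simp
 obtain r where r: "\<q> = Suc (Suc r)" by (rule q_Suc)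
 have "w / w ^ \<q> = inverse w ^ Suc r" using nz unfolding r by (simp add: field_simps power_inverse)
 then show "w / w ^ \<q> \<in> mx V" using power_mx[OF V notin_mx[OF V w], of "Suc r"] by simp
qed

lemma AS_in: assumes V: "valring V" and w: "w ^ \<q> + w \<in> V" shows "w \<in> V"
proof (rule ccontr)
 assume n: "w \<notin> V"
 then have "w ^ \<q> \<in> V" using veq_in[OF V AS_value[OF V n]] w by blast
 then show False using V_root[OF V _ q_pos] n by blast
qed

text \<open>The Artin-Schreier equation is smooth: an approximate solution modulo t is a
 solution.\<close>

lemma AS_residue:
 assumes V: "valring V" and R: "sring R" "R \<subseteq> V" "kf \<subseteq> R" and t: "t \<in> mx V"
  and w: "w \<in> R" and c: "c \<in> kf" and b: "b \<in> loc R V" "w ^ \<q> + w - c = t * b"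
 shows "\<exists>r\<in>kf. \<exists>b\<in>loc R V. w - r = t * b"
proof -
 note LD = sringD[OF loc_ring[OF V R]]
 obtain rs where rs: "set rs \<subseteq> kf" "\<And>t. t ^ \<q> + t - c = prod_list (map (%r. t - r) rs)"
  using AS_split[OF c] by metis
 have "t * b \<in> mx V" using mx_mult[OF V t] b(1) loc_V[OF V R] by blast
 then have "prod_list (map (%r. w - r) rs) \<in> mx V" unfolding rs(2)[symmetric] b(2) .
 then obtain r where r: "r \<in> set rs" "w - r \<in> mx V"
  using prod_list_mx[OF V, of rs "%r. w - r"] w R(2,3) rs(1) VD(6)[OF V] by blast
 have rk: "r \<in> kf" using r rs by auto
 have "prod_list (map (%s. r - s) rs) = 0" using r(1) by (rule prod_list_root)
 then have root: "r ^ \<q> + r = c" using rs(2)[of r] by simp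
 define v where "v = w - r"
 have v: "v \<in> R" "v \<in> mx V" using w rk R(3) sringD(6)[OF R(1)] r(2) by (auto simp: v_def)
 have "v ^ \<q> + v = (w ^ \<q> + w) - (r ^ \<q> + r)" unfolding v_def frob_diff by (simp add: algebra_simps)
 then have eq: "v ^ \<q> + v = t * b" using b(2) root by simp
 obtain n where n: "\<q> = Suc n" "0 < n" using q_ge3 by (cases \<q>) auto
 have "1 + v ^ n \<in> R" using sringD(2,3)[OF R(1)] sring_power[OF R(1) v(1)] by blast
 have "1 + v ^ n \<notin> mx V"
  using unit_add_mx[OF V VD(2)[OF V] one_notin_mx[OF V] power_mx[OF V v(2) n(2)]] .
 have inv: "inverse (1 + v ^ n) \<in> loc R V" "1 + v ^ n \<noteq> 0"
  using loc_unit[OF V R, of "1 + v ^ n"] loc_incl[OF V R] \<open>1 + v ^ n \<in> R\<close> \<open>1 + v ^ n \<notin> mx V\<close> mx_0[OF V] by auto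
 have "v * (1 + v ^ n) = t * b" using eq unfolding n(1) by (simp add: algebra_simps)
 then have "v = t * (b * inverse (1 + v ^ n))" using inv(2) by (simp add: field_simps)
 then show ?thesis using rk LD(5)[OF b(1) inv(1)] unfolding v_def by blast
qed

lemma residue_ring:
 assumes V: "valring V" and R: "sring R" "R \<subseteq> V" "kf \<subseteq> R"
 shows "sring {a \<in> loc R V. \<exists>c\<in>kf. \<exists>b\<in>loc R V. a - c = t * b}" (is "sring ?S")
proof -
 note LD = sringD[OF loc_ring[OF V R]]
 have SI: "a \<in> ?S" if "c \<in> kf" "b \<in> loc R V" "a \<in> loc R V" "a - c = t * b" for a b c using that by blast
 have kL: "c \<in> kf ==> c \<in> loc R V" for c using R(3) loc_incl[OF V R] by blast
 show ?thesis
 proof (rule sringI)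
  show "0 \<in> ?S" by (rule SI[of 0 0]) (use LD kfD in auto)
  show "1 \<in> ?S" by (rule SI[of 1 0]) (use LD kfD in auto)
  fix a a' assume "a \<in> ?S" "a' \<in> ?S"
  then obtain c b c' b' where *: "a \<in> loc R V" "c \<in> kf" "b \<in> loc R V" "a - c = t * b"
   "a' \<in> loc R V" "c' \<in> kf" "b' \<in> loc R V" "a' - c' = t * b'" by auto
  then have a: "a = c + t * b" "a' = c' + t * b'" by (simp_all add: diff_eq_eq add.commute)
  show "a + a' \<in> ?S"
  proof (rule SI[of "c + c'" "b + b'"])
   show "a + a' - (c + c') = t * (b + b')" unfolding a by (simp add: algebra_simps)
  qed (use * LD kfD in auto)
  show "a * a' \<in> ?S"
  proof (rule SI[of "c * c'" "b * a' + c * b'"])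
   show "a * a' - c * c' = t * (b * a' + c * b')" unfolding a by (simp add: algebra_simps)
  qed (use * LD kfD kL in auto)
 next
  fix a assume "a \<in> ?S"
  then obtain c b where *: "a \<in> loc R V" "c \<in> kf" "b \<in> loc R V" "a - c = t * b" by auto
  then have a: "a = c + t * b" by (simp add: diff_eq_eq add.commute)
  show "- a \<in> ?S"
  proof (rule SI[of "- c" "- b"])
   show "- a - - c = t * - b" unfolding a by (simp add: algebra_simps)
  qed (use * LD kfD in auto)
 qed
qed

abbreviation "tt \<equiv> inverse xx"
abbreviation "E1 \<equiv> fgen (kf \<union> {xx, ss})"

lemma E1_field: "sfield E1" by (rule sfield_fgen)
lemma E1_mem: "c \<in> kf ==> c \<in> E1" "xx \<in> E1" "ss \<in> E1" using fgen_incl[of "kf \<union> {xx, ss}"] by auto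

context
 fixes V assumes V: "valring V" and tt: "tt \<in> mx V"
begin

lemma xx_notin: "xx ^ n \<in> V ==> n = 0"
 using V_root[OF V, of xx n] inverse_mx[OF V tt] xx_nz by auto

lemma zz_notin: "zz \<notin> V"
proof
 assume "zz \<in> V"
 then have "xx ^ \<m> \<in> V" unfolding zz_eq[symmetric] using VD(3)[OF V] sring_power[OF V_ring[OF V]] by blast
 from xx_notin[OF this] show False using mm_pos by simp
qed

lemma zz_value: "veq V (zz ^ \<q>) (zp tt (- int \<m>))"
proof -
 have "zp tt (- int \<m>) = xx ^ \<m>" by (simp add: zp_inverse_base)
 then show ?thesis using veq_sym[OF V AS_value[OF V zz_notin]] zz_eq by simp
qed

lemma ss_in: "ss \<in> V"
 using AS_in[OF V, of ss] ss_eq sring_power[OF V_ring[OF V] mx_in[OF V tt], of \<m>] by simp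

text \<open>The subfield k(x, s) is unramified at infinity: 1/x stays a local parameter.\<close>

lemma E1_smooth:
 fixes c :: 'a
 defines "R \<equiv> rgen (kf \<union> {tt, ss})"
 assumes "c \<in> E1" "c \<noteq> 0" shows "R \<subseteq> V" "\<exists>n. \<exists>u\<in>loc R V. u \<notin> mx V \<and> c = zp tt n * u"
proof -
 define S where "S = kf \<union> {tt, ss}"
 have R_def: "R = rgen S" by (simp add: S_def assms(1))
 have SR: "S \<subseteq> R" unfolding R_def by (rule rgen_incl)
 have RV: "R \<subseteq> V" unfolding R_def
  using V_kf[OF V] mx_in[OF V tt] ss_in by (intro rgen_least V_ring[OF V]) (auto simp: S_def)
 have R: "sring R" "R \<subseteq> V" "kf \<subseteq> R" using SR RV by (auto simp: R_def sring_rgen S_def)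
 have tR: "tt \<in> R" "ss \<in> R" using SR by (auto simp: S_def)
 have tnz: "tt \<noteq> 0" using xx_nz by simp
 note LI = loc_incl[OF V R] and LD = sringD[OF loc_ring[OF V R]]
 let ?S = "{a \<in> loc R V. \<exists>c\<in>kf. \<exists>b\<in>loc R V. a - c = tt * b}"
 have "R \<subseteq> ?S" unfolding R_def
 proof (rule rgen_least, fold R_def)
  show "sring ?S" by (rule residue_ring[OF V R])
  have "\<exists>r\<in>kf. \<exists>b\<in>loc R V. ss - r = tt * b"
  proof (rule AS_residue[OF V R tt tR(2), of 0 "tt ^ (\<m> - 1)"])
   show "tt ^ (\<m> - 1) \<in> loc R V" using sring_power[OF R(1) tR(1)] LI by blast
   show "ss ^ \<q> + ss - 0 = tt * tt ^ (\<m> - 1)" using ss_eq mm_pos by (simp flip: power_Suc)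
  qed (rule kfD(1))
  moreover have "\<exists>r\<in>kf. \<exists>b\<in>loc R V. tt - r = tt * b" using kfD(1) LD(2) by (intro bexI[of _ 0] bexI[of _ 1]) auto
  moreover have "\<exists>r\<in>kf. \<exists>b\<in>loc R V. c - r = tt * b" if "c \<in> kf" for c
   using that LD(1) by (intro bexI[of _ c] bexI[of _ 0]) auto
  ultimately show "S \<subseteq> ?S" using SR LI by (auto simp: S_def)
 qed
 then have res: "\<exists>c\<in>kf. \<exists>b\<in>loc R V. a - c = tt * b" if "a \<in> R" for a using that by blast
 have al: "alg (fgen (insert tt kf)) a" if "a \<in> R" for a
 proof -
  let ?K = "fgen (insert tt kf)"
  note K = sfield_fgen[of "insert tt kf"]
  have "tt \<in> ?K" "kf \<subseteq> ?K" using fgen_incl[of "insert tt kf"] by auto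
  moreover have "alg ?K ss" using AS_alg[OF K] ss_eq \<open>tt \<in> ?K\<close> sring_power[OF sfield_sring[OF K]] by simp
  ultimately have "S \<subseteq> {a. alg ?K a}" using alg_self[OF K] by (auto simp: S_def)
  then show ?thesis using rgen_least[OF sfield_sring[OF alg_sfield[OF K]], of S] that by (auto simp: R_def)
 qed
 show "R \<subseteq> V" by (rule RV)
 have SP: "\<exists>n. \<exists>u\<in>loc R V. u \<notin> mx V \<and> a = tt ^ n * u" if "a \<in> R" "a \<noteq> 0" for a
  using that LI by (intro smooth_point[OF V R tR(1) tt tnz res al]) auto
 have "E1 \<subseteq> fgen S"
 proof (rule fgen_least[OF sfield_fgen])
  show "kf \<union> {xx, ss} \<subseteq> fgen S"
   using fgen_incl[of S] sfield_inverse[OF sfield_fgen, of tt S] by (auto simp: S_def)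
 qed
 then have "c \<in> fgen S" using assms(2) by blast
 then obtain a b where ab: "a \<in> R" "b \<in> R" "c = a / b" by (auto simp: fgen_fraction[of S] R_def)
 have "a \<noteq> 0" "b \<noteq> 0" using assms(3) ab(3) by auto
 then obtain i u j w where u: "u \<in> loc R V" "u \<notin> mx V" "a = tt ^ i * u" and w: "w \<in> loc R V" "w \<notin> mx V" "b = tt ^ j * w"
  using SP[OF ab(1)] SP[OF ab(2)] by blast
 have iw: "inverse w \<in> loc R V" by (rule loc_unit[OF V R w(1,2)])
 have wV: "w \<in> V" "inverse w \<in> V" using w(1) iw loc_V[OF V R] by auto
 have "c = zp tt (int i - int j) * (u * inverse w)"
  unfolding ab(3) u(3) w(3) zp_diff_nat[OF tnz] by (simp add: divide_inverse mult_ac)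
 moreover have "u * inverse w \<in> loc R V" by (rule LD(5)[OF u(1) iw])
 moreover have "u * inverse w \<notin> mx V"
 proof
  assume "u * inverse w \<in> mx V"
  then have "u * inverse w * w \<in> mx V" by (rule mx_mult[OF V _ wV(1)])
  then show False using u(2) w(2) mx_0[OF V] by (cases "w = 0") (simp_all add: mult.assoc)
 qed
 ultimately show "\<exists>n. \<exists>u\<in>loc R V. u \<notin> mx V \<and> c = zp tt n * u" by blast
qed

lemma E1_value: assumes "c \<in> E1" "c \<noteq> 0" shows "\<exists>n. veq V c (zp tt n)"
proof -
 let ?R = "rgen (kf \<union> {tt, ss})"
 have "kf \<subseteq> ?R" using rgen_incl[of "kf \<union> {tt, ss}"] by blast
 note R = sring_rgen[of "kf \<union> {tt, ss}"] E1_smooth(1)[OF assms] this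
 obtain n u where u: "u \<in> loc ?R V" "u \<notin> mx V" "c = zp tt n * u" using E1_smooth(2)[OF assms] by blast
 show ?thesis using veq_mult_unit[OF V, of "zp tt n" u] u loc_V[OF V R] zp_nonzero[of tt n] xx_nz by auto
qed

lemma term_value:
 assumes "c \<in> E1" "c \<noteq> 0" shows "\<exists>n. veq V ((c * zz ^ j) ^ \<q>) (zp tt (n * int \<q> - int \<m> * int j))"
proof -
 have tnz: "tt \<noteq> 0" using xx_nz by simp
 obtain n where n: "veq V c (zp tt n)" using E1_value[OF assms] by blast
 have "(c * zz ^ j) ^ \<q> = c ^ \<q> * (zz ^ \<q>) ^ j" by (simp add: power_mult_distrib power_swap[of zz j])
 moreover have "veq V (c ^ \<q> * (zz ^ \<q>) ^ j) (zp tt n ^ \<q> * zp tt (- int \<m>) ^ j)"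
  by (intro veq_mult[OF V] veq_power[OF V] n zz_value)
 moreover have "zp tt n ^ \<q> * zp tt (- int \<m>) ^ j = zp tt (n * int \<q> - int \<m> * int j)"
  using zp_mult_nat[OF tnz, of n \<q>] zp_mult_nat[OF tnz, of "- int \<m>" j] zp_add[OF tnz, of "n * int \<q>" "- int \<m> * int j"]
  by simp
 ultimately show ?thesis by metis
qed

lemma term_distinct:
 assumes "c \<in> E1" "d \<in> E1" "i < \<q>" "j < \<q>" "i \<noteq> j" "c * zz ^ i \<noteq> 0" "d * zz ^ j \<noteq> 0"
 shows "\<not> veq V (c * zz ^ i) (d * zz ^ j)"
proof
 assume eq: "veq V (c * zz ^ i) (d * zz ^ j)"
 have cd: "c \<noteq> 0" "d \<noteq> 0" using assms(6,7) by auto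
 obtain n n' where "veq V ((c * zz ^ i) ^ \<q>) (zp tt (n * int \<q> - int \<m> * int i))"
  "veq V ((d * zz ^ j) ^ \<q>) (zp tt (n' * int \<q> - int \<m> * int j))"
  using term_value[OF assms(1) cd(1)] term_value[OF assms(2) cd(2)] by blast
 then have "veq V (zp tt (n * int \<q> - int \<m> * int i)) (zp tt (n' * int \<q> - int \<m> * int j))"
  using veq_power[OF V eq, of \<q>] veq_trans[OF V] veq_sym[OF V] by blast
 then have "n * int \<q> - int \<m> * int i = n' * int \<q> - int \<m> * int j"
  using veq_zp_inj[OF V tt] xx_nz by simp
 then show False using value_congruence[OF coprime_mq] assms(3-5) by auto
qed

lemma dominant_power:
 assumes "\<And>j. c j \<in> E1" "\<exists>j<\<q>. c j \<noteq> 0"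
 obtains i where "i < \<q>" "c i \<noteq> 0" "veq V (\<Sum>j<\<q>. c j * zz ^ j) (c i * zz ^ i)"
  "\<And>j. j < \<q> ==> j \<noteq> i ==> (c j * zz ^ j) / (c i * zz ^ i) \<in> mx V"
proof -
 have znz: "zz \<noteq> 0" using zz_notin VD(1)[OF V] by auto
 have ex: "\<exists>i\<in>{..<\<q>}. c i * zz ^ i \<noteq> 0" using assms(2) znz by auto
 have "\<not> veq V (c i * zz ^ i) (c j * zz ^ j)"
  if "i \<in> {..<\<q>}" "j \<in> {..<\<q>}" "i \<noteq> j" "c i * zz ^ i \<noteq> 0" "c j * zz ^ j \<noteq> 0" for i j
  using that term_distinct[of "c i" "c j" i j] assms(1) by auto
 from dominant_term[OF V finite_lessThan this ex] obtain i where
  "i \<in> {..<\<q>}" "c i * zz ^ i \<noteq> 0" "veq V (\<Sum>j<\<q>. c j * zz ^ j) (c i * zz ^ i)"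
  "\<And>j. j \<in> {..<\<q>} ==> j \<noteq> i ==> (c j * zz ^ j) / (c i * zz ^ i) \<in> mx V"
  by blast
 then show ?thesis using that[of i] by auto
qed

end

lemma place_infinity: obtains V where "valring V" "tt \<in> mx V"
 using valring_trans[OF trans_inverse[OF trans_xx]] by blast

text \<open>A nontrivial combination has a dominant term, hence is not zero.\<close>

lemma z_independent:
 assumes "\<And>j. c j \<in> E1" "(\<Sum>j<\<q>. c j * zz ^ j) = 0" "i < \<q>" shows "c i = 0"
proof (rule ccontr)
 assume "c i \<noteq> 0"
 then have ex: "\<exists>j<\<q>. c j \<noteq> 0" using assms(3) by blast
 obtain V where V: "valring V" "tt \<in> mx V" by (rule place_infinity)
 obtain i where "veq V (\<Sum>j<\<q>. c j * zz ^ j) (c i * zz ^ i)" by (rule dominant_power[OF V assms(1) ex])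
 then show False using assms(2) by (simp add: veq_def)
qed

lemma z_unique:
 assumes "\<And>j. c j \<in> E1" "\<And>j. d j \<in> E1" "(\<Sum>j<\<q>. c j * zz ^ j) = (\<Sum>j<\<q>. d j * zz ^ j)" "i < \<q>"
 shows "c i = d i"
proof -
 have "(\<Sum>j<\<q>. (c j - d j) * zz ^ j) = (\<Sum>j<\<q>. c j * zz ^ j) - (\<Sum>j<\<q>. d j * zz ^ j)"
  by (simp only: left_diff_distrib sum_minus)
 then have "(\<Sum>j<\<q>. (c j - d j) * zz ^ j) = 0" using assms(3) by simp
 then show ?thesis using z_independent[of "%j. c j - d j" i] assms sringD(6)[OF sfield_sring[OF E1_field]] by auto
qed

text \<open>The span is a ring of algebraic elements, hence a field.\<close>

lemma AS_span:
 assumes E: "sfield E" and w: "w ^ \<q> + w \<in> E"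
 shows "sfield (span_ext E w \<q>)" "E \<subseteq> span_ext E w \<q>" "w \<in> span_ext E w \<q>"
proof -
 note R = sfield_sring[OF E]
 have "w ^ \<q> = (w ^ \<q> + w) * w ^ 0 + (-1) * w ^ 1" by simp
 moreover have "w ^ 0 \<in> span_ext E w \<q>" "w ^ 1 \<in> span_ext E w \<q>"
  using q_ge3 by (intro span_ext_power[OF R]; linarith)+
 moreover have "-1 \<in> E" using sringD(2,4)[OF R] by blast
 ultimately have wq: "w ^ \<q> \<in> span_ext E w \<q>" using span_ext_ops(2,3)[OF R] w by metis
 note S = span_ext_ring[OF R q_pos wq]
 show "E \<subseteq> span_ext E w \<q>" "w \<in> span_ext E w \<q>" by fact+
 have alw: "alg E w" by (rule AS_alg[OF E w])
 show "sfield (span_ext E w \<q>)"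
 proof (rule algebraic_ring_sfield[OF E S(1,2)])
  fix b assume "b \<in> span_ext E w \<q>"
  then obtain c where c: "\<forall>i. c i \<in> E" "b = (\<Sum>i<\<q>. c i * w ^ i)" by (auto simp: span_ext_def)
  note AR = sfield_sring[OF alg_sfield[OF E]]
  have "c i \<in> {a. alg E a}" for i using c(1) alg_self[OF E] by blast
  moreover have "w ^ i \<in> {a. alg E a}" for i by (rule sring_power[OF AR]) (use alw in simp)
  ultimately have "c i * w ^ i \<in> {a. alg E a}" for i by (rule sringD(5)[OF AR])
  then have "b \<in> {a. alg E a}" unfolding c(2) by (rule sring_sum[OF AR])
  then show "alg E b" by simp
 qed
qed

lemma z_span: "span_ext E1 zz \<q> = UNIV"
proof -
 have "zz ^ \<q> + zz \<in> E1" using zz_eq E1_mem(2) sring_power[OF sfield_sring[OF E1_field]] by simp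
 note S = AS_span[OF E1_field this]
 have "kf \<union> {xx, ss, zz} \<subseteq> span_ext E1 zz \<q>" using S(2,3) E1_mem by blast
 from fgen_least[OF S(1) this] show ?thesis unfolding generates by blast
qed

lemma z_expansion: obtains c where "\<And>j. c j \<in> E1" "a = (\<Sum>j<\<q>. c j * zz ^ j)"
proof -
 have "a \<in> span_ext E1 zz \<q>" using z_span by simp
 then show ?thesis using that by (auto simp: span_ext_def)
qed

lemma any_value:
 assumes V: "valring V" "tt \<in> mx V" and a: "a \<noteq> 0" shows "\<exists>n. veq V (a ^ \<q>) (zp tt n)"
proof -
 obtain c where c: "\<And>j. c j \<in> E1" "a = (\<Sum>j<\<q>. c j * zz ^ j)" using z_expansion by blast
 have "\<exists>j<\<q>. c j \<noteq> 0"
 proof (rule ccontr)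
  assume "\<not> ?thesis" then have "a = 0" unfolding c(2) by simp
  then show False using a by simp
 qed
 then obtain i where i: "c i \<noteq> 0" "veq V (\<Sum>j<\<q>. c j * zz ^ j) (c i * zz ^ i)"
  by (rule dominant_power[OF V c(1)])
 then show ?thesis using veq_power[OF V(1) i(2)[folded c(2)], of \<q>] term_value[OF V c(1) i(1), of i] veq_trans[OF V(1)] by blast
qed

end

section \<open>Construction of automorphisms\<close>

lemma nat_dvd_factor: "(l::nat) dvd n ==> n dvd i ==> \<exists>j. i = l * j"
 by (meson dvd_trans dvdE)

lemma nat_coprime_dvd: "coprime (l::nat) n ==> n dvd i * l ==> n dvd i"
 by (simp add: coprime_commute coprime_dvd_mult_left_iff)

lemma nat_coprime_mult_dvd: "coprime (l::nat) n ==> l dvd i ==> n dvd i ==> l * n dvd i"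
 by (rule divides_mult)

lemma nat_mult_dvdD: "(l::nat) * n dvd i ==> l dvd i \<and> n dvd i"
 by (auto dest: dvd_mult_left dvd_mult_right)

lemma nat_prime_coprime: "Factorial_Ring.prime (l::nat) ==> \<not> l dvd n ==> coprime l n"
 by (rule prime_imp_coprime)

lemma nat_prime_gcd: "Factorial_Ring.prime (l::nat) ==> gcd l n \<noteq> 1 ==> l dvd n"
 using prime_imp_coprime coprime_iff_gcd_eq_1 by blast

lemma nat_prime_coprime_not_dvd: "Factorial_Ring.prime (p::nat) ==> coprime l p ==> \<not> p dvd l"
 by (metis coprime_common_divisor dvd_refl not_prime_unit)

context ffield begin

definition homon :: "'a set => ('a => 'a) => bool" where
 "homon A f \<longleftrightarrow> f 1 = 1 \<and> (\<forall>a\<in>A. \<forall>b\<in>A. f (a + b) = f a + f b \<and> f (a * b) = f a * f b)"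

definition aut :: "('a => 'a) => bool" where
 "aut f \<longleftrightarrow> bij f \<and> homon UNIV f \<and> (\<forall>c\<in>kf. f c = c)"

lemma homonD:
 assumes "homon A f" shows "f 1 = 1" "a \<in> A ==> b \<in> A ==> f (a + b) = f a + f b"
  "a \<in> A ==> b \<in> A ==> f (a * b) = f a * f b"
 using assms by (auto simp: homon_def)

lemma hom_0: assumes "sring A" "homon A f" shows "f 0 = 0"
 using homonD(2)[OF assms(2), of 0 0] sringD(1)[OF assms(1)] by simp

lemma hom_minus: assumes "sring A" "homon A f" "a \<in> A" shows "f (- a) = - f a"
proof -
 have "f a + f (- a) = 0"
  using homonD(2)[OF assms(2,3), of "-a"] sringD(4)[OF assms(1,3)] hom_0[OF assms(1,2)] by simp
 then show ?thesis by (simp add: eq_neg_iff_add_eq_0 add.commute)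
qed

lemma hom_diff: assumes "sring A" "homon A f" "a \<in> A" "b \<in> A" shows "f (a - b) = f a - f b"
 using homonD(2)[OF assms(2,3), of "-b"] hom_minus[OF assms(1,2,4)] sringD(4)[OF assms(1,4)] by simp

lemma hom_power: assumes "sring A" "homon A f" "a \<in> A" shows "f (a ^ n) = f a ^ n"
 by (induction n) (simp_all add: homonD[OF assms(2)] assms(3) sring_power[OF assms(1,3)])

lemma hom_inverse: assumes "sfield A" "homon A f" "a \<in> A" shows "f (inverse a) = inverse (f a)"
proof (cases "a = 0")
 case True then show ?thesis using hom_0[OF sfield_sring[OF assms(1)] assms(2)] by simp
next
 case False
 have "f a * f (inverse a) = 1"
  using homonD(3)[OF assms(2,3) sfield_inverse[OF assms(1,3)]] False homonD(1)[OF assms(2)] by simp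
 then show ?thesis by (rule inverse_unique[symmetric])
qed

lemma hom_sum: assumes "sring A" "homon A f" "\<And>i. i \<in> I ==> g i \<in> A" shows "f (sum g I) = (\<Sum>i\<in>I. f (g i))"
 using assms(3)
proof (induction I rule: infinite_finite_induct)
 case (insert i I)
 then show ?case using homonD(2)[OF assms(2), of "g i" "sum g I"] sring_sum[OF assms(1), of I g] by simp
qed (simp_all add: hom_0[OF assms(1,2)])

lemma autD:
 assumes "aut f"
 shows "bij f" "homon UNIV f" "c \<in> kf ==> f c = c" "f (a + b) = f a + f b" "f (a * b) = f a * f b"
  "f 0 = 0" "f 1 = 1" "f (- a) = - f a" "f (a - b) = f a - f b" "f (a ^ n) = f a ^ n"
  "f (inverse a) = inverse (f a)" "f (a / b) = f a / f b"
proof -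
 have h: "homon UNIV f" using assms by (simp add: aut_def)
 have U: "sfield UNIV" by (simp add: sfield_def sring_UNIV)
 show "bij f" "homon UNIV f" "c \<in> kf ==> f c = c" using assms by (auto simp: aut_def)
 show "f (a + b) = f a + f b" and m: "f (a * b) = f a * f b" for a b using homonD[OF h] by auto
 show "f 0 = 0" "f 1 = 1" "f (- a) = - f a" "f (a - b) = f a - f b" "f (a ^ n) = f a ^ n"
  using hom_0[OF sring_UNIV h] homonD(1)[OF h] hom_minus[OF sring_UNIV h] hom_diff[OF sring_UNIV h]
   hom_power[OF sring_UNIV h] by auto
 show i: "f (inverse a) = inverse (f a)" for a using hom_inverse[OF U h] by auto
 show "f (a / b) = f a / f b" by (simp add: field_divide_inverse m i)
qed

lemma aut_sum: "aut f ==> f (sum g I) = (\<Sum>i\<in>I. f (g i))"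
 using hom_sum[OF sring_UNIV autD(2)] by simp

lemma aut_eq_iff: "aut f ==> f a = f b \<longleftrightarrow> a = b"
 using autD(1) by (metis bij_pointE)

lemma aut_comp: "aut f ==> aut g ==> aut (f \<circ> g)"
 unfolding aut_def homon_def by (auto intro: bij_comp)

lemma aut_id: "aut (%a. a)" unfolding aut_def homon_def by (auto simp: bij_def)

lemma aut_inv: assumes f: "aut f" shows "aut (inv_into UNIV f)"
proof -
 let ?g = "inv_into UNIV f"
 have fg: "f (?g a) = a" for a using autD(1)[OF f] by (simp add: bij_is_surj surj_f_inv_f)
 have gf: "?g (f a) = a" for a using autD(1)[OF f] by (simp add: bij_is_inj inv_f_f)
 have "?g (a + b) = ?g a + ?g b" "?g (a * b) = ?g a * ?g b" for a b
  using autD(4)[OF f, of "?g a" "?g b"] autD(5)[OF f, of "?g a" "?g b"] fg gf by metis+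
 moreover have "?g 1 = 1" using gf[of 1] autD(7)[OF f] by simp
 moreover have "?g c = c" if "c \<in> kf" for c using gf[of c] autD(3)[OF f that] by simp
 ultimately show ?thesis unfolding aut_def homon_def using bij_imp_bij_inv[OF autD(1)[OF f]] by simp
qed

lemma aut_fixed_sfield: "aut f ==> sfield {a. f a = a}"
 by (intro sfieldI sringI) (auto simp: autD)

lemma aut_agree_sfield: "aut f ==> aut g ==> sfield {a. f a = g a}"
 by (intro sfieldI sringI) (auto simp: autD)

text \<open>A rational function in a transcendental element determines its value at any other such
 element.\<close>

lemma rational_hom:
 assumes x: "trans x" and y: "trans y"
 obtains f where "homon (fgen (insert x kf)) f" "\<And>c. c \<in> kf ==> f c = c" "f x = y"
proof -
 define rel where "rel a b \<longleftrightarrow> (\<exists>P\<in>polys kf. \<exists>Q\<in>polys kf. Q x \<noteq> 0 \<and> a = P x / Q x \<and> b = P y / Q y)" for a b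
 have nz: "Q y \<noteq> 0" if "Q \<in> polys kf" "Q x \<noteq> 0" for Q using trans_fun[OF y that(1)] that(2) by blast
 have relI: "rel (P x / Q x) (P y / Q y)" if "P \<in> polys kf" "Q \<in> polys kf" "Q x \<noteq> 0" for P Q
  using that by (auto simp: rel_def)
 have uniq: "b = b'" if "rel a b" "rel a b'" for a b b'
 proof -
  obtain P Q P' Q' where *: "P \<in> polys kf" "Q \<in> polys kf" "Q x \<noteq> 0" "a = P x / Q x" "b = P y / Q y"
   "P' \<in> polys kf" "Q' \<in> polys kf" "Q' x \<noteq> 0" "a = P' x / Q' x" "b' = P' y / Q' y"
   using \<open>rel a b\<close> \<open>rel a b'\<close> unfolding rel_def by blast
  have "(%t. P t * Q' t - P' t * Q t) \<in> polys kf" using * by (intro polys_diff polys_mult kf_ring)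
  moreover have "P x * Q' x - P' x * Q x = 0" using * by (simp add: frac_eq_eq)
  ultimately have "P y * Q' y - P' y * Q y = 0" by (rule trans_fun[OF x])
  then show "b = b'" using * nz by (simp add: frac_eq_eq)
 qed
 have ex: "\<exists>b. rel a b" if a: "a \<in> fgen (insert x kf)" for a
 proof -
  obtain P Q where PQ: "P \<in> polys kf" "Q \<in> polys kf" "a = P x / Q x"
   using a unfolding fgen_fraction rgen_insert[OF kf_ring] by auto
  show ?thesis
  proof (cases "Q x = 0")
   case True
   have "rel 0 0" using relI[OF polys_const[OF kfD(1)] polys_const[OF kfD(2)]] by simp
   then show ?thesis using PQ(3) True by auto
  next
   case False then show ?thesis using relI PQ by blast
  qed
 qed
 define f where "f a = (THE b. rel a b)" for a
 have fI: "f a = b" if "rel a b" for a b unfolding f_def using that uniq by blast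
 have add: "rel (a + c) (b + d)" and mult: "rel (a * c) (b * d)" if ab: "rel a b" and cd: "rel c d" for a b c d
 proof -
  obtain P Q P' Q' where *: "P \<in> polys kf" "Q \<in> polys kf" "Q x \<noteq> 0" "a = P x / Q x" "b = P y / Q y"
   "P' \<in> polys kf" "Q' \<in> polys kf" "Q' x \<noteq> 0" "c = P' x / Q' x" "d = P' y / Q' y"
   using ab cd unfolding rel_def by blast
  have Q: "(%t. Q t * Q' t) \<in> polys kf" using * by (intro polys_mult kf_ring)
  have "(%t. P t * Q' t + P' t * Q t) \<in> polys kf" "(%t. P t * P' t) \<in> polys kf"
   by (intro polys_add polys_mult kf_ring *)+
  from relI[OF this(1) Q] relI[OF this(2) Q] show "rel (a + c) (b + d)" "rel (a * c) (b * d)"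
   using * nz by (simp_all add: add_frac_eq)
 qed
 have "homon (fgen (insert x kf)) f"
  unfolding homon_def
 proof (intro conjI ballI)
  show "f 1 = 1" using fI relI[OF polys_const[OF kfD(2)] polys_const[OF kfD(2)]] by simp
  fix a c assume "a \<in> fgen (insert x kf)" "c \<in> fgen (insert x kf)"
  then obtain b d where "rel a b" "rel c d" using ex by blast
  then show "f (a + c) = f a + f c" "f (a * c) = f a * f c" using fI add mult by metis+
 qed
 moreover have "f c = c" if "c \<in> kf" for c
  using fI relI[OF polys_const[OF that] polys_const[OF kfD(2)]] by simp
 moreover have "f x = y" using fI relI[OF polys_id[OF kf_ring] polys_const[OF kfD(2)]] by simp
 ultimately show ?thesis using that by blast
qed

lemma of_nat_nz: assumes "\<not> \<p> dvd n" shows "of_nat n \<noteq> (0::'a)"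
proof
 assume z: "of_nat n = (0::'a)"
 have "n \<noteq> 0"
 proof
  assume "n = 0" then have "\<p> dvd n" by simp
  then show False using assms by contradiction
 qed
 then obtain d i j where d: "d dvd n" "d dvd \<p>" "n * i = \<p> * j + d" using bezout_add_strong_nat by blast
 have "d = 1" using d(1,2) prime_chp assms unfolding prime_nat_iff by blast
 then have "of_nat (n * i) = (of_nat (\<p> * j + 1) :: 'a)" using d(3) by simp
 then show False using z char_chp by simp
qed

lemma order_multiple:
 assumes "a ^ n = 1" "a ^ i = (1::'a)" shows "a ^ gcd n i = 1"
proof (cases "n = 0")
 case False
 then obtain j l where "n * j = i * l + gcd n i" using bezout_nat by blast
 then have "(a ^ n) ^ j = (a ^ i) ^ l * a ^ gcd n i" by (simp add: power_mult[symmetric] power_add[symmetric])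
 then show ?thesis using assms by simp
qed (use assms in simp)

text \<open>By induction over the prime factors l of n. If l divides n/l, take an l-th root of a
 primitive root of order n/l; otherwise multiply the latter by a root of unity of order l.\<close>

lemma primitive_root_ex:
 assumes "0 < n" "coprime n \<p>"
 shows "\<exists>r\<in>kf. \<forall>i. r ^ i = 1 \<longleftrightarrow> n dvd i"
 using assms
proof (induction n rule: less_induct)
 case (less n)
 show ?case
 proof (cases "n = 1")
  case True then show ?thesis using kfD(2) by (intro bexI[of _ 1]) auto
 next
  case False
  then obtain l where l: "Factorial_Ring.prime l" "l dvd n" using prime_factor_nat by blast
  then obtain n' where n': "n = l * n'" by blast
  have n'0: "0 < n'" "n' < n" using less.prems(1) n' prime_gt_1_nat[OF l(1)] by auto
  have co: "coprime l \<p>" "coprime n' \<p>" using less.prems(2) n' by auto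
  obtain a where a: "a \<in> kf" "\<And>i. a ^ i = 1 \<longleftrightarrow> n' dvd i" using less.IH[OF n'0(2,1) co(2)] by blast
  show ?thesis
  proof (cases "l dvd n'")
   case True
   obtain l' where l': "l = Suc l'" using l(1) by (metis not0_implies_Suc not_prime_0)
   have "set ([- a] @ replicate l' 0) \<subseteq> kf" using a(1) kfD(1,4) by auto
   from root_ex[OF _ this] obtain b where b: "b \<in> kf" "peval (([- a] @ replicate l' 0) @ [1]) b = 0" by auto
   have "peval (replicate i 0 @ [1]) b = b ^ i" for i by (induction i) auto
   then have ba: "b ^ l = a" using b(2) l' by (simp add: peval_append)
   have "b ^ i = 1 \<longleftrightarrow> n dvd i" for i
   proof
    assume i: "b ^ i = 1"
    have "a ^ i = (b ^ i) ^ l" unfolding ba[symmetric] by (rule power_swap)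
    then have "n' dvd i" using i a(2) by simp
    then obtain j where j: "i = l * j" using nat_dvd_factor[OF True] by blast
    have "a ^ j = 1" using i unfolding j ba[symmetric] by (simp add: power_mult)
    then show "n dvd i" using a(2) n' j by simp
   next
    assume "n dvd i"
    then obtain j where "i = n * j" using nat_dvd_factor[of n n i] by auto
    then have "i = l * (n' * j)" by (simp add: n')
    then show "b ^ i = 1" using a(2)[of "n' * j"] ba by (simp add: power_mult)
   qed
   then show ?thesis using b(1) by blast
  next
   case False
   obtain l' where l': "l = Suc l'" "0 < l'" using prime_gt_1_nat[OF l(1)] by (cases l) auto
   have "set (replicate l' (1::'a)) \<subseteq> kf" "replicate l' (1::'a) \<noteq> []" using l'(2) kfD(2) by auto
   then obtain r where r: "r \<in> kf" "peval (replicate l' 1 @ [1]) r = 0" using root_ex by blast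
   have pe: "peval (replicate i 1 @ [1]) b = (\<Sum>j<Suc i. b ^ j)" for i b
    by (induction i) (simp_all add: sum.lessThan_Suc_shift sum_distrib_left distrib_left del: sum.lessThan_Suc)
   have rl: "r ^ l = 1"
   proof -
    have "(r - 1) * peval (replicate i 1 @ [1]) r = r ^ Suc i - 1" for i
    proof (induction i)
     case (Suc i)
     have "(r - 1) * peval (replicate (Suc i) 1 @ [1]) r = (r - 1) + r * ((r - 1) * peval (replicate i 1 @ [1]) r)"
      by (simp add: algebra_simps)
     also have "... = (r - 1) + r * (r ^ Suc i - 1)" using Suc by simp
     also have "... = r ^ Suc (Suc i) - 1" by (simp add: algebra_simps)
     finally show ?case .
    qed simp
    from this[of l'] have "r ^ Suc l' - 1 = 0" using r(2) by (metis mult_zero_right)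
    then show ?thesis unfolding l'(1) by (simp only: right_minus_eq)
   qed
   have r1: "r \<noteq> 1"
   proof
    assume "r = 1"
    then have "of_nat l = (0::'a)" using r(2) pe[of l' 1] l'(1) by simp
    moreover have "\<not> \<p> dvd l" using nat_prime_coprime_not_dvd[OF prime_chp co(1)] .
    ultimately show False using of_nat_nz by blast
   qed
   have ri: "r ^ i = 1 \<longleftrightarrow> l dvd i" for i
   proof
    assume i: "r ^ i = 1"
    have "gcd l i \<noteq> 1" using order_multiple[OF rl i] r1 by auto
    then show "l dvd i" by (rule nat_prime_gcd[OF l(1)])
   qed (use rl in \<open>auto simp: power_mult\<close>)
   have cop: "coprime l n'" by (rule nat_prime_coprime[OF l(1) False])
   have "(a * r) ^ i = 1 \<longleftrightarrow> n dvd i" for i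
   proof
    assume i: "(a * r) ^ i = 1"
    have "(a ^ i) ^ l * (r ^ l) ^ i = 1" using i by (metis power_mult_distrib power_one power_swap)
    then have "a ^ (i * l) = 1" using rl by (simp add: power_mult)
    then have "n' dvd i * l" using a(2) by simp
    then have n'i: "n' dvd i" by (rule nat_coprime_dvd[OF cop])
    then have "a ^ i = 1" using a(2) by blast
    then have "r ^ i = 1" using i by (simp add: power_mult_distrib)
    then show "n dvd i" using nat_coprime_mult_dvd[OF cop _ n'i] ri n' by simp
   next
    assume "n dvd i"
    then have "n' dvd i" "l dvd i" unfolding n' using nat_mult_dvdD by blast+
    then have "a ^ i = 1" "r ^ i = 1" using a(2) ri by blast+
    then show "(a * r) ^ i = 1" by (simp add: power_mult_distrib)
   qed
   then show ?thesis using a(1) r(1) kfD(5) by blast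
  qed
 qed
qed

lemma monom_peval: "\<exists>as. set as \<subseteq> {0, - a} \<and> length as = n \<and> (\<forall>t. peval (as @ [1]) t = t ^ n - a)" if n0: "0 < n"
proof -
 obtain n' where n: "n = Suc n'" using n0 gr0_implies_Suc by blast
 have "peval (replicate i 0 @ [1]) b = b ^ i" for i b by (induction i) auto
 then show ?thesis using n by (intro exI[of _ "[- a] @ replicate n' 0"]) (auto simp: peval_append algebra_simps)
qed

lemma nth_root_ex: assumes "a \<in> kf" "0 < n" shows "\<exists>r\<in>kf. r ^ n = a"
proof -
 obtain as where as: "set as \<subseteq> {0, - a}" "length as = n" "\<forall>t. peval (as @ [1]) t = t ^ n - a"
  using monom_peval[OF assms(2)] by blast
 have "set as \<subseteq> kf" "as \<noteq> []" using as(1,2) assms kfD(1,4) by auto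
 then show ?thesis using root_ex[of as] as(3) by auto
qed

lemma roots_of_unity:
 assumes r: "\<And>i. r ^ i = 1 \<longleftrightarrow> n dvd i" "0 < n" "b ^ n = 1"
 shows "\<exists>i<n. b = r ^ i"
proof (rule ccontr)
 assume no: "\<not> ?thesis"
 have r0: "r \<noteq> 0" using r(1)[of n] r(2) by (auto simp: power_0_left)
 have le: "i = j" if "r ^ i = r ^ j" "i \<le> j" "j < n" for i j
 proof -
  have "r ^ (j - i) = 1" using that r0 by (simp add: power_diff)
  then have "n dvd j - i" using r(1) by simp
  moreover have "j - i < n" using that(3) by simp
  ultimately have "j - i = 0" using nat_dvd_not_less by blast
  then show ?thesis using that(2) by simp
 qed
 have inj: "inj_on (%i. r ^ i) {..<n}"
 proof (rule inj_onI)
  fix i j assume "i \<in> {..<n}" "j \<in> {..<n}" "r ^ i = r ^ j"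
  then show "i = j" using le[of i j] le[of j i] by (cases "i \<le> j") auto
 qed
 obtain as where as: "length as = n" "\<forall>t. peval (as @ [1]) t = t ^ n - 1" using monom_peval[OF r(2)] by blast
 have "card (insert b ((%i. r ^ i) ` {..<n})) \<le> length as"
 proof (rule monic_roots_le)
  fix t assume "t \<in> insert b ((%i. r ^ i) ` {..<n})"
  then have "t ^ n = 1" using r(3) r(1)[of n] by (auto simp: power_swap[of r _ n])
  then show "peval (as @ [1]) t = 0" using as(2) by simp
 qed simp
 moreover have "b \<notin> (%i. r ^ i) ` {..<n}" using no by auto
 ultimately show False using card_image[OF inj] as(1) by simp
qed

text \<open>As a polynomial in w the element a takes the same value at all conjugates of w, so it is
 constant.\<close>

lemma fixed_in_base:
 assumes E: "sring E" and a: "a \<in> span_ext E w n" and n: "0 < n"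
  and T: "finite T" "n \<le> card T"
  and conj: "\<And>t. t \<in> T ==> \<exists>f. aut f \<and> f w = t \<and> (\<forall>e\<in>E. f e = e) \<and> f a = a"
 shows "a \<in> E"
proof -
 obtain c where c: "\<forall>i. c i \<in> E" "a = (\<Sum>i<n. c i * w ^ i)" using a by (auto simp: span_ext_def)
 have "(\<Sum>i<n. c i * t ^ i) = a" if tT: "t \<in> T" for t
 proof -
  obtain f where f: "aut f" "f w = t" "\<forall>e\<in>E. f e = e" "f a = a" using conj[OF tT] by blast
  have "f a = (\<Sum>i<n. f (c i * w ^ i))" unfolding c(2) by (rule aut_sum[OF f(1)])
  also have "... = (\<Sum>i<n. c i * t ^ i)" using f c(1) by (simp add: autD[OF f(1)])
  finally show ?thesis using f(4) by simp
 qed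
 then have "c 0 = a" by (rule coeffs_const_if_many_values[OF T _ n])
 then show ?thesis using c(1) by metis
qed

end

context cfield begin

text \<open>The group of translations.\<close>

definition Om :: "'a set" where "Om = {a \<in> kf. a ^ \<q> + a = 0}"

lemma OmD: "a \<in> Om ==> a \<in> kf" "a \<in> Om ==> a ^ \<q> = - a"
 by (auto simp: Om_def eq_neg_iff_add_eq_0)

lemma OmI: "a \<in> kf ==> a ^ \<q> = - a ==> a \<in> Om"
 by (simp add: Om_def)

lemma Om_add: assumes "a \<in> Om" "b \<in> Om" shows "a + b \<in> Om"
proof (rule OmI)
 show "a + b \<in> kf" using OmD(1)[OF assms(1)] OmD(1)[OF assms(2)] by (rule kfD(3))
 show "(a + b) ^ \<q> = - (a + b)" unfolding frob_add OmD(2)[OF assms(1)] OmD(2)[OF assms(2)] by simp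
qed

lemma Om_minus: assumes "a \<in> Om" shows "- a \<in> Om"
proof (rule OmI)
 show "- a \<in> kf" using OmD(1)[OF assms] by (rule kfD(4))
 show "(- a) ^ \<q> = - (- a)" unfolding frob_minus OmD(2)[OF assms] by simp
qed

lemma Om_0: "0 \<in> Om"
 by (rule OmI) (use kfD(1) q_pos in \<open>auto simp: power_0_left\<close>)

lemma Om_scale: assumes "c \<in> kf" "c ^ \<q> = c" "a \<in> Om" shows "c * a \<in> Om"
proof (rule OmI)
 show "c * a \<in> kf" using assms(1) OmD(1)[OF assms(3)] by (rule kfD(5))
 show "(c * a) ^ \<q> = - (c * a)" unfolding power_mult_distrib OmD(2)[OF assms(3)] assms(2) by simp
qed

lemma card_Om: "card Om = \<q>" "finite Om"
proof -
 obtain r where r: "\<q> = Suc r" "0 < r" by (metis q_Suc zero_less_Suc)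
 obtain e where e: "e \<in> kf" "e ^ r = - 1" using nth_root_ex[of "-1" r] r(2) kfD(2,4) by auto
 have e0: "e \<noteq> 0" using e(2) r(2) by (auto simp: power_0_left)
 have eq: "e ^ \<q> = - e" unfolding r(1) using e(2) by simp
 have "Om = (%a. e * a) ` {a \<in> kf. a ^ \<q> = a}"
 proof (intro equalityI subsetI)
  fix a assume a: "a \<in> Om"
  have "(a / e) ^ \<q> = a / e" using OmD[OF a] eq by (simp add: power_divide)
  then show "a \<in> (%a. e * a) ` {a \<in> kf. a ^ \<q> = a}"
   using OmD(1)[OF a] sfield_divide[OF kf _ e(1)] e0 by (intro image_eqI[of _ _ "a / e"]) auto
 next
  fix b assume "b \<in> (%a. e * a) ` {a \<in> kf. a ^ \<q> = a}"
  then obtain a where a: "b = e * a" "a \<in> kf" "a ^ \<q> = a" by blast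
  show "b \<in> Om"
  proof (rule OmI)
   show "b \<in> kf" unfolding a(1) using e(1) a(2) by (rule kfD(5))
   show "b ^ \<q> = - b" unfolding a(1) power_mult_distrib eq a(3) by simp
  qed
 qed
 moreover have "inj_on (%a. e * a) {a \<in> kf. a ^ \<q> = a}" using e0 by (auto simp: inj_on_def)
 ultimately show "card Om = \<q>" using card_Fq by (simp add: card_image)
 then show "finite Om" using q_pos card_ge_0_finite by metis
qed

text \<open>Multiplication by w in coordinates with respect to the powers of w.\<close>

lemma AS_shift:
 assumes "w ^ \<q> + w = a"
 shows "w * (\<Sum>i<\<q>. c i * w ^ i)
  = (\<Sum>i<\<q>. (if i = 0 then c (\<q> - 1) * a else c (i - 1) - (if i = 1 then c (\<q> - 1) else 0)) * w ^ i)"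
  (is "_ = ?r")
proof -
 obtain r where r: "\<q> = Suc (Suc r)" by (rule q_Suc)
 have "?r = c (Suc r) * a + ((c 0 - c (Suc r)) * w + (\<Sum>i<r. c (Suc i) * w ^ Suc (Suc i)))"
  unfolding r by (simp add: sum.lessThan_Suc_shift del: sum.lessThan_Suc)
 also have "... = c (Suc r) * (a - w) + (c 0 * w + (\<Sum>i<r. c (Suc i) * w ^ Suc (Suc i)))"
  by (simp add: algebra_simps)
 also have "a - w = w ^ \<q>" using assms by (metis add_diff_cancel_right')
 also have "c (Suc r) * w ^ \<q> + (c 0 * w + (\<Sum>i<r. c (Suc i) * w ^ Suc (Suc i)))
   = c 0 * w + (\<Sum>i<Suc r. c (Suc i) * w ^ Suc (Suc i))"
  unfolding r sum.lessThan_Suc power_Suc by (simp only: add.assoc add.commute add.left_commute)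
 also have "... = (\<Sum>i<Suc (Suc r). c i * w ^ Suc i)"
  by (subst (2) sum.lessThan_Suc_shift) simp
 also have "... = w * (\<Sum>i<\<q>. c i * w ^ i)" unfolding r
  by (simp add: sum_distrib_left mult.left_commute del: sum.lessThan_Suc)
 finally show ?thesis by simp
qed

text \<open>The powers of w are a basis, so the only relation to respect is the equation of
 w.\<close>

lemma AS_hom:
 assumes E: "sfield E" and f: "homon E f" and a: "a \<in> E" "w ^ \<q> + w = a" and b: "b ^ \<q> + b = f a"
  and ind: "\<forall>c. (\<forall>j. c j \<in> E) --> (\<Sum>j<\<q>. c j * w ^ j) = 0 --> (\<forall>i<\<q>. c i = 0)"
 obtains g where "homon (span_ext E w \<q>) g" "\<And>e. e \<in> E ==> g e = f e" "g w = b"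
proof -
 note R = sfield_sring[OF E]
 note RD = sringD[OF R]
 define g where "g u = (\<Sum>i<\<q>. f ((SOME c. (\<forall>i. c i \<in> E) \<and> u = (\<Sum>i<\<q>. c i * w ^ i)) i) * b ^ i)" for u
 have g: "g (\<Sum>i<\<q>. c i * w ^ i) = (\<Sum>i<\<q>. f (c i) * b ^ i)" if c: "\<And>i. c i \<in> E" for c
 proof -
  let ?P = "%d. (\<forall>i. d i \<in> E) \<and> (\<Sum>i<\<q>. c i * w ^ i) = (\<Sum>i<\<q>. d i * w ^ i)"
  define d where "d = (SOME d. ?P d)"
  have d: "?P d" unfolding d_def by (rule someI[of ?P c]) (use c in auto)
  have "(\<Sum>j<\<q>. (c j - d j) * w ^ j) = (\<Sum>j<\<q>. c j * w ^ j) - (\<Sum>j<\<q>. d j * w ^ j)"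
   by (simp only: left_diff_distrib sum_minus)
  also have "... = 0" using d by simp
  finally have z: "(\<Sum>j<\<q>. (c j - d j) * w ^ j) = 0" .
  have "c i = d i" if "i < \<q>" for i
   using ind[rule_format, of "%j. c j - d j" i, OF _ z that] c d RD(6) by simp
  then show ?thesis unfolding g_def d_def[symmetric] by (intro sum.cong) auto
 qed
 have get: "\<exists>c. (\<forall>i. c i \<in> E) \<and> u = (\<Sum>i<\<q>. c i * w ^ i)" if "u \<in> span_ext E w \<q>" for u
  using that by (auto simp: span_ext_def)
 have g_add: "g (u + v) = g u + g v" if uv: "u \<in> span_ext E w \<q>" "v \<in> span_ext E w \<q>" for u v
 proof -
  obtain c d where c: "\<And>i. c i \<in> E" "u = (\<Sum>i<\<q>. c i * w ^ i)" and d: "\<And>i. d i \<in> E" "v = (\<Sum>i<\<q>. d i * w ^ i)"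
   using get uv by metis
  have "u + v = (\<Sum>i<\<q>. (c i + d i) * w ^ i)" unfolding c d by (simp add: sum.distrib distrib_right)
  then have "g (u + v) = (\<Sum>i<\<q>. f (c i + d i) * b ^ i)" using g[of "%i. c i + d i"] c d RD(3) by simp
  also have "... = (\<Sum>i<\<q>. f (c i) * b ^ i) + (\<Sum>i<\<q>. f (d i) * b ^ i)"
   using c d by (simp add: homonD[OF f] sum.distrib distrib_right)
  finally show ?thesis using g[OF c(1)] g[OF d(1)] c(2) d(2) by simp
 qed
 have g_scale: "g (e * u) = f e * g u" if e: "e \<in> E" and u: "u \<in> span_ext E w \<q>" for e u
 proof -
  obtain c where c: "\<And>i. c i \<in> E" "u = (\<Sum>i<\<q>. c i * w ^ i)" using get[OF u] by blast
  have "e * u = (\<Sum>i<\<q>. (e * c i) * w ^ i)" unfolding c by (simp add: sum_distrib_left mult.assoc)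
  then have "g (e * u) = (\<Sum>i<\<q>. f (e * c i) * b ^ i)" using g[of "%i. e * c i"] c e RD(5) by simp
  also have "... = f e * (\<Sum>i<\<q>. f (c i) * b ^ i)"
   using c e by (simp add: homonD[OF f] sum_distrib_left mult.assoc)
  finally show ?thesis using g[OF c(1)] c(2) by simp
 qed
 have g_shift: "g (w * u) = b * g u" if u: "u \<in> span_ext E w \<q>" for u
 proof -
  obtain c where c: "\<And>i. c i \<in> E" "u = (\<Sum>i<\<q>. c i * w ^ i)" using get[OF u] by blast
  define c' where "c' a c i = (if i = 0 then c (\<q> - 1) * a else c (i - 1) - (if i = 1 then c (\<q> - 1) else 0))"
   for a and c :: "nat => 'a" and i :: nat
  have "c' a c i \<in> E" for i using c a RD by (auto simp: c'_def)
  moreover have "w * u = (\<Sum>i<\<q>. c' a c i * w ^ i)" unfolding c(2) c'_def by (rule AS_shift[OF a(2)])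
  ultimately have "g (w * u) = (\<Sum>i<\<q>. f (c' a c i) * b ^ i)" using g[of "c' a c"] by simp
  also have "... = (\<Sum>i<\<q>. c' (f a) (%i. f (c i)) i * b ^ i)"
   using c a by (intro sum.cong) (auto simp: c'_def homonD[OF f] hom_diff[OF R f])
  also have "... = b * (\<Sum>i<\<q>. f (c i) * b ^ i)" unfolding c'_def by (rule AS_shift[OF b, symmetric])
  finally show ?thesis using g[OF c(1)] c(2) by simp
 qed
 have aE: "w ^ \<q> + w \<in> E" using a by simp
 note S = AS_span[OF E aE]
 note SR = sfield_sring[OF S(1)]
 note SD = sringD[OF SR]
 have g_shifts: "g (w ^ i * u) = b ^ i * g u" if "u \<in> span_ext E w \<q>" for u i
  using that
 proof (induction i)
  case (Suc i)
  have "w ^ i * u \<in> span_ext E w \<q>" using SD(5) sring_power[OF SR S(3)] Suc.prems by blast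
  then show ?case using g_shift[of "w ^ i * u"] Suc by (simp add: mult.assoc)
 qed simp
 have f0: "f 0 = 0" by (rule hom_0[OF R f])
 have g0: "g 0 = 0" using g[of "%_. 0"] RD(1) f0 by simp
 have g_sum: "g (sum h I) = (\<Sum>i\<in>I. g (h i))" if "\<And>i. i \<in> I ==> h i \<in> span_ext E w \<q>" for h and I :: "nat set"
  using that
 proof (induction I rule: infinite_finite_induct)
  case (insert i I)
  then show ?case using g_add[of "h i" "sum h I"] sring_sum[OF SR, of I h] by simp
 qed (simp_all add: g0)
 have g_mult: "g (u * v) = g u * g v" if uv: "u \<in> span_ext E w \<q>" "v \<in> span_ext E w \<q>" for u v
 proof -
  obtain c where c: "\<And>i. c i \<in> E" "u = (\<Sum>i<\<q>. c i * w ^ i)" using get[OF uv(1)] by blast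
  have wv: "w ^ i * v \<in> span_ext E w \<q>" for i using SD(5) sring_power[OF SR S(3)] uv(2) by blast
  have "u * v = (\<Sum>i<\<q>. c i * (w ^ i * v))" unfolding c by (simp add: sum_distrib_right mult.assoc)
  then have "g (u * v) = (\<Sum>i<\<q>. g (c i * (w ^ i * v)))"
   using g_sum[of "{..<\<q>}" "%i. c i * (w ^ i * v)"] span_ext_ops(3)[OF R c(1) wv] by simp
  also have "... = (\<Sum>i<\<q>. f (c i) * (b ^ i * g v))" using g_scale[OF c(1) wv] g_shifts[OF uv(2)] by simp
  also have "... = (\<Sum>i<\<q>. f (c i) * b ^ i) * g v" by (simp add: sum_distrib_right mult.assoc)
  finally show ?thesis using g[OF c(1)] c(2) by simp
 qed
 have one: "1 \<in> span_ext E w \<q>" by (rule SD(2))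
 obtain r where r: "\<q> = Suc (Suc r)" by (rule q_Suc)
 have g1: "g 1 = 1"
  using g[of "%i. if i = 0 then 1 else 0"] RD(1,2) f0 homonD(1)[OF f]
  unfolding r by (simp add: sum.lessThan_Suc_shift del: sum.lessThan_Suc)
 show ?thesis
 proof (rule that)
  show "homon (span_ext E w \<q>) g" unfolding homon_def using g1 g_add g_mult by blast
  show "g e = f e" if "e \<in> E" for e using g_scale[OF that one] g1 by simp
  show "g w = b" using g_shift[OF one] g1 by simp
 qed
qed

abbreviation "E0 \<equiv> fgen (insert xx kf)"

lemma E0_field: "sfield E0" by (rule sfield_fgen)
lemma E0_mem: "c \<in> kf ==> c \<in> E0" "xx \<in> E0" using fgen_incl[of "insert xx kf"] by auto

lemma E0_E1: "E0 \<subseteq> E1" using E1_mem by (intro fgen_least[OF E1_field]) auto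

lemma E1_span: "E1 = span_ext E0 ss \<q>"
proof
 have "ss ^ \<q> + ss \<in> E0" using ss_eq sring_power[OF sfield_sring[OF E0_field]] sfield_inverse[OF E0_field] E0_mem by simp
 note S = AS_span[OF E0_field this]
 show "E1 \<subseteq> span_ext E0 ss \<q>" using S(2,3) E0_mem by (intro fgen_least[OF S(1)]) auto
 show "span_ext E0 ss \<q> \<subseteq> E1"
 proof
  fix a assume "a \<in> span_ext E0 ss \<q>"
  then obtain c where c: "\<forall>i. c i \<in> E0" "a = (\<Sum>i<\<q>. c i * ss ^ i)" by (auto simp: span_ext_def)
  note R = sfield_sring[OF E1_field]
  have "c i * ss ^ i \<in> E1" for i using c(1) E0_E1 E1_mem(3) sringD(5)[OF R] sring_power[OF R] by blast
  then show "a \<in> E1" unfolding c(2) by (rule sring_sum[OF R])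
 qed
qed

lemma s_independent:
 assumes "\<And>j. c j \<in> fgen (kf \<union> {tt, zz})" "(\<Sum>j<\<q>. c j * ss ^ j) = 0" "i < \<q>" shows "c i = 0"
 by (rule cfield.z_independent[OF swap assms])

lemma E0_Ez: "E0 \<subseteq> fgen (kf \<union> {tt, zz})"
proof (rule fgen_least[OF sfield_fgen])
 show "insert xx kf \<subseteq> fgen (kf \<union> {tt, zz})"
  using fgen_incl[of "kf \<union> {tt, zz}"] sfield_inverse[OF sfield_fgen, of tt "kf \<union> {tt, zz}"] by auto
qed

text \<open>Three steps k(x), k(x, s), k(x, s, z); surjectivity is the assumption that the images
 generate.\<close>

lemma aut_exists:
 assumes x: "trans x" and s: "s ^ \<q> + s = inverse x ^ \<m>" and z: "z ^ \<q> + z = x ^ \<m>"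
  and g: "{xx, ss, zz} \<subseteq> fgen (kf \<union> {x, s, z})"
 obtains f where "aut f" "f xx = x" "f ss = s" "f zz = z"
proof -
 note R0 = sfield_sring[OF E0_field] and R1 = sfield_sring[OF E1_field]
 obtain f0 where f0: "homon E0 f0" "\<And>c. c \<in> kf ==> f0 c = c" "f0 xx = x"
  using rational_hom[OF trans_xx x] by blast
 have tm: "inverse xx ^ \<m> \<in> E0" using sring_power[OF R0] sfield_inverse[OF E0_field] E0_mem by simp
 have "f0 (inverse xx ^ \<m>) = inverse x ^ \<m>"
  using hom_power[OF R0 f0(1)] hom_inverse[OF E0_field f0(1) E0_mem(2)] sfield_inverse[OF E0_field E0_mem(2)] f0(3) by simp
 then have s': "s ^ \<q> + s = f0 (inverse xx ^ \<m>)" using s by simp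
 have ind0: "\<forall>c. (\<forall>j. c j \<in> E0) --> (\<Sum>j<\<q>. c j * ss ^ j) = 0 --> (\<forall>i<\<q>. c i = 0)"
  using s_independent E0_Ez by blast
 have ind1: "\<forall>c. (\<forall>j. c j \<in> E1) --> (\<Sum>j<\<q>. c j * zz ^ j) = 0 --> (\<forall>i<\<q>. c i = 0)"
  using z_independent by blast
 obtain f1 where f1: "homon E1 f1" "\<And>e. e \<in> E0 ==> f1 e = f0 e" "f1 ss = s"
  using AS_hom[OF E0_field f0(1) tm ss_eq s' ind0] unfolding E1_span by blast
 have xm: "xx ^ \<m> \<in> E1" using sring_power[OF R1 E1_mem(2)] .
 have "f1 (xx ^ \<m>) = x ^ \<m>" using hom_power[OF R1 f1(1) E1_mem(2)] f1(2)[OF E0_mem(2)] f0(3) by simp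
 then have z': "z ^ \<q> + z = f1 (xx ^ \<m>)" using z by simp
 obtain f where f: "homon UNIV f" "\<And>e. e \<in> E1 ==> f e = f1 e" "f zz = z"
  using AS_hom[OF E1_field f1(1) xm zz_eq z' ind1] unfolding z_span by blast
 have fx: "f xx = x" using f(2)[OF E1_mem(2)] f1(2)[OF E0_mem(2)] f0(3) by simp
 have fs: "f ss = s" using f(2)[OF E1_mem(3)] f1(3) by simp
 have fk: "f c = c" if "c \<in> kf" for c
  using f(2)[OF E1_mem(1)[OF that]] f1(2)[OF E0_mem(1)[OF that]] f0(2)[OF that] by simp
 have U: "sfield UNIV" by (simp add: sfield_def sring_UNIV)
 have inj: "inj f"
 proof (rule injI, rule ccontr)
  fix a b assume ab: "f a = f b" "a \<noteq> b"
  have "f (a - b) = 0" using hom_diff[OF sring_UNIV f(1)] ab(1) by simp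
  then have "f ((a - b) * inverse (a - b)) = 0" using homonD(3)[OF f(1)] by simp
  then show False using ab(2) homonD(1)[OF f(1)] by simp
 qed
 have "sfield (range f)"
 proof (rule sfieldI, rule sringI)
  show "0 \<in> range f" using hom_0[OF sring_UNIV f(1)] by (intro image_eqI[of _ _ 0]) auto
  show "1 \<in> range f" using homonD(1)[OF f(1)] by (intro image_eqI[of _ _ 1]) auto
  fix u v assume "u \<in> range f" "v \<in> range f"
  then obtain a b where ab: "u = f a" "v = f b" by blast
  have "u + v = f (a + b)" "u * v = f (a * b)" using homonD(2,3)[OF f(1)] ab by auto
  then show "u + v \<in> range f" "u * v \<in> range f" by blast+
 next
  fix u assume "u \<in> range f"
  then obtain a where a: "u = f a" by blast
  have "- u = f (- a)" "inverse u = f (inverse a)"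
   using hom_minus[OF sring_UNIV f(1)] hom_inverse[OF U f(1)] a by auto
  then show "- u \<in> range f" "inverse u \<in> range f" by blast+
 qed
 moreover have "kf \<union> {x, s, z} \<subseteq> range f"
 proof
  fix u assume "u \<in> kf \<union> {x, s, z}"
  then have "u = f u \<or> u = f xx \<or> u = f ss \<or> u = f zz" using fk fx fs f(3) by auto
  then show "u \<in> range f" by blast
 qed
 ultimately have rf: "fgen (kf \<union> {x, s, z}) \<subseteq> range f" by (rule fgen_least)
 moreover have "kf \<union> {xx, ss, zz} \<subseteq> fgen (kf \<union> {x, s, z})" using g fgen_incl[of "kf \<union> {x, s, z}"] by blast
 then have "UNIV \<subseteq> fgen (kf \<union> {x, s, z})" using fgen_least[OF sfield_fgen] generates by metis
 ultimately have "surj f" by blast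
 then have "aut f" using inj f(1) fk by (simp add: aut_def bij_def)
 then show ?thesis using that fx fs f(3) by blast
qed

lemma aut_ext:
 assumes "aut f" "aut g" "f xx = g xx" "f ss = g ss" "f zz = g zz" shows "f = g"
proof
 fix a
 have "kf \<union> {xx, ss, zz} \<subseteq> {a. f a = g a}" using assms autD(3)[OF assms(1)] autD(3)[OF assms(2)] by auto
 from fgen_least[OF aut_agree_sfield[OF assms(1,2)] this] show "f a = g a" unfolding generates by blast
qed

end

section \<open>The derivation \<open>x d/dx\<close>\<close>

context Fields.field begin

lemma monic_times_linear:
 "\<exists>bs. length bs = Suc (length as) \<and> (\<forall>t. peval (bs @ [1]) t = (t - b) * peval (as @ [1]) t + e)"
proof (induction as arbitrary: e)
 case Nil
 have "\<forall>t. peval ([e - b] @ [1]) t = (t - b) * peval ([] @ [1]) t + e" by (simp add: algebra_simps)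
 then show ?case by (intro exI[of _ "[e - b]"]) simp
next
 case (Cons a as)
 then obtain bs where bs: "length bs = Suc (length as)" "\<forall>t. peval (bs @ [1]) t = (t - b) * peval (as @ [1]) t + a"
  by blast
 have "peval ((e - b * a) # bs @ [1]) t = (t - b) * peval ((a # as) @ [1]) t + e" for t
 proof -
  have "peval ((e - b * a) # bs @ [1]) t = (e - b * a) + t * ((t - b) * peval (as @ [1]) t + a)"
   using bs(2) by simp
  also have "... = (t - b) * (a + t * peval (as @ [1]) t) + e" by (simp add: algebra_simps)
  finally show ?thesis by simp
 qed
 then show ?case using bs(1) by (intro exI[of _ "(e - b * a) # bs"]) simp
qed

lemma monic_of_roots:
 assumes "finite T"
 shows "\<exists>as. length as = card T \<and> (\<forall>t. peval (as @ [1]) t = (\<Prod>b\<in>T. t - b))"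
 using assms
proof (induction T rule: finite_induct)
 case empty then show ?case by (intro exI[of _ "[]"]) simp
next
 case (insert b T)
 then obtain as where as: "length as = card T" "\<forall>t. peval (as @ [1]) t = (\<Prod>b\<in>T. t - b)" by blast
 obtain bs where "length bs = Suc (length as)" "\<forall>t. peval (bs @ [1]) t = (t - b) * peval (as @ [1]) t + 0"
  using monic_times_linear by blast
 then show ?case using as insert.hyps by (intro exI[of _ bs]) simp
qed

definition deriv :: "('a => 'a) => bool" where
 "deriv D \<longleftrightarrow> (\<forall>a b. D (a + b) = D a + D b) \<and> (\<forall>a b. D (a * b) = a * D b + D a * b)"

lemma derivD:
 assumes "deriv D"
 shows "D (a + b) = D a + D b" "D (a * b) = a * D b + D a * b" "D 0 = 0" "D 1 = 0" "D (- a) = - D a"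
  "D (a - b) = D a - D b"
proof -
 show add: "D (a + b) = D a + D b" and mult: "D (a * b) = a * D b + D a * b" for a b
  using assms by (auto simp: deriv_def)
 show z: "D 0 = 0" using add[of 0 0] by simp
 show "D 1 = 0" using mult[of 1 1] by simp
 have m: "D (- a) = - D a" for a
  using add[of a "- a"] z by (simp add: eq_neg_iff_add_eq_0 add.commute)
 show "D (- a) = - D a" by (rule m)
 show "D (a - b) = D a - D b" using add[of a "- b"] m[of b] by simp
qed

lemma deriv_power_Suc: assumes "deriv D" shows "D (a ^ Suc n) = of_nat (Suc n) * a ^ n * D a"
proof (induction n)
 case (Suc n)
 have "D (a ^ Suc (Suc n)) = a * (of_nat (Suc n) * a ^ n * D a) + D a * a ^ Suc n"
  using Suc derivD(2)[OF assms, of a "a ^ Suc n"] by simp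
 also have "... = of_nat (Suc (Suc n)) * a ^ Suc n * D a" by (simp add: algebra_simps)
 finally show ?case .
qed simp

lemma deriv_power: "deriv D ==> a * D (a ^ n) = of_nat n * a ^ n * D a"
 by (cases n) (simp_all only: deriv_power_Suc, simp_all add: derivD algebra_simps)

lemma deriv_inverse: assumes "deriv D" shows "D (inverse a) = - (D a * inverse a ^ 2)"
proof (cases "a = 0")
 case True then show ?thesis using derivD(3)[OF assms] by simp
next
 case False
 have "a * D (inverse a) + D a * inverse a = 0"
  using derivD(2)[OF assms, of a "inverse a"] derivD(4)[OF assms] False by simp
 then have "inverse a * (a * D (inverse a) + D a * inverse a) = 0" by simp
 then have "D (inverse a) + inverse a * (D a * inverse a) = 0" using False by (simp add: distrib_left flip: mult.assoc)
 then have "D (inverse a) = - (inverse a * (D a * inverse a))" by (simp add: eq_neg_iff_add_eq_0)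
 then show ?thesis by (simp add: power2_eq_square mult.commute mult.left_commute)
qed

lemma deriv_sum: "deriv D ==> D (sum f I) = (\<Sum>i\<in>I. D (f i))"
 by (induction I rule: infinite_finite_induct) (simp_all add: derivD)

lemma deriv_scale: "deriv D ==> deriv (%a. g * D a)"
 unfolding deriv_def by (simp add: algebra_simps)

lemma deriv_agree_sfield: assumes "deriv D" "deriv D'" shows "sfield {a. D a = D' a}"
 using assms by (intro sfieldI sringI) (auto simp: derivD deriv_inverse)

end

context ffield begin

lemma deriv_frob: assumes "deriv D" shows "D (a ^ \<p>) = 0"
proof -
 obtain n where n: "\<p> = Suc n" using prime_gt_0_nat[OF prime_chp] by (cases "\<p>") auto
 then show ?thesis using deriv_power_Suc[OF assms, of a n] char_chp by simp
qed

lemma kf_root: assumes "c \<in> kf" obtains d where "d \<in> kf" "d ^ \<p> = c"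
 using nth_root_ex[OF assms prime_gt_0_nat[OF prime_chp]] by blast

lemma deriv_kf: "deriv D ==> c \<in> kf ==> D c = 0"
 using deriv_frob by (metis kf_root)

end

context cfield begin

lemma q_factor: obtains n where "\<q> = \<p> * n" "n = \<p> ^ (hh TYPE('a) - 1)"
proof -
 obtain h' where "hh TYPE('a) = Suc h'" using hh_pos by (cases "hh TYPE('a)") auto
 then show ?thesis using that[of "\<p> ^ (hh TYPE('a) - 1)"] by simp
qed

lemma frobq_power: "\<exists>b. a ^ \<q> = b ^ \<p>"
proof -
 obtain n where n: "\<q> = \<p> * n" using q_factor by blast
 then have "a ^ \<q> = (a ^ n) ^ \<p>" by (simp only: power_mult power_swap)
 then show ?thesis by blast
qed

lemma deriv_q: "deriv D ==> D (a ^ \<q>) = 0" using frobq_power[of a] deriv_frob by metis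

lemma deriv_ext:
 assumes D: "deriv D" "deriv D'" and x: "D xx = D' xx" shows "D = D'"
proof
 fix a
 note S = deriv_agree_sfield[OF D]
 note SD = sringD[OF sfield_sring[OF S]]
 have xS: "xx \<in> {a. D a = D' a}" using x by simp
 have qS: "b ^ \<q> \<in> {a. D a = D' a}" for b using deriv_q[OF D(1)] deriv_q[OF D(2)] by simp
 have "ss = inverse xx ^ \<m> - ss ^ \<q>" using ss_eq by (metis add_diff_cancel_left')
 moreover have "inverse xx ^ \<m> - ss ^ \<q> \<in> {a. D a = D' a}"
  by (rule SD(6)[OF sring_power[OF sfield_sring[OF S] sfield_inverse[OF S xS]] qS])
 ultimately have "ss \<in> {a. D a = D' a}" by metis
 moreover have "zz = xx ^ \<m> - zz ^ \<q>" using zz_eq by (metis add_diff_cancel_left')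
 moreover have "xx ^ \<m> - zz ^ \<q> \<in> {a. D a = D' a}"
  by (rule SD(6)[OF sring_power[OF sfield_sring[OF S] xS] qS])
 ultimately have "kf \<union> {xx, ss, zz} \<subseteq> {a. D a = D' a}" using deriv_kf[OF D(1)] deriv_kf[OF D(2)] xS by auto
 from fgen_least[OF S this] show "D a = D' a" unfolding generates by blast
qed

text \<open>The powers of z are a basis over the subfield of p-th powers.\<close>

definition Lp :: "'a set" where "Lp = range (%c. c ^ \<p>)"

lemma frobp_add: "(a + b) ^ \<p> = a ^ \<p> + b ^ \<p>" by (rule frobenius_add_prime[OF prime_chp char_chp])
lemma frobp_minus: "(- a) ^ \<p> = - (a ^ \<p>)" by (rule frobenius_uminus[OF odd_chr])
lemma frobp_diff: "(a - b) ^ \<p> = a ^ \<p> - b ^ \<p>" using frobp_add[of a "- b"] frobp_minus[of b] by simp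
lemma p_pos: "0 < \<p>" using chr_ge3 by linarith

lemma LpI: "c ^ \<p> \<in> Lp" by (simp add: Lp_def)

lemma Lp_sfield: "sfield Lp"
proof (rule sfieldI, rule sringI)
 show "0 \<in> Lp" "1 \<in> Lp" using LpI[of 0] LpI[of 1] p_pos by (simp_all add: power_0_left)
 fix u v assume "u \<in> Lp" "v \<in> Lp"
 then obtain a b where "u = a ^ \<p>" "v = b ^ \<p>" by (auto simp: Lp_def)
 then show "u + v \<in> Lp" "u * v \<in> Lp" using LpI[of "a + b"] LpI[of "a * b"] by (simp_all add: frobp_add power_mult_distrib)
next
 fix u assume "u \<in> Lp"
 then obtain a where "u = a ^ \<p>" by (auto simp: Lp_def)
 then show "- u \<in> Lp" "inverse u \<in> Lp" using LpI[of "- a"] LpI[of "inverse a"] by (simp_all add: frobp_minus power_inverse)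
qed

lemma Lp_span:
 shows "sfield (span_ext Lp w \<p>)" "Lp \<subseteq> span_ext Lp w \<p>" "w \<in> span_ext Lp w \<p>"
  "kf \<subseteq> span_ext Lp w \<p>" "b ^ \<q> \<in> span_ext Lp w \<p>"
proof -
 note R = sfield_sring[OF Lp_sfield]
 have "w ^ \<p> * w ^ 0 \<in> span_ext Lp w \<p>"
  by (rule span_ext_ops(3)[OF R LpI span_ext_power[OF R p_pos]])
 then have zp: "w ^ \<p> \<in> span_ext Lp w \<p>" by simp
 note S = span_ext_ring[OF R p_pos zp]
 note SD = sringD[OF S(1)]
 show "Lp \<subseteq> span_ext Lp w \<p>" "w \<in> span_ext Lp w \<p>" by fact+
 show "sfield (span_ext Lp w \<p>)"
 proof (rule sfieldI[OF S(1)])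
  fix a assume a: "a \<in> span_ext Lp w \<p>" "a \<noteq> 0"
  obtain n where n: "\<p> = Suc n" using p_pos by (cases "\<p>") auto
  have "a ^ n * inverse a ^ \<p> = inverse a * (a * inverse a) ^ n" unfolding n by (simp add: power_mult_distrib mult_ac)
  also have "... = inverse a" using a(2) by simp
  finally show "inverse a \<in> span_ext Lp w \<p>"
   using SD(5)[OF sring_power[OF S(1) a(1), of n] subsetD[OF S(2) LpI[of "inverse a"]]] by simp
 qed
 have pw: "b ^ \<p> \<in> span_ext Lp w \<p>" for b using S(2) LpI by blast
 show "kf \<subseteq> span_ext Lp w \<p>" using pw by (metis kf_root subsetI)
 show "b ^ \<q> \<in> span_ext Lp w \<p>" using pw frobq_power by metis
qed

lemma z_basis_span: "span_ext Lp zz \<p> = UNIV"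
proof -
 note F = Lp_span(1)[of zz] and S = sfield_sring[OF Lp_span(1)[of zz]] Lp_span(2)[of zz] Lp_span(3)[of zz] and qp = Lp_span(5)[of _ zz]
 note SD = sringD[OF S(1)]
 have pw: "b ^ \<p> \<in> span_ext Lp zz \<p>" for b using S(2) LpI by blast
 have xm: "xx ^ \<m> \<in> span_ext Lp zz \<p>" using SD(3)[OF qp[of zz] S(3)] zz_eq by simp
 have "xx \<in> span_ext Lp zz \<p>"
 proof -
  have "\<m> \<noteq> 0" using mm_pos by linarith
  then obtain i j where ij: "\<m> * i = \<p> * j + gcd \<m> \<p>" using bezout_nat by blast
  have "gcd \<m> \<p> = 1" using coprime_mm by simp
  then have "\<m> * i = Suc (\<p> * j)" using ij by simp
  then have "(xx ^ \<m>) ^ i = xx ^ Suc (\<p> * j)" by (metis power_mult)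
  also have "... = (xx ^ \<p>) ^ j * xx" by (simp add: power_mult power_commutes mult.commute)
  also have "(xx ^ \<p>) ^ j = (xx ^ j) ^ \<p>" by (rule power_swap)
  finally have "(xx ^ \<m>) ^ i = (xx ^ j) ^ \<p> * xx" .
  then have "xx = (xx ^ \<m>) ^ i / (xx ^ j) ^ \<p>" using xx_nz by simp
  then show ?thesis using sfield_divide[OF F sring_power[OF S(1) xm] pw] by metis
 qed
 moreover have "ss \<in> span_ext Lp zz \<p>"
 proof -
  have "ss = inverse (xx ^ \<m>) - ss ^ \<q>" using ss_eq by (metis add_diff_cancel_left' power_inverse)
  then show ?thesis using SD(6)[OF sfield_inverse[OF F xm] qp[of ss]] by simp
 qed
 ultimately have "kf \<union> {xx, ss, zz} \<subseteq> span_ext Lp zz \<p>" using S(3) Lp_span(4)[of zz] by blast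
 from fgen_least[OF F this] show ?thesis unfolding generates by blast
qed

lemma z_basis_independent:
 assumes c: "\<forall>i. c i \<in> Lp" "(\<Sum>i<\<p>. c i * zz ^ i) = 0" and i: "i < \<p>" shows "c i = 0"
proof (rule ccontr)
 assume ci: "c i \<noteq> 0"
 obtain V where V: "valring V" "tt \<in> mx V" by (rule place_infinity)
 note tnz = xx_nz
 have znz: "zz \<noteq> 0" using zz_notin[OF V] VD(1)[OF V(1)] by auto
 have val: "\<exists>n. veq V ((c i * zz ^ i) ^ \<q>) (zp tt (n * int \<p> - int \<m> * int i))" if nz: "c i * zz ^ i \<noteq> 0" for i
 proof -
  obtain d where d: "c i = d ^ \<p>" using c(1) by (auto simp: Lp_def)
  then have "d \<noteq> 0" using nz p_pos by (auto simp: power_0_left)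
  then obtain n where n: "veq V (d ^ \<q>) (zp tt n)" using any_value[OF V] by blast
  have "(c i * zz ^ i) ^ \<q> = (d ^ \<q>) ^ \<p> * (zz ^ \<q>) ^ i"
   unfolding d by (simp add: power_mult_distrib power_swap[of zz i] power_swap[of d \<p>])
  moreover have "veq V ((d ^ \<q>) ^ \<p> * (zz ^ \<q>) ^ i) (zp tt n ^ \<p> * zp tt (- int \<m>) ^ i)"
   by (intro veq_mult[OF V(1)] veq_power[OF V(1)] n zz_value[OF V])
  moreover have "zp tt n ^ \<p> * zp tt (- int \<m>) ^ i = zp tt (n * int \<p> - int \<m> * int i)"
   using zp_mult_nat[of tt n "\<p>"] zp_mult_nat[of tt "- int \<m>" i] zp_add[of tt "n * int \<p>" "- int \<m> * int i"] xx_nz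
   by simp
  ultimately show ?thesis by metis
 qed
 have "\<not> veq V (c i * zz ^ i) (c j * zz ^ j)"
  if ij: "i \<in> {..<\<p>}" "j \<in> {..<\<p>}" "i \<noteq> j" "c i * zz ^ i \<noteq> 0" "c j * zz ^ j \<noteq> 0" for i j
 proof
  assume eq: "veq V (c i * zz ^ i) (c j * zz ^ j)"
  obtain n n' where "veq V ((c i * zz ^ i) ^ \<q>) (zp tt (n * int \<p> - int \<m> * int i))"
   "veq V ((c j * zz ^ j) ^ \<q>) (zp tt (n' * int \<p> - int \<m> * int j))" using val ij by blast
  then have "veq V (zp tt (n * int \<p> - int \<m> * int i)) (zp tt (n' * int \<p> - int \<m> * int j))"
   using veq_power[OF V(1) eq, of \<q>] veq_trans[OF V(1)] veq_sym[OF V(1)] by blast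
  then have "n * int \<p> - int \<m> * int i = n' * int \<p> - int \<m> * int j"
   using veq_zp_inj[OF V] xx_nz by simp
  moreover have "coprime (int \<m>) (int \<p>)" using coprime_mm by simp
  ultimately show False using value_congruence[of "int \<m>" "int \<p>" n i n' j] ij by auto
 qed
 moreover have "\<exists>i\<in>{..<\<p>}. c i * zz ^ i \<noteq> 0" using ci i znz by auto
 ultimately obtain i where "veq V (\<Sum>i<\<p>. c i * zz ^ i) (c i * zz ^ i)"
  using dominant_term[OF V(1) finite_lessThan, of \<p> "%i. c i * zz ^ i"] by blast
 then show False using c(2) by (simp add: veq_def)
qed

text \<open>Since z = x^m - z^q, the powers of z below p form a basis over the p-th powers, so that
 z d/dz is well defined; a multiple of it sends x to x.\<close>

lemma deriv_exists: "\<exists>D. deriv D \<and> D xx = xx"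
proof -
 note R = sfield_sring[OF Lp_sfield]
 note RD = sringD[OF R]
 define D where "D u = (\<Sum>i<\<p>. of_nat i * (SOME c. (\<forall>i. c i \<in> Lp) \<and> u = (\<Sum>i<\<p>. c i * zz ^ i)) i * zz ^ i)" for u
 have D: "D (\<Sum>i<\<p>. c i * zz ^ i) = (\<Sum>i<\<p>. of_nat i * c i * zz ^ i)" if c: "\<And>i. c i \<in> Lp" for c
 proof -
  let ?P = "%d. (\<forall>i. d i \<in> Lp) \<and> (\<Sum>i<\<p>. c i * zz ^ i) = (\<Sum>i<\<p>. d i * zz ^ i)"
  define d where "d = (SOME d. ?P d)"
  have d: "?P d" unfolding d_def by (rule someI[of ?P c]) (use c in auto)
  have "(\<Sum>j<\<p>. (c j - d j) * zz ^ j) = (\<Sum>j<\<p>. c j * zz ^ j) - (\<Sum>j<\<p>. d j * zz ^ j)"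
   by (simp only: left_diff_distrib sum_minus)
  also have "... = 0" using d by simp
  finally have z: "(\<Sum>j<\<p>. (c j - d j) * zz ^ j) = 0" .
  have cd: "\<forall>i. c i - d i \<in> Lp" using c d RD(6) by blast
  have "c i = d i" if "i < \<p>" for i using z_basis_independent[OF cd z that] by simp
  then show ?thesis unfolding D_def d_def[symmetric] by (intro sum.cong) auto
 qed
 have get: "\<exists>c. (\<forall>i. c i \<in> Lp) \<and> u = (\<Sum>i<\<p>. c i * zz ^ i)" for u
 proof -
  have "u \<in> span_ext Lp zz \<p>" using z_basis_span by simp
  then show ?thesis by (auto simp: span_ext_def)
 qed
 have add: "D (u + v) = D u + D v" for u v
 proof -
  obtain c d where c: "\<And>i. c i \<in> Lp" "u = (\<Sum>i<\<p>. c i * zz ^ i)" and d: "\<And>i. d i \<in> Lp" "v = (\<Sum>i<\<p>. d i * zz ^ i)"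
   using get by metis
  have "u + v = (\<Sum>i<\<p>. (c i + d i) * zz ^ i)" unfolding c d by (simp add: sum.distrib distrib_right)
  then have "D (u + v) = (\<Sum>i<\<p>. of_nat i * (c i + d i) * zz ^ i)" using D[of "%i. c i + d i"] c d RD(3) by simp
  also have "... = (\<Sum>i<\<p>. of_nat i * c i * zz ^ i) + (\<Sum>i<\<p>. of_nat i * d i * zz ^ i)"
   by (simp add: sum.distrib distrib_right distrib_left)
  finally show ?thesis using D[OF c(1)] D[OF d(1)] c(2) d(2) by simp
 qed
 have scale: "D (e * u) = e * D u" if e: "e \<in> Lp" for e u
 proof -
  obtain c where c: "\<And>i. c i \<in> Lp" "u = (\<Sum>i<\<p>. c i * zz ^ i)" using get by metis
  have "e * u = (\<Sum>i<\<p>. (e * c i) * zz ^ i)" unfolding c by (simp add: sum_distrib_left mult.assoc)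
  then have "D (e * u) = (\<Sum>i<\<p>. of_nat i * (e * c i) * zz ^ i)" using D[of "%i. e * c i"] c e RD(5) by simp
  also have "... = e * (\<Sum>i<\<p>. of_nat i * c i * zz ^ i)" by (simp add: sum_distrib_left mult_ac)
  finally show ?thesis using D[OF c(1)] c(2) by simp
 qed
 have shift: "D (zz * u) = zz * D u + zz * u" for u
 proof -
  obtain c where c: "\<And>i. c i \<in> Lp" "u = (\<Sum>i<\<p>. c i * zz ^ i)" using get by metis
  obtain n where n: "\<p> = Suc n" using p_pos by (cases "\<p>") auto
  define c' where "c' i = (if i = 0 then c n * zz ^ \<p> else c (i - 1))" for i
  have c': "c' i \<in> Lp" for i using c(1) RD(5)[OF c(1) LpI] by (auto simp: c'_def)
  have pn: "1 + of_nat n = (0::'a)" using char_chp unfolding n by simp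
  have "zz * u = (\<Sum>i<\<p>. c i * zz ^ Suc i)" unfolding c(2) by (simp add: sum_distrib_left mult_ac)
  also have "... = c n * zz ^ \<p> + (\<Sum>i<n. c i * zz ^ Suc i)" unfolding n by (simp add: add.commute)
  also have "... = (\<Sum>i<\<p>. c' i * zz ^ i)"
   unfolding c'_def n by (simp add: sum.lessThan_Suc_shift del: sum.lessThan_Suc)
  finally have "D (zz * u) = (\<Sum>i<\<p>. of_nat i * c' i * zz ^ i)" using D[OF c'] by simp
  also have "... = (\<Sum>i<n. (1 + of_nat i) * c i * zz ^ Suc i)"
   unfolding c'_def n by (simp add: sum.lessThan_Suc_shift del: sum.lessThan_Suc)
  also have "... = (\<Sum>i<\<p>. (1 + of_nat i) * c i * zz ^ Suc i)" unfolding n by (simp add: pn)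
  also have "... = (\<Sum>i<\<p>. zz * (of_nat i * c i * zz ^ i) + zz * (c i * zz ^ i))"
   by (rule sum.cong) (simp_all add: algebra_simps)
  also have "... = zz * D u + zz * u"
  proof -
   have Du: "D u = (\<Sum>i<\<p>. of_nat i * c i * zz ^ i)" using D[OF c(1)] c(2) by simp
   show ?thesis unfolding Du unfolding c(2) by (simp only: sum.distrib sum_distrib_left)
  qed
  finally show ?thesis .
 qed
 have shifts: "D (zz ^ i * u) = zz ^ i * D u + of_nat i * zz ^ i * u" for i u
 proof (induction i)
  case (Suc i)
  have "D (zz ^ Suc i * u) = zz * D (zz ^ i * u) + zz * (zz ^ i * u)" using shift[of "zz ^ i * u"] by (simp add: mult.assoc)
  also have "... = zz ^ Suc i * D u + of_nat (Suc i) * zz ^ Suc i * u" unfolding Suc by (simp add: algebra_simps)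
  finally show ?case .
 qed simp
 have D0: "D 0 = 0" using add[of 0 0] by simp
 have Dsum: "D (sum h I) = (\<Sum>i\<in>I. D (h i))" for h and I :: "nat set"
  by (induction I rule: infinite_finite_induct) (simp_all add: D0 add)
 have mult: "D (u * v) = u * D v + D u * v" for u v
 proof -
  obtain c where c: "\<And>i. c i \<in> Lp" "u = (\<Sum>i<\<p>. c i * zz ^ i)" using get by metis
  have "u * v = (\<Sum>i<\<p>. c i * (zz ^ i * v))" unfolding c by (simp add: sum_distrib_right mult.assoc)
  then have "D (u * v) = (\<Sum>i<\<p>. c i * (zz ^ i * D v + of_nat i * zz ^ i * v))"
   using Dsum scale[OF c(1)] shifts by simp
  also have "... = (\<Sum>i<\<p>. (c i * zz ^ i) * D v + (of_nat i * c i * zz ^ i) * v)"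
   by (rule sum.cong) (simp_all add: algebra_simps)
  also have "... = u * D v + D u * v"
  proof -
   have Du: "D u = (\<Sum>i<\<p>. of_nat i * c i * zz ^ i)" using D[OF c(1)] c(2) by simp
   show ?thesis unfolding Du unfolding c(2) by (simp only: sum.distrib sum_distrib_right)
  qed
  finally show ?thesis .
 qed
 have dD: "deriv D" using add mult by (auto simp: deriv_def)
 have z0: "zz \<noteq> 0"
 proof
  assume "zz = 0"
  then have "zz ^ \<q> + zz = 0" using q_pos by (simp add: power_0_left)
  then show False unfolding zz_eq using xx_nz by simp
 qed
 have "D 1 = 0" by (rule derivD(4)[OF dD])
 then have "D zz = zz" using shift[of 1] by simp
 then have "D (xx ^ \<m>) = zz" unfolding zz_eq[symmetric] derivD(1)[OF dD] deriv_q[OF dD] by simp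
 then have "of_nat \<m> * xx ^ \<m> * D xx = xx * zz" using deriv_power[OF dD, of xx \<m>] by simp
 then have "(of_nat \<m> * xx ^ \<m> / zz) * D xx = xx" using z0 by (simp add: field_simps)
 then show ?thesis using deriv_scale[OF dD, of "of_nat \<m> * xx ^ \<m> / zz"] by (intro exI conjI)
qed

definition dd :: "'a => 'a" where "dd = (SOME D. deriv D \<and> D xx = xx)"

lemma dd: "deriv dd" "dd xx = xx"
 using someI_ex[OF deriv_exists] unfolding dd_def by blast+

lemmas ddD = derivD[OF dd(1)]

text \<open>Derivations are determined by their value at x, because s and z are polynomials in 1/x
 and x up to q-th powers.\<close>

lemma deriv_multiple: assumes "deriv D" shows "D a = (D xx / xx) * dd a"
proof -
 have "D = (%a. (D xx / xx) * dd a)"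
  by (rule deriv_ext[OF assms deriv_scale[OF dd(1)]]) (use xx_nz dd(2) in simp)
 then show ?thesis by metis
qed

lemma dd_xxm: "dd (xx ^ \<m>) = of_nat \<m> * xx ^ \<m>"
 using deriv_power[OF dd(1), of xx \<m>] dd(2) xx_nz by (simp add: mult.commute)

lemma dd_zz: "dd zz = of_nat \<m> * xx ^ \<m>"
proof -
 have "zz = xx ^ \<m> - zz ^ \<q>" using zz_eq by (metis add_diff_cancel_left')
 then have "dd zz = dd (xx ^ \<m> - zz ^ \<q>)" by (rule arg_cong)
 then show ?thesis using ddD(6) deriv_q[OF dd(1)] dd_xxm by simp
qed

lemma dd_ttm: "dd (tt ^ \<m>) = - (of_nat \<m> * tt ^ \<m>)"
proof -
 have "dd (tt ^ \<m>) = - (dd (xx ^ \<m>) * (tt ^ \<m>) ^ 2)"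
  using deriv_inverse[OF dd(1), of "xx ^ \<m>"] by (simp add: power_inverse)
 also have "... = - (of_nat \<m> * tt ^ \<m>)"
 proof -
  have "xx ^ \<m> \<noteq> 0" using xx_nz by simp
  then show ?thesis unfolding dd_xxm power_inverse by (simp add: field_simps power2_eq_square)
 qed
 finally show ?thesis .
qed

lemma dd_ss: "dd ss = - (of_nat \<m> * tt ^ \<m>)"
proof -
 have "ss = tt ^ \<m> - ss ^ \<q>" using ss_eq by (metis add_diff_cancel_left')
 then have "dd ss = dd (tt ^ \<m> - ss ^ \<q>)" by (rule arg_cong)
 then show ?thesis using ddD(6) deriv_q[OF dd(1)] dd_ttm by simp
qed

lemma m_nz: "of_nat \<m> \<noteq> (0::'a)"
 using nat_prime_coprime_not_dvd[OF prime_chp coprime_mm] by (rule of_nat_nz)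

end

section \<open>The Galois group over \<open>k(x\<^sup>n)\<close>\<close>

syntax "_n_exponent" :: logic ("\<n>")
translations "\<n>" \<rightharpoonup> "CONST mm (CONST Pure.type) * (CONST chp (CONST Pure.type) ^ CONST hh (CONST Pure.type) - CONST Suc (CONST Groups.zero))"

context cfield begin

lemma n_pos: "0 < \<n>"
proof -
 have "0 < \<q> - Suc 0" using q_ge3 by linarith
 moreover have "0 < \<m>" using mm_pos by linarith
 ultimately show ?thesis by simp
qed

definition mu :: "'a set" where "mu = {c \<in> kf. c ^ \<n> = 1}"

lemma muD: "c \<in> mu ==> c \<in> kf" "c \<in> mu ==> c ^ \<n> = 1" by (auto simp: mu_def)

lemma mu_nz: "c \<in> mu ==> c \<noteq> 0" using muD(2)[of c] n_pos by (auto simp: power_0_left)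

lemma mu_mult: "c \<in> mu ==> d \<in> mu ==> c * d \<in> mu"
 by (simp add: mu_def power_mult_distrib kfD(5))

lemma mu_inverse: "c \<in> mu ==> inverse c \<in> mu"
 using sfield_inverse[OF kf] by (simp add: mu_def power_inverse)

lemma mu_1: "1 \<in> mu" by (simp add: mu_def kfD(2))

lemma mu_power: "c \<in> mu ==> c ^ i \<in> mu" by (induction i) (simp_all add: mu_1 mu_mult)

lemma mu_q: assumes "c \<in> mu" shows "(c ^ \<m>) ^ \<q> = c ^ \<m>"
proof -
 have "\<q> = Suc (\<q> - Suc 0)" using q_pos by linarith
 then have "(c ^ \<m>) ^ \<q> = c ^ \<m> * (c ^ \<m>) ^ (\<q> - Suc 0)" by (metis power_Suc)
 then show ?thesis using muD(2)[OF assms] by (simp only: power_mult[symmetric] mult_1_right)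
qed

lemma mu_m_kf: "c \<in> mu ==> c ^ \<m> \<in> kf" "c \<in> mu ==> inverse c ^ \<m> \<in> kf"
 using muD(1) sring_power[OF kf_ring] sfield_inverse[OF kf] by blast+

lemma mu_root: obtains r where "r \<in> mu" "\<And>i. r ^ i = 1 \<longleftrightarrow> \<n> dvd i" "mu = (%i. r ^ i) ` {..<\<n>}" "card mu = \<n>" "finite mu"
proof -
 have "coprime \<n> \<p>"
 proof -
  have "coprime (\<q> - Suc 0) \<q>" using q_pos by (metis One_nat_def coprime_diff_one_left_nat)
  then have "coprime (\<q> - Suc 0) \<p>" using hh_pos by (simp add: coprime_power_right_iff)
  then show ?thesis using coprime_mm by simp
 qed
 then obtain r where r: "r \<in> kf" "\<And>i. r ^ i = 1 \<longleftrightarrow> \<n> dvd i" using primitive_root_ex[OF n_pos] by blast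
 have rm: "r \<in> mu" using r(1) r(2)[of "\<n>"] by (auto simp: mu_def)
 have eq: "mu = (%i. r ^ i) ` {..<\<n>}"
 proof
  show "mu \<subseteq> (%i. r ^ i) ` {..<\<n>}"
  proof
   fix b assume "b \<in> mu"
   from roots_of_unity[OF r(2) n_pos muD(2)[OF this]] show "b \<in> (%i. r ^ i) ` {..<\<n>}" by blast
  qed
  show "(%i. r ^ i) ` {..<\<n>} \<subseteq> mu" using mu_power[OF rm] by blast
 qed
 have le: "i = j" if ij: "r ^ i = r ^ j" "i \<le> j" "j < \<n>" for i j
 proof -
  have "r ^ j = r ^ i * r ^ (j - i)" using ij(2) by (simp flip: power_add)
  then have "r ^ (j - i) = 1" using ij(1) mu_nz[OF rm] by simp
  then have "\<n> dvd j - i" using r(2) by blast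
  moreover have "j - i < \<n>" using ij(3) by simp
  ultimately have "j - i = 0" using nat_dvd_not_less by blast
  then show ?thesis using ij(2) by simp
 qed
 have "inj_on (%i. r ^ i) {..<\<n>}"
 proof (rule inj_onI)
  fix i j assume "i \<in> {..<\<n>}" "j \<in> {..<\<n>}" "r ^ i = r ^ j"
  then show "i = j" using le[of i j] le[of j i] by (cases "i \<le> j") auto
 qed
 then have "card mu = \<n>" unfolding eq by (simp add: card_image)
 moreover have "finite mu" unfolding eq by simp
 ultimately show ?thesis by (rule that[OF rm r(2) eq])
qed

text \<open>The automorphisms that preserve each of the two families of ramified places.\<close>

definition typ1 :: "('a => 'a) => 'a => 'a => 'a => bool" where
 "typ1 f c a b \<longleftrightarrow> f xx = c * xx \<and> f ss = inverse c ^ \<m> * ss + a \<and> f zz = c ^ \<m> * zz + b"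

lemma trans_scale: assumes x: "trans x" and c: "c \<in> kf" "c \<noteq> 0" shows "trans (c * x)"
 unfolding trans_def
proof (intro allI impI)
 fix as assume as: "set as \<subseteq> kf" "peval as (c * x) = 0"
 have "(%t. peval as (c * t)) \<in> polys kf"
  using as(1)
 proof (induction as)
  case Nil then show ?case using polys_const[OF kfD(1)] by simp
 next
  case (Cons a as)
  have "(%t. a + (c * t) * peval as (c * t)) \<in> polys kf"
   using Cons by (intro polys_add[OF kf_ring] polys_mult[OF kf_ring] polys_scale[OF kf_ring] polys_id[OF kf_ring] polys_const c) auto
  then show ?case by simp
 qed
 from trans_fun[OF x this as(2)] have "peval as (c * t) = 0" for t .
 from this[of "_ / c"] have z: "peval as t = 0" for t using c(2) by simp
 then show "set as \<subseteq> {0}" using x as(1) by (auto simp: trans_def)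
qed

lemma typ1_exists:
 assumes c: "c \<in> mu" and a: "a \<in> Om" and b: "b \<in> Om"
 obtains f where "aut f" "typ1 f c a b"
proof -
 have c0: "c \<noteq> 0" by (rule mu_nz[OF c])
 have cm: "c ^ \<m> \<noteq> 0" "inverse c ^ \<m> \<noteq> 0" using c0 by auto
 have s: "(inverse c ^ \<m> * ss + a) ^ \<q> + (inverse c ^ \<m> * ss + a) = inverse (c * xx) ^ \<m>"
 proof -
  have E: "(inverse c ^ \<m> * ss + a) ^ \<q> = inverse c ^ \<m> * ss ^ \<q> - a"
   using mu_q[OF mu_inverse[OF c]] OmD(2)[OF a] by (simp add: frob_add power_mult_distrib)
  have "(inverse c ^ \<m> * ss + a) ^ \<q> + (inverse c ^ \<m> * ss + a) = inverse c ^ \<m> * (ss ^ \<q> + ss)"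
   unfolding E by (simp add: algebra_simps)
  then show ?thesis unfolding ss_eq by (simp add: power_mult_distrib mult.commute)
 qed
 have z: "(c ^ \<m> * zz + b) ^ \<q> + (c ^ \<m> * zz + b) = (c * xx) ^ \<m>"
 proof -
  have E: "(c ^ \<m> * zz + b) ^ \<q> = c ^ \<m> * zz ^ \<q> - b"
   using mu_q[OF c] OmD(2)[OF b] by (simp add: frob_add power_mult_distrib)
  have "(c ^ \<m> * zz + b) ^ \<q> + (c ^ \<m> * zz + b) = c ^ \<m> * (zz ^ \<q> + zz)"
   unfolding E by (simp add: algebra_simps)
  then show ?thesis unfolding zz_eq by (simp add: power_mult_distrib)
 qed
 define S where "S = kf \<union> {c * xx, inverse c ^ \<m> * ss + a, c ^ \<m> * zz + b}"
 note F = sfield_fgen[of S]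
 note FD = sringD[OF sfield_sring[OF F]]
 have k: "e \<in> fgen S" if "e \<in> kf" for e using that fgen_incl[of S] by (auto simp: S_def)
 have g: "c * xx \<in> fgen S" "inverse c ^ \<m> * ss + a \<in> fgen S" "c ^ \<m> * zz + b \<in> fgen S"
  using fgen_incl[of S] by (auto simp: S_def)
 have "xx = (c * xx) / c" using c0 by simp
 then have "xx \<in> fgen S" using sfield_divide[OF F g(1) k[OF muD(1)[OF c]]] by metis
 moreover have "ss = ((inverse c ^ \<m> * ss + a) - a) / inverse c ^ \<m>" using cm by simp
 then have "ss \<in> fgen S"
  using sfield_divide[OF F FD(6)[OF g(2) k[OF OmD(1)[OF a]]] k[OF mu_m_kf(2)[OF c]]] by metis
 moreover have "zz = ((c ^ \<m> * zz + b) - b) / c ^ \<m>" using cm by simp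
 then have "zz \<in> fgen S"
  using sfield_divide[OF F FD(6)[OF g(3) k[OF OmD(1)[OF b]]] k[OF mu_m_kf(1)[OF c]]] by metis
 ultimately have gen: "{xx, ss, zz} \<subseteq> fgen (kf \<union> {c * xx, inverse c ^ \<m> * ss + a, c ^ \<m> * zz + b})"
  by (simp add: S_def)
 obtain f where "aut f" "f xx = c * xx" "f ss = inverse c ^ \<m> * ss + a" "f zz = c ^ \<m> * zz + b"
  using aut_exists[OF trans_scale[OF trans_xx muD(1)[OF c] c0] s z gen] by blast
 then show ?thesis using that by (auto simp: typ1_def)
qed

lemma xi_exists: obtains f where "aut f" "f xx = tt" "f ss = zz" "f zz = ss"
proof -
 have "{xx, ss, zz} \<subseteq> fgen (kf \<union> {tt, zz, ss})"
  using cfield.generates[OF swap] by simp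
 then show ?thesis
  using aut_exists[OF trans_inverse[OF trans_xx], of zz ss] zz_eq ss_eq that by (auto simp: power_inverse)
qed

lemma typ1_comp:
 assumes f: "aut f" "typ1 f c a b" and g: "aut g" "typ1 g c' a' b'" and c: "c \<in> mu" "c' \<in> mu"
  and ab: "a \<in> Om" "b \<in> Om" "a' \<in> Om" "b' \<in> Om"
 shows "typ1 (f \<circ> g) (c * c') (inverse c' ^ \<m> * a + a') (c' ^ \<m> * b + b')"
  "inverse c' ^ \<m> * a + a' \<in> Om" "c' ^ \<m> * b + b' \<in> Om"
proof -
 have k: "f (c' ^ \<m>) = c' ^ \<m>" "f (inverse c' ^ \<m>) = inverse c' ^ \<m>" "f c' = c'" "f a' = a'" "f b' = b'"
  using autD(3)[OF f(1)] mu_m_kf[OF c(2)] muD(1)[OF c(2)] OmD(1) ab by auto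
 have "f (g xx) = c * c' * xx" using f g k by (simp add: typ1_def autD(5)[OF f(1)] mult_ac)
 moreover have "f (g ss) = inverse (c * c') ^ \<m> * ss + (inverse c' ^ \<m> * a + a')"
 proof -
  have "f (g ss) = f (inverse c' ^ \<m>) * f ss + f a'"
   using g(2) autD(4,5)[OF f(1)] by (simp add: typ1_def)
  then show ?thesis using f(2) unfolding k by (simp add: typ1_def power_mult_distrib algebra_simps)
 qed
 moreover have "f (g zz) = (c * c') ^ \<m> * zz + (c' ^ \<m> * b + b')"
 proof -
  have "f (g zz) = f (c' ^ \<m>) * f zz + f b'"
   using g(2) autD(4,5)[OF f(1)] by (simp add: typ1_def)
  then show ?thesis using f(2) unfolding k by (simp add: typ1_def power_mult_distrib algebra_simps)
 qed
 ultimately show "typ1 (f \<circ> g) (c * c') (inverse c' ^ \<m> * a + a') (c' ^ \<m> * b + b')"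
  by (simp add: typ1_def)
 show "inverse c' ^ \<m> * a + a' \<in> Om" "c' ^ \<m> * b + b' \<in> Om"
  using Om_add Om_scale mu_m_kf[OF c(2)] mu_q[OF c(2)] mu_q[OF mu_inverse[OF c(2)]] ab by auto
qed

definition Gal :: "('a => 'a) set" where
 "Gal = {f. aut f \<and> (\<exists>c\<in>mu. \<exists>a\<in>Om. \<exists>b\<in>Om. typ1 f c a b)}"

lemma Gal_comp: assumes "f \<in> Gal" "g \<in> Gal" shows "f \<circ> g \<in> Gal"
proof -
 obtain c a b where f: "aut f" "c \<in> mu" "a \<in> Om" "b \<in> Om" "typ1 f c a b" using assms(1) by (auto simp: Gal_def)
 obtain c' a' b' where g: "aut g" "c' \<in> mu" "a' \<in> Om" "b' \<in> Om" "typ1 g c' a' b'" using assms(2) by (auto simp: Gal_def)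
 note T = typ1_comp[OF f(1,5) g(1,5) f(2) g(2) f(3,4) g(3,4)]
 show ?thesis using T aut_comp[OF f(1) g(1)] mu_mult[OF f(2) g(2)] unfolding Gal_def by blast
qed

lemma Gal_finite: "finite Gal"
proof -
 obtain r where "finite mu" using mu_root by metis
 have "Gal \<subseteq> (%(c, a, b). SOME f. aut f \<and> typ1 f c a b) ` (mu \<times> Om \<times> Om)"
 proof
  fix f assume "f \<in> Gal"
  then obtain c a b where f: "aut f" "c \<in> mu" "a \<in> Om" "b \<in> Om" "typ1 f c a b" by (auto simp: Gal_def)
  define g where "g = (SOME f. aut f \<and> typ1 f c a b)"
  have "aut g \<and> typ1 g c a b" unfolding g_def by (rule someI[of _ f]) (use f in auto)
  then have "f = g" using f(1,5) by (intro aut_ext) (auto simp: typ1_def)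
  then show "f \<in> (%(c, a, b). SOME f. aut f \<and> typ1 f c a b) ` (mu \<times> Om \<times> Om)"
   using f(2-4) unfolding g_def by (intro image_eqI[of _ _ "(c, a, b)"]) auto
 qed
 then show ?thesis using \<open>finite mu\<close> card_Om(2) finite_subset by blast
qed

lemma Gal_id: "(%a. a) \<in> Gal"
proof -
 have "typ1 (%a. a) 1 0 0" by (simp add: typ1_def)
 then show ?thesis using aut_id mu_1 Om_0 unfolding Gal_def by blast
qed

lemma aut_fix_gen: "aut f ==> (\<And>a. a \<in> S ==> f a = a) ==> a \<in> fgen S ==> f a = a"
 using fgen_least[OF aut_fixed_sfield, of f S] by blast

lemma card_translates: "card ((%b. w + b) ` Om) = \<q>" "finite ((%b. w + b) ` Om)"
 using card_Om by (simp_all add: card_image inj_on_def)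

lemma fixed_Dz:
 assumes "\<And>f b. aut f ==> b \<in> Om ==> typ1 f 1 0 b ==> f a = a" shows "a \<in> E1"
proof (rule fixed_in_base[OF sfield_sring[OF E1_field] _ q_pos card_translates(2)[of zz]])
 show "a \<in> span_ext E1 zz \<q>" using z_span by simp
 show "\<q> \<le> card ((+) zz ` Om)" using card_translates(1) by simp
 fix t assume "t \<in> (+) zz ` Om"
 then obtain b where b: "b \<in> Om" "t = zz + b" by blast
 obtain f where f: "aut f" "typ1 f 1 0 b" by (rule typ1_exists[OF mu_1 Om_0 b(1)])
 have "f e = e" if e: "e \<in> E1" for e
 proof (rule aut_fix_gen[OF f(1) _ e])
  fix u assume "u \<in> kf \<union> {xx, ss}"
  then show "f u = u" using autD(3)[OF f(1), of u] f(2) by (auto simp: typ1_def)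
 qed
 then show "\<exists>f. aut f \<and> f zz = t \<and> (\<forall>e\<in>E1. f e = e) \<and> f a = a"
  using f b assms[OF f(1) b(1) f(2)] by (intro exI[of _ f]) (auto simp: typ1_def)
qed

lemma fixed_Delta:
 assumes "\<And>f c b. aut f ==> c \<in> Om ==> b \<in> Om ==> typ1 f 1 c b ==> f a = a" shows "a \<in> E0"
proof (rule fixed_in_base[OF sfield_sring[OF E0_field] _ q_pos card_translates(2)[of ss]])
 have "a \<in> E1" using assms Om_0 by (intro fixed_Dz) blast
 then show "a \<in> span_ext E0 ss \<q>" using E1_span by simp
 show "\<q> \<le> card ((+) ss ` Om)" using card_translates(1) by simp
 fix t assume "t \<in> (+) ss ` Om"
 then obtain b where b: "b \<in> Om" "t = ss + b" by blast
 obtain f where f: "aut f" "typ1 f 1 b 0" by (rule typ1_exists[OF mu_1 b(1) Om_0])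
 have "f e = e" if e: "e \<in> E0" for e
 proof (rule aut_fix_gen[OF f(1) _ e])
  fix u assume "u \<in> insert xx kf"
  then show "f u = u" using autD(3)[OF f(1), of u] f(2) by (auto simp: typ1_def)
 qed
 then show "\<exists>f. aut f \<and> f ss = t \<and> (\<forall>e\<in>E0. f e = e) \<and> f a = a"
  using f b assms[OF f(1) b(1) Om_0 f(2)] by (intro exI[of _ f]) (auto simp: typ1_def)
qed

text \<open>Descent through k(x, s) and k(x): at each step the conjugates of the generator under the
 automorphisms fixing the base are as many as the degree.\<close>

lemma fixed_Gal:
 assumes fixed: "\<And>f. f \<in> Gal ==> f a = a" shows "a \<in> fgen (insert (xx ^ \<n>) kf)"
proof -
 let ?H = "fgen (insert (xx ^ \<n>) kf)"
 note H = sfield_fgen[of "insert (xx ^ \<n>) kf"]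
 note HR = sfield_sring[OF H]
 have Hm: "xx ^ \<n> \<in> ?H" "c \<in> kf ==> c \<in> ?H" for c using fgen_incl[of "insert (xx ^ \<n>) kf"] by auto
 have "xx ^ \<n> * xx ^ 0 \<in> span_ext ?H xx (\<n>)"
  by (rule span_ext_ops(3)[OF HR Hm(1) span_ext_power[OF HR n_pos]])
 then have xn: "xx ^ \<n> \<in> span_ext ?H xx (\<n>)" by simp
 note S = span_ext_ring[OF HR n_pos xn]
 have alx: "alg ?H xx"
 proof -
  obtain as where as: "set as \<subseteq> {0, - (xx ^ \<n>)}" "\<forall>t. peval (as @ [1]) t = t ^ \<n> - xx ^ \<n>"
   using monom_peval[OF n_pos] by blast
  have "set (as @ [1]) \<subseteq> ?H" using as(1) Hm(1) sringD[OF HR] by auto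
  then show ?thesis unfolding alg_def using as(2) by (intro exI[of _ "as @ [1]"]) auto
 qed
 have F: "sfield (span_ext ?H xx (\<n>))"
 proof (rule algebraic_ring_sfield[OF H S(1,2)])
  fix b assume "b \<in> span_ext ?H xx (\<n>)"
  then obtain c where c: "\<forall>i. c i \<in> ?H" "b = (\<Sum>i<\<n>. c i * xx ^ i)" by (auto simp: span_ext_def)
  note AR = sfield_sring[OF alg_sfield[OF H]]
  have "c i \<in> {a. alg ?H a}" for i using c(1) alg_self[OF H] by blast
  moreover have "xx ^ i \<in> {a. alg ?H a}" for i by (rule sring_power[OF AR]) (use alx in simp)
  ultimately have "c i * xx ^ i \<in> {a. alg ?H a}" for i by (rule sringD(5)[OF AR])
  then have "b \<in> {a. alg ?H a}" unfolding c(2) by (rule sring_sum[OF AR])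
  then show "alg ?H b" by simp
 qed
 have E0sub: "E0 \<subseteq> span_ext ?H xx (\<n>)"
  using S(2,3) Hm(2) by (intro fgen_least[OF F]) auto
 have inG: "f \<in> Gal" if "aut f" "c \<in> mu" "a \<in> Om" "b \<in> Om" "typ1 f c a b" for f c a b
  using that by (auto simp: Gal_def)
 have aE0: "a \<in> E0" using fixed inG mu_1 by (intro fixed_Delta) blast
 obtain r where r: "r \<in> mu" "card mu = \<n>" "finite mu" using mu_root by metis
 show ?thesis
 proof (rule fixed_in_base[OF HR _ n_pos])
  show "a \<in> span_ext ?H xx (\<n>)" using aE0 E0sub by blast
  show "finite ((%c. c * xx) ` mu)" using r by simp
  show "\<n> \<le> card ((%c. c * xx) ` mu)" using r xx_nz by (simp add: card_image inj_on_def)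
  fix t assume "t \<in> (%c. c * xx) ` mu"
  then obtain c where c: "c \<in> mu" "t = c * xx" by blast
  obtain f where f: "aut f" "typ1 f c 0 0" by (rule typ1_exists[OF c(1) Om_0 Om_0])
  have "f (xx ^ \<n>) = xx ^ \<n>" using f(2) muD(2)[OF c(1)] by (simp add: autD(10)[OF f(1)] typ1_def power_mult_distrib)
  then have "f e = e" if e: "e \<in> ?H" for e
   using autD(3)[OF f(1)] by (intro aut_fix_gen[OF f(1) _ e]) auto
  then show "\<exists>f. aut f \<and> f xx = t \<and> (\<forall>e\<in>?H. f e = e) \<and> f a = a"
   using f c fixed[OF inG[OF f(1) c(1) Om_0 Om_0 f(2)]] by (intro exI[of _ f]) (auto simp: typ1_def)
 qed
qed

text \<open>The polynomial with the conjugates of a as roots has coefficients in the fixed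
 field.\<close>

lemma galois_polynomial:
 "\<exists>T as. finite T \<and> a \<in> T \<and> set as \<subseteq> fgen (insert (xx ^ \<n>) kf) \<and> length as = card T \<and>
  (\<forall>t. peval (as @ [1]) t = (\<Prod>b\<in>T. t - b))"
proof -
 define T where "T = (%f. f a) ` Gal"
 have T: "finite T" "a \<in> T" using Gal_finite Gal_id by (auto simp: T_def)
 obtain as where as: "length as = card T" "\<forall>t. peval (as @ [1]) t = (\<Prod>b\<in>T. t - b)"
  using monic_of_roots[OF T(1)] by blast
 have zero: "peval (as @ [1]) t = 0" if "t \<in> T" for t
  using that T(1) as(2) by (auto intro: prod_zero)
 have "as ! i \<in> fgen (insert (xx ^ \<n>) kf)" if i: "i < length as" for i
 proof (rule fixed_Gal)
  fix f assume f: "f \<in> Gal"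
  then have au: "aut f" by (simp add: Gal_def)
  have sub: "f ` T \<subseteq> T"
  proof
   fix u assume "u \<in> f ` T"
   then obtain g where g: "g \<in> Gal" "u = (f \<circ> g) a" by (auto simp: T_def)
   then show "u \<in> T" unfolding T_def using Gal_comp[OF f g(1)] by blast
  qed
  have "inj_on f T" using aut_eq_iff[OF au] by (auto simp: inj_on_def)
  then have onto: "f ` T = T" using sub T(1) by (simp add: endo_inj_surj)
  have "(\<Sum>i<card T. (as ! i - f (as ! i)) * t ^ i) = 0" if t: "t \<in> T" for t
  proof -
   obtain t' where t': "t' \<in> T" "t = f t'" using t onto by blast
   have pe: "peval (as @ [1]) u = (\<Sum>i<card T. as ! i * u ^ i) + u ^ card T" for u
    using as(1) peval_sum[of as u] by (simp add: peval_append)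
   have "f (peval (as @ [1]) t') = (\<Sum>i<card T. f (as ! i) * t ^ i) + t ^ card T"
    unfolding pe t'(2) by (simp add: autD[OF au] aut_sum[OF au])
   then have "(\<Sum>i<card T. f (as ! i) * t ^ i) + t ^ card T = 0" using zero[OF t'(1)] autD(6)[OF au] by simp
   moreover have "(\<Sum>i<card T. as ! i * t ^ i) + t ^ card T = 0" using zero[OF t] unfolding pe .
   ultimately have "(\<Sum>i<card T. as ! i * t ^ i) = (\<Sum>i<card T. f (as ! i) * t ^ i)" by (metis add_right_cancel)
   then show ?thesis by (simp only: left_diff_distrib sum_minus diff_self)
  qed
  then have "as ! i - f (as ! i) = 0"
   using coeffs_zero_if_many_roots[OF T(1) order_refl, of "%i. as ! i - f (as ! i)" i] i as(1) by simp
  then show "f (as ! i) = as ! i" by simp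
 qed
 then have "set as \<subseteq> fgen (insert (xx ^ \<n>) kf)" by (auto simp: in_set_conv_nth)
 then show ?thesis using T as by blast
qed

end

section \<open>The Cartier operator and regular differentials\<close>

lemma int_dvd_add_multiple: "n = int r + k * (p::int) ==> p dvd int r ==> p dvd n"
 by simp

context cfield begin

lemma pow_p_Suc: "(c :: 'a) ^ (\<p> ^ Suc j) = (c ^ (\<p> ^ j)) ^ \<p>"
proof -
 have "c ^ (\<p> ^ Suc j) = c ^ (\<p> * \<p> ^ j)" by simp
 also have "... = (c ^ \<p>) ^ (\<p> ^ j)" by (rule power_mult)
 finally show ?thesis by (simp only: power_swap[of c \<p>])
qed

lemma zero_q: "(0::'a) ^ \<q> = 0" using q_pos by (simp only: power_0_left) simp

lemma AS_add: "(a + b) - (a + b) ^ \<p> = (a - a ^ \<p>) + (b - b ^ \<p>)"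
 by (simp add: frobp_add algebra_simps)

lemma AS_minus: "(- a) - (- a) ^ \<p> = - (a - a ^ \<p>)"
 by (simp add: frobp_minus)

lemma dd_p: "dd (c ^ \<p> * a) = c ^ \<p> * dd a"
 by (simp add: ddD deriv_frob[OF dd(1)])

lemma dd_pp: "dd (c ^ (\<p> ^ Suc j) * a) = c ^ (\<p> ^ Suc j) * dd a"
proof -
 show ?thesis unfolding pow_p_Suc by (rule dd_p)
qed

lemma dd_kf: "c \<in> kf ==> dd (c * a) = c * dd a"
 by (simp add: ddD deriv_kf[OF dd(1)])

lemma x_basis_span: "span_ext Lp xx \<p> = UNIV"
proof -
 note F = Lp_span(1)[of xx]
 note SD = sringD[OF sfield_sring[OF F]]
 have "ss = inverse xx ^ \<m> - ss ^ \<q>" using ss_eq by (metis add_diff_cancel_left')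
 moreover have "inverse xx ^ \<m> - ss ^ \<q> \<in> span_ext Lp xx \<p>"
  by (rule SD(6)[OF sring_power[OF sfield_sring[OF F] sfield_inverse[OF F Lp_span(3)]] Lp_span(5)])
 ultimately have "ss \<in> span_ext Lp xx \<p>" by metis
 moreover have "zz = xx ^ \<m> - zz ^ \<q>" using zz_eq by (metis add_diff_cancel_left')
 moreover have "xx ^ \<m> - zz ^ \<q> \<in> span_ext Lp xx \<p>"
  by (rule SD(6)[OF sring_power[OF sfield_sring[OF F] Lp_span(3)] Lp_span(5)])
 ultimately have "kf \<union> {xx, ss, zz} \<subseteq> span_ext Lp xx \<p>" using Lp_span(3,4)[of xx] by auto
 from fgen_least[OF F this] show ?thesis unfolding generates by blast
qed

lemma of_nat_frob: "(of_nat i :: 'a) ^ \<p> = of_nat i"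
 using p_pos by (induction i) (simp_all add: frobp_add power_0_left)

lemma dd_eigen: "dd (c ^ \<p> * xx ^ i) = of_nat i * (c ^ \<p> * xx ^ i)"
proof -
 have "xx * dd (xx ^ i) = xx * (of_nat i * xx ^ i)" using deriv_power[OF dd(1), of xx i] dd(2) by (simp add: mult_ac)
 then have "dd (xx ^ i) = of_nat i * xx ^ i" using xx_nz by simp
 then show ?thesis using dd_p by (simp add: mult_ac)
qed

lemma dd_iterate: "(dd ^^ \<p>) a = dd a"
proof -
 have eig: "(dd ^^ n) (c ^ \<p> * xx ^ i) = of_nat i ^ n * (c ^ \<p> * xx ^ i)" for n c i
 proof (induction n)
  case (Suc n)
  have "dd (of_nat i ^ n * (c ^ \<p> * xx ^ i)) = of_nat i ^ n * dd (c ^ \<p> * xx ^ i)"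
   by (rule dd_kf[OF sring_power[OF kf_ring sring_of_nat[OF kf_ring]]])
  then show ?case using Suc dd_eigen by (simp add: mult_ac)
 qed simp
 have add: "(dd ^^ n) (sum f I) = (\<Sum>i\<in>I. (dd ^^ n) (f i))" for n f and I :: "nat set"
  by (induction n arbitrary: f) (simp_all add: deriv_sum[OF dd(1)] funpow_swap1)
 have "a \<in> span_ext Lp xx \<p>" using x_basis_span by simp
 then obtain c where c: "\<forall>i. c i \<in> Lp" "a = (\<Sum>i<\<p>. c i * xx ^ i)" by (auto simp: span_ext_def)
 have "(dd ^^ \<p>) (c i * xx ^ i) = dd (c i * xx ^ i)" for i
 proof -
  obtain d where "c i = d ^ \<p>" using c(1) by (auto simp: Lp_def)
  then show ?thesis using eig dd_eigen of_nat_frob by simp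
 qed
 then show ?thesis unfolding c(2) add by (simp add: deriv_sum[OF dd(1)])
qed

text \<open>The p-th iterate of dd is dd itself.\<close>

lemma dd_dd: assumes "dd (dd a) = 0" shows "dd a = 0"
proof -
 define k where "k = \<p> - 2"
 have n: "\<p> = k + 2" using chr_ge3 unfolding k_def by linarith
 have z: "(dd ^^ i) 0 = 0" for i by (induction i) (simp_all add: ddD(3))
 have "(dd ^^ (n + 2)) a = (dd ^^ n) (dd (dd a))" for n
 proof -
  have "(dd ^^ 2) a = dd (dd a)" by (simp add: numeral_2_eq_2)
  then show ?thesis by (simp only: funpow_add comp_def)
 qed
 then have "(dd ^^ (k + 2)) a = 0" unfolding assms z .
 then have "(dd ^^ \<p>) a = 0" using n by metis
 then show ?thesis using dd_iterate by simp
qed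

text \<open>Sums of exact forms and their Frobenius twists.\<close>

primrec BB :: "nat => 'a set" where
 "BB 0 = {0}"
| "BB (Suc j) = {dd g + c ^ \<p> |g c. c \<in> BB j}"

lemma BB_SucI: "c \<in> BB j ==> dd g + c ^ \<p> \<in> BB (Suc j)" by auto

lemma BB_zero: "0 \<in> BB j"
proof (induction j)
 case (Suc j) then show ?case using BB_SucI[OF Suc, of 0] p_pos by (simp add: ddD power_0_left)
qed simp

lemma BB_add: "a \<in> BB j ==> b \<in> BB j ==> a + b \<in> BB j"
proof (induction j arbitrary: a b)
 case (Suc j)
 then obtain g c g' c' where *: "a = dd g + c ^ \<p>" "c \<in> BB j" "b = dd g' + c' ^ \<p>" "c' \<in> BB j" by auto
 have "a + b = dd (g + g') + (c + c') ^ \<p>" unfolding * by (simp add: ddD frobp_add algebra_simps)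
 then show ?case using BB_SucI[OF Suc.IH[OF *(2,4)]] by metis
qed simp

lemma BB_minus: "a \<in> BB j ==> - a \<in> BB j"
proof (induction j arbitrary: a)
 case (Suc j)
 then obtain g c where *: "a = dd g + c ^ \<p>" "c \<in> BB j" by auto
 have "- a = dd (- g) + (- c) ^ \<p>" unfolding * by (simp add: ddD frobp_minus)
 then show ?case using BB_SucI[OF Suc.IH[OF *(2)]] by metis
qed simp

lemma BB_diff: "a \<in> BB j ==> b \<in> BB j ==> a - b \<in> BB j"
 using BB_add[of a j "- b"] BB_minus[of b j] by simp

lemma BB_scale: "a \<in> BB j ==> c ^ (\<p> ^ j) * a \<in> BB j"
proof (induction j arbitrary: a)
 case (Suc j)
 then obtain g b where *: "a = dd g + b ^ \<p>" "b \<in> BB j" by auto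
 have "c ^ (\<p> ^ Suc j) * a = dd (c ^ (\<p> ^ Suc j) * g) + (c ^ (\<p> ^ j) * b) ^ \<p>"
  unfolding * dd_pp by (simp only: distrib_left power_mult_distrib pow_p_Suc)
 then show ?case using BB_SucI[OF Suc.IH[OF *(2)]] by metis
qed simp

lemma frobp_inj: assumes "a ^ \<p> = b ^ \<p>" shows "a = b"
proof -
 have "(a - b) ^ \<p> = 0" using assms by (simp add: frobp_diff)
 then show ?thesis by simp
qed

lemma BB_power: "e ^ (\<p> ^ j) \<in> BB j ==> e = 0"
proof (induction j)
 case (Suc j)
 then obtain g c where *: "e ^ (\<p> ^ Suc j) = dd g + c ^ \<p>" "c \<in> BB j" by auto
 have "dd (dd g + c ^ \<p>) = 0" unfolding *(1)[symmetric] using deriv_frob[OF dd(1)] by (simp only: pow_p_Suc)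
 then have "dd (dd g) = 0" using deriv_frob[OF dd(1)] by (simp add: ddD)
 then have "dd g = 0" by (rule dd_dd)
 then have "(e ^ (\<p> ^ j)) ^ \<p> = c ^ \<p>" using *(1) unfolding pow_p_Suc by simp
 then have "e ^ (\<p> ^ j) = c" by (rule frobp_inj)
 then show ?case using Suc.IH *(2) by simp
qed simp

text \<open>Away from exponents divisible by p a monomial is an eigenvector of dd with nonzero
 eigenvalue, hence exact.\<close>

lemma BB_monomial: "\<not> int (\<p> ^ j) dvd n ==> zp xx n * g ^ (\<p> ^ j) \<in> BB j"
proof (induction j arbitrary: n)
 case (Suc j)
 show ?case
 proof (cases "int \<p> dvd n")
  case True
  then obtain n' where n': "n = int \<p> * n'" by blast
  have "\<not> int (\<p> ^ j) dvd n'"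
  proof
   assume "int (\<p> ^ j) dvd n'"
   then have "int \<p> * int (\<p> ^ j) dvd n" unfolding n' by simp
   then show False using Suc.prems by simp
  qed
  from BB_SucI[OF Suc.IH[OF this], of 0]
  have "(zp xx n' * g ^ (\<p> ^ j)) ^ \<p> \<in> BB (Suc j)" by (simp add: ddD(3) del: BB.simps)
  moreover have "zp xx n = zp xx n' ^ \<p>"
   using zp_mult_nat[OF xx_nz, of n' \<p>] n' by (simp add: ab_semigroup_mult_class.mult.commute)
  ultimately show ?thesis by (simp only: power_mult_distrib pow_p_Suc)
 next
  case False
  define r where "r = nat (n mod int \<p>)"
  have r: "n = int r + (n div int \<p>) * int \<p>" using p_pos by (simp add: r_def)
  have "\<not> \<p> dvd r"
  proof
   assume "\<p> dvd r"
   then have "int \<p> dvd int r" by simp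
   then show False using False int_dvd_add_multiple[OF r] by blast
  qed
  then have nz: "of_nat r \<noteq> (0::'a)" by (rule of_nat_nz)
  define e where "e = zp xx (n div int \<p>) * g ^ (\<p> ^ j)"
  have eq: "zp xx n * g ^ (\<p> ^ Suc j) = e ^ \<p> * xx ^ r"
  proof -
   have "zp xx n = xx ^ r * zp xx (n div int \<p>) ^ \<p>"
    using zp_add[OF xx_nz, of "int r" "(n div int \<p>) * int \<p>"] zp_mult_nat[OF xx_nz, of "n div int \<p>" \<p>] r by simp
   then show ?thesis unfolding e_def by (simp only: power_mult_distrib pow_p_Suc mult_ac)
  qed
  have "dd (inverse (of_nat r) * (e ^ \<p> * xx ^ r)) = inverse (of_nat r) * dd (e ^ \<p> * xx ^ r)"
   by (rule dd_kf[OF sfield_inverse[OF kf sring_of_nat[OF kf_ring]]])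
  also have "... = e ^ \<p> * xx ^ r" unfolding dd_eigen using nz by (simp flip: mult.assoc)
  finally have "zp xx n * g ^ (\<p> ^ Suc j) = dd (inverse (of_nat r) * (e ^ \<p> * xx ^ r)) + 0 ^ \<p>"
   using eq p_pos by (simp add: power_0_left)
  then show ?thesis using BB_SucI[OF BB_zero] by metis
 qed
qed simp

text \<open>Logarithmic differentials are fixed by the Cartier operator.\<close>

definition LG :: "'a set" where "LG = {w. w = 0 \<or> (\<exists>g. dd w / w - (dd w / w) ^ \<p> = dd g)}"

lemma LG_mult: assumes "w \<in> LG" "v \<in> LG" shows "w * v \<in> LG"
proof (cases "w = 0 \<or> v = 0")
 case False
 then obtain g g' where g: "dd w / w - (dd w / w) ^ \<p> = dd g" "dd v / v - (dd v / v) ^ \<p> = dd g'"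
  using assms by (auto simp: LG_def)
 have "dd (w * v) / (w * v) = dd w / w + dd v / v" using False by (simp add: ddD field_simps)
 then have "dd (w * v) / (w * v) - (dd (w * v) / (w * v)) ^ \<p> = dd (g + g')"
  by (simp only: AS_add g ddD(1))
 then show ?thesis by (auto simp: LG_def)
qed (auto simp: LG_def)

lemma LG_inverse: assumes "w \<in> LG" shows "inverse w \<in> LG"
proof (cases "w = 0")
 case False
 then obtain g where g: "dd w / w - (dd w / w) ^ \<p> = dd g" using assms by (auto simp: LG_def)
 have "dd (inverse w) / inverse w = - (dd w / w)"
  unfolding deriv_inverse[OF dd(1)] using False by (simp add: power2_eq_square divide_inverse mult.assoc)
 then have "dd (inverse w) / inverse w - (dd (inverse w) / inverse w) ^ \<p> = dd (- g)"
  by (simp only: AS_minus g ddD(5))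
 then show ?thesis by (auto simp: LG_def)
qed (auto simp: LG_def)

lemma LG_const: assumes "dd w = 0" shows "w \<in> LG"
proof -
 have "dd w / w - (dd w / w) ^ \<p> = dd 0" using assms p_pos by (simp add: ddD(3) power_0_left)
 then show ?thesis unfolding LG_def by blast
qed

lemma power_times_dd: assumes "Suc j < \<p>" shows "\<exists>g. w ^ j * dd w = dd g"
proof -
 have "\<not> \<p> dvd Suc j" using assms by (metis nat_dvd_not_less zero_less_Suc)
 then have nz: "of_nat (Suc j) \<noteq> (0::'a)" by (rule of_nat_nz)
 have "dd (inverse (of_nat (Suc j)) * w ^ Suc j) = inverse (of_nat (Suc j)) * (of_nat (Suc j) * w ^ j * dd w)"
  using dd_kf[OF sfield_inverse[OF kf sring_of_nat[OF kf_ring]], of "Suc j" "w ^ Suc j"]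
  unfolding deriv_power_Suc[OF dd(1)] .
 also have "... = w ^ j * dd w" using nz by (simp flip: mult.assoc del: of_nat_Suc)
 finally show ?thesis by metis
qed

lemma power_diff_times_dd: "n + i < \<p> ==> \<exists>g. ((w + 1) ^ n - w ^ n) * w ^ i * dd w = dd g"
proof (induction n arbitrary: i)
 case 0 then show ?case using ddD(3) by (intro exI[of _ 0]) simp
next
 case (Suc n)
 obtain g1 where g1: "((w + 1) ^ n - w ^ n) * w ^ Suc i * dd w = dd g1" using Suc.IH[of "Suc i"] Suc.prems by auto
 obtain g2 where g2: "((w + 1) ^ n - w ^ n) * w ^ i * dd w = dd g2" using Suc.IH[of i] Suc.prems by auto
 obtain g3 where g3: "w ^ (n + i) * dd w = dd g3" using power_times_dd[of "n + i" w] Suc.prems by auto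
 have "((w + 1) ^ Suc n - w ^ Suc n) * w ^ i * dd w
   = ((w + 1) ^ n - w ^ n) * w ^ Suc i * dd w + ((w + 1) ^ n - w ^ n) * w ^ i * dd w + w ^ (n + i) * dd w"
  by (simp add: algebra_simps power_add)
 also have "... = dd (g1 + g2 + g3)" unfolding g1 g2 g3 by (simp add: ddD(1))
 finally show ?case by blast
qed

text \<open>Expanding (w + 1)^(p-1) - w^(p-1) reduces the claim to exactness of w^i dw for i < p -
 1.\<close>

lemma LG_add_one: assumes w: "w \<in> LG" shows "w + 1 \<in> LG"
proof (cases "w = 0 \<or> w + 1 = 0")
 case True
 then show ?thesis
 proof
  assume "w = 0" then show ?thesis using LG_const[OF ddD(4)] by simp
 next
  assume "w + 1 = 0" then show ?thesis by (simp add: LG_def)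
 qed
next
 case False
 then have nz: "w \<noteq> 0" "w + 1 \<noteq> 0" by auto
 obtain g where g: "dd w / w - (dd w / w) ^ \<p> = dd g" using w nz by (auto simp: LG_def)
 obtain n where n: "\<p> = Suc n" using p_pos by (cases "\<p>") auto
 have d1: "dd (w + 1) = dd w" by (simp add: ddD(1,4))
 have lift: "v ^ \<p> * (dd w / v - (dd w / v) ^ \<p>) = v ^ n * dd w - dd w ^ \<p>" if "v \<noteq> 0" for v
 proof -
  have "v * (dd w / v) = dd w" using that by simp
  moreover have "v ^ \<p> * (dd w / v) = v ^ n * (v * (dd w / v))" unfolding n by (simp only: power_Suc mult_ac)
  ultimately have "v ^ \<p> * (dd w / v) = v ^ n * dd w" by simp
  moreover have "v ^ \<p> * (dd w / v) ^ \<p> = dd w ^ \<p>" using that by (simp flip: power_mult_distrib)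
  ultimately show ?thesis by (simp add: right_diff_distrib)
 qed
 have "w ^ n * dd w - dd w ^ \<p> = dd (w ^ \<p> * g)" using lift[OF nz(1)] g dd_p by simp
 moreover obtain g' where "((w + 1) ^ n - w ^ n) * w ^ 0 * dd w = dd g'"
  using power_diff_times_dd[of n 0 w] n by auto
 ultimately have "(w + 1) ^ n * dd w - dd w ^ \<p> = dd (w ^ \<p> * g + g')"
  by (simp add: ddD(1) algebra_simps)
 then have "(w + 1) ^ \<p> * (dd w / (w + 1) - (dd w / (w + 1)) ^ \<p>) = dd (w ^ \<p> * g + g')"
  using lift[OF nz(2)] by simp
 then have "dd w / (w + 1) - (dd w / (w + 1)) ^ \<p> = inverse (w + 1) ^ \<p> * dd (w ^ \<p> * g + g')"
 proof -
  have "inverse (w + 1) ^ \<p> * (w + 1) ^ \<p> = 1" using nz(2) by (simp flip: power_mult_distrib)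
  then have "inverse (w + 1) ^ \<p> * ((w + 1) ^ \<p> * u) = u" for u by (simp flip: mult.assoc)
  then show ?thesis using \<open>(w + 1) ^ \<p> * _ = _\<close> by metis
 qed
 then have "dd (w + 1) / (w + 1) - (dd (w + 1) / (w + 1)) ^ \<p> = dd (inverse (w + 1) ^ \<p> * (w ^ \<p> * g + g'))"
  unfolding d1 dd_p .
 then show ?thesis by (auto simp: LG_def)
qed

text \<open>LG is closed under products, inverses and w \<mapsto> w + 1, hence a field; it contains
 the p-th powers and x.\<close>

lemma LG_UNIV: "w \<in> LG"
proof -
 have S: "sfield LG"
 proof (rule sfieldI, rule sringI)
  show "0 \<in> LG" "1 \<in> LG" using LG_const ddD(3,4) by auto
  show m: "u * v \<in> LG" if "u \<in> LG" "v \<in> LG" for u v by (rule LG_mult[OF that])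
  show "inverse u \<in> LG" if "u \<in> LG" for u by (rule LG_inverse[OF that])
  show "- u \<in> LG" if "u \<in> LG" for u
   using m[OF LG_const[of "-1"] that] ddD(4,5) by simp
  show "u + v \<in> LG" if "u \<in> LG" "v \<in> LG" for u v
  proof (cases "v = 0")
   case False
   then have "u + v = v * (u * inverse v + 1)" by (simp add: field_simps)
   then show ?thesis using LG_mult[OF that(2) LG_add_one[OF LG_mult[OF that(1) LG_inverse[OF that(2)]]]] by simp
  qed (use that in simp)
 qed
 note SD = sringD[OF sfield_sring[OF S]]
 have q: "b ^ \<q> \<in> LG" for b using LG_const deriv_q[OF dd(1)] by blast
 have x: "xx \<in> LG" unfolding LG_def using dd(2) xx_nz ddD(3) by (auto intro!: exI[of _ 0])
 have "ss = inverse xx ^ \<m> - ss ^ \<q>" using ss_eq by (metis add_diff_cancel_left')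
 then have s: "ss \<in> LG" using SD(6)[OF sring_power[OF sfield_sring[OF S] sfield_inverse[OF S x]] q] by metis
 have "zz = xx ^ \<m> - zz ^ \<q>" using zz_eq by (metis add_diff_cancel_left')
 then have z: "zz \<in> LG" using SD(6)[OF sring_power[OF sfield_sring[OF S] x] q] by metis
 have "kf \<union> {xx, ss, zz} \<subseteq> LG" using x s z LG_const deriv_kf[OF dd(1)] by auto
 from fgen_least[OF S this] show ?thesis unfolding generates by blast
qed

lemma log_BB: assumes "w \<noteq> 0" shows "dd w / w - (dd w / w) ^ (\<p> ^ j) \<in> BB j"
proof (induction j)
 case (Suc j)
 obtain g where g: "dd w / w - (dd w / w) ^ \<p> = dd g" using LG_UNIV[of w] assms by (auto simp: LG_def)
 let ?f = "dd w / w"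
 have "?f - ?f ^ (\<p> ^ Suc j) = (?f - ?f ^ \<p>) + (?f - ?f ^ (\<p> ^ j)) ^ \<p>"
  by (simp only: pow_p_Suc frobp_diff add_diff_eq diff_add_cancel)
 then show ?case using BB_SucI[OF Suc, of g] unfolding g by simp
qed simp

text \<open>car f g: the h-th iterate of the Cartier operator sends f dx/x to g dx/x.\<close>

definition car :: "'a => 'a => bool" where "car f g \<longleftrightarrow> f - g ^ \<q> \<in> BB (hh TYPE('a))"

text \<open>A difference of two candidates would be a q-th power in BB h.\<close>

lemma car_unique: assumes "car f g" "car f g'" shows "g = g'"
proof -
 have "(f - g' ^ \<q>) - (f - g ^ \<q>) \<in> BB (hh TYPE('a))" using assms BB_diff unfolding car_def by blast
 moreover have "(f - g' ^ \<q>) - (f - g ^ \<q>) = (g - g') ^ \<q>" unfolding frob_diff by (simp add: algebra_simps)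
 ultimately have "g - g' = 0" using BB_power by metis
 then show ?thesis by simp
qed

lemma car_add: assumes "car f g" "car f' g'" shows "car (f + f') (g + g')"
proof -
 have "(f + f') - (g + g') ^ \<q> = (f - g ^ \<q>) + (f' - g' ^ \<q>)" unfolding frob_add by (simp add: algebra_simps)
 then show ?thesis using BB_add assms unfolding car_def by metis
qed

lemma car_minus: assumes "car f g" shows "car (- f) (- g)"
proof -
 have "- f - (- g) ^ \<q> = - (f - g ^ \<q>)" unfolding frob_minus by simp
 then show ?thesis using BB_minus assms unfolding car_def by metis
qed

lemma car_scale: assumes "car f g" shows "car (c ^ \<q> * f) (c * g)"
proof -
 have "c ^ \<q> * f - (c * g) ^ \<q> = c ^ \<q> * (f - g ^ \<q>)" by (simp add: power_mult_distrib right_diff_distrib)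
 then show ?thesis using BB_scale assms unfolding car_def by metis
qed

lemma car_0: "car 0 0" using BB_zero unfolding car_def zero_q by simp

lemma car_monomial: "\<not> int \<q> dvd n ==> car (zp xx n * g ^ \<q>) 0"
 using BB_monomial[of "hh TYPE('a)" n g] unfolding car_def zero_q diff_0_right .

lemma car_power: "car (zp xx (n * int \<q>) * g ^ \<q>) (zp xx n * g)"
 using BB_zero unfolding car_def zp_mult_nat[OF xx_nz] power_mult_distrib diff_self .

text \<open>The action of an automorphism on f dx/x.\<close>

definition uu :: "('a => 'a) => 'a" where "uu f = dd (f xx) / f xx"

text \<open>Both sides are derivations after transport by f, compared at x.\<close>

lemma aut_dd: assumes f: "aut f" shows "dd (f a) = uu f * f (dd a)"
proof -
 let ?g = "inv_into UNIV f"
 have g: "aut ?g" by (rule aut_inv[OF f])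
 have fg: "f (?g b) = b" for b using autD(1)[OF f] by (simp add: bij_is_surj surj_f_inv_f)
 have "deriv (%a. ?g (dd (f a)))" unfolding deriv_def
  using autD(1)[OF f] by (simp add: autD(4,5)[OF f] autD(4,5)[OF g] ddD(1,2) bij_is_inj inv_f_f)
 from deriv_multiple[OF this, of a] have "f (?g (dd (f a))) = f (?g (dd (f xx)) / xx * dd a)" by simp
 then show ?thesis unfolding fg by (simp add: autD(5,12)[OF f] fg uu_def)
qed

lemma aut_xx_nz: "aut f ==> f xx \<noteq> 0"
 using aut_eq_iff[of f xx 0] autD(6)[of f] xx_nz by simp

lemma uu_nz: assumes f: "aut f" shows "uu f \<noteq> 0"
proof
 assume u: "uu f = 0"
 have "dd (f (inv_into UNIV f xx)) = 0" using aut_dd[OF f] u by simp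
 then show False using autD(1)[OF f] dd(2) xx_nz by (simp add: bij_is_surj surj_f_inv_f)
qed

lemma BB_aut: assumes f: "aut f" shows "b \<in> BB j ==> f b * uu f \<in> BB j"
proof (induction j arbitrary: b)
 case (Suc j)
 then obtain g c where b: "b = dd g + c ^ \<p>" "c \<in> BB j" by auto
 obtain e where e: "uu f - uu f ^ \<p> = dd e" using LG_UNIV[of "f xx"] aut_xx_nz[OF f] by (auto simp: LG_def uu_def)
 have "f b * uu f = uu f * f (dd g) + f c ^ \<p> * (uu f - uu f ^ \<p>) + (f c * uu f) ^ \<p>"
  unfolding b by (simp add: autD(4,10)[OF f] power_mult_distrib algebra_simps)
 also have "... = dd (f g + f c ^ \<p> * e) + (f c * uu f) ^ \<p>"
  unfolding e aut_dd[OF f, symmetric] by (simp add: ddD(1) dd_p)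
 finally show ?case using BB_SucI[OF Suc.IH[OF b(2)]] by metis
qed (simp add: autD(6)[OF f])

text \<open>The logarithmic form uu f is its own image by log_BB.\<close>

lemma car_aut: assumes f: "aut f" and c: "car a b" shows "car (f a * uu f) (f b * uu f)"
proof -
 have "f (a - b ^ \<q>) * uu f \<in> BB (hh TYPE('a))" using BB_aut[OF f] c by (simp add: car_def)
 moreover have "f b ^ \<q> * (uu f - uu f ^ \<q>) \<in> BB (hh TYPE('a))"
  using BB_scale log_BB[OF aut_xx_nz[OF f]] unfolding uu_def by blast
 moreover have "f a * uu f - (f b * uu f) ^ \<q> = f (a - b ^ \<q>) * uu f + f b ^ \<q> * (uu f - uu f ^ \<q>)"
  by (simp add: autD(9,10)[OF f] power_mult_distrib algebra_simps)
 ultimately show ?thesis using BB_add unfolding car_def by metis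
qed

text \<open>Regular differentials, tested against derivations of valuation rings.\<close>

definition Hol :: "'a set" where
 "Hol = {f. \<forall>V a. valring V --> (\<forall>b\<in>V. a * dd b \<in> mx V) --> a * f \<in> mx V}"

lemma HolD: "f \<in> Hol ==> valring V ==> (\<And>b. b \<in> V ==> a * dd b \<in> mx V) ==> a * f \<in> mx V"
 by (auto simp: Hol_def)

lemma Hol_zero: "0 \<in> Hol" using mx_0 by (auto simp: Hol_def)

lemma Hol_add: "f \<in> Hol ==> g \<in> Hol ==> f + g \<in> Hol"
 unfolding Hol_def using mx_add by (simp add: distrib_left)

lemma Hol_minus: "f \<in> Hol ==> - f \<in> Hol"
 unfolding Hol_def using mx_minus by simp

lemma aut_valring:
 assumes f: "aut f" and V: "valring V" shows "valring {a. f a \<in> V}" "mx {a. f a \<in> V} = {a. f a \<in> mx V}"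
proof -
 show "valring {a. f a \<in> V}" unfolding valring_def
 proof (intro conjI sringI allI)
  show "kf \<subseteq> {a. f a \<in> V}" using V_kf[OF V] autD(3)[OF f] by auto
  show "a \<in> {a. f a \<in> V} \<or> inverse a \<in> {a. f a \<in> V}" for a using V_dich[OF V, of "f a"] by (auto simp: autD(11)[OF f])
 qed (auto simp: autD(4-8)[OF f] VD[OF V])
 show "mx {a. f a \<in> V} = {a. f a \<in> mx V}"
  using aut_eq_iff[OF f, of _ 0] by (auto simp: mx_def autD(6,11)[OF f])
qed

lemma Hol_aut: assumes f: "aut f" and g: "g \<in> Hol" shows "f g * uu f \<in> Hol"
 unfolding Hol_def
proof (intro CollectI allI impI)
 fix V a assume V: "valring V" and a: "\<forall>b\<in>V. a * dd b \<in> mx V"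
 define a' where "a' = inv_into UNIV f (a * uu f)"
 have fa: "f a' = a * uu f" unfolding a'_def using autD(1)[OF f] by (simp add: bij_is_surj surj_f_inv_f)
 have "a' * g \<in> mx {b. f b \<in> V}"
 proof (rule HolD[OF g aut_valring(1)[OF f V]])
  fix b assume "b \<in> {b. f b \<in> V}"
  then have "a * dd (f b) \<in> mx V" using a by simp
  then show "a' * dd b \<in> mx {b. f b \<in> V}"
   unfolding aut_valring(2)[OF f V] by (simp add: autD(5)[OF f] fa aut_dd[OF f] mult_ac)
 qed
 then have "f (a' * g) \<in> mx V" unfolding aut_valring(2)[OF f V] by simp
 then show "a * (f g * uu f) \<in> mx V" by (simp add: autD(5)[OF f] fa mult_ac)
qed

text \<open>At a pole of w the inverse of w is integral, and its derivative is w^(q-2) up to a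
 unit.\<close>

lemma pole_Hol:
 assumes V: "valring V" and w: "w \<notin> V" and a: "\<And>b. b \<in> V ==> a * dd b \<in> mx V"
  and e: "e \<in> kf" "e \<noteq> 0" "dd w = e * (w ^ \<q> + w)" and i: "i + 2 \<le> \<q>"
 shows "a * w ^ i \<in> mx V"
proof -
 have w0: "w \<noteq> 0" using w VD(1)[OF V] by blast
 have iw: "inverse w \<in> V" by (rule V_dich[OF V w])
 obtain r where r: "\<q> = Suc (Suc r)" by (rule q_Suc)
 have veq: "veq V (w ^ \<q> + w) (w ^ \<q>)" by (rule AS_value[OF V w])
 define g where "g = (w ^ \<q> + w) / w ^ \<q>"
 have g: "g \<in> V" "inverse g \<in> V" "g \<noteq> 0" using veq by (auto simp: g_def veq_def)
 have "w ^ \<q> * inverse w ^ 2 = w ^ r" unfolding r power2_eq_square power_Suc using w0 by (simp add: field_simps)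
 then have "(w ^ \<q> + w) * inverse w ^ 2 = g * w ^ r" using w0 unfolding g_def by (simp add: field_simps)
 then have "dd (inverse w) = - (e * (g * w ^ r))" unfolding deriv_inverse[OF dd(1)] e(3) by (simp add: mult.assoc)
 then have "a * - (e * (g * w ^ r)) \<in> mx V" using a[OF iw] by simp
 moreover have "- inverse (e * g) \<in> V"
  using VD(4,5)[OF V] V_kf[OF V sfield_inverse[OF kf e(1)]] g(2) by simp
 ultimately have "a * - (e * (g * w ^ r)) * - inverse (e * g) \<in> mx V" by (rule mx_mult[OF V])
 moreover have "a * - (e * (g * w ^ r)) * - inverse (e * g) = a * w ^ r" using e(2) g(3) by (simp add: field_simps)
 ultimately have ar: "a * w ^ r \<in> mx V" by simp
 have "i \<le> r" using i r by simp
 then have "w ^ r * inverse w ^ (r - i) = w ^ i"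
  using w0 by (simp add: power_inverse power_diff field_simps)
 then have "a * w ^ i = (a * w ^ r) * inverse w ^ (r - i)" by (simp add: mult.assoc)
 then show ?thesis using mx_mult[OF V ar sring_power[OF V_ring[OF V] iw]] by simp
qed

text \<open>At x = \<infinity> only z has a pole, at x = 0 only s, and elsewhere dd x is a
 unit.\<close>

lemma monomial_Hol:
 assumes ij: "i + 2 \<le> \<q>" "j + 2 \<le> \<q>" shows "ss ^ i * zz ^ j \<in> Hol"
 unfolding Hol_def
proof (intro CollectI allI impI)
 fix V a assume V: "valring V" and "\<forall>b\<in>V. a * dd b \<in> mx V"
 then have a: "a * dd b \<in> mx V" if "b \<in> V" for b using that by blast
 have VP: "b ^ n \<in> V" if "b \<in> V" for b n using sring_power[OF V_ring[OF V] that] .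
 have mk: "of_nat \<m> \<in> kf" "- of_nat \<m> \<in> kf" using sring_of_nat[OF kf_ring] kfD(4) by auto
 have zs: "dd zz = of_nat \<m> * (zz ^ \<q> + zz)" "dd ss = - of_nat \<m> * (ss ^ \<q> + ss)"
  unfolding dd_zz dd_ss zz_eq ss_eq by simp_all
 have s_in: "ss \<in> V" if "tt \<in> V" using AS_in[OF V, of ss] VP[OF that, of \<m>] by (simp add: ss_eq)
 have z_in: "zz \<in> V" if "xx \<in> V" using AS_in[OF V, of zz] VP[OF that, of \<m>] by (simp add: zz_eq)
 consider "xx \<in> V" "tt \<in> V" | "xx \<notin> V" "tt \<in> V" | "xx \<in> V" "tt \<notin> V" using V_dich[OF V] by blast
 then show "a * (ss ^ i * zz ^ j) \<in> mx V"
 proof cases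
  case 1
  have "a * xx \<in> mx V" using a[OF 1(1)] dd(2) by simp
  then have "a * xx * tt \<in> mx V" using mx_mult[OF V _ 1(2)] by blast
  then have "a \<in> mx V" using xx_nz by (simp add: mult.assoc)
  then show ?thesis using mx_mult[OF V _ VD(5)[OF V VP[OF s_in[OF 1(2)]] VP[OF z_in[OF 1(1)]]]] by blast
 next
  case 2
  have "tt \<in> mx V" using notin_mx[OF V 2(1)] .
  then have "a * zz ^ j \<in> mx V"
   using pole_Hol[OF V zz_notin[OF V] a mk(1) m_nz zs(1) ij(2)] by blast
  then have "a * zz ^ j * ss ^ i \<in> mx V" using mx_mult[OF V _ VP[OF s_in[OF 2(2)]]] by blast
  then show ?thesis by (simp add: mult_ac)
 next
  case 3
  have "xx \<in> mx V" using notin_mx[OF V 3(2)] by simp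
  then have "ss \<notin> V" using cfield.zz_notin[OF swap V] by simp
  then have "a * ss ^ i \<in> mx V"
   using pole_Hol[OF V _ a mk(2) _ zs(2) ij(1)] m_nz by simp
  then have "a * ss ^ i * zz ^ j \<in> mx V" using mx_mult[OF V _ VP[OF z_in[OF 3(1)]]] by blast
  then show ?thesis by (simp add: mult_ac)
 qed
qed

end

section \<open>Regular differentials as Laurent polynomials\<close>

lemma nat_mult_dvd_cancel_left: "0 < (k::nat) ==> k * a dvd k * b ==> a dvd b"
 by simp

context Fields.field begin

inductive_set zspan :: "'a set => 'a set" for S where
 zero: "0 \<in> zspan S"
| plus: "g \<in> S ==> a \<in> zspan S ==> g + a \<in> zspan S"
| minus: "g \<in> S ==> a \<in> zspan S ==> a - g \<in> zspan S"

lemma zspan_base: "g \<in> S ==> g \<in> zspan S"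
 using zspan.plus[OF _ zspan.zero] by force

lemma zspan_add: "a \<in> zspan S ==> b \<in> zspan S ==> a + b \<in> zspan S"
proof (induction rule: zspan.induct)
 case (plus g a) then show ?case using zspan.plus[of g S "a + b"] by (simp add: add.assoc)
next
 case (minus g a)
 have "a - g + b = (a + b) - g" by (simp add: algebra_simps)
 then show ?case using zspan.minus[OF minus(1) minus(3)[OF minus.prems]] by metis
qed simp

lemma zspan_uminus: "a \<in> zspan S ==> - a \<in> zspan S"
proof (induction rule: zspan.induct)
 case (plus g a)
 have "- (g + a) = - a - g" by (simp only: minus_add diff_conv_add_uminus)
 then show ?case using zspan.minus[OF plus(1,3)] by metis
next
 case (minus g a)
 have "- (a - g) = g + (- a)" by simp
 then show ?case using zspan.plus[OF minus(1,3)] by metis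
qed (simp add: zspan.zero)

lemma zspan_diff: "a \<in> zspan S ==> b \<in> zspan S ==> a - b \<in> zspan S"
 using zspan_add[of a S "- b"] zspan_uminus[of b S] by simp

lemma zspan_least:
 assumes "0 \<in> A" "\<And>a b. a \<in> A ==> b \<in> A ==> a + b \<in> A" "\<And>a. a \<in> A ==> - a \<in> A" "S \<subseteq> A"
 shows "zspan S \<subseteq> A"
proof
 fix a assume "a \<in> zspan S"
 then show "a \<in> A"
 proof (induction rule: zspan.induct)
  case (minus g a)
  then have "a + - g \<in> A" using assms by blast
  then show ?case by simp
 qed (use assms in auto)
qed

lemma zspan_mono: "S \<subseteq> zspan S' ==> zspan S \<subseteq> zspan S'"
 by (rule zspan_least) (auto intro: zspan.zero zspan_add zspan_uminus)

lemma zspan_mult: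
 assumes a: "a \<in> zspan S" and h: "\<And>g. g \<in> S ==> h * g \<in> zspan S'" shows "h * a \<in> zspan S'"
 using a
proof (induction rule: zspan.induct)
 case (plus g a) then show ?case using zspan_add[OF h[OF plus(1)]] by (simp add: distrib_left)
next
 case (minus g a) then show ?case using zspan_diff[OF _ h[OF minus(1)], of "h * a"] by (simp add: right_diff_distrib)
qed (simp add: zspan.zero)

lemma zspan_finite:
 assumes p: "of_nat p = (0::'a)" "0 < p" and S: "finite S" shows "finite (zspan S)"
 using S
proof (induction S rule: finite_induct)
 case empty
 have "zspan {} \<subseteq> {0}" by (rule zspan_least) auto
 then show ?case using finite_subset by blast
next
 case (insert g S)
 let ?A = "(%(n, a). of_nat n * g + a) ` ({..<p} \<times> zspan S)"
 have red: "of_nat n * g + a \<in> ?A" if "a \<in> zspan S" for n a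
 proof -
  have "(of_nat n :: 'a) = of_nat (p * (n div p) + n mod p)" by simp
  also have "... = of_nat (n mod p)" by (simp only: of_nat_add of_nat_mult p(1)) simp
  finally show ?thesis using that p(2) by (intro image_eqI[of _ _ "(n mod p, a)"]) auto
 qed
 have "zspan (insert g S) \<subseteq> ?A"
 proof (rule zspan_least)
  show "0 \<in> ?A" using red[OF zspan.zero, of 0] by simp
  show "insert g S \<subseteq> ?A"
  proof
   fix b assume "b \<in> insert g S"
   then consider "b = g" | "b \<in> S" by blast
   then show "b \<in> ?A"
   proof cases
    case 1 then show ?thesis using red[OF zspan.zero, of 1] by simp
   next
    case 2 then show ?thesis using red[OF zspan_base[OF 2], of 0] by simp
   qed
  qed
  fix a b assume "a \<in> ?A" "b \<in> ?A"
  then obtain i j u v where *: "a = of_nat i * g + u" "u \<in> zspan S" "b = of_nat j * g + v" "v \<in> zspan S" by auto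
  have "a + b = of_nat (i + j) * g + (u + v)" unfolding * by (simp add: algebra_simps)
  then show "a + b \<in> ?A" using red[OF zspan_add[OF *(2,4)]] by metis
 next
  fix a assume "a \<in> ?A"
  then obtain i u where *: "a = of_nat i * g + u" "u \<in> zspan S" "i < p" by auto
  have "of_nat (p - i) = - (of_nat i :: 'a)" using *(3) p(1) by (simp add: of_nat_diff)
  then have "- a = of_nat (p - i) * g + (- u)" unfolding * by simp
  then show "- a \<in> ?A" using red[OF zspan_uminus[OF *(2)]] by metis
 qed
 moreover have "finite ?A" using insert.IH by simp
 ultimately show ?case using finite_subset by blast
qed

end

context ffield begin

definition kspan :: "'a set => 'a set" where "kspan S = zspan {c * g |c g. c \<in> kf \<and> g \<in> S}"

lemma kspan_ops:
 "0 \<in> kspan S" "a \<in> kspan S ==> b \<in> kspan S ==> a + b \<in> kspan S" "a \<in> kspan S ==> - a \<in> kspan S"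
 "c \<in> kf ==> g \<in> S ==> c * g \<in> kspan S"
 by (auto simp: kspan_def intro: zspan.zero zspan_add zspan_uminus zspan_base)

lemma kspan_base: "g \<in> S ==> g \<in> kspan S" using kspan_ops(4)[OF kfD(2), of g S] by simp

lemma kspan_least:
 assumes "0 \<in> A" "\<And>a b. a \<in> A ==> b \<in> A ==> a + b \<in> A" "\<And>c a. c \<in> kf ==> a \<in> A ==> c * a \<in> A" "S \<subseteq> A"
 shows "kspan S \<subseteq> A"
 unfolding kspan_def
proof (rule zspan_least)
 show "- a \<in> A" if "a \<in> A" for a using assms(3)[OF kfD(4)[OF kfD(2)] that] by simp
qed (use assms in auto)

lemma kspan_mult:
 assumes a: "a \<in> kspan S" and h: "\<And>g. g \<in> S ==> h * g \<in> kspan S'" shows "h * a \<in> kspan S'"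
proof -
 have sc: "c * b \<in> kspan S'" if "c \<in> kf" "b \<in> kspan S'" for c b
  using that(2) unfolding kspan_def
 proof (rule zspan_mult)
  fix g assume "g \<in> {c * g |c g. c \<in> kf \<and> g \<in> S'}"
  then obtain d g' where g: "g = d * g'" "d \<in> kf" "g' \<in> S'" by blast
  have "c * g = (c * d) * g'" "c * d \<in> kf" using g kfD(5)[OF that(1) g(2)] by (simp_all add: mult.assoc)
  then show "c * g \<in> zspan {c * g |c g. c \<in> kf \<and> g \<in> S'}" using g(3) by (intro zspan_base) blast
 qed
 show ?thesis using a unfolding kspan_def[of S]
 proof (rule zspan_mult[of _ _ h "{c * g |c g. c \<in> kf \<and> g \<in> S'}", folded kspan_def])
  fix g assume "g \<in> {c * g |c g. c \<in> kf \<and> g \<in> S}"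
  then obtain d g' where g: "g = d * g'" "d \<in> kf" "g' \<in> S" by blast
  have "h * g = d * (h * g')" using g(1) by (simp add: mult_ac)
  then show "h * g \<in> kspan S'" using sc[OF g(2) h[OF g(3)]] by simp
 qed
qed

lemma kspan_scale: "c \<in> kf ==> a \<in> kspan S ==> c * a \<in> kspan S"
 using kspan_mult[of a S c S] kspan_ops(4) by blast

end

context cfield begin

text \<open>The coordinate ring of the part of the curve away from x = 0 and x =
 \<infinity>.\<close>

definition RR :: "'a set" where "RR = rgen (kf \<union> {xx, tt, ss, zz})"

lemma RR_ring: "sring RR" by (simp add: RR_def sring_rgen)
lemma RR_mem: "c \<in> kf ==> c \<in> RR" "xx \<in> RR" "tt \<in> RR" "ss \<in> RR" "zz \<in> RR"
 using rgen_incl[of "kf \<union> {xx, tt, ss, zz}"] by (auto simp: RR_def)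

lemma dd_RR: "a \<in> RR ==> dd a \<in> RR"
proof -
 note D = sringD[OF RR_ring]
 have tm: "tt ^ n \<in> RR" "xx ^ n \<in> RR" for n using sring_power[OF RR_ring] RR_mem by auto
 have mR: "of_nat \<m> \<in> RR" by (rule sring_of_nat[OF RR_ring])
 have "sring {a \<in> RR. dd a \<in> RR}" by (rule sringI) (auto simp: ddD intro: D)
 moreover have "dd tt = - (xx * tt ^ 2)" using deriv_inverse[OF dd(1), of xx] dd(2) by simp
 then have "kf \<union> {xx, tt, ss, zz} \<subseteq> {a \<in> RR. dd a \<in> RR}"
  using RR_mem tm D mR deriv_kf[OF dd(1)] by (auto simp: dd(2) dd_ss dd_zz)
 ultimately have "RR \<subseteq> {a \<in> RR. dd a \<in> RR}" unfolding RR_def[symmetric] using rgen_least RR_def by metis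
 then show "a \<in> RR ==> dd a \<in> RR" by blast
qed

context
 fixes V c assumes V: "valring V" and c: "c \<in> kf" "c \<noteq> 0" and xc: "xx - c \<in> mx V"
begin

lemma point_RR: "RR \<subseteq> V"
proof -
 have x: "xx \<in> V" using VD(3)[OF V mx_in[OF V xc] V_kf[OF V c(1)]] by simp
 have "xx \<notin> mx V"
 proof
  assume "xx \<in> mx V"
  then have "xx - (xx - c) \<in> mx V" using mx_diff[OF V _ xc] by blast
  moreover have "xx - (xx - c) = c" by (simp add: algebra_simps)
  ultimately show False using kf_mx[OF V c(1)] c(2) by simp
 qed
 then have t: "tt \<in> V" using unitD(2)[OF V x] by blast
 have s: "ss \<in> V" using AS_in[OF V, of ss] sring_power[OF V_ring[OF V] t] by (simp add: ss_eq)
 have z: "zz \<in> V" using AS_in[OF V, of zz] sring_power[OF V_ring[OF V] x] by (simp add: zz_eq)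
 show ?thesis unfolding RR_def using x t s z V_kf[OF V] by (intro rgen_least V_ring[OF V]) auto
qed

text \<open>The affine part x \<noteq> 0 of the curve is smooth with local parameter x - c.\<close>

lemma point_loc: "V = loc RR V"
proof -
 have kR: "kf \<subseteq> RR" using RR_mem by blast
 note R = RR_ring point_RR kR
 note LI = loc_incl[OF V R] and LD = sringD[OF loc_ring[OF V R]]
 define t where "t = xx - c"
 have tR: "t \<in> RR" using sringD(6)[OF RR_ring RR_mem(2) RR_mem(1)[OF c(1)]] by (simp add: t_def)
 have tm: "t \<in> mx V" using xc by (simp add: t_def)
 have tnz: "t \<noteq> 0" using trans_notin[OF trans_xx] c(1) by (auto simp: t_def)
 let ?S = "{a \<in> loc RR V. \<exists>c\<in>kf. \<exists>b\<in>loc RR V. a - c = t * b}"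
 note SR = residue_ring[OF V R, of t]
 have "RR \<subseteq> ?S"
 proof -
  have 1: "e \<in> ?S" if "e \<in> kf" for e using that LD(1) LI R(3) by (intro CollectI conjI bexI[of _ e] bexI[of _ 0]) auto
  have 2: "xx \<in> ?S" using LI RR_mem(2) c(1) LD(2) by (intro CollectI conjI bexI[of _ c] bexI[of _ 1]) (auto simp: t_def)
  have ic: "inverse c \<in> kf" by (rule sfield_inverse[OF kf c(1)])
  have 3: "tt \<in> ?S"
  proof (intro CollectI conjI bexI)
   show "tt - inverse c = t * (- (tt * inverse c))" unfolding t_def using xx_nz c(2) by (simp add: field_simps)
   have "tt * inverse c \<in> RR" by (rule sringD(5)[OF RR_ring RR_mem(3) RR_mem(1)[OF ic]])
   then show "- (tt * inverse c) \<in> loc RR V" using LI sringD(4)[OF RR_ring] by blast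
  qed (use ic LI RR_mem in auto)
  have AS: "w \<in> ?S" if w: "w \<in> RR" "w ^ \<q> + w \<in> ?S" for w
  proof -
   obtain e b where "e \<in> kf" "b \<in> loc RR V" "w ^ \<q> + w - e = t * b" using w(2) by blast
   from AS_residue[OF V R tm w(1) this] show ?thesis using w(1) LI by blast
  qed
  have 4: "ss \<in> ?S" using AS[OF RR_mem(4)] sring_power[OF SR 3] by (simp add: ss_eq)
  have 5: "zz \<in> ?S" using AS[OF RR_mem(5)] sring_power[OF SR 2] by (simp add: zz_eq)
  have "kf \<union> {xx, tt, ss, zz} \<subseteq> ?S" using 1 2 3 4 5 by blast
  from rgen_least[OF SR this] show ?thesis by (simp add: RR_def)
 qed
 then have res: "\<exists>c\<in>kf. \<exists>b\<in>loc RR V. a - c = t * b" if "a \<in> RR" for a using that by blast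
 let ?K = "fgen (insert t kf)"
 note K = sfield_fgen[of "insert t kf"]
 note KR = sfield_sring[OF K]
 have al: "alg ?K a" if a: "a \<in> RR" for a
 proof -
  have tK: "t \<in> ?K" "c \<in> ?K" "kf \<subseteq> ?K" using fgen_incl[of "insert t kf"] c(1) by auto
  then have xK: "xx \<in> ?K" using sringD(3)[OF KR tK(1,2)] by (simp add: t_def)
  then have tK': "tt \<in> ?K" by (rule sfield_inverse[OF K])
  have "alg ?K ss" "alg ?K zz"
   using AS_alg[OF K] sring_power[OF KR xK] sring_power[OF KR tK'] by (simp_all add: ss_eq zz_eq)
  then have "kf \<union> {xx, tt, ss, zz} \<subseteq> {a. alg ?K a}" using alg_self[OF K] xK tK' tK(3) by auto
  from rgen_least[OF sfield_sring[OF alg_sfield[OF K]] this] show ?thesis using a by (auto simp: RR_def)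
 qed
 have SP: "\<exists>n. \<exists>u\<in>loc RR V. u \<notin> mx V \<and> a = t ^ n * u" if "a \<in> loc RR V" "a \<noteq> 0" for a
  by (rule smooth_point[OF V R tR tm tnz]) (use res al that in auto)
 have "V \<subseteq> loc RR V"
 proof
  fix b assume b: "b \<in> V"
  show "b \<in> loc RR V"
  proof (cases "b = 0")
   case False
   have "UNIV \<subseteq> fgen (kf \<union> {xx, tt, ss, zz})"
    using fgen_least[OF sfield_fgen, of "kf \<union> {xx, ss, zz}" "kf \<union> {xx, tt, ss, zz}"]
     fgen_incl[of "kf \<union> {xx, tt, ss, zz}"] generates by auto
   then have "b \<in> fgen (kf \<union> {xx, tt, ss, zz})" by blast
   then obtain u v where uv: "u \<in> RR" "v \<in> RR" "b = u / v" unfolding fgen_fraction RR_def by blast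
   have nz: "u \<noteq> 0" "v \<noteq> 0" using False uv(3) by auto
   obtain i u' where u': "u' \<in> loc RR V" "u' \<notin> mx V" "u = t ^ i * u'"
    using SP[OF subsetD[OF LI uv(1)] nz(1)] by blast
   obtain j v' where v': "v' \<in> loc RR V" "v' \<notin> mx V" "v = t ^ j * v'"
    using SP[OF subsetD[OF LI uv(2)] nz(2)] by blast
   have iv: "inverse v' \<in> loc RR V" "inverse u' \<in> loc RR V" using loc_unit[OF V R] u' v' by auto
   have nz': "u' \<noteq> 0" "v' \<noteq> 0" using u'(2) v'(2) mx_0[OF V] by auto
   show ?thesis
   proof (cases "j \<le> i")
    case True
    then have "b = t ^ (i - j) * (u' * inverse v')"
     unfolding uv(3) u'(3) v'(3) using tnz nz' by (simp add: power_diff field_simps)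
    then show ?thesis using LD(5)[OF subsetD[OF LI sring_power[OF RR_ring tR]] LD(5)[OF u'(1) iv(1)]] by simp
   next
    case False
    then have "inverse b = t ^ (j - i) * (v' * inverse u')"
     unfolding uv(3) u'(3) v'(3) using tnz nz' by (simp add: power_diff field_simps)
    moreover have "t ^ (j - i) \<in> mx V" using False power_mx[OF V tm] by simp
    moreover have "v' * inverse u' \<in> V" using LD(5)[OF v'(1) iv(2)] loc_V[OF V R] by blast
    ultimately have "inverse b \<in> mx V" using mx_mult[OF V] by metis
    then show ?thesis using b \<open>b \<noteq> 0\<close> by (simp add: mx_def)
   qed
  qed (simp add: LD(1))
 qed
 then show ?thesis using loc_V[OF V R] by blast
qed

lemma point_dd: assumes b: "b \<in> V" shows "dd b \<in> V"
proof -
 have kR: "kf \<subseteq> RR" using RR_mem by blast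
 note R = RR_ring point_RR kR
 obtain u v where uv: "b = u / v" "u \<in> RR" "v \<in> RR" "v \<notin> mx V" using subsetD[OF equalityD1[OF point_loc] b] by (auto simp: loc_def)
 have v: "inverse v \<in> V" using unitD(2)[OF V] uv R(2) by blast
 have "dd b = u * - (dd v * inverse v ^ 2) + dd u * inverse v"
  unfolding uv(1) divide_inverse ddD(2) deriv_inverse[OF dd(1)] ..
 moreover have "dd u \<in> V" "dd v \<in> V" "u \<in> V" using uv dd_RR R(2) by blast+
 ultimately show ?thesis using v sring_power[OF V_ring[OF V] v] VD[OF V] by simp
qed

lemma point_Hol: assumes f: "f \<in> Hol" shows "f \<in> V"
proof (rule ccontr)
 assume n: "f \<notin> V"
 have "inverse f * f \<in> mx V"
  by (rule HolD[OF f V]) (rule mx_mult[OF V notin_mx[OF V n] point_dd])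
 moreover have "f \<noteq> 0" using n VD(1)[OF V] by blast
 ultimately show False using one_notin_mx[OF V] by simp
qed

end

definition Reg :: "'a set" where
 "Reg = {f. \<forall>V c. valring V --> c \<in> kf --> c \<noteq> 0 --> xx - c \<in> mx V --> f \<in> V}"

lemma Hol_Reg: "Hol \<subseteq> Reg" using point_Hol by (auto simp: Reg_def)

lemma RR_Reg: "RR \<subseteq> Reg" using point_RR by (auto simp: Reg_def)

lemma Reg_ring: "sring Reg"
 by (rule sringI) (auto simp: Reg_def VD)

lemma Reg_aut: assumes f: "aut f" "f xx = xx" and a: "a \<in> Reg" shows "f a \<in> Reg"
 unfolding Reg_def
proof (intro CollectI allI impI)
 fix V c assume V: "valring V" "c \<in> kf" "c \<noteq> 0" "xx - c \<in> mx V"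
 have "f (xx - c) = xx - c" using f(2) autD(3)[OF f(1) V(2)] autD(9)[OF f(1)] by simp
 then have "xx - c \<in> mx {b. f b \<in> V}" unfolding aut_valring(2)[OF f(1) V(1)] using V(4) by simp
 then have "a \<in> {b. f b \<in> V}" using a aut_valring(1)[OF f(1) V(1)] V(2,3) unfolding Reg_def by blast
 then show "f a \<in> V" by simp
qed

lemma Om_power_sum: assumes "Suc i < \<q>" shows "(\<Sum>b\<in>Om. b ^ i) = 0"
proof (cases "i = 0")
 case True
 have "of_nat \<q> = (0::'a)" using char_chp hh_pos by simp
 then show ?thesis using True card_Om(1) by simp
next
 case False
 obtain r where r: "r \<in> mu" "\<And>i. r ^ i = 1 \<longleftrightarrow> \<n> dvd i" using mu_root by metis
 define c where "c = r ^ \<m>"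
 have c: "c \<in> kf" "c ^ \<q> = c" "c \<noteq> 0" using mu_m_kf(1)[OF r(1)] mu_q[OF r(1)] mu_nz[OF r(1)] by (auto simp: c_def)
 have ci: "c ^ i \<noteq> 1"
 proof
  assume "c ^ i = 1"
  then have "r ^ (\<m> * i) = 1" by (simp only: c_def power_mult)
  then have "\<n> dvd \<m> * i" using r(2) by blast
  then have "(\<q> - Suc 0) dvd i" using nat_mult_dvd_cancel_left[of "\<m>"] mm_pos by simp
  then show False using assms False nat_dvd_not_less[of i "\<q> - Suc 0"] by linarith
 qed
 have "(%b. c * b) ` Om = Om"
 proof (rule endo_inj_surj[OF card_Om(2)])
  show "(%b. c * b) ` Om \<subseteq> Om" using Om_scale[OF c(1,2)] by blast
  show "inj_on (%b. c * b) Om" using c(3) by (auto simp: inj_on_def)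
 qed
 moreover have "inj_on (%b. c * b) Om" using c(3) by (auto simp: inj_on_def)
 ultimately have "(\<Sum>b\<in>Om. b ^ i) = (\<Sum>b\<in>Om. (c * b) ^ i)" by (metis (no_types, lifting) sum.reindex_cong)
 also have "... = c ^ i * (\<Sum>b\<in>Om. b ^ i)" by (simp add: power_mult_distrib sum_distrib_left)
 finally have "(c ^ i - 1) * (\<Sum>b\<in>Om. b ^ i) = 0" by (simp add: left_diff_distrib)
 then show ?thesis using ci by simp
qed

lemma Om_power_sum_top: assumes "Suc i = \<q>" shows "(\<Sum>b\<in>Om. b ^ i) = 1"
proof -
 have ipos: "0 < i" using assms q_ge3 by linarith
 have "b ^ i = - 1" if "b \<in> Om" "b \<noteq> 0" for b
 proof -
  have "b * b ^ i = b * - 1" using OmD(2)[OF that(1)] by (simp flip: assms)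
  then show ?thesis using that(2) by (metis mult_left_cancel)
 qed
 then have "(\<Sum>b\<in>Om. b ^ i) = (\<Sum>b\<in>Om - {0}. - 1)"
  using sum.remove[OF card_Om(2) Om_0, of "%b. b ^ i"] ipos by (simp add: power_0_left)
 also have "... = - of_nat i" using card_Om Om_0 by (simp flip: assms)
 also have "... = 1"
 proof -
  have "of_nat (Suc i) = (0::'a)" using char_chp hh_pos unfolding assms by simp
  then show ?thesis by (simp add: neg_eq_iff_add_eq_0 add.commute)
 qed
 finally show ?thesis .
qed

text \<open>Power sums over the roots of t^q + t vanish below the exponent q - 1.\<close>

lemma translate_sum:
 "Suc j < \<q> ==> (\<Sum>b\<in>Om. (w + b) ^ j) = 0" "Suc j = \<q> ==> (\<Sum>b\<in>Om. (w + b) ^ j) = 1"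
proof -
 have ex: "(\<Sum>b\<in>Om. (w + b) ^ j) = (\<Sum>k\<le>j. of_nat (j choose k) * w ^ k * (\<Sum>b\<in>Om. b ^ (j - k)))" for j
  by (simp only: binomial_ring sum_distrib_left) (rule sum.swap)
 show "(\<Sum>b\<in>Om. (w + b) ^ j) = 0" if "Suc j < \<q>"
 proof -
  have z: "(\<Sum>b\<in>Om. b ^ (j - k)) = 0" for k by (rule Om_power_sum) (use that in linarith)
  show ?thesis unfolding ex z by simp
 qed
 show "(\<Sum>b\<in>Om. (w + b) ^ j) = 1" if j: "Suc j = \<q>"
 proof -
  have z: "(\<Sum>b\<in>Om. b ^ (j - k)) = 0" if "0 < k" for k by (rule Om_power_sum) (use j that q_ge3 in linarith)
  have "{..j} = insert 0 {1..j}" by auto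
  then show ?thesis unfolding ex using z Om_power_sum_top[OF j] by simp
 qed
qed

definition tz :: "'a => 'a => 'a" where "tz b = (SOME f. aut f \<and> typ1 f 1 0 b)"

lemma tz: assumes "b \<in> Om" shows "aut (tz b)" "tz b xx = xx" "tz b ss = ss" "tz b zz = zz + b"
proof -
 have "\<exists>f. aut f \<and> typ1 f 1 0 b" using typ1_exists[OF mu_1 Om_0 assms] by blast
 then have "aut (tz b) \<and> typ1 (tz b) 1 0 b" unfolding tz_def by (rule someI_ex)
 then show "aut (tz b)" "tz b xx = xx" "tz b ss = ss" "tz b zz = zz + b" by (auto simp: typ1_def)
qed

lemma tz_E1: "b \<in> Om ==> e \<in> E1 ==> tz b e = e"
proof (rule aut_fix_gen[OF tz(1)])
 fix a assume "b \<in> Om" "a \<in> kf \<union> {xx, ss}"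
 then show "tz b a = a" using autD(3)[OF tz(1)] tz(2,3) by auto
qed

definition Tz :: "'a => 'a" where "Tz a = (\<Sum>b\<in>Om. tz b a)"

lemma Tz_expansion:
 assumes c: "\<And>j. c j \<in> E1" and n: "n \<le> \<q>"
 shows "Tz (\<Sum>j<n. c j * zz ^ j) = (if n = \<q> then c (\<q> - 1) else 0)"
proof -
 have "Tz (\<Sum>j<n. c j * zz ^ j) = (\<Sum>b\<in>Om. \<Sum>j<n. c j * (zz + b) ^ j)"
  unfolding Tz_def
 proof (rule sum.cong[OF refl])
  fix b assume b: "b \<in> Om"
  show "tz b (\<Sum>j<n. c j * zz ^ j) = (\<Sum>j<n. c j * (zz + b) ^ j)"
   using tz(1,4)[OF b] tz_E1[OF b c] by (simp add: aut_sum autD(5,10))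
 qed
 also have "... = (\<Sum>j<n. c j * (\<Sum>b\<in>Om. (zz + b) ^ j))"
  by (simp only: sum_distrib_left) (rule sum.swap)
 also have "... = (\<Sum>j<n. if Suc j = \<q> then c j else 0)"
 proof (rule sum.cong[OF refl])
  fix j assume "j \<in> {..<n}"
  then have "Suc j < \<q> \<or> Suc j = \<q>" using n by auto
  then show "c j * (\<Sum>b\<in>Om. (zz + b) ^ j) = (if Suc j = \<q> then c j else 0)"
   using translate_sum by auto
 qed
 also have "... = (if n = \<q> then c (\<q> - 1) else 0)"
 proof (cases "n = \<q>")
  case True
  obtain r where r: "\<q> = Suc r" using q_pos gr0_implies_Suc by blast
  show ?thesis using True unfolding r by simp
 next
  case False
  then show ?thesis using n by (auto intro!: sum.neutral)
 qed
 finally show ?thesis .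
qed

text \<open>Multiplying by a suitable power of z moves the top coefficient to degree q - 1, where
 the trace reads it off.\<close>

lemma coefficients_in:
 assumes A: "sring A" "zz \<in> A" "\<And>f a. aut f ==> f xx = xx ==> f ss = ss ==> a \<in> A ==> f a \<in> A"
  and c: "\<And>j. c j \<in> E1"
 shows "n \<le> \<q> ==> (\<Sum>j<n. c j * zz ^ j) \<in> A ==> j < n ==> c j \<in> A"
proof (induction n)
 case (Suc n)
 note AD = sringD[OF A(1)]
 define d where "d j = (if j + Suc n < \<q> then 0 else c (j + Suc n - \<q>))" for j
 have d: "d j \<in> E1" for j using c sringD(1)[OF sfield_sring[OF E1_field]] by (simp add: d_def)
 have "zz ^ (\<q> - Suc n) * (\<Sum>j<Suc n. c j * zz ^ j) = (\<Sum>j<Suc n. c j * zz ^ (j + (\<q> - Suc n)))"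
  by (simp add: sum_distrib_left power_add mult_ac del: sum.lessThan_Suc)
 also have "... = (\<Sum>j\<in>{\<q> - Suc n..<\<q>}. d j * zz ^ j)"
 proof (rule sum.reindex_bij_witness[of _ "%j. j - (\<q> - Suc n)" "%j. j + (\<q> - Suc n)"])
  fix j assume "j \<in> {..<Suc n}"
  have "j + (\<q> - Suc n) + Suc n = j + \<q>" using Suc.prems(1) by linarith
  then show "d (j + (\<q> - Suc n)) * zz ^ (j + (\<q> - Suc n)) = c j * zz ^ (j + (\<q> - Suc n))"
   unfolding d_def by (simp only: not_less le_add2 if_False add_diff_cancel_right' linorder_not_less[symmetric]) simp
 qed (use Suc.prems(1) in auto)
 also have "... = (\<Sum>j<\<q>. d j * zz ^ j)"
  using Suc.prems(1) by (intro sum.mono_neutral_left) (auto simp: d_def)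
 finally have eq: "zz ^ (\<q> - Suc n) * (\<Sum>j<Suc n. c j * zz ^ j) = (\<Sum>j<\<q>. d j * zz ^ j)" .
 have "Tz (\<Sum>j<\<q>. d j * zz ^ j) \<in> A"
  unfolding Tz_def eq[symmetric]
 proof (rule sring_sum[OF A(1)])
  fix b assume b: "b \<in> Om"
  show "tz b (zz ^ (\<q> - Suc n) * (\<Sum>j<Suc n. c j * zz ^ j)) \<in> A"
   by (rule A(3)[OF tz(1-3)[OF b] AD(5)[OF sring_power[OF A(1,2)] Suc.prems(2)]])
 qed
 then have "d (\<q> - 1) \<in> A" using Tz_expansion[OF d, of "\<q>"] by simp
 moreover have "d (\<q> - 1) = c n"
 proof -
  obtain r where r: "\<q> = Suc r" using q_pos gr0_implies_Suc by blast
  show ?thesis unfolding d_def r using Suc.prems(1) by simp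
 qed
 ultimately have cn: "c n \<in> A" by simp
 have "(\<Sum>j<n. c j * zz ^ j) = (\<Sum>j<Suc n. c j * zz ^ j) - c n * zz ^ n" by simp
 then have "(\<Sum>j<n. c j * zz ^ j) \<in> A" using AD(6)[OF Suc.prems(2) AD(5)[OF cn sring_power[OF A(1,2)]]] by metis
 then have "j < n ==> c j \<in> A" by (rule Suc.IH[OF Suc_leD[OF Suc.prems(1)]])
 then show ?case using cn less_SucE[OF Suc.prems(3)] by blast
qed simp

text \<open>A rational function without poles outside 0 and \<infinity> is a Laurent
 polynomial.\<close>

definition RR0 :: "'a set" where "RR0 = rgen (kf \<union> {xx, tt})"

lemma RR0: "sring RR0" "c \<in> kf ==> c \<in> RR0" "xx \<in> RR0" "tt \<in> RR0"
 using rgen_incl[of "kf \<union> {xx, tt}"] by (auto simp: RR0_def sring_rgen)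

text \<open>Zeros of the denominator other than 0 can be cancelled one at a time.\<close>

lemma regular_rational:
 assumes "set as \<subseteq> kf" "set bs \<subseteq> kf" "peval bs xx \<noteq> 0" "f * peval bs xx = peval as xx" "f \<in> Reg"
 shows "f \<in> RR0"
 using assms
proof (induction "length bs" arbitrary: as bs f rule: less_induct)
 case less
 obtain bs' c where bs: "bs = bs' @ [c]" using less.prems(3) by (cases bs rule: rev_cases) auto
 have ck: "c \<in> kf" "set bs' \<subseteq> kf" using less.prems(2) bs by auto
 have asR: "set ds \<subseteq> kf ==> peval ds xx \<in> RR0" for ds using RR0 by (intro peval_in[OF RR0(1)]) auto
 show ?case
 proof (cases "c = 0")
  case True
  then have "peval bs xx = peval bs' xx" unfolding bs by (simp add: peval_append)
  then show ?thesis using less.hyps[of bs' as f] less.prems ck bs by simp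
 next
  case False
  show ?thesis
  proof (cases "bs' = []")
   case True
   then have "f = peval as xx * inverse c" using less.prems(4) False bs by (simp add: field_simps)
   then show ?thesis
    using sringD(5)[OF RR0(1) asR[OF less.prems(1)] RR0(2)[OF sfield_inverse[OF kf ck(1)]]] by simp
  next
   case ne: False
   define ms where "ms = map (%b. b / c) bs'"
   have msk: "set ms \<subseteq> kf" "ms \<noteq> []" using ck sfield_divide[OF kf _ ck(1)] ne by (auto simp: ms_def)
   obtain r where r: "r \<in> kf" "peval (ms @ [1]) r = 0" using root_ex[OF msk(2,1)] by blast
   have "c * peval (map (%b. b / c) ds) t = peval ds t" for ds t
   proof (induction ds)
    case (Cons d ds)
    have "c * peval (map (%b. b / c) (d # ds)) t = d + t * (c * peval (map (%b. b / c) ds) t)"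
     using False by (simp add: distrib_left mult.left_commute)
    then show ?case using Cons by simp
   qed simp
   then have "c * peval (ms @ [1]) r = peval bs r" unfolding ms_def bs by (simp add: peval_append distrib_left ac_simps)
   then have br: "peval bs r = 0" using r(2) by simp
   define cs where "cs = sdiv r bs"
   have cs: "set cs \<subseteq> kf" "length cs < length bs" "peval bs xx = (xx - r) * peval cs xx"
    using sdiv_in[OF kf_ring less.prems(2) r(1)] length_sdiv[of r bs] sdiv[of bs xx r] br bs by (auto simp: cs_def)
   have csn: "peval cs xx \<noteq> 0" using less.prems(3) cs(3) by auto
   show ?thesis
   proof (cases "r = 0")
    case True
    have "(xx * f) * peval cs xx = peval as xx" using less.prems(4) cs(3) True by (simp add: mult_ac)
    moreover have "xx * f \<in> Reg" using sringD(5)[OF Reg_ring _ less.prems(5)] RR_Reg RR_mem(2) by blast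
    ultimately have "xx * f \<in> RR0" using less.hyps[OF cs(2) less.prems(1) cs(1) csn] by blast
    then have "tt * (xx * f) \<in> RR0" by (rule sringD(5)[OF RR0(1) RR0(4)])
    then show ?thesis using xx_nz by (simp flip: mult.assoc)
   next
    case rn: False
    obtain V where V: "valring V" "xx - r \<in> mx V" using valring_trans[OF trans_diff[OF trans_xx r(1)]] by blast
    have fV: "f \<in> V" using less.prems(5) V r(1) rn by (auto simp: Reg_def)
    have RV: "peval ds xx \<in> V" if "set ds \<subseteq> kf" for ds
     using that RR_mem point_RR[OF V(1) r(1) rn V(2)] by (intro peval_in[OF V_ring[OF V(1)]]) auto
    have "peval as xx = (xx - r) * (f * peval cs xx)" using less.prems(4) cs(3) by (simp add: mult_ac)
    then have m1: "peval as xx \<in> mx V" using mx_mult[OF V VD(5)[OF V(1) fV RV[OF cs(1)]]] by simp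
    define es where "es = sdiv r as"
    have es: "set es \<subseteq> kf" "peval as xx = (xx - r) * peval es xx + peval as r"
     using sdiv_in[OF kf_ring less.prems(1) r(1)] sdiv[of as xx r] by (auto simp: es_def)
    have "(xx - r) * peval es xx \<in> mx V" by (rule mx_mult[OF V RV[OF es(1)]])
    then have "peval as xx - (xx - r) * peval es xx \<in> mx V" using m1 mx_diff[OF V(1)] by blast
    then have "peval as r \<in> mx V" using es(2) by simp
    then have "peval as r = 0" using kf_mx[OF V(1) peval_in[OF kf_ring less.prems(1) r(1)]] by blast
    then have "(xx - r) * (f * peval cs xx) = (xx - r) * peval es xx"
     using es(2) less.prems(4) cs(3) by (simp add: mult_ac)
    moreover have "xx - r \<noteq> 0" using trans_notin[OF trans_xx] r(1) by auto
    ultimately have "f * peval cs xx = peval es xx" by simp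
    then show ?thesis using less.hyps[OF cs(2) es(1) cs(1) csn] less.prems(5) by blast
   qed
  qed
 qed
qed

lemma E0_Reg: "f \<in> E0 ==> f \<in> Reg ==> f \<in> RR0"
proof -
 assume f: "f \<in> E0" "f \<in> Reg"
 obtain u v where uv: "u \<in> rgen (insert xx kf)" "v \<in> rgen (insert xx kf)" "f = u / v"
  using f(1) unfolding fgen_fraction by blast
 obtain as bs where "set as \<subseteq> kf" "u = peval as xx" "set bs \<subseteq> kf" "v = peval bs xx"
  using uv(1,2) unfolding rgen_insert[OF kf_ring] polys_def by auto
 then show ?thesis
  using regular_rational[of as bs f] f(2) uv(3) RR0(1) sringD(1) by (cases "v = 0") auto
qed

definition mono :: "int => nat => nat => 'a" where "mono i a b = zp xx i * (ss ^ a * zz ^ b)"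

lemma RR0_span: "RR0 \<subseteq> kspan (range (%i. zp xx i))"
proof -
 let ?S = "kspan (range (%i. zp xx i))"
 have m: "a * b \<in> ?S" if a: "a \<in> ?S" and b: "b \<in> ?S" for a b
 proof (rule kspan_mult[OF b])
  fix g assume "g \<in> range (%i. zp xx i)"
  then obtain j where j: "g = zp xx j" by blast
  have "g * a \<in> ?S"
  proof (rule kspan_mult[OF a])
   fix g' assume "g' \<in> range (%i. zp xx i)"
   then obtain i where "g' = zp xx i" by blast
   then have "g * g' = zp xx (j + i)" using j zp_add[OF xx_nz] by simp
   then show "g * g' \<in> ?S" using kspan_base by simp
  qed
  then show "a * g \<in> ?S" by (simp add: mult.commute)
 qed
 have "1 \<in> range (%i. zp xx i)" using rangeI[of "zp xx" 0] by simp
 then have k: "c \<in> ?S" if "c \<in> kf" for c using kspan_ops(4)[OF that, of 1 "range (%i. zp xx i)"] by simp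
 have R: "sring ?S"
  by (rule sringI) (use k kfD m kspan_ops in auto)
 have "xx \<in> ?S" using kspan_base[OF rangeI[of "zp xx" 1]] unfolding zp_1 .
 moreover have "tt \<in> ?S" using kspan_base[OF rangeI[of "zp xx" "-1"]] unfolding zp_minus zp_1 .
 ultimately have "kf \<union> {xx, tt} \<subseteq> ?S" using k by blast
 then show ?thesis unfolding RR0_def by (rule rgen_least[OF R])
qed

lemma Hol_span: "Hol \<subseteq> kspan {mono i a b |i a b. a < \<q> \<and> b < \<q>}" (is "_ \<subseteq> ?S")
proof
 fix f assume "f \<in> Hol"
 then have f: "f \<in> Reg" using Hol_Reg by blast
 have sR: "ss \<in> Reg" "zz \<in> Reg" using RR_Reg RR_mem by blast+
 obtain c where c: "\<And>j. c j \<in> E1" "f = (\<Sum>j<\<q>. c j * zz ^ j)" using z_expansion by blast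
 have cR: "c j \<in> Reg" if "j < \<q>" for j
 proof (rule coefficients_in[OF Reg_ring sR(2), of c "\<q>"])
  show "(\<Sum>j<\<q>. c j * zz ^ j) \<in> Reg" using f c(2) by simp
 qed (use c(1) that Reg_aut in auto)
 have sum_in: "sum g I \<in> ?S" if "\<And>i. i \<in> I ==> g i \<in> ?S" for g and I :: "nat set"
  using that by (induction I rule: infinite_finite_induct) (auto intro: kspan_ops)
 have "c j * zz ^ j \<in> ?S" if j: "j < \<q>" for j
 proof -
  have "c j \<in> span_ext E0 ss \<q>" using c(1) E1_span by blast
  then obtain d where d: "\<forall>i. d i \<in> E0" "c j = (\<Sum>i<\<q>. d i * ss ^ i)" by (auto simp: span_ext_def)
  have dk: "d i \<in> fgen (kf \<union> {tt, zz})" for i using d(1) E0_Ez by blast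
  have dR: "d i \<in> Reg" if "i < \<q>" for i
  proof (rule cfield.coefficients_in[OF swap Reg_ring sR(1), of d \<q>])
   show "(\<Sum>i<\<q>. d i * ss ^ i) \<in> Reg" using cR[OF j] d(2) by simp
   show "g a \<in> Reg" if "aut g" "g tt = tt" "g zz = zz" "a \<in> Reg" for g a
   proof -
    have "g xx = xx" using that(2) autD(11)[OF that(1), of xx] by (metis inverse_inverse_eq)
    then show ?thesis using Reg_aut that by blast
   qed
  qed (use dk that in auto)
  have "d i * ss ^ i * zz ^ j \<in> ?S" if i: "i < \<q>" for i
  proof -
   have "d i \<in> kspan (range (%i. zp xx i))" using E0_Reg d(1) dR[OF i] RR0_span by blast
   then have "(ss ^ i * zz ^ j) * d i \<in> ?S"
   proof (rule kspan_mult)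
    fix g assume "g \<in> range (%i. zp xx i)"
    then obtain n where "g = zp xx n" by blast
    then have "(ss ^ i * zz ^ j) * g = mono n i j" by (simp add: mono_def mult_ac)
    then show "(ss ^ i * zz ^ j) * g \<in> ?S" using i j by (intro kspan_base) blast
   qed
   then show ?thesis by (simp add: mult_ac)
  qed
  then have "(\<Sum>i<\<q>. d i * ss ^ i * zz ^ j) \<in> ?S" by (intro sum_in) simp
  then show ?thesis unfolding d(2) by (simp add: sum_distrib_right)
 qed
 then show "f \<in> ?S" unfolding c(2) by (intro sum_in) simp
qed

end

section \<open>Differentials stable under the Cartier operator\<close>

lemma nat_le_less_pair: "k \<le> a ==> l \<le> b ==> (k, l) \<noteq> (a, b) ==> k + l < a + (b::nat)"
 by auto

lemma nat_le_2: "k \<le> a ==> a + 2 \<le> q ==> k + 2 \<le> (q::nat)"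
 by simp

text \<open>Without a power of x to start with none can arise: q would have to divide a number of
 absolute value below q.\<close>

lemma int_no_shift:
 assumes "coprime (int m) (int q)" "i * int q = int m * ((int b - int l) - (int a - int k))"
  "a < q" "b < q" "k \<le> a" "l \<le> b"
 shows "i = 0"
proof -
 have "int q dvd int m * ((int b - int l) - (int a - int k))" using assms(2) by (metis dvd_triv_right)
 then have d: "int q dvd (int b - int l) - (int a - int k)"
  using assms(1) by (simp add: coprime_commute coprime_dvd_mult_right_iff)
 have "(int b - int l) - (int a - int k) = 0"
 proof (rule ccontr)
  assume nz: "\<not> ?thesis"
  have "\<bar>int q\<bar> \<le> \<bar>(int b - int l) - (int a - int k)\<bar>" using dvd_imp_le_int[OF nz d] .
  then show False using assms(3-6) by linarith
 qed
 then have "i * int q = 0" using assms(2) by simp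
 then show ?thesis using assms(3) by simp
qed

lemma int_div_smaller: "int q dvd i ==> 2 \<le> q ==> i \<noteq> 0 ==> i div int q * int q = i \<and> nat \<bar>i div int q\<bar> < nat \<bar>i\<bar>"
proof (elim dvdE)
 fix k assume q: "2 \<le> q" "i \<noteq> 0" "i = int q * k"
 then have "k \<noteq> 0" by auto
 then have "\<bar>k\<bar> * 2 \<le> \<bar>k\<bar> * int q" using q(1) by (intro mult_left_mono) auto
 then have "\<bar>k\<bar> < \<bar>i\<bar>" using q(3) \<open>k \<noteq> 0\<close> by (simp add: abs_mult mult.commute)
 then show ?thesis using q by simp
qed

definition shift :: "nat => int => nat => nat => nat => nat => int" where
 "shift m i a b k l = i + int m * ((int b - int l) - (int a - int k))"

context cfield begin

lemma sign_zspan: "g \<in> zspan S ==> (- 1) ^ n * g \<in> zspan S"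
 by (induction n) (simp_all add: mult.assoc zspan_uminus)

lemma car_sign: "car f g ==> car ((- 1) ^ n * f) ((- 1) ^ n * g)"
 by (induction n) (simp_all add: mult.assoc car_minus)

lemma car_zspan:
 assumes f: "f \<in> zspan S" and g: "\<And>g. g \<in> S ==> \<exists>g'\<in>zspan S'. car g g'"
 shows "\<exists>g\<in>zspan S'. car f g"
 using f
proof (induction rule: zspan.induct)
 case zero then show ?case using car_0 zspan.zero by blast
next
 case (plus h a)
 obtain h' a' where "h' \<in> zspan S'" "car h h'" "a' \<in> zspan S'" "car a a'" using g[OF plus(1)] plus.IH by blast
 then show ?case using car_add zspan_add by blast
next
 case (minus h a)
 obtain h' a' where "h' \<in> zspan S'" "car h h'" "a' \<in> zspan S'" "car a a'" using g[OF minus(1)] minus.IH by blast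
 then have "car (a + - h) (a' + - h')" "a' + - h' \<in> zspan S'"
  using car_add[OF _ car_minus] zspan_add[OF _ zspan_uminus] by blast+
 then show ?case by auto
qed

definition lst :: "int => nat => nat => 'a set" where
 "lst i a b = {zp xx (shift \<m> i a b k l) * (ss ^ k * zz ^ l) ^ \<q> |k l. k \<le> a \<and> l \<le> b \<and> (k, l) \<noteq> (a, b)}"

lemma lst_step:
 assumes g: "\<And>k l. k \<le> a ==> l \<le> b ==> h * (zp xx (shift \<m> i a b k l) * (ss ^ k * zz ^ l) ^ \<q>) \<in> zspan S"
  and h': "\<And>k l. k \<le> a ==> l \<le> b ==> (k, l) \<noteq> (a, b) ==> h' * (zp xx (shift \<m> i a b k l) * (ss ^ k * zz ^ l) ^ \<q>) \<in> zspan S"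
  and M: "M - e * (zp xx i * (ss ^ a * zz ^ b) ^ \<q>) \<in> zspan (lst i a b)" and e: "e = (- 1) ^ n"
 shows "(h - h') * M - (- e) * (h' * (zp xx i * (ss ^ a * zz ^ b) ^ \<q>)) \<in> zspan S"
proof -
 let ?P = "zp xx i * (ss ^ a * zz ^ b) ^ \<q>"
 have 1: "h * (M - e * ?P) \<in> zspan S"
  using M by (rule zspan_mult) (auto simp: lst_def intro: g)
 have 2: "h' * (M - e * ?P) \<in> zspan S"
  using M by (rule zspan_mult) (auto simp: lst_def intro: h')
 have "h * ?P \<in> zspan S" using g[of a b] by (simp add: shift_def)
 then have 3: "e * (h * ?P) \<in> zspan S" unfolding e by (rule sign_zspan)
 have "(h - h') * M - (- e) * (h' * ?P) = (h * (M - e * ?P) + e * (h * ?P)) - h' * (M - e * ?P)"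
  by (simp add: algebra_simps)
 then show ?thesis using zspan_diff[OF zspan_add[OF 1 3] 2] by simp
qed

text \<open>Expand s = x^(-m) - s^q and z = x^m - z^q; the leading term takes all the q-th
 powers.\<close>

lemma mono_lead: "mono i a b - (- 1) ^ (a + b) * (zp xx i * (ss ^ a * zz ^ b) ^ \<q>) \<in> zspan (lst i a b)"
proof (induction a)
 case 0
 show ?case
 proof (induction b)
  case 0
  show ?case by (simp add: mono_def zspan.zero)
 next
  case (Suc b)
  have z: "xx ^ \<m> - zz ^ \<q> = zz" using zz_eq by (metis add_diff_cancel_left')
  have "(xx ^ \<m> - zz ^ \<q>) * mono i 0 b - (- ((- 1) ^ (0 + b))) * (zz ^ \<q> * (zp xx i * (ss ^ 0 * zz ^ b) ^ \<q>))
    \<in> zspan (lst i 0 (Suc b))"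
  proof (rule lst_step[OF _ _ Suc refl])
   fix k l assume kl: "k \<le> (0::nat)" "l \<le> b"
   have "shift \<m> i 0 (Suc b) k l = int \<m> + shift \<m> i 0 b k l" by (simp add: shift_def algebra_simps)
   then have "xx ^ \<m> * (zp xx (shift \<m> i 0 b k l) * (ss ^ k * zz ^ l) ^ \<q>) = zp xx (shift \<m> i 0 (Suc b) k l) * (ss ^ k * zz ^ l) ^ \<q>"
    using zp_add[OF xx_nz, of "int \<m>" "shift \<m> i 0 b k l"] by (simp add: mult.assoc)
   then show "xx ^ \<m> * (zp xx (shift \<m> i 0 b k l) * (ss ^ k * zz ^ l) ^ \<q>) \<in> zspan (lst i 0 (Suc b))"
    using kl unfolding lst_def by (intro zspan_base CollectI exI[of _ k] exI[of _ l]) auto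
  next
   fix k l assume kl: "k \<le> (0::nat)" "l \<le> b" "(k, l) \<noteq> (0, b)"
   have "shift \<m> i 0 (Suc b) k (Suc l) = shift \<m> i 0 b k l" by (simp add: shift_def)
   then have "zz ^ \<q> * (zp xx (shift \<m> i 0 b k l) * (ss ^ k * zz ^ l) ^ \<q>) = zp xx (shift \<m> i 0 (Suc b) k (Suc l)) * (ss ^ k * zz ^ Suc l) ^ \<q>"
    by (simp add: power_mult_distrib mult_ac)
   then show "zz ^ \<q> * (zp xx (shift \<m> i 0 b k l) * (ss ^ k * zz ^ l) ^ \<q>) \<in> zspan (lst i 0 (Suc b))"
    using kl unfolding lst_def by (intro zspan_base CollectI exI[of _ k] exI[of _ "Suc l"]) auto
  qed
  then show ?case unfolding z by (simp add: mono_def power_mult_distrib mult_ac)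
 qed
next
 case (Suc a)
 have s: "tt ^ \<m> - ss ^ \<q> = ss" using ss_eq by (metis add_diff_cancel_left')
 have "(tt ^ \<m> - ss ^ \<q>) * mono i a b - (- ((- 1) ^ (a + b))) * (ss ^ \<q> * (zp xx i * (ss ^ a * zz ^ b) ^ \<q>))
   \<in> zspan (lst i (Suc a) b)"
 proof (rule lst_step[OF _ _ Suc refl])
  fix k l assume kl: "k \<le> a" "l \<le> b"
  have "shift \<m> i (Suc a) b k l = - int \<m> + shift \<m> i a b k l" by (simp add: shift_def algebra_simps)
  moreover have "tt ^ \<m> = zp xx (- int \<m>)" by (simp add: zp_minus power_inverse)
  ultimately have "tt ^ \<m> * (zp xx (shift \<m> i a b k l) * (ss ^ k * zz ^ l) ^ \<q>) = zp xx (shift \<m> i (Suc a) b k l) * (ss ^ k * zz ^ l) ^ \<q>"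
   using zp_add[OF xx_nz, of "- int \<m>" "shift \<m> i a b k l"] by (simp add: mult.assoc)
  then show "tt ^ \<m> * (zp xx (shift \<m> i a b k l) * (ss ^ k * zz ^ l) ^ \<q>) \<in> zspan (lst i (Suc a) b)"
   using kl unfolding lst_def by (intro zspan_base CollectI exI[of _ k] exI[of _ l]) auto
 next
  fix k l assume kl: "k \<le> a" "l \<le> b" "(k, l) \<noteq> (a, b)"
  have "shift \<m> i (Suc a) b (Suc k) l = shift \<m> i a b k l" by (simp add: shift_def)
  then have "ss ^ \<q> * (zp xx (shift \<m> i a b k l) * (ss ^ k * zz ^ l) ^ \<q>) = zp xx (shift \<m> i (Suc a) b (Suc k) l) * (ss ^ Suc k * zz ^ l) ^ \<q>"
   by (simp add: power_mult_distrib mult_ac)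
  then show "ss ^ \<q> * (zp xx (shift \<m> i a b k l) * (ss ^ k * zz ^ l) ^ \<q>) \<in> zspan (lst i (Suc a) b)"
   using kl unfolding lst_def by (intro zspan_base CollectI exI[of _ "Suc k"] exI[of _ l]) auto
 qed
 then show ?case unfolding s by (simp add: mono_def power_mult_distrib mult_ac)
qed

lemma car_lead:
 "\<exists>e g. g \<in> zspan {mono i' k l |i' k l. k \<le> a \<and> l \<le> b \<and> (k, l) \<noteq> (a, b) \<and> i' * int \<q> = shift \<m> i a b k l} \<and>
  car (mono i a b) (e + g) \<and> (if int \<q> dvd i then e = (- 1) ^ (a + b) * mono (i div int \<q>) a b else e = 0)"
proof -
 let ?S = "{mono i' k l |i' k l. k \<le> a \<and> l \<le> b \<and> (k, l) \<noteq> (a, b) \<and> i' * int \<q> = shift \<m> i a b k l}"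
 have cm: "\<exists>i'. i' * int \<q> = j \<and> car (zp xx j * g ^ \<q>) (zp xx i' * g)" if dv: "int \<q> dvd j" for j g
 proof -
  have "j div int \<q> * int \<q> = j" using dv by (rule Rings.dvd_div_mult_self)
  then show ?thesis using car_power[of "j div int \<q>" g] by metis
 qed
 have "\<exists>g\<in>zspan ?S. car (mono i a b - (- 1) ^ (a + b) * (zp xx i * (ss ^ a * zz ^ b) ^ \<q>)) g"
 proof (rule car_zspan[OF mono_lead])
  fix g assume "g \<in> lst i a b"
  then obtain k l where kl: "k \<le> a" "l \<le> b" "(k, l) \<noteq> (a, b)" "g = zp xx (shift \<m> i a b k l) * (ss ^ k * zz ^ l) ^ \<q>"
   by (auto simp: lst_def)
  show "\<exists>g'\<in>zspan ?S. car g g'"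
  proof (cases "int \<q> dvd shift \<m> i a b k l")
   case True
   obtain i' where i': "i' * int \<q> = shift \<m> i a b k l" "car g (zp xx i' * (ss ^ k * zz ^ l))"
    using cm[OF True] kl(4) by metis
   then have "mono i' k l \<in> ?S" using kl by blast
   from zspan_base[OF this] show ?thesis using i'(2) unfolding mono_def by blast
  next
   case False
   then show ?thesis using car_monomial kl(4) zspan.zero by blast
  qed
 qed
 then obtain g where g: "g \<in> zspan ?S" "car (mono i a b - (- 1) ^ (a + b) * (zp xx i * (ss ^ a * zz ^ b) ^ \<q>)) g" by blast
 define e where "e = (if int \<q> dvd i then (- 1) ^ (a + b) * mono (i div int \<q>) a b else 0)"
 have "car ((- 1) ^ (a + b) * (zp xx i * (ss ^ a * zz ^ b) ^ \<q>)) e"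
 proof (cases "int \<q> dvd i")
  case True
  have "i div int \<q> * int \<q> = i" using True by (rule Rings.dvd_div_mult_self)
  then show ?thesis
   using car_sign[OF car_power[of "i div int \<q>" "ss ^ a * zz ^ b"], of "a + b"] True by (simp add: e_def mono_def)
 next
  case False
  then show ?thesis using car_sign[OF car_monomial[OF False], of "a + b"] by (simp add: e_def)
 qed
 from car_add[OF g(2) this] have "car (mono i a b) (e + g)" by (simp only: diff_add_cancel add.commute[of g e])
 then show ?thesis using g(1) unfolding e_def by (intro exI[of _ e] exI[of _ g]) (auto simp: e_def)
qed

lemma mono_0: "mono 0 a b = ss ^ a * zz ^ b" by (simp add: mono_def)

lemma car_lead_0:
 assumes "a < \<q>" "b < \<q>"
 shows "\<exists>g\<in>zspan {mono 0 k l |k l. k \<le> a \<and> l \<le> b \<and> (k, l) \<noteq> (a, b)}. car (mono 0 a b) ((- 1) ^ (a + b) * mono 0 a b + g)"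
proof -
 obtain e g where g: "g \<in> zspan {mono i' k l |i' k l. k \<le> a \<and> l \<le> b \<and> (k, l) \<noteq> (a, b) \<and> i' * int \<q> = shift \<m> 0 a b k l}"
  "car (mono 0 a b) (e + g)" "e = (- 1) ^ (a + b) * mono 0 a b"
  using car_lead[of a b 0] by auto
 have "{mono i' k l |i' k l. k \<le> a \<and> l \<le> b \<and> (k, l) \<noteq> (a, b) \<and> i' * int \<q> = shift \<m> 0 a b k l}
   \<subseteq> {mono 0 k l |k l. k \<le> a \<and> l \<le> b \<and> (k, l) \<noteq> (a, b)}" (is "?A \<subseteq> ?B")
 proof
  fix f assume "f \<in> ?A"
  then obtain i' k l where f: "f = mono i' k l" "k \<le> a" "l \<le> b" "(k, l) \<noteq> (a, b)" "i' * int \<q> = shift \<m> 0 a b k l" by blast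
  have "i' = 0"
   by (rule int_no_shift[OF coprime_mq _ assms f(2,3)]) (use f(5) in \<open>simp add: shift_def\<close>)
  then show "f \<in> ?B" using f by blast
 qed
 then have "?A \<subseteq> zspan ?B" using zspan_base by blast
 from subsetD[OF zspan_mono[OF this] g(1)] show ?thesis using g(2,3) by blast
qed

text \<open>The span of the monomials without power of x.\<close>

definition R0 :: "'a set" where "R0 = kspan {mono 0 a b |a b. a < \<q> \<and> b < \<q>}"

lemma kf_q_root: "c \<in> kf ==> \<exists>d\<in>kf. d ^ \<q> = c" by (rule nth_root_ex[OF _ q_pos])

lemma R0_ops: "0 \<in> R0" "f \<in> R0 ==> g \<in> R0 ==> f + g \<in> R0" "f \<in> R0 ==> - f \<in> R0" "c \<in> kf ==> f \<in> R0 ==> c * f \<in> R0"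
 by (simp_all add: R0_def kspan_ops kspan_scale)

lemma R0_zspan: "S \<subseteq> R0 ==> zspan S \<subseteq> R0"
 by (rule zspan_least) (use R0_ops in auto)

lemma R0_car: "f \<in> R0 ==> \<exists>g\<in>R0. car f g"
proof -
 have "R0 \<subseteq> {f. \<exists>g\<in>R0. car f g}" unfolding R0_def
 proof (rule kspan_least, fold R0_def)
  show "0 \<in> {f. \<exists>g\<in>R0. car f g}" using R0_ops(1) car_0 by blast
  show "f + f' \<in> {f. \<exists>g\<in>R0. car f g}" if "f \<in> {f. \<exists>g\<in>R0. car f g}" "f' \<in> {f. \<exists>g\<in>R0. car f g}" for f f'
   using that R0_ops(2) car_add by blast
  show "c * f \<in> {f. \<exists>g\<in>R0. car f g}" if c: "c \<in> kf" and f: "f \<in> {f. \<exists>g\<in>R0. car f g}" for c f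
  proof -
   obtain d where "d \<in> kf" "c = d ^ \<q>" using kf_q_root[OF c] by blast
   then show ?thesis using f R0_ops(4) car_scale by blast
  qed
  have base: "mono 0 a b \<in> R0" if "a < \<q>" "b < \<q>" for a b
   unfolding R0_def by (rule kspan_base) (use that in blast)
  show "{mono 0 a b |a b. a < \<q> \<and> b < \<q>} \<subseteq> {f. \<exists>g\<in>R0. car f g}"
  proof
   fix f assume "f \<in> {mono 0 a b |a b. a < \<q> \<and> b < \<q>}"
   then obtain a b where ab: "a < \<q>" "b < \<q>" "f = mono 0 a b" by blast
   obtain g where g: "g \<in> zspan {mono 0 k l |k l. k \<le> a \<and> l \<le> b \<and> (k, l) \<noteq> (a, b)}"
    "car f ((- 1) ^ (a + b) * mono 0 a b + g)" using car_lead_0[OF ab(1,2)] ab(3) by blast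
   have "{mono 0 k l |k l. k \<le> a \<and> l \<le> b \<and> (k, l) \<noteq> (a, b)} \<subseteq> R0"
    using base ab(1,2) by (blast intro: le_less_trans)
   then have "g \<in> R0" using R0_zspan g(1) by blast
   moreover have "(- 1) ^ (a + b) * mono 0 a b \<in> R0"
    using base[OF ab(1,2)] sring_power[OF kf_ring kfD(4)[OF kfD(2)]] R0_ops(4) by blast
   ultimately show "f \<in> {f. \<exists>g\<in>R0. car f g}" using g(2) R0_ops(2) by blast
  qed
 qed
 then show "f \<in> R0 ==> \<exists>g\<in>R0. car f g" by blast
qed

text \<open>Elements that some iterate of the operator sends to R0.\<close>

inductive_set Ev :: "'a set" where
 base: "f \<in> R0 ==> f \<in> Ev"
| step: "car f g ==> g \<in> Ev ==> f \<in> Ev"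

lemma Ev_car: assumes "f \<in> Ev" shows "\<exists>g\<in>Ev. car f g"
 using assms
proof cases
 case base then show ?thesis using R0_car Ev.base by blast
next
 case step then show ?thesis by blast
qed

lemma Ev_add_R0: "f \<in> Ev ==> f' \<in> R0 ==> f' + f \<in> Ev"
proof (induction arbitrary: f' rule: Ev.induct)
 case (base f) then show ?case using Ev.base R0_ops(2) by blast
next
 case (step f g)
 obtain g' where "g' \<in> R0" "car f' g'" using R0_car step.prems by blast
 then show ?case using Ev.step[OF car_add[OF _ step(1)] step.IH] by blast
qed

lemma Ev_add: "f \<in> Ev ==> f' \<in> Ev ==> f + f' \<in> Ev"
proof (induction arbitrary: f' rule: Ev.induct)
 case (base f) then show ?case using Ev_add_R0 by blast
next
 case (step f g)
 obtain g' where "g' \<in> Ev" "car f' g'" using Ev_car step.prems by blast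
 then show ?case using Ev.step[OF car_add[OF step(1)] step.IH] by blast
qed

lemma Ev_scale: "f \<in> Ev ==> c \<in> kf ==> c * f \<in> Ev"
proof (induction arbitrary: c rule: Ev.induct)
 case (base f) then show ?case using Ev.base R0_ops(4) by blast
next
 case (step f g)
 obtain d where "d \<in> kf" "c = d ^ \<q>" using kf_q_root[OF step.prems] by blast
 then show ?case using Ev.step[OF car_scale[OF step(1)] step.IH] by blast
qed

lemma Ev_0: "0 \<in> Ev" by (rule Ev.base[OF R0_ops(1)])

lemma Ev_zspan: "S \<subseteq> Ev ==> zspan S \<subseteq> Ev"
 by (rule zspan_least) (use Ev_0 Ev_add Ev_scale[OF _ kfD(4)[OF kfD(2)]] in auto)

text \<open>Either a + b drops or the exponent of x is divided by q.\<close>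

lemma mono_Ev_step:
 assumes IH: "\<And>k l i'. k + l < a + b ==> k < \<q> ==> l < \<q> ==> mono i' k l \<in> Ev"
  and ab: "a < \<q>" "b < \<q>"
 shows "mono i a b \<in> Ev"
proof (induction "nat \<bar>i\<bar>" arbitrary: i rule: less_induct)
 case less
 show ?case
 proof (cases "i = 0")
  case True
  show ?thesis unfolding True R0_def by (rule Ev.base, unfold R0_def, rule kspan_base) (use ab in blast)
 next
  case False
  obtain e g where g: "g \<in> zspan {mono i' k l |i' k l. k \<le> a \<and> l \<le> b \<and> (k, l) \<noteq> (a, b) \<and> i' * int \<q> = shift \<m> i a b k l}"
   "car (mono i a b) (e + g)" "if int \<q> dvd i then e = (- 1) ^ (a + b) * mono (i div int \<q>) a b else e = 0"
   using car_lead[of a b i] by blast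
  have "{mono i' k l |i' k l. k \<le> a \<and> l \<le> b \<and> (k, l) \<noteq> (a, b) \<and> i' * int \<q> = shift \<m> i a b k l} \<subseteq> Ev"
  proof
   fix f assume "f \<in> {mono i' k l |i' k l. k \<le> a \<and> l \<le> b \<and> (k, l) \<noteq> (a, b) \<and> i' * int \<q> = shift \<m> i a b k l}"
   then obtain i' k l where f: "f = mono i' k l" "k \<le> a" "l \<le> b" "(k, l) \<noteq> (a, b)" by blast
   show "f \<in> Ev" unfolding f(1)
    by (rule IH[OF nat_le_less_pair[OF f(2-4)] le_less_trans[OF f(2) ab(1)] le_less_trans[OF f(3) ab(2)]])
  qed
  then have gE: "g \<in> Ev" using Ev_zspan g(1) by blast
  have "e \<in> Ev"
  proof (cases "int \<q> dvd i")
   case True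
   have "2 \<le> \<q>" using q_ge3 by linarith
   then have "mono (i div int \<q>) a b \<in> Ev" using int_div_smaller[OF True _ False] by (intro less) blast
   then show ?thesis using g(3) True Ev_scale[OF _ sring_power[OF kf_ring kfD(4)[OF kfD(2)]]] by simp
  qed (use g(3) Ev_0 in simp)
  then show ?thesis using Ev.step[OF g(2) Ev_add[OF _ gE]] by blast
 qed
qed

lemma mono_Ev: "a < \<q> ==> b < \<q> ==> mono i a b \<in> Ev"
proof (induction "a + b" arbitrary: a b i rule: less_induct)
 case less
 show ?case by (rule mono_Ev_step[OF less.hyps less.prems])
qed

lemma Hol_Ev: "Hol \<subseteq> Ev"
proof -
 have "kspan {mono i a b |i a b. a < \<q> \<and> b < \<q>} \<subseteq> Ev"
  by (rule kspan_least) (use Ev_0 Ev_add Ev_scale mono_Ev in auto)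
 then show ?thesis using Hol_span by blast
qed

text \<open>The operator permutes \<Phi>, since it is a function by car_unique and \<Phi> is
 finite.\<close>

definition Vs :: "'a set" where
 "Vs = {f. \<exists>\<Phi>. finite \<Phi> \<and> f \<in> \<Phi> \<and> \<Phi> \<subseteq> Hol \<and> (\<forall>g\<in>\<Phi>. \<exists>g'\<in>\<Phi>. car g' g)}"

lemma Vs_Hol: "Vs \<subseteq> Hol" by (auto simp: Vs_def)

text \<open>A permutation of a finite set that preserves a subset and eventually maps everything
 into it leaves nothing outside.\<close>

lemma Vs_R0: "Vs \<subseteq> R0"
proof
 fix f assume "f \<in> Vs"
 then obtain \<Phi> where P: "finite \<Phi>" "f \<in> \<Phi>" "\<Phi> \<subseteq> Hol" "\<forall>g\<in>\<Phi>. \<exists>g'\<in>\<Phi>. car g' g" by (auto simp: Vs_def)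
 from bchoice[OF P(4)[unfolded Bex_def]] obtain r where r: "\<forall>g\<in>\<Phi>. r g \<in> \<Phi> \<and> car (r g) g" by blast
 have "inj_on r \<Phi>"
 proof (rule inj_onI)
  fix g g' assume "g \<in> \<Phi>" "g' \<in> \<Phi>" "r g = r g'"
  then show "g = g'" using r car_unique by metis
 qed
 then have onto: "r ` \<Phi> = \<Phi>" using r P(1) by (intro endo_inj_surj) auto
 have bwd: "g \<in> R0" if "g \<in> \<Phi>" "r g \<in> R0" for g
  using R0_car[OF that(2)] r that(1) car_unique by metis
 have fwd: "r g \<in> R0" if g: "g \<in> \<Phi>" "g \<in> R0" for g
 proof -
  let ?A = "{g \<in> \<Phi>. r g \<in> R0}" and ?B = "\<Phi> \<inter> R0"
  have sub: "?A \<subseteq> ?B" using bwd by blast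
  have "r ` ?A = ?B" using onto r by auto
  then have "card ?B \<le> card ?A" using card_image_le[of ?A r] P(1) by simp
  then have "?A = ?B" using sub P(1) by (intro card_seteq) auto
  then show ?thesis using g by blast
 qed
 have "g \<in> \<Phi> ==> g \<in> R0" if "g \<in> Ev" for g
  using that
 proof (induction rule: Ev.induct)
  case (step g g')
  obtain g0 where g0: "g0 \<in> \<Phi>" "g = r g0" using step.prems onto by blast
  then have "g' = g0" using r step(1) car_unique by metis
  then show ?case using fwd[of g0] g0 step.IH by blast
 qed
 then show "f \<in> R0" using P(2,3) Hol_Ev by blast
qed

lemma Vs_aut: assumes f: "aut f" and g: "g \<in> Vs" shows "f g * uu f \<in> Vs"
proof -
 obtain \<Phi> where P: "finite \<Phi>" "g \<in> \<Phi>" "\<Phi> \<subseteq> Hol" "\<forall>g\<in>\<Phi>. \<exists>g'\<in>\<Phi>. car g' g" using g by (auto simp: Vs_def)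
 let ?r = "%g. f g * uu f"
 have "finite (?r ` \<Phi>)" "?r g \<in> ?r ` \<Phi>" "?r ` \<Phi> \<subseteq> Hol" using P(1-3) Hol_aut[OF f] by auto
 moreover have "\<exists>g'\<in>?r ` \<Phi>. car g' (?r g)" if "g \<in> \<Phi>" for g
  using P(4) that car_aut[OF f] by (meson imageI)
 then have "\<forall>g\<in>?r ` \<Phi>. \<exists>g'\<in>?r ` \<Phi>. car g' g" by blast
 ultimately show ?thesis unfolding Vs_def by blast
qed

lemma zspan_car_lift:
 assumes f: "f \<in> zspan S" and g: "\<And>g. g \<in> S ==> \<exists>g'\<in>zspan S'. car g' g"
 shows "\<exists>f'\<in>zspan S'. car f' f"
 using f
proof (induction rule: zspan.induct)
 case zero then show ?case using car_0 zspan.zero by blast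
next
 case (plus h a) then show ?case using g[OF plus(1)] car_add zspan_add by blast
next
 case (minus h a)
 obtain h' a' where *: "h' \<in> zspan S'" "car h' h" "a' \<in> zspan S'" "car a' a" using g[OF minus(1)] minus.IH by blast
 have "car (a' + - h') (a + - h)" by (rule car_add[OF *(4) car_minus[OF *(2)]])
 then show ?case using zspan_add[OF *(3) zspan_uminus[OF *(1)]] by auto
qed

text \<open>On the finite group generated by these monomials the operator is triangular with
 diagonal entries 1 or -1, hence surjective.\<close>

lemma monomial_Vs: assumes ab: "a + 2 \<le> \<q>" "b + 2 \<le> \<q>" shows "ss ^ a * zz ^ b \<in> Vs"
proof -
 let ?S = "{mono 0 k l |k l. k + 2 \<le> \<q> \<and> l + 2 \<le> \<q>}"
 have "?S \<subseteq> (%(k, l). mono 0 k l) ` ({..<\<q>} \<times> {..<\<q>})"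
 proof
  fix f assume "f \<in> ?S"
  then obtain k l where "f = mono 0 k l" "k + 2 \<le> \<q>" "l + 2 \<le> \<q>" by blast
  then show "f \<in> (%(k, l). mono 0 k l) ` ({..<\<q>} \<times> {..<\<q>})" by (intro image_eqI[of _ _ "(k, l)"]) auto
 qed
 then have "finite ?S" by (rule finite_subset) simp
 then have fin: "finite (zspan ?S)" by (rule zspan_finite[OF char_chp p_pos])
 have hol: "zspan ?S \<subseteq> Hol"
  using monomial_Hol Hol_zero Hol_add Hol_minus by (intro zspan_least) (auto simp: mono_0)
 have gen: "\<exists>g'\<in>zspan ?S. car g' (mono 0 k l)" if "k + 2 \<le> \<q>" "l + 2 \<le> \<q>" for k l
  using that
 proof (induction "k + l" arbitrary: k l rule: less_induct)
  case less
  have kl: "k < \<q>" "l < \<q>" using less.prems by linarith+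
  obtain g where g: "g \<in> zspan {mono 0 k' l' |k' l'. k' \<le> k \<and> l' \<le> l \<and> (k', l') \<noteq> (k, l)}"
   "car (mono 0 k l) ((- 1) ^ (k + l) * mono 0 k l + g)" using car_lead_0[OF kl] by blast
  have "\<exists>g'\<in>zspan ?S. car g' g"
   using g(1)
  proof (rule zspan_car_lift)
   fix h assume "h \<in> {mono 0 k' l' |k' l'. k' \<le> k \<and> l' \<le> l \<and> (k', l') \<noteq> (k, l)}"
   then obtain k' l' where kl': "h = mono 0 k' l'" "k' \<le> k" "l' \<le> l" "(k', l') \<noteq> (k, l)" by blast
   show "\<exists>h'\<in>zspan ?S. car h' h" unfolding kl'(1)
    by (rule less.hyps[OF nat_le_less_pair[OF kl'(2-4)] nat_le_2[OF kl'(2) less.prems(1)] nat_le_2[OF kl'(3) less.prems(2)]])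
  qed
  then obtain g' where g': "g' \<in> zspan ?S" "car g' g" by blast
  have m: "mono 0 k l \<in> zspan ?S" by (rule zspan_base) (use less.prems in blast)
  have "car (mono 0 k l + - g') ((- 1) ^ (k + l) * mono 0 k l + g + - g)" by (rule car_add[OF g(2) car_minus[OF g'(2)]])
  then have "car (mono 0 k l + - g') ((- 1) ^ (k + l) * mono 0 k l)" by simp
  from car_sign[OF this, of "k + l"] have "car ((- 1) ^ (k + l) * (mono 0 k l + - g')) (((- 1) ^ (k + l) * (- 1) ^ (k + l)) * mono 0 k l)"
   by (simp only: mult.assoc)
  moreover have "(- 1) ^ (k + l) * (- 1) ^ (k + l) = (1 :: 'a)" by (simp flip: power_mult_distrib)
  moreover have "(- 1) ^ (k + l) * (mono 0 k l + - g') \<in> zspan ?S"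
   by (rule sign_zspan[OF zspan_add[OF m zspan_uminus[OF g'(1)]]])
  ultimately show ?case by auto
 qed
 have surj: "\<exists>g'\<in>zspan ?S. car g' g" if "g \<in> zspan ?S" for g
  using that by (rule zspan_car_lift) (use gen in blast)
 have mem: "ss ^ a * zz ^ b \<in> zspan ?S"
  unfolding mono_0[symmetric] by (rule zspan_base) (use ab in blast)
 show ?thesis unfolding Vs_def
  by (intro CollectI exI[of _ "zspan ?S"] conjI ballI fin mem hol surj)
qed

end

section \<open>Traces of stable differentials\<close>

context Fields.field begin

text \<open>Multiplying the weights by S - r lowers the admissible degree by one.\<close>

lemma moments_remove:
 assumes A: "finite A"
  and mom: "\<And>a b. a \<le> d ==> b \<le> d' ==> (\<Sum>i\<in>I. w i * (S i ^ a * Z i ^ b)) = (0::'a)"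
 shows "a + card A \<le> d ==> b \<le> d' ==> (\<Sum>i\<in>I. (w i * (\<Prod>r\<in>A. S i - r)) * (S i ^ a * Z i ^ b)) = 0"
 using A
proof (induction A arbitrary: a rule: finite_induct)
 case empty then show ?case using mom by simp
next
 case (insert r A)
 let ?w = "%i. w i * (\<Prod>r\<in>A. S i - r)"
 have "(\<Sum>i\<in>I. (w i * (\<Prod>r\<in>insert r A. S i - r)) * (S i ^ a * Z i ^ b))
   = (\<Sum>i\<in>I. ?w i * (S i ^ Suc a * Z i ^ b) - r * (?w i * (S i ^ a * Z i ^ b)))"
  using insert.hyps by (intro sum.cong[OF refl]) (simp add: algebra_simps)
 also have "... = (\<Sum>i\<in>I. ?w i * (S i ^ Suc a * Z i ^ b)) - r * (\<Sum>i\<in>I. ?w i * (S i ^ a * Z i ^ b))"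
  by (simp only: sum_minus sum_distrib_left)
 also have "... = 0"
  using insert.IH[of "Suc a"] insert.IH[of a] insert.prems insert.hyps by simp
 finally show ?case .
qed

text \<open>A polynomial in S of degree q - 2 leaves only two of the points.\<close>

lemma moments_collapse:
 assumes I: "finite I" and w: "\<And>i. i \<in> I ==> w i \<noteq> 0"
  and d: "card I \<le> d + 2" "1 \<le> d"
  and mom: "\<And>a b. a \<le> d ==> b \<le> d ==> (\<Sum>i\<in>I. w i * (S i ^ a * Z i ^ b)) = (0::'a)"
  and inj: "inj_on S I" and ij: "i \<in> I" "j \<in> I"
 shows "Z i = Z j"
proof (cases "i = j")
 case False
 let ?A = "S ` (I - {i, j})"
 have "card ?A \<le> card (I - {i, j})" using I by (intro card_image_le) simp
 also have "... = card I - 2" using ij False by (simp add: card_Diff_subset)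
 finally have A: "card ?A \<le> d" "finite ?A" using d I by auto
 let ?P = "%i. \<Prod>r\<in>?A. S i - r"
 have Z0: "?P l = 0" if "l \<in> I - {i, j}" for l using that A(2) by (intro prod_zero) auto
 have two: "(w i * ?P i) * Z i ^ b + (w j * ?P j) * Z j ^ b = 0" if "b \<le> d" for b
 proof -
  have "(\<Sum>l\<in>I. (w l * ?P l) * (S l ^ 0 * Z l ^ b)) = 0"
   using A that by (intro moments_remove[OF A(2) mom, of d d]) auto
  moreover have "(\<Sum>l\<in>I. (w l * ?P l) * (S l ^ 0 * Z l ^ b)) = (\<Sum>l\<in>{i, j}. (w l * ?P l) * (S l ^ 0 * Z l ^ b))"
   using I ij Z0 by (intro sum.mono_neutral_right) auto
  ultimately show ?thesis using False by simp
 qed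
 have Pi: "?P i \<noteq> 0"
 proof
  assume "?P i = 0"
  then obtain r where "r \<in> ?A" "S i - r = 0" using A(2) by (auto simp: prod_zero_iff)
  then show False using inj ij by (auto simp: inj_on_def)
 qed
 have 0: "w i * ?P i + w j * ?P j = 0" using two[of 0] by simp
 have 1: "(w i * ?P i) * Z i + (w j * ?P j) * Z j = 0" using two[of 1] d(2) by simp
 have "(w i * ?P i) * (Z i - Z j) = ((w i * ?P i) * Z i + (w j * ?P j) * Z j) - (w i * ?P i + w j * ?P j) * Z j"
  by (simp add: algebra_simps)
 then have "(w i * ?P i) * (Z i - Z j) = 0" unfolding 0 1 by simp
 then show ?thesis using w[OF ij(1)] Pi by simp
qed simp

text \<open>If both coordinates repeat, a product of two interpolation polynomials isolates one
 point.\<close>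

lemma moments_line:
 assumes I: "finite I" "I \<noteq> {}" and w: "\<And>i. i \<in> I ==> w i \<noteq> 0"
  and d: "card I \<le> d + 2" "1 \<le> d"
  and mom: "\<And>a b. a \<le> d ==> b \<le> d ==> (\<Sum>i\<in>I. w i * (S i ^ a * Z i ^ b)) = (0::'a)"
  and pts: "\<And>i j. i \<in> I ==> j \<in> I ==> S i = S j ==> Z i = Z j ==> i = j"
 shows "(\<forall>i\<in>I. \<forall>j\<in>I. S i = S j) \<or> (\<forall>i\<in>I. \<forall>j\<in>I. Z i = Z j)"
proof (cases "inj_on S I \<or> inj_on Z I")
 case True
 then show ?thesis
 proof
  assume "inj_on S I"
  then show ?thesis using moments_collapse[OF I(1) w d mom] by blast
 next
  assume *: "inj_on Z I"
  have "(\<Sum>i\<in>I. w i * (Z i ^ a * S i ^ b)) = 0" if "a \<le> d" "b \<le> d" for a b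
   using mom[OF that(2,1)] by (simp add: mult_ac)
  have "S i = S j" if "i \<in> I" "j \<in> I" for i j
   by (rule moments_collapse[OF I(1) w d _ * that]) (use \<open>\<And>a b. a \<le> d ==> b \<le> d ==> (\<Sum>i\<in>I. w i * (Z i ^ a * S i ^ b)) = 0\<close> in auto)
  then show ?thesis by blast
 qed
next
 case False
 have small: "card (f ` I - {f i}) \<le> d" if "\<not> inj_on f I" "i \<in> I" for f :: "'b => 'a" and i
 proof -
  have "card (f ` I) \<noteq> card I" using that(1) I(1) eq_card_imp_inj_on by blast
  then have "card (f ` I) < card I" using card_image_le[OF I(1), of f] by linarith
  then show ?thesis using that(2) d(1) I(1) by (simp add: card_Diff_subset)
 qed
 obtain i where i: "i \<in> I" using I(2) by blast
 let ?A = "S ` I - {S i}" and ?B = "Z ` I - {Z i}"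
 have AB: "finite ?A" "finite ?B" "card ?A \<le> d" "card ?B \<le> d" using False small[OF _ i] I(1) by auto
 let ?P = "%i. \<Prod>r\<in>?A. S i - r" and ?Q = "%i. \<Prod>r\<in>?B. Z i - r"
 have 1: "(\<Sum>l\<in>I. (w l * ?P l) * (Z l ^ b * S l ^ 0)) = 0" if "b \<le> d" for b
 proof -
  have "(\<Sum>l\<in>I. (w l * ?P l) * (S l ^ 0 * Z l ^ b)) = 0"
   using AB that by (intro moments_remove[OF AB(1) mom, of d d]) auto
  then show ?thesis by (simp add: mult_ac)
 qed
 have 2: "(\<Sum>l\<in>I. ((w l * ?P l) * ?Q l) * (Z l ^ 0 * S l ^ 0)) = 0"
 proof (rule moments_remove[OF AB(2), of d 0])
  show "(\<Sum>l\<in>I. (w l * ?P l) * (Z l ^ a * S l ^ b)) = 0" if "a \<le> d" "b \<le> 0" for a b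
   using 1[OF that(1)] that(2) by simp
 qed (use AB in auto)
 have zero: "(w l * ?P l) * ?Q l = 0" if l: "l \<in> I - {i}" for l
 proof (cases "S l = S i")
  case True
  then have "Z l \<noteq> Z i" using pts[of l i] l i by blast
  then have "?Q l = 0" using AB(2) l by (intro prod_zero) auto
  then show ?thesis by simp
 next
  case False
  then have "?P l = 0" using AB(1) l by (intro prod_zero) auto
  then show ?thesis by simp
 qed
 have "(\<Sum>l\<in>I. ((w l * ?P l) * ?Q l) * (Z l ^ 0 * S l ^ 0)) = (\<Sum>l\<in>{i}. ((w l * ?P l) * ?Q l) * (Z l ^ 0 * S l ^ 0))"
  using I(1) i zero by (intro sum.mono_neutral_right) auto
 then have "(w i * ?P i) * ?Q i = 0" using 2 by simp
 moreover have "?P i \<noteq> 0" "?Q i \<noteq> 0" using AB(1,2) by (auto simp: prod_zero_iff)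
 ultimately show ?thesis using w[OF i] by simp
qed

end

context cfield begin

subsection \<open>Behaviour at infinity\<close>

context
 fixes V assumes V: "valring V" and tt: "tt \<in> mx V"
begin

lemma dd_tt: "dd tt = - tt"
 using deriv_inverse[OF dd(1), of xx] dd(2) xx_nz by (simp add: power2_eq_square field_simps)

text \<open>Write c as a power of 1/x times a unit of the local ring, which dd preserves.\<close>

lemma E1_dlog: assumes "c \<in> E1" "c \<noteq> 0" shows "dd c / c \<in> V"
proof -
 let ?R = "rgen (kf \<union> {tt, ss})"
 have kR: "kf \<subseteq> ?R" "tt \<in> ?R" "ss \<in> ?R" using rgen_incl[of "kf \<union> {tt, ss}"] by auto
 note R = sring_rgen[of "kf \<union> {tt, ss}"] E1_smooth(1)[OF V tt assms] kR(1)
 note D = sringD[OF R(1)]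
 have ddR: "dd a \<in> ?R" if "a \<in> ?R" for a
 proof -
  have "sring {a \<in> ?R. dd a \<in> ?R}"
   by (rule sringI) (auto simp: ddD simp del: Un_insert_right intro: D)
  moreover have "dd ss \<in> ?R" unfolding dd_ss
   by (intro D(5) D(4) sring_of_nat[OF R(1)] sring_power[OF R(1)] kR(2))
  then have "kf \<union> {tt, ss} \<subseteq> {a \<in> ?R. dd a \<in> ?R}"
   using kR D(1,4) by (auto simp: dd_tt deriv_kf[OF dd(1)])
  ultimately have "?R \<subseteq> {a \<in> ?R. dd a \<in> ?R}" by (rule rgen_least)
  then show ?thesis using that by blast
 qed
 obtain n u where u: "u \<in> loc ?R V" "u \<notin> mx V" "c = zp tt n * u" using E1_smooth(2)[OF V tt assms] by blast
 have uV: "u \<in> V" "inverse u \<in> V" "u \<noteq> 0"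
  using u loc_V[OF V R] unitD[OF V, of u] by auto
 obtain a b where ab: "a \<in> ?R" "b \<in> ?R" "b \<notin> mx V" "u = a / b" using u(1) by (auto simp: loc_def)
 have bV: "inverse b \<in> V" "b \<noteq> 0" using ab(2,3) R(2) unitD[OF V, of b] by auto
 have "dd u = (dd a * b - a * dd b) * inverse b ^ 2"
 proof -
  have "dd (u * b) = dd u * b + u * dd b" by (simp add: ddD add.commute)
  then have "dd a = dd u * b + u * dd b" using ab(4) bV(2) by simp
  then show ?thesis unfolding ab(4) using bV(2) by (simp add: field_simps power2_eq_square)
 qed
 moreover have "dd a * b - a * dd b \<in> V"
  using R(2) by (intro subsetD[OF R(2)] D(6) D(5) ddR ab)
 ultimately have "dd u \<in> V" using VD(5)[OF V] sring_power[OF V_ring[OF V] bV(1)] by metis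
 then have 1: "dd u / u \<in> V" using VD(5)[OF V _ uV(2)] by (simp add: divide_inverse)
 have "dd (zp tt n) / zp tt n \<in> V"
 proof -
  have nat: "dd (tt ^ i) / tt ^ i = - of_nat i" for i
  proof (induction i)
   case (Suc i)
   have "dd (a * b) / (a * b) = dd a / a + dd b / b" if "a \<noteq> 0" "b \<noteq> 0" for a b
    using that by (simp add: ddD field_simps)
   from this[of tt "tt ^ i"] have "dd (tt ^ Suc i) / tt ^ Suc i = dd tt / tt + dd (tt ^ i) / tt ^ i"
    using xx_nz by simp
   then show ?case using Suc xx_nz by (simp add: dd_tt)
  qed (simp add: ddD)
  have sub: "dd (a / b) / (a / b) = dd a / a - dd b / b" if "a \<noteq> 0" "b \<noteq> 0" for a b
  proof -
   have "dd (a / b * b) = dd (a / b) * b + a / b * dd b" by (simp only: ddD add.commute)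
   then have "dd a = dd (a / b) * b + a / b * dd b" using that by simp
   then show ?thesis using that by (simp add: field_simps)
  qed
  obtain i j where "n = int i - int j" by (rule int_diff_cases)
  then have "dd (zp tt n) / zp tt n = - of_nat i - - of_nat j"
   using sub[of "tt ^ i" "tt ^ j"] nat zp_diff_nat[of tt i j] xx_nz by simp
  moreover have "of_nat i \<in> V" "of_nat j \<in> V" using sring_of_nat[OF V_ring[OF V]] by blast+
  ultimately show ?thesis using VD(4,6)[OF V] by metis
 qed
 moreover have "dd c / c = dd (zp tt n) / zp tt n + dd u / u"
  unfolding u(3) using uV(3) zp_nonzero[of tt n] xx_nz by (simp add: ddD field_simps)
 ultimately show ?thesis using VD(3)[OF V _ 1] by metis
qed

text \<open>The values of c z^j and of 1 are distinct.\<close>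

lemma term_unit_free:
 assumes c: "c \<in> E1" and j: "0 < j" "j < \<q>" and i: "c * zz ^ j \<in> V" shows "c * zz ^ j \<in> mx V"
proof (rule ccontr)
 assume nm: "c * zz ^ j \<notin> mx V"
 have nz: "c * zz ^ j \<noteq> 0" using nm mx_0[OF V] by metis
 then have c0: "c \<noteq> 0" by auto
 have "veq V (c * zz ^ j) (1 * zz ^ 0)" using unit_veq_1[OF V i nm] by simp
 moreover have "\<not> veq V (c * zz ^ j) (1 * zz ^ 0)"
  by (rule term_distinct[OF V tt c sringD(2)[OF sfield_sring[OF E1_field]] j(2) q_pos _ nz]) (use j(1) in simp_all)
 ultimately show False by contradiction
qed

text \<open>The terms of the expansion of b in powers of z are integral, and each is differentiated
 separately.\<close>

lemma infinity_dd: assumes b: "b \<in> V" shows "inverse zz ^ (\<q> - 1) * dd b \<in> mx V"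
proof (cases "b = 0")
 case False
 obtain r where r: "\<q> = Suc r" "0 < r" using q_Suc by (metis zero_less_Suc)
 obtain c where c: "\<And>j. c j \<in> E1" "b = (\<Sum>j<\<q>. c j * zz ^ j)" using z_expansion by blast
 have zn: "zz \<notin> V" by (rule zz_notin[OF V tt])
 have z0: "zz \<noteq> 0" using zn VD(1)[OF V] by auto
 have iz: "inverse zz \<in> mx V" by (rule notin_mx[OF V zn])
 have ex: "\<exists>j<\<q>. c j \<noteq> 0"
 proof (rule ccontr)
  assume "\<not> ?thesis" then have "b = 0" unfolding c(2) by simp
  then show False using False by simp
 qed
 obtain i where i: "i < \<q>" "c i \<noteq> 0" "veq V (\<Sum>j<\<q>. c j * zz ^ j) (c i * zz ^ i)"
  "\<And>j. j < \<q> ==> j \<noteq> i ==> (c j * zz ^ j) / (c i * zz ^ i) \<in> mx V"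
  by (rule dominant_power[OF V tt c(1) ex]) blast
 have iV: "c i * zz ^ i \<in> V" using veq_in[OF V i(3)] b c(2) by simp
 have cV: "c j * zz ^ j \<in> V" if "j < \<q>" for j
 proof (cases "j = i")
  case False
  have "(c j * zz ^ j) / (c i * zz ^ i) * (c i * zz ^ i) \<in> V"
   using VD(5)[OF V mx_in[OF V i(4)[OF that False]] iV] .
  then show ?thesis using i(2) z0 by simp
 qed (use iV in simp)
 have "inverse zz ^ r * dd (c j * zz ^ j) \<in> mx V" if j: "j < \<q>" for j
 proof (cases "c j = 0")
  case True then show ?thesis using mx_0[OF V] by (simp add: ddD)
 next
  case cj: False
  have izr: "inverse zz ^ r \<in> mx V" by (rule power_mx[OF V iz r(2)])
  have "(c j * zz ^ j) * (dd (c j) / c j) \<in> V" by (rule VD(5)[OF V cV[OF j] E1_dlog[OF c(1) cj]])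
  then have "inverse zz ^ r * ((c j * zz ^ j) * (dd (c j) / c j)) \<in> mx V" by (rule mx_mult[OF V izr])
  then have A: "inverse zz ^ r * (dd (c j) * zz ^ j) \<in> mx V" using cj by (simp add: field_simps)
  have B: "inverse zz ^ r * (c j * dd (zz ^ j)) \<in> mx V"
  proof (cases j)
   case (Suc j')
   have "zz * dd (zz ^ j) = of_nat j * zz ^ j * dd zz" using deriv_power[OF dd(1), of zz j] by (simp add: mult_ac)
   then have "inverse zz ^ r * c j * (zz * dd (zz ^ j)) = inverse zz ^ r * c j * (of_nat j * zz ^ j * (of_nat \<m> * (zz ^ \<q> + zz)))"
    unfolding dd_zz zz_eq by simp
   then have "zz * (inverse zz ^ r * (c j * dd (zz ^ j))) = inverse zz ^ r * c j * (of_nat j * zz ^ j * (of_nat \<m> * (zz ^ \<q> + zz)))"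
    by (simp only: mult_ac)
   also have "... = zz * ((of_nat j * of_nat \<m>) * ((c j * zz ^ j) * (inverse zz ^ r * (zz ^ r + 1))))"
    unfolding r(1) by (simp add: algebra_simps)
   finally have "inverse zz ^ r * (c j * dd (zz ^ j)) = (of_nat j * of_nat \<m>) * ((c j * zz ^ j) * (inverse zz ^ r * (zz ^ r + 1)))"
    using z0 by (metis mult_left_cancel)
   also have "inverse zz ^ r * (zz ^ r + 1) = 1 + inverse zz ^ r" using z0 by (simp add: distrib_left power_inverse)
   finally have e: "inverse zz ^ r * (c j * dd (zz ^ j)) = (of_nat j * of_nat \<m>) * ((c j * zz ^ j) * (1 + inverse zz ^ r))" .
   have "c j * zz ^ j \<in> mx V" by (rule term_unit_free[OF c(1) _ j cV[OF j]]) (use Suc in simp)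
   moreover have "1 + inverse zz ^ r \<in> V" using VD(3)[OF V VD(2)[OF V] mx_in[OF V izr]] .
   moreover have "of_nat j * of_nat \<m> \<in> V"
    using VD(5)[OF V sring_of_nat[OF V_ring[OF V]] sring_of_nat[OF V_ring[OF V]]] .
   ultimately show ?thesis unfolding e using mx_mult[OF V] mx_mult'[OF V] by blast
  qed (use mx_0[OF V] in \<open>simp add: ddD\<close>)
  have "inverse zz ^ r * dd (c j * zz ^ j) = inverse zz ^ r * (dd (c j) * zz ^ j) + inverse zz ^ r * (c j * dd (zz ^ j))"
   by (simp add: ddD algebra_simps)
  then show ?thesis using mx_add[OF V A B] by simp
 qed
 then have "(\<Sum>j<n. inverse zz ^ r * dd (c j * zz ^ j)) \<in> mx V" if "n \<le> \<q>" for n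
  using that by (induction n) (auto intro: mx_0[OF V] mx_add[OF V])
 moreover have "inverse zz ^ r * dd b = (\<Sum>j<\<q>. inverse zz ^ r * dd (c j * zz ^ j))"
  unfolding c(2) by (simp only: sum_distrib_left deriv_sum[OF dd(1)])
 moreover have "\<q> - 1 = r" using r(1) by simp
 ultimately show ?thesis by (metis order_refl)
qed (use mx_0[OF V] in \<open>simp add: ddD\<close>)

end

text \<open>A place above infinity takes s to some root of t^q + t, and a translation moves this
 root to a.\<close>

lemma place_translate:
 assumes a: "a \<in> Om" obtains V where "valring V" "tt \<in> mx V" "ss - a \<in> mx V"
proof -
 obtain V where V: "valring V" "tt \<in> mx V" by (rule place_infinity)
 obtain rs where rs: "set rs \<subseteq> kf" "length rs = \<q>" "\<And>t. t ^ \<q> + t - 0 = prod_list (map (%r. t - r) rs)"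
  by (rule AS_split[OF kfD(1)]) (rule that)
 have "ss ^ \<q> + ss \<in> mx V" unfolding ss_eq by (rule power_mx[OF V]) (use mm_pos in simp)
 then have "prod_list (map (%r. ss - r) rs) \<in> mx V" using rs(3)[of ss] by simp
 moreover have "ss - b \<in> V" if "b \<in> set rs" for b using VD(6)[OF V(1) ss_in[OF V] V_kf[OF V(1)]] rs(1) that by blast
 ultimately obtain b where b: "b \<in> set rs" "ss - b \<in> mx V" using prod_list_mx[OF V(1), of rs "%r. ss - r"] by blast
 have "b ^ \<q> + b = 0" using rs(3)[of b] prod_list_root[OF b(1)] by simp
 then have bO: "b \<in> Om" using rs(1) b(1) by (auto simp: Om_def)
 have "a - b \<in> Om" using Om_add[OF a Om_minus[OF bO]] by simp
 then obtain f where f: "aut f" "typ1 f 1 (a - b) 0" using typ1_exists[OF mu_1 _ Om_0] by blast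
 note A = aut_valring[OF f(1) V(1)]
 have "f tt = tt" using f(2) by (simp add: autD(11)[OF f(1)] typ1_def)
 moreover have "f (ss - a) = ss - b" using f(2) autD(3)[OF f(1) OmD(1)[OF a]] by (simp add: autD(9)[OF f(1)] typ1_def algebra_simps)
 ultimately show ?thesis using A V(2) b(2) by (intro that[OF A(1)]) auto
qed

lemma R0_expansion:
 assumes "f \<in> R0" obtains d where "\<And>i j. d i j \<in> kf" "f = (\<Sum>j<\<q>. (\<Sum>i<\<q>. d i j * ss ^ i) * zz ^ j)"
proof -
 let ?S = "{f. \<exists>d. (\<forall>i j. d i j \<in> kf) \<and> f = (\<Sum>j<\<q>. (\<Sum>i<\<q>. d i j * ss ^ i) * zz ^ j)}"
 have "R0 \<subseteq> ?S" unfolding R0_def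
 proof (rule kspan_least)
  show "0 \<in> ?S" using kfD(1) by (intro CollectI exI[of _ "%i j. 0"]) simp
 next
  fix f g assume "f \<in> ?S" "g \<in> ?S"
  then obtain d e where d: "\<forall>i j. d i j \<in> kf" "f = (\<Sum>j<\<q>. (\<Sum>i<\<q>. d i j * ss ^ i) * zz ^ j)"
   and e: "\<forall>i j. e i j \<in> kf" "g = (\<Sum>j<\<q>. (\<Sum>i<\<q>. e i j * ss ^ i) * zz ^ j)" by blast
  show "f + g \<in> ?S" unfolding d(2) e(2)
   using d(1) e(1) kfD(3) by (intro CollectI exI[of _ "%i j. d i j + e i j"]) (simp add: distrib_right sum.distrib)
 next
  fix c f assume "c \<in> kf" "f \<in> ?S"
  then obtain d where d: "c \<in> kf" "\<forall>i j. d i j \<in> kf" "f = (\<Sum>j<\<q>. (\<Sum>i<\<q>. d i j * ss ^ i) * zz ^ j)" by blast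
  show "c * f \<in> ?S" unfolding d(3)
   using d(1,2) kfD(5) by (intro CollectI exI[of _ "%i j. c * d i j"]) (simp add: sum_distrib_left sum_distrib_right mult.assoc)
 next
  show "{mono 0 a b |a b. a < \<q> \<and> b < \<q>} \<subseteq> ?S"
  proof
   fix f assume "f \<in> {mono 0 a b |a b. a < \<q> \<and> b < \<q>}"
   then obtain a b where ab: "a < \<q>" "b < \<q>" "f = ss ^ a * zz ^ b" by (auto simp: mono_0)
   let ?d = "%i j. if i = a \<and> j = b then 1 else (0::'a)"
   have "(\<Sum>j<\<q>. (\<Sum>i<\<q>. ?d i j * ss ^ i) * zz ^ j) = (\<Sum>j<\<q>. if j = b then (\<Sum>i<\<q>. ?d i b * ss ^ i) * zz ^ b else 0)"
    by (intro sum.cong) auto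
   also have "... = (\<Sum>i<\<q>. ?d i b * ss ^ i) * zz ^ b" using ab(2) by simp
   also have "(\<Sum>i<\<q>. ?d i b * ss ^ i) = (\<Sum>i<\<q>. if i = a then ss ^ a else 0)" by (intro sum.cong) auto
   also have "... = ss ^ a" using ab(1) by simp
   finally show "f \<in> ?S" using ab(3) kfD(1,2) by (intro CollectI exI[of _ ?d]) auto
  qed
 qed
 then show ?thesis using assms that by blast
qed

lemma s_poly_E1: "(\<And>i. d i \<in> kf) ==> (\<Sum>i<n. d i * ss ^ i) \<in> E1"
 using sfield_sring[OF E1_field] E1_mem by (intro sring_sum[OF _ sringD(5)[OF _ _ sring_power]]) auto

text \<open>The coefficient of z^(q-1) is a polynomial in s of degree below q. By regularity it
 vanishes at the q values of s above infinity.\<close>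

lemma Vs_trace: assumes f: "f \<in> Vs" shows "Tz f = 0"
proof -
 obtain d where d: "\<And>i j. d i j \<in> kf" "f = (\<Sum>j<\<q>. (\<Sum>i<\<q>. d i j * ss ^ i) * zz ^ j)"
  using R0_expansion Vs_R0 f by blast
 define c where "c j = (\<Sum>i<\<q>. d i j * ss ^ i)" for j
 have cE: "c j \<in> E1" for j unfolding c_def by (rule s_poly_E1) (rule d)
 obtain r where r: "\<q> = Suc r" "0 < r" using q_Suc by (metis zero_less_Suc)
 have fe: "f = (\<Sum>j<\<q>. c j * zz ^ j)" unfolding d(2) c_def ..
 have root: "(\<Sum>i<\<q>. d i r * a ^ i) = 0" if a: "a \<in> Om" for a
 proof -
  obtain V where V: "valring V" "tt \<in> mx V" "ss - a \<in> mx V" by (rule place_translate[OF a])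
  have zn: "zz \<notin> V" by (rule zz_notin[OF V(1,2)])
  have z0: "zz \<noteq> 0" using zn VD(1)[OF V(1)] by auto
  have iz: "inverse zz \<in> mx V" by (rule notin_mx[OF V(1) zn])
  have cV: "c j \<in> V" for j unfolding c_def
   using sring_power[OF V_ring[OF V(1)] ss_in[OF V(1,2)]] V_kf[OF V(1) d(1)] VD(5)[OF V(1)]
   by (intro sring_sum[OF V_ring[OF V(1)]]) blast
  have "inverse zz ^ r * f \<in> mx V"
   by (rule HolD[OF _ V(1)]) (use f Vs_Hol infinity_dd[OF V(1,2)] r(1) in auto)
  moreover have "inverse zz ^ r * f = c r + (\<Sum>j<r. c j * inverse zz ^ (r - j))"
  proof -
   have "inverse zz ^ r * f = (\<Sum>j<\<q>. inverse zz ^ r * (c j * zz ^ j))" unfolding fe by (simp add: sum_distrib_left)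
   also have "... = inverse zz ^ r * (c r * zz ^ r) + (\<Sum>j<r. inverse zz ^ r * (c j * zz ^ j))"
    unfolding r(1) by (simp add: add.commute)
   also have "inverse zz ^ r * (c r * zz ^ r) = c r" using z0 by (simp add: power_inverse field_simps)
   also have "(\<Sum>j<r. inverse zz ^ r * (c j * zz ^ j)) = (\<Sum>j<r. c j * inverse zz ^ (r - j))"
   proof (rule sum.cong[OF refl])
    fix j assume "j \<in> {..<r}"
    then have "inverse zz ^ r = inverse zz ^ (r - j) * inverse zz ^ j" by (simp flip: power_add)
    then show "inverse zz ^ r * (c j * zz ^ j) = c j * inverse zz ^ (r - j)" using z0 by (simp add: power_inverse field_simps)
   qed
   finally show ?thesis .
  qed
  moreover have "(\<Sum>j<n. c j * inverse zz ^ (r - j)) \<in> mx V" if "n \<le> r" for n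
   using that
  proof (induction n)
   case (Suc n)
   have "c n * inverse zz ^ (r - n) \<in> mx V" using mx_mult'[OF V(1) cV power_mx[OF V(1) iz]] Suc.prems by simp
   then show ?case using Suc mx_add[OF V(1)] by simp
  qed (simp add: mx_0[OF V(1)])
  ultimately have crm: "c r \<in> mx V" using mx_diff[OF V(1)] by (metis add_diff_cancel_right' order_refl)
  define as where "as = map (%i. d i r) [0..<\<q>]"
  have as: "set as \<subseteq> kf" "length as = \<q>" "\<And>t. peval as t = (\<Sum>i<\<q>. d i r * t ^ i)"
   using d(1) by (auto simp: as_def peval_sum)
  have "peval as ss = (ss - a) * peval (sdiv a as) ss + peval as a" using sdiv[of as ss a] as(2) r(1) by auto
  moreover have "peval (sdiv a as) ss \<in> V"
   by (rule peval_in[OF V_ring[OF V(1)] _ ss_in[OF V(1,2)]])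
    (use sdiv_in[OF kf_ring as(1) OmD(1)[OF a]] V_kf[OF V(1)] in auto)
  ultimately have "peval as a \<in> mx V"
   using mx_diff[OF V(1) crm mx_mult[OF V(1,3)]] unfolding c_def as(3)[symmetric] by (metis add_diff_cancel_left')
  then show ?thesis using kf_mx[OF V(1) peval_in[OF kf_ring as(1) OmD(1)[OF a]]] as(3) by simp
 qed
 have "d i r = 0" if "i < \<q>" for i
  by (rule coeffs_zero_if_many_roots[OF card_Om(2), of \<q> "%i. d i r" i]) (use root card_Om(1) that in auto)
 then have "c r = 0" unfolding c_def by simp
 then show ?thesis unfolding fe using Tz_expansion[of c \<q>] cE r(1) by simp
qed

end

section \<open>Classification of the automorphisms\<close>

lemma nat_no_multiple: "coprime (int m) (int q) ==> 2 \<le> q ==> - int m \<noteq> n * int q"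
proof
 assume c: "coprime (int m) (int q)" "2 \<le> q" and e: "- int m = n * int q"
 have "int m = (- n) * int q" using e by simp
 then have "int q dvd int m" by (metis dvd_triv_right)
 then have "int q dvd 1" using c(1) by (metis coprime_common_divisor dvd_refl)
 then show False using c(2) by simp
qed

context cfield begin

lemma root_in_kf: assumes b: "b ^ n \<in> kf" and n: "0 < n" shows "b \<in> kf"
proof -
 obtain as where as: "set as \<subseteq> {0, - (b ^ n)}" "\<forall>t. peval (as @ [1]) t = t ^ n - b ^ n"
  using monom_peval[OF n] by blast
 have "set as \<subseteq> kf" using as(1) kfD(1) kfD(4)[OF b] by auto
 then obtain rs where rs: "set rs \<subseteq> kf" "\<forall>t. peval (as @ [1]) t = prod_list (map (%r. t - r) rs)"
  using monic_splits by metis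
 have "prod_list (map (%r. b - r) rs) = 0" using as(2) rs(2) by (metis diff_self)
 then have "b \<in> set rs" by (induction rs) auto
 then show ?thesis using rs(1) by blast
qed

lemma AS_zero_Om: assumes w: "w ^ \<q> + w = 0" shows "w \<in> Om"
proof -
 obtain rs where rs: "set rs \<subseteq> kf" "length rs = \<q>" "\<And>t. t ^ \<q> + t - 0 = prod_list (map (%r. t - r) rs)"
  by (rule AS_split[OF kfD(1)]) (rule that)
 have "prod_list (map (%r. w - r) rs) = 0" using rs(3)[of w] w by simp
 then have "w \<in> set rs" by (induction rs) auto
 then show ?thesis using rs(1) w by (auto simp: Om_def)
qed

lemma same_power: assumes "w ^ \<m> = v ^ \<m>" "v \<noteq> 0" obtains c where "c \<in> kf" "w = c * v"
proof -
 have "(w / v) ^ \<m> = 1" using assms by (simp add: power_divide)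
 then have "w / v \<in> kf" using root_in_kf[of "w / v" \<m>] kfD(2) mm_pos by simp
 then show ?thesis using that[of "w / v"] assms(2) by simp
qed

lemma aut_funpow: "aut f ==> aut (f ^^ n)"
 by (induction n) (simp_all add: aut_comp aut_id id_def)

text \<open>A translation has order dividing p, and 1 is the only p-th root of unity.\<close>

lemma Delta_eigen:
 assumes f: "aut f" "typ1 f 1 a b" and ab: "a \<in> Om" "b \<in> Om" and w: "w \<noteq> 0" "f w = c * w" "c \<in> kf"
 shows "f w = w"
proof -
 have "(f ^^ n) xx = xx \<and> (f ^^ n) ss = ss + of_nat n * a \<and> (f ^^ n) zz = zz + of_nat n * b \<and> (f ^^ n) w = c ^ n * w" for n
 proof (induction n)
  case (Suc n)
  have k: "f (of_nat n * a) = of_nat n * a" "f (of_nat n * b) = of_nat n * b" "f (c ^ n) = c ^ n"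
   using autD(3)[OF f(1)] kfD(5) sring_of_nat[OF kf_ring] sring_power[OF kf_ring w(3)] OmD(1) ab by auto
  show ?case using Suc f(2) k w(2) by (simp add: typ1_def autD(4,5)[OF f(1)] algebra_simps)
 qed simp
 from this[of \<p>] have p: "(f ^^ \<p>) xx = xx" "(f ^^ \<p>) ss = ss" "(f ^^ \<p>) zz = zz" "(f ^^ \<p>) w = c ^ \<p> * w"
  by (simp_all add: char_chp)
 then have "f ^^ \<p> = (%a. a)" by (intro aut_ext aut_funpow f(1) aut_id) simp_all
 then have "c ^ \<p> = 1 ^ \<p>" using p(4) w(1) by simp
 then show ?thesis using frobp_inj w(2) by force
qed

lemma aut_AS: assumes f: "aut f" shows "f ss ^ \<q> + f ss = inverse (f xx) ^ \<m>" "f zz ^ \<q> + f zz = f xx ^ \<m>"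
proof -
 have "f ss ^ \<q> + f ss = f (ss ^ \<q> + ss)" by (simp only: autD(4,10)[OF f])
 then show "f ss ^ \<q> + f ss = inverse (f xx) ^ \<m>" unfolding ss_eq by (simp only: autD(10,11)[OF f])
 have "f zz ^ \<q> + f zz = f (zz ^ \<q> + zz)" by (simp only: autD(4,10)[OF f])
 then show "f zz ^ \<q> + f zz = f xx ^ \<m>" unfolding zz_eq by (simp only: autD(10)[OF f])
qed

lemma Delta_xx:
 assumes g: "aut g" and f: "aut f" "typ1 f 1 a b" and ab: "a \<in> Om" "b \<in> Om"
  and fx: "f (g ss) = g ss \<or> f (g zz) = g zz"
 shows "f (g xx) = g xx"
proof -
 have x0: "g xx \<noteq> 0" by (rule aut_xx_nz[OF g])
 have "f (g xx) ^ \<m> = g xx ^ \<m>"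
  using fx
 proof
  assume "f (g ss) = g ss"
  then have "inverse (f (g xx)) ^ \<m> = inverse (g xx) ^ \<m>"
   using aut_AS(1)[OF aut_comp[OF f(1) g]] aut_AS(1)[OF g] by simp
  then show ?thesis by (simp add: power_inverse)
 next
  assume "f (g zz) = g zz"
  then show ?thesis using aut_AS(2)[OF aut_comp[OF f(1) g]] aut_AS(2)[OF g] by simp
 qed
 then obtain c where "c \<in> kf" "f (g xx) = c * g xx" using same_power[OF _ x0] by blast
 then show ?thesis using Delta_eigen[OF f ab x0] by blast
qed

lemma Delta_separate_1:
 assumes g: "aut g" and f: "aut f" "typ1 f 1 a b" and ab: "a \<in> Om" "b \<in> Om"
  and fx: "f (g ss) = g ss" "f (g zz) = g zz"
 shows "a = 0 \<and> b = 0"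
proof -
 have "f \<circ> g = g"
  using Delta_xx[OF g f ab] fx by (intro aut_ext aut_comp f(1) g) auto
 then have "f t = t" for t
  using bij_is_surj[OF autD(1)[OF g]] by (metis comp_apply surjD)
 then show ?thesis using f(2) by (simp add: typ1_def)
qed

lemma Delta_separate:
 assumes g: "aut g" and f: "aut f" "typ1 f 1 a b" and ab: "a \<in> Om" "b \<in> Om"
  and f': "aut f'" "typ1 f' 1 a' b'" and ab': "a' \<in> Om" "b' \<in> Om"
  and eq: "f (g ss) = f' (g ss)" "f (g zz) = f' (g zz)"
 shows "a = a' \<and> b = b'"
proof -
 let ?i = "inv_into UNIV f'"
 have i: "aut ?i" by (rule aut_inv[OF f'(1)])
 have if': "?i (f' t) = t" for t using bij_is_inj[OF autD(1)[OF f'(1)]] by simp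
 have fi: "f' (?i t) = t" for t using bij_is_surj[OF autD(1)[OF f'(1)]] by (simp add: surj_f_inv_f)
 have k: "?i c = c" if "c \<in> kf" for c by (rule autD(3)[OF i that])
 have x: "?i xx = xx" using if'[of xx] f'(2) by (simp add: typ1_def)
 have "?i (ss + a') = ss" using if'[of ss] f'(2) by (simp add: typ1_def)
 then have s: "?i ss = ss - a'" using k[OF OmD(1)[OF ab'(1)]] by (simp add: autD(4)[OF i] eq_diff_eq)
 have "?i (zz + b') = zz" using if'[of zz] f'(2) by (simp add: typ1_def)
 then have z: "?i zz = zz - b'" using k[OF OmD(1)[OF ab'(2)]] by (simp add: autD(4)[OF i] eq_diff_eq)
 have "typ1 (?i \<circ> f) 1 (a - a') (b - b')"
  using f(2) x s z k[OF OmD(1)[OF ab(1)]] k[OF OmD(1)[OF ab(2)]] by (simp add: typ1_def autD(4)[OF i] algebra_simps)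
 moreover have "a - a' \<in> Om" "b - b' \<in> Om" using Om_add[OF _ Om_minus] ab ab' by fastforce+
 ultimately have "a - a' = 0 \<and> b - b' = 0"
  using eq if' by (intro Delta_separate_1[OF g aut_comp[OF i f(1)]]) auto
 then show ?thesis by simp
qed

text \<open>Invariance under the translations of z, respectively of s.\<close>

definition Fz :: "'a => bool" where "Fz w \<longleftrightarrow> (\<forall>f. aut f --> f xx = xx --> f ss = ss --> f w = w)"
definition Fs :: "'a => bool" where "Fs w \<longleftrightarrow> (\<forall>f. aut f --> f xx = xx --> f zz = zz --> f w = w)"

lemma fixing_typ1:
 assumes f: "aut f" "f xx = xx" obtains a b where "a \<in> Om" "b \<in> Om" "typ1 f 1 a b" "f ss = ss + a" "f zz = zz + b"
proof -
 have "(f ss - ss) ^ \<q> + (f ss - ss) = (f ss ^ \<q> + f ss) - (ss ^ \<q> + ss)" unfolding frob_diff by (simp add: algebra_simps)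
 also have "... = 0" unfolding aut_AS(1)[OF f(1)] ss_eq f(2) by simp
 finally have a: "f ss - ss \<in> Om" by (rule AS_zero_Om)
 have "(f zz - zz) ^ \<q> + (f zz - zz) = (f zz ^ \<q> + f zz) - (zz ^ \<q> + zz)" unfolding frob_diff by (simp add: algebra_simps)
 also have "... = 0" unfolding aut_AS(2)[OF f(1)] zz_eq f(2) by simp
 finally have b: "f zz - zz \<in> Om" by (rule AS_zero_Om)
 show ?thesis by (rule that[OF a b]) (simp_all add: typ1_def f(2) algebra_simps)
qed

lemma Fz_Fs: assumes w: "Fz w" "Fs w" and f: "aut f" "f xx = xx" shows "f w = w"
proof -
 obtain a b where ab: "a \<in> Om" "b \<in> Om" "f ss = ss + a" "f zz = zz + b" by (rule fixing_typ1[OF f])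
 obtain f1 where f1: "aut f1" "typ1 f1 1 a 0" by (rule typ1_exists[OF mu_1 ab(1) Om_0])
 obtain f2 where f2: "aut f2" "typ1 f2 1 0 b" by (rule typ1_exists[OF mu_1 Om_0 ab(2)])
 have "f = f1 \<circ> f2"
  using f ab f1(2) f2(2) autD(3)[OF f1(1) OmD(1)[OF ab(2)]]
  by (intro aut_ext aut_comp f1(1) f2(1)) (auto simp: typ1_def autD(4)[OF f1(1)])
 moreover have "f2 w = w" using w(1) f2 by (auto simp: Fz_def typ1_def)
 moreover have "f1 w = w" using w(2) f1 by (auto simp: Fs_def typ1_def)
 ultimately show ?thesis by simp
qed

lemma uu_fixing: "f xx = xx ==> uu f = 1" using xx_nz by (simp add: uu_def dd(2))

lemma line_z: assumes g: "aut g" shows "Fz (g ss) \<or> Fz (g zz)"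
proof -
 let ?S = "%b. tz b (g ss)" and ?Z = "%b. tz b (g zz)" and ?w = "%b. tz b (uu g)"
 have t: "typ1 (tz b) 1 0 b" if "b \<in> Om" for b using tz(2-4)[OF that] by (simp add: typ1_def)
 have "(\<forall>i\<in>Om. \<forall>j\<in>Om. ?S i = ?S j) \<or> (\<forall>i\<in>Om. \<forall>j\<in>Om. ?Z i = ?Z j)"
 proof (rule moments_line[OF card_Om(2), of ?w "\<q> - 2"])
  show "Om \<noteq> {}" using Om_0 by blast
  show "?w b \<noteq> 0" if "b \<in> Om" for b using uu_nz[OF g] aut_eq_iff[OF tz(1)[OF that], of _ 0] autD(6)[OF tz(1)[OF that]] by auto
  show "card Om \<le> \<q> - 2 + 2" "1 \<le> \<q> - 2" using card_Om(1) q_ge3 by linarith+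
 next
  fix a b assume ab: "a \<le> \<q> - 2" "b \<le> \<q> - 2"
  have "a + 2 \<le> \<q>" "b + 2 \<le> \<q>" using ab q_ge3 by linarith+
  from Vs_trace[OF Vs_aut[OF g monomial_Vs[OF this]]]
  have "(\<Sum>i\<in>Om. tz i (g (ss ^ a * zz ^ b) * uu g)) = 0" by (simp only: Tz_def)
  moreover have "tz i (g (ss ^ a * zz ^ b) * uu g) = ?w i * (?S i ^ a * ?Z i ^ b)" if "i \<in> Om" for i
   by (simp add: autD(5,10)[OF g] autD(5,10)[OF tz(1)[OF that]] mult_ac)
  ultimately show "(\<Sum>i\<in>Om. ?w i * (?S i ^ a * ?Z i ^ b)) = 0" by simp
 next
  fix i j assume ij: "i \<in> Om" "j \<in> Om" "?S i = ?S j" "?Z i = ?Z j"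
  show "i = j" using Delta_separate[OF g tz(1)[OF ij(1)] t[OF ij(1)] Om_0 ij(1) tz(1)[OF ij(2)] t[OF ij(2)] Om_0 ij(2-4)] by blast
 qed
 moreover have "Fz w" if eq: "\<forall>i\<in>Om. \<forall>j\<in>Om. tz i w = tz j w" for w
  unfolding Fz_def
 proof (intro allI impI)
  fix f assume f: "aut f" "f xx = xx" "f ss = ss"
  obtain b where b: "b \<in> Om" "f zz = zz + b" using fixing_typ1[OF f(1,2)] by metis
  have "f = tz b" using f b tz[OF b(1)] by (intro aut_ext) auto
  moreover have "(%a. a) = tz 0" using tz[OF Om_0] by (intro aut_ext aut_id) auto
  ultimately show "f w = w" using eq b(1) Om_0 by metis
 qed
 ultimately show ?thesis by blast
qed

lemma line_s: assumes g: "aut g" shows "Fs (g zz) \<or> Fs (g ss)"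
proof -
 have t: "f tt = tt" if "aut f" "f xx = xx" for f using autD(11)[OF that(1), of xx] that(2) by simp
 show ?thesis using cfield.line_z[OF swap g] t unfolding cfield.Fz_def[OF swap] Fs_def by blast
qed

text \<open>The q^2 translations would send g z to pairwise distinct elements of the form g z + b,
 of which there are only q.\<close>

lemma not_both: assumes g: "aut g" "Fz (g ss)" "Fs (g ss)" shows False
proof -
 define G where "G = (%(a, b). SOME f. aut f \<and> typ1 f 1 a b)"
 have G: "aut (G (a, b))" "typ1 (G (a, b)) 1 a b" if "a \<in> Om" "b \<in> Om" for a b
 proof -
  obtain f where "aut f" "typ1 f 1 a b" using typ1_exists[OF mu_1 \<open>a \<in> Om\<close> \<open>b \<in> Om\<close>] by blast
  then have "aut f \<and> typ1 f 1 a b" by blast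
  from someI[of "%f. aut f \<and> typ1 f 1 a b", OF this] show "aut (G (a, b))" "typ1 (G (a, b)) 1 a b" by (auto simp: G_def)
 qed
 have Gs: "G (a, b) (g ss) = g ss" if "a \<in> Om" "b \<in> Om" for a b
  using Fz_Fs[OF g(2,3) G(1)[OF that]] G(2)[OF that] by (simp add: typ1_def)
 let ?h = "%ab. G ab (g zz) - g zz"
 have "?h ` (Om \<times> Om) \<subseteq> Om"
 proof
  fix w assume "w \<in> ?h ` (Om \<times> Om)"
  then obtain a b where ab: "a \<in> Om" "b \<in> Om" "w = ?h (a, b)" by auto
  note A = G(1)[OF ab(1,2)]
  have x: "G (a, b) (g xx) = g xx" using Delta_xx[OF g(1) A G(2)[OF ab(1,2)] ab(1,2)] Gs[OF ab(1,2)] by blast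
  have "w ^ \<q> + w = (G (a, b) (g zz) ^ \<q> + G (a, b) (g zz)) - (g zz ^ \<q> + g zz)"
   unfolding ab(3) frob_diff by (simp add: algebra_simps)
  also have "... = 0" using aut_AS(2)[OF aut_comp[OF A g(1)]] aut_AS(2)[OF g(1)] x by simp
  finally show "w \<in> Om" by (rule AS_zero_Om)
 qed
 moreover have "inj_on ?h (Om \<times> Om)"
 proof (rule inj_onI)
  fix c d assume "c \<in> Om \<times> Om" "d \<in> Om \<times> Om" and eq: "?h c = ?h d"
  then obtain a b a' b' where ab: "c = (a, b)" "a \<in> Om" "b \<in> Om" "d = (a', b')" "a' \<in> Om" "b' \<in> Om" by auto
  have "G (a, b) (g ss) = G (a', b') (g ss)" using Gs ab by simp
  moreover have "G (a, b) (g zz) = G (a', b') (g zz)" using eq unfolding ab(1,4) by (metis diff_add_cancel)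
  ultimately have "a = a' \<and> b = b'"
   by (rule Delta_separate[OF g(1) G[OF ab(2,3)] ab(2,3) G[OF ab(5,6)] ab(5,6)])
  then show "c = d" using ab by simp
 qed
 ultimately have "card (Om \<times> Om) \<le> card Om" by (intro card_inj_on_le[of ?h] card_Om(2))
 then have "\<q> * \<q> \<le> \<q> * 1" by (simp add: card_cartesian_product card_Om(1))
 then show False using q_ge3 by (simp only: mult_le_cancel1) linarith
qed

lemma s_poly:
 assumes w: "w \<in> R0" "Fz w" obtains d where "\<And>i. d i \<in> kf" "w = (\<Sum>i<\<q>. d i * ss ^ i)"
proof -
 obtain d where d: "\<And>i j. d i j \<in> kf" "w = (\<Sum>j<\<q>. (\<Sum>i<\<q>. d i j * ss ^ i) * zz ^ j)"
  using R0_expansion w(1) by blast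
 have wE: "w \<in> E1" by (rule fixed_Dz) (use w(2) in \<open>auto simp: Fz_def typ1_def\<close>)
 have "(\<Sum>i<\<q>. d i 0 * ss ^ i) = (if (0::nat) = 0 then w else 0)"
 proof (rule z_unique[of "%j. \<Sum>i<\<q>. d i j * ss ^ i" "%j. if j = 0 then w else 0" 0])
  show "(\<Sum>i<\<q>. d i j * ss ^ i) \<in> E1" for j :: nat by (rule s_poly_E1) (rule d)
  show "(if j = 0 then w else 0) \<in> E1" for j :: nat using wE sringD(1)[OF sfield_sring[OF E1_field]] by simp
  have "(\<Sum>j<\<q>. (if j = 0 then w else 0) * zz ^ j) = (\<Sum>j<\<q>. if j = 0 then w else 0)" by (intro sum.cong) auto
  also have "... = w" using q_pos by simp
  finally show "(\<Sum>j<\<q>. (\<Sum>i<\<q>. d i j * ss ^ i) * zz ^ j) = (\<Sum>j<\<q>. (if j = 0 then w else 0) * zz ^ j)"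
   using d(2) by simp
 qed (rule q_pos)
 then show ?thesis using that[of "%i. d i 0"] d(1) by simp
qed

lemma s_poly_const:
 assumes d: "\<And>i. d i \<in> kf" and w: "w \<in> E0" "w = (\<Sum>i<\<q>. d i * ss ^ i)" shows "w \<in> kf"
proof -
 let ?c = "%i. d i - (if i = 0 then w else 0)"
 have "(\<Sum>i<\<q>. ?c i * ss ^ i) = (\<Sum>i<\<q>. d i * ss ^ i) - (\<Sum>i<\<q>. if i = 0 then w else 0)"
  by (simp only: left_diff_distrib sum_minus) (simp add: if_distrib[of "%u. u * _"] cong: if_cong)
 also have "... = 0" using w(2) q_pos by simp
 finally have z: "(\<Sum>i<\<q>. ?c i * ss ^ i) = 0" .
 note ED = sringD[OF sfield_sring[OF E0_field]]
 have "?c i \<in> E0" for i using ED(6)[OF E0_mem(1)[OF d]] w(1) ED(1) by simp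
 then have "?c 0 = 0" using s_independent[OF _ z q_pos] E0_Ez by blast
 then show ?thesis using d[of 0] by simp
qed

lemma s_poly_dd:
 assumes d: "\<And>i. d i \<in> kf" obtains e where "\<And>i. e i \<in> kf" "dd (\<Sum>i<\<q>. d i * ss ^ i) = (\<Sum>i<\<q>. e i * ss ^ i) * dd ss"
proof -
 let ?w = "\<Sum>i<\<q>. (d i * of_nat i) * ss ^ (i - 1)"
 have "?w \<in> span_ext kf ss \<q>"
 proof (rule span_ext_sum[OF kf_ring])
  fix i assume "i \<in> {..<\<q>}"
  then have "ss ^ (i - 1) \<in> span_ext kf ss \<q>" by (intro span_ext_power[OF kf_ring]) auto
  moreover have "d i * of_nat i \<in> kf" by (rule kfD(5)[OF d sring_of_nat[OF kf_ring]])
  ultimately show "(d i * of_nat i) * ss ^ (i - 1) \<in> span_ext kf ss \<q>" by (intro span_ext_ops(3)[OF kf_ring])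
 qed
 then obtain e where e: "\<forall>i. e i \<in> kf" "?w = (\<Sum>i<\<q>. e i * ss ^ i)" by (auto simp: span_ext_def)
 have p: "dd (ss ^ i) = of_nat i * ss ^ (i - 1) * dd ss" for i
 proof (cases i)
  case (Suc j)
  then show ?thesis using deriv_power_Suc[OF dd(1), of ss j] by simp
 qed (simp add: ddD)
 have "dd (\<Sum>i<\<q>. d i * ss ^ i) = (\<Sum>i<\<q>. d i * (of_nat i * ss ^ (i - 1) * dd ss))"
  by (simp only: deriv_sum[OF dd(1)] dd_kf[OF d] p)
 also have "... = ?w * dd ss" by (simp add: sum_distrib_right mult.assoc)
 finally show ?thesis using that[of e] e by simp
qed

text \<open>At x = 0 the value of s would be that of a q-th power.\<close>

lemma no_AS: assumes e: "e \<in> kf" "e \<noteq> 0" shows "v ^ \<q> + v \<noteq> e * ss"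
proof
 assume eq: "v ^ \<q> + v = e * ss"
 obtain V where V: "valring V" "xx \<in> mx V" using valring_trans[OF trans_xx] by blast
 have V': "valring V" "inverse tt \<in> mx V" using V by simp_all
 have ie: "inverse e \<in> V" "e \<in> V" using V_kf[OF V(1)] sfield_inverse[OF kf e(1)] e(1) by auto
 have sn: "ss \<notin> V" by (rule cfield.zz_notin[OF swap V'])
 have vn: "v \<notin> V"
 proof
  assume "v \<in> V"
  then have "e * ss \<in> V" unfolding eq[symmetric] by (intro VD(3)[OF V(1)] sring_power[OF V_ring[OF V(1)]])
  then have "inverse e * (e * ss) \<in> V" by (rule VD(5)[OF V(1) ie(1)])
  then show False using sn e(2) by (simp flip: mult.assoc)
 qed
 have v0: "v \<noteq> 0" using vn VD(1)[OF V(1)] by auto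
 obtain n where n: "veq V (v ^ \<q>) (zp xx n)" using cfield.any_value[OF swap V' v0] by auto
 have s0: "ss \<noteq> 0" using sn VD(1)[OF V(1)] by auto
 have "veq V ss (e * ss)" using e(2) s0 ie by (simp add: veq_def field_simps)
 then have "veq V ss (v ^ \<q>)" using AS_value[OF V(1) vn] veq_trans[OF V(1)] unfolding eq by blast
 then have "veq V ss (zp xx n)" using n veq_trans[OF V(1)] by blast
 then have "veq V (ss ^ \<q>) (zp xx n ^ \<q>)" by (rule veq_power[OF V(1)])
 moreover have "veq V (ss ^ \<q>) (zp xx (- int \<m>))" using cfield.zz_value[OF swap V'] by simp
 ultimately have "veq V (zp xx (- int \<m>)) (zp xx (n * int \<q>))"
  using veq_trans[OF V(1)] veq_sym[OF V(1)] zp_mult_nat[OF xx_nz] by metis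
 then have "- int \<m> = n * int \<q>" using veq_zp_inj[OF V xx_nz] by blast
 moreover have "2 \<le> \<q>" using q_ge3 by linarith
 ultimately show False using nat_no_multiple[OF coprime_mq] by blast
qed

text \<open>Since g x is invariant, so is uu g, which is then constant; hence g s is a polynomial in
 s. Comparing derivatives gives g x = c x, and no_AS shows that g s - t s is a root of t^q +
 t.\<close>

lemma typ1_if_fixed: assumes g: "aut g" "Fz (g ss)" "Fs (g zz)" shows "g \<in> Gal"
proof -
 let ?X = "g xx" and ?u = "uu g"
 have X0: "?X \<noteq> 0" by (rule aut_xx_nz[OF g(1)])
 have "Fz ?X" unfolding Fz_def
 proof (intro allI impI)
  fix f assume f: "aut f" "f xx = xx" "f ss = ss"
  obtain a b where "a \<in> Om" "b \<in> Om" "typ1 f 1 a b" by (rule fixing_typ1[OF f(1,2)])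
  then show "f ?X = ?X" using Delta_xx[OF g(1) f(1)] g(2) f unfolding Fz_def by blast
 qed
 moreover have "Fs ?X" unfolding Fs_def
 proof (intro allI impI)
  fix f assume f: "aut f" "f xx = xx" "f zz = zz"
  obtain a b where "a \<in> Om" "b \<in> Om" "typ1 f 1 a b" by (rule fixing_typ1[OF f(1,2)])
  then show "f ?X = ?X" using Delta_xx[OF g(1) f(1)] g(3) f unfolding Fs_def by blast
 qed
 ultimately have FX: "f ?X = ?X" if "aut f" "f xx = xx" for f using Fz_Fs that by blast
 have Fu: "f ?u = ?u" if f: "aut f" "f xx = xx" for f
  using aut_dd[OF f(1), of ?X] uu_fixing[of f] f(2) FX[OF f] by (simp add: uu_def autD(12)[OF f(1)])
 have E0I: "w \<in> E0" if "\<And>f. aut f ==> f xx = xx ==> f w = w" for w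
  by (rule fixed_Delta) (use that in \<open>auto simp: typ1_def\<close>)
 have uV: "?u \<in> Vs" using Vs_aut[OF g(1) monomial_Vs[of 0 0]] q_ge3 by (simp add: autD(7)[OF g(1)])
 have uk: "?u \<in> kf"
 proof -
  have "Fz ?u" unfolding Fz_def using Fu by blast
  then obtain d where "\<And>i. d i \<in> kf" "?u = (\<Sum>i<\<q>. d i * ss ^ i)" using s_poly[OF subsetD[OF Vs_R0 uV]] by blast
  moreover have "?u \<in> E0" by (rule E0I) (rule Fu)
  ultimately show ?thesis using s_poly_const by blast
 qed
 have u0: "?u \<noteq> 0" by (rule uu_nz[OF g(1)])
 have "g ss * ?u \<in> R0" using Vs_aut[OF g(1) monomial_Vs[of 1 0]] q_ge3 Vs_R0 by auto
 then have "inverse ?u * (g ss * ?u) \<in> R0" by (rule R0_ops(4)[OF sfield_inverse[OF kf uk]])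
 then have "g ss \<in> R0" using u0 by (simp add: mult.left_commute)
 then obtain d where d: "\<And>i. d i \<in> kf" "g ss = (\<Sum>i<\<q>. d i * ss ^ i)" using s_poly[OF _ g(2)] by blast
 obtain e where e: "\<And>i. e i \<in> kf" "dd (g ss) = (\<Sum>i<\<q>. e i * ss ^ i) * dd ss"
  unfolding d(2) by (rule s_poly_dd[of d]) (use d(1) in blast)+
 define D where "D = (\<Sum>i<\<q>. e i * ss ^ i)"
 have gm: "g (of_nat \<m>) = of_nat \<m>" by (rule autD(3)[OF g(1) sring_of_nat[OF kf_ring]])
 have "dd (g ss) = ?u * - (of_nat \<m> * inverse ?X ^ \<m>)"
  unfolding aut_dd[OF g(1)] dd_ss by (simp only: autD(5,8,10,11)[OF g(1)] gm)
 then have "of_nat \<m> * (D * tt ^ \<m>) = of_nat \<m> * (?u * inverse ?X ^ \<m>)"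
  using e(2) unfolding D_def[symmetric] dd_ss by (simp add: mult_ac)
 then have DX: "D * tt ^ \<m> = ?u * inverse ?X ^ \<m>" using m_nz by simp
 then have De: "D = ?u * inverse ?X ^ \<m> * xx ^ \<m>" using xx_nz by (simp add: field_simps)
 have "D \<in> E0"
 proof (rule E0I)
  fix f assume f: "aut f" "f xx = xx"
  show "f D = D" unfolding De using f(2) FX[OF f] Fu[OF f] by (simp only: autD(5,10,11)[OF f(1)])
 qed
 then have Dk: "D \<in> kf" using s_poly_const[of e D] e(1) D_def by blast
 have D0: "D \<noteq> 0" using De u0 X0 xx_nz by simp
 have "(?X / xx) ^ \<m> = ?u / D" unfolding De using xx_nz X0 u0 by (simp add: power_divide field_simps)
 then have ck: "?X / xx \<in> kf" using root_in_kf[of "?X / xx" \<m>] sfield_divide[OF kf uk Dk] mm_pos by simp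
 define c where "c = ?X / xx"
 have c: "c \<in> kf" "c \<noteq> 0" "?X = c * xx" using ck X0 xx_nz by (simp_all add: c_def)
 define r where "r = inverse c ^ \<m>"
 have rk: "r \<in> kf" unfolding r_def by (rule sring_power[OF kf_ring sfield_inverse[OF kf c(1)]])
 have Seq: "g ss ^ \<q> + g ss = r * (ss ^ \<q> + ss)"
  unfolding aut_AS(1)[OF g(1)] ss_eq c(3) r_def by (simp add: power_mult_distrib)
 \<comment> \<open>The multiple of \<open>s\<close> is chosen to cancel the \<open>q\<close>-th powers.\<close>
 obtain t where t: "t \<in> kf" "t ^ \<q> = r" using kf_q_root[OF rk] by blast
 define v where "v = g ss - t * ss"
 have "v ^ \<q> + v = (g ss ^ \<q> + g ss) - r * ss ^ \<q> - t * ss"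
  unfolding v_def frob_diff power_mult_distrib t(2) by (simp add: algebra_simps)
 then have "v ^ \<q> + v = (r - t) * ss" unfolding Seq by (simp add: algebra_simps)
 then have rt: "r - t = 0" and v0: "v ^ \<q> + v = 0"
  using no_AS[of "r - t" v] kfD(6)[OF rk t(1)] by auto
 have rq: "r ^ \<q> = r" using rt t(2) by simp
 have vO: "v \<in> Om" by (rule AS_zero_Om[OF v0])
 have cm: "(c ^ \<m>) ^ \<q> = c ^ \<m>" using rq unfolding r_def by (simp add: power_inverse)
 have "c \<in> mu"
 proof -
  obtain s where s: "\<q> = Suc s" using q_pos gr0_implies_Suc by blast
  have "c ^ \<m> * (c ^ \<m>) ^ s = c ^ \<m> * 1" using cm unfolding s by simp
  then have "(c ^ \<m>) ^ s = 1" using c(2) by simp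
  then have "c ^ (\<m> * (\<q> - Suc 0)) = 1" unfolding s by (simp add: power_mult)
  then show ?thesis using c(1) by (simp add: mu_def)
 qed
 moreover have "g zz - c ^ \<m> * zz \<in> Om"
 proof (rule AS_zero_Om)
  have "(g zz - c ^ \<m> * zz) ^ \<q> + (g zz - c ^ \<m> * zz) = (g zz ^ \<q> + g zz) - c ^ \<m> * (zz ^ \<q> + zz)"
   unfolding frob_diff power_mult_distrib cm by (simp add: algebra_simps)
  also have "... = 0" unfolding aut_AS(2)[OF g(1)] zz_eq c(3) by (simp add: power_mult_distrib)
  finally show "(g zz - c ^ \<m> * zz) ^ \<q> + (g zz - c ^ \<m> * zz) = 0" .
 qed
 moreover have "typ1 g c v (g zz - c ^ \<m> * zz)"
  using c(3) rt by (simp add: typ1_def v_def r_def algebra_simps)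
 ultimately show ?thesis using g(1) vO unfolding Gal_def by blast
qed

lemma classification:
 assumes g: "aut g" and x: "aut x" "x xx = tt" "x ss = zz" "x zz = ss"
 shows "g \<in> Gal \<or> g \<circ> x \<in> Gal"
proof -
 note gx = aut_comp[OF g x(1)]
 consider "Fz (g ss)" "Fs (g zz)" | "Fz (g zz)" "Fs (g ss)" | "Fz (g ss)" "Fs (g ss)" | "Fz (g zz)" "Fs (g zz)"
  using line_z[OF g] line_s[OF g] by blast
 then show ?thesis
 proof cases
  case 1 then show ?thesis using typ1_if_fixed[OF g] by blast
 next
  case 2 then show ?thesis using typ1_if_fixed[OF gx] x by simp
 next
  case 3 then show ?thesis using not_both[OF g] by blast
 next
  case 4 then show ?thesis using not_both[OF gx] x by simp
 qed
qed

end

section \<open>Existence of the second Artin-Schreier generator\<close>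

lemma int_half_coprime: "coprime (int (Suc k)) (int (Suc (2 * k) * k))"
proof -
 have "coprime (Suc k) k" by simp
 moreover have "coprime (Suc k) (Suc (2 * k))"
 proof (rule coprimeI)
  fix d assume d: "d dvd Suc k" "d dvd Suc (2 * k)"
  then have "d dvd 2 * Suc k - Suc (2 * k)" by (intro dvd_diff_nat dvd_mult)
  then show "is_unit d" by simp
 qed
 ultimately have "coprime (Suc k) (Suc (2 * k) * k)" by (simp only: coprime_mult_right_iff)
 then show ?thesis by (simp only: coprime_int_iff)
qed

lemma int_minus_minus: "- (- i) = (i::int)" by simp

lemma nat_size_half: "q = Suc (2 * k) ==> q \<noteq> 3 ==> 3 \<le> q ==> q < q * (k::nat)"
 by (cases k; cases "k - 1") auto

context ffield begin

text \<open>In a shorter relation all terms would have distinct values.\<close>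

lemma degree_from_value:
 assumes V: "valring V" and t: "t \<in> mx V" "t \<noteq> 0"
  and a: "a \<noteq> 0" "veq V (a ^ n) (zp t (- int l))" and cop: "coprime (int l) (int n)" "0 < n"
  and bs: "set bs \<subseteq> fgen (insert t kf)" "peval (bs @ [1]) a = 0"
 shows "n \<le> length bs"
proof (rule ccontr)
 assume short: "\<not> n \<le> length bs"
 define d where "d i = (bs @ [1]) ! i" for i
 have E: "sring (fgen (insert t kf))" by (rule sfield_sring[OF sfield_fgen])
 have dE: "d i \<in> fgen (insert t kf)" if "i \<le> length bs" for i
 proof -
  have "d i \<in> set (bs @ [1])" unfolding d_def using that by (intro nth_mem) simp
  then show ?thesis using bs(1) sringD(2)[OF E] by auto
 qed
 let ?f = "%i. d i * a ^ i"
 have val: "\<exists>e. veq V (?f i ^ n) (zp t (e * int n - int l * int i))" if i: "i \<le> length bs" "?f i \<noteq> 0" for i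
 proof -
  have "d i \<noteq> 0" using i(2) by auto
  then obtain e where e: "veq V (d i) (zp t e)" using rational_value[OF V t dE[OF i(1)]] by blast
  have "?f i ^ n = d i ^ n * (a ^ n) ^ i" by (simp add: power_mult_distrib power_swap[of a i])
  moreover have "veq V (d i ^ n * (a ^ n) ^ i) (zp t e ^ n * zp t (- int l) ^ i)"
   by (intro veq_mult[OF V] veq_power[OF V] e a(2))
  moreover have "zp t e ^ n * zp t (- int l) ^ i = zp t (e * int n - int l * int i)"
   using zp_mult_nat[OF t(2), of e n] zp_mult_nat[OF t(2), of "- int l" i] zp_add[OF t(2), of "e * int n" "- int l * int i"]
   by simp
  ultimately show ?thesis by metis
 qed
 have "\<exists>i\<in>{..length bs}. ?f i \<noteq> 0" using a(1) by (intro bexI[of _ "length bs"]) (auto simp: d_def nth_append)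
 then obtain i where "veq V (sum ?f {..length bs}) (?f i)"
 proof (rule dominant_term[OF V finite_atMost, rotated])
  fix i j assume ij: "i \<in> {..length bs}" "j \<in> {..length bs}" "i \<noteq> j" "?f i \<noteq> 0" "?f j \<noteq> 0"
  show "\<not> veq V (?f i) (?f j)"
  proof
   assume "veq V (?f i) (?f j)"
   then have "veq V (?f i ^ n) (?f j ^ n)" by (rule veq_power[OF V])
   moreover obtain e where e: "veq V (?f i ^ n) (zp t (e * int n - int l * int i))" using val[of i] ij by auto
   moreover obtain e' where e': "veq V (?f j ^ n) (zp t (e' * int n - int l * int j))" using val[of j] ij by auto
   ultimately have "veq V (zp t (e * int n - int l * int i)) (zp t (e' * int n - int l * int j))"
    using veq_trans[OF V] veq_sym[OF V] by meson
   then have "e * int n - int l * int i = e' * int n - int l * int j" by (rule veq_zp_inj[OF V t])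
   then have "i = j" by (rule value_congruence[OF cop(1)]) (use ij(1,2) short in auto)
   then show False using ij(3) by contradiction
  qed
 qed blast
 moreover have "sum ?f {..length bs} = peval (bs @ [1]) a"
  unfolding peval_sum d_def by (intro sum.cong) auto
 ultimately show False using bs(2) by (simp add: veq_def)
qed

lemma split_off_root:
 assumes x: "trans x" and q: "q = chp TYPE('a) ^ h" "odd (chp TYPE('a))" "1 \<le> h" "q \<noteq> 3" and m: "1 \<le> m"
  and y: "y ^ q + y = x ^ m + inverse (x ^ m)"
  and irr: "set bs \<subseteq> fgen (insert (x ^ (m * (q - Suc 0))) kf)" "peval (bs @ [1]) (y * x ^ m) = 0"
   "finite T" "length bs \<le> card T"
   "\<And>b cs. b \<in> T ==> set cs \<subseteq> fgen (insert (x ^ (m * (q - Suc 0))) kf) ==> peval cs (y * x ^ m) = 0 ==> peval cs b = 0"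
 shows "\<exists>z. z ^ q + z = x ^ m"
proof -
 note fa = frobenius_add[OF prime_chp char_chp, of _ _ h, folded q(1)]
 note fd = frobenius_diff[OF prime_chp char_chp q(2), of _ _ h, folded q(1)]
 have "chp TYPE('a) \<noteq> 2" using q(2) by auto
 then have "3 \<le> chp TYPE('a)" using prime_ge_2_nat[OF prime_chp] by linarith
 moreover have "chp TYPE('a) ^ 1 \<le> chp TYPE('a) ^ h" using q(3) calculation by (intro power_increasing) auto
 ultimately have q3: "3 \<le> q" using q(1) by simp
 have "odd q" using q(1,2) by simp
 then obtain k where k: "q = Suc (2 * k)" by (metis oddE Suc_eq_plus1)
 have k0: "0 < k" using q3 k by simp
 define X1 where "X1 = x ^ m"
 define w where "w = X1 ^ (2 * k)"
 define a where "a = y * X1"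
 let ?H = "fgen (insert w kf)"
 have x0: "x \<noteq> 0" by (rule trans_nonzero[OF x])
 have X0: "X1 \<noteq> 0" "w \<noteq> 0" using x0 by (simp_all add: X1_def w_def)
 have wx: "x ^ (m * (q - Suc 0)) = w" by (simp add: w_def X1_def k power_mult)
 note irr = irr[unfolded wx X1_def[symmetric] a_def[symmetric]]
 have Xq: "X1 ^ q = w * X1" by (simp add: w_def k mult.commute)
 have "a ^ q = (y ^ q + y) * (w * X1) - w * a" unfolding a_def power_mult_distrib Xq by (simp add: algebra_simps)
 also have "(y ^ q + y) * (w * X1) = w * X1 ^ 2 + w"
  unfolding y X1_def[symmetric] using X0 by (simp add: field_simps power2_eq_square)
 finally have aq: "a ^ q + w * a - w = w * X1 ^ 2" by simp
 have wk: "(w * X1 ^ 2) ^ k = w ^ Suc k"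
  unfolding w_def by (simp add: power_mult_distrib mult.commute flip: power_mult)
 let ?P = "%t. (t ^ q + w * t - w) ^ k - w ^ Suc k"
 have HR: "sring ?H" by (rule sfield_sring[OF sfield_fgen])
 have wH: "w \<in> ?H" using fgen_incl[of "insert w kf"] by blast
 have "?P \<in> polys ?H"
  by (intro polys_diff polys_power polys_add polys_scale polys_id polys_const HR wH sring_power)
 then obtain cs where cs: "set cs \<subseteq> ?H" "?P = peval cs" by (auto simp: polys_def)
 \<comment> \<open>A conjugate \<open>b\<close> satisfies the equation of \<open>a\<close> up to a factor \<open>g\<close> with \<open>g\<^sup>q\<^sup>-\<^sup>1 = 1\<close>.\<close>
 have "?P a = 0" using aq wk by simp
 then have "peval cs a = 0" using cs(2) by metis
 then have root: "?P b = 0" if "b \<in> T" for b using irr(5)[OF that cs(1)] cs(2) by metis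
 show ?thesis
 proof (cases "\<exists>b\<in>T. b ^ q + w * b - w \<noteq> w * X1 ^ 2")
  case True
  then obtain b where b: "b \<in> T" "b ^ q + w * b - w \<noteq> w * X1 ^ 2" by blast
  define g where "g = (b ^ q + w * b - w) / (w * X1 ^ 2)"
  have bq: "b ^ q + w * b - w = g * (w * X1 ^ 2)" using X0 by (simp add: g_def)
  have "g ^ k * w ^ Suc k = w ^ Suc k" using root[OF b(1)] unfolding bq power_mult_distrib[of g] wk by simp
  then have "g ^ k = 1" using X0(2) by simp
  moreover have "2 * k = k + k" by simp
  ultimately have "g ^ q = g" unfolding k by (simp only: power_Suc power_add) simp
  then have g1: "(g - 1) ^ q = g - 1" unfolding fd by simp
  have gn: "g - 1 \<noteq> 0" using b(2) bq by auto
  define d where "d = (b - a) / X1"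
  have "(b - a) ^ q + w * (b - a) = (b ^ q + w * b - w) - (a ^ q + w * a - w)" unfolding fd by (simp add: algebra_simps)
  also have "... = (g - 1) * (w * X1 ^ 2)" unfolding bq aq by (simp add: algebra_simps)
  finally have e: "(b - a) ^ q + w * (b - a) = (g - 1) * (w * X1 ^ 2)" .
  have "(d ^ q + d) * (w * X1) = (b - a) ^ q + w * (b - a)"
   unfolding d_def power_divide Xq using X0 by (simp add: field_simps)
  also have "... = ((g - 1) * X1) * (w * X1)" unfolding e by (simp add: power2_eq_square mult_ac)
  finally have d: "d ^ q + d = (g - 1) * X1" using X0 by simp
  have "(d / (g - 1)) ^ q + d / (g - 1) = (d ^ q + d) / (g - 1)" unfolding power_divide g1 by (simp add: add_divide_distrib)
  also have "... = X1" unfolding d using gn by simp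
  finally show ?thesis unfolding X1_def by blast
 next
  case False
  have "card T \<le> q"
  proof -
   have "(%t. t ^ q + w * t - w - w * X1 ^ 2) = (%t. t ^ q + (w * t + (- w - w * X1 ^ 2)))" by (simp add: algebra_simps)
   obtain r where r: "q = Suc (Suc r)" using q3 by (metis numeral_3_eq_3 Suc_le_D Suc_le_mono)
   let ?as = "(- w - w * X1 ^ 2) # w # replicate r 0"
   have "peval (replicate r 0 @ [1]) t = t ^ r" for t by (induction r) simp_all
   then have "peval (?as @ [1]) t = t ^ q + w * t - w - w * X1 ^ 2" for t
    unfolding r by (simp add: algebra_simps)
   then have "card T \<le> length ?as" using False by (intro monic_roots_le[OF irr(3)]) simp
   then show ?thesis using r by simp
  qed
  obtain V where V: "valring V" "inverse x \<in> mx V" using valring_trans[OF trans_inverse[OF x]] by blast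
  have iX: "inverse X1 \<in> mx V" using power_mx[OF V, of m] m by (simp add: X1_def power_inverse)
  have iw: "inverse w \<in> mx V" "inverse w \<noteq> 0" using power_mx[OF V(1) iX, of "2 * k"] k0 X0 by (simp_all add: w_def power_inverse)
  have Xn: "X1 \<notin> V" using inverse_mx[OF V(1) iX] X0 by simp
  have "inverse X1 / X1 \<in> mx V" using mx_mult[OF V(1) iX mx_in[OF V(1) iX]] by (simp add: divide_inverse)
  then have vX: "veq V (X1 + inverse X1) X1" by (rule veq_add[OF V(1) X0(1)])
  have yn: "y \<notin> V"
  proof
   assume "y \<in> V"
   then have "y ^ q + y \<in> V" using VD(3)[OF V(1)] sring_power[OF V_ring[OF V(1)]] by blast
   then have "X1 + inverse X1 \<in> V" unfolding y X1_def .
   then show False using veq_in[OF V(1) vX] Xn by blast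
  qed
  have y0: "y \<noteq> 0" using yn VD(1)[OF V(1)] by auto
  have "y / y ^ q = inverse y ^ (2 * k)" unfolding k using y0 by (simp add: power_inverse divide_inverse flip: mult.assoc)
  moreover have "inverse y ^ (2 * k) \<in> mx V" using power_mx[OF V(1) notin_mx[OF V(1) yn]] k0 by simp
  ultimately have "veq V (y ^ q + y) (y ^ q)" using veq_add[OF V(1)] y0 by simp
  then have yX: "veq V (y ^ q) X1" using vX veq_trans[OF V(1)] veq_sym[OF V(1)] unfolding y X1_def by blast
  have "veq V (y ^ q * X1 ^ q) (X1 * X1 ^ q)" by (rule veq_mult[OF V(1) yX veq_refl[OF V(1)]]) (use X0 in simp)
  then have "veq V ((a ^ q) ^ k) ((X1 * X1 ^ q) ^ k)" unfolding a_def power_mult_distrib[of y X1 q] by (rule veq_power[OF V(1)])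
  moreover have "(X1 * X1 ^ q) ^ k = w ^ Suc k"
  proof -
   have "X1 * X1 ^ q = w * X1 ^ 2" unfolding Xq by (simp add: power2_eq_square mult_ac)
   then show ?thesis using wk by simp
  qed
  moreover have "w ^ Suc k = zp (inverse w) (- int (Suc k))" using zp_nat[of w "Suc k"] by (simp only: zp_inverse_base int_minus_minus)
  ultimately have av: "veq V (a ^ (q * k)) (zp (inverse w) (- int (Suc k)))" by (simp only: power_mult)
  have aH: "?H \<subseteq> fgen (insert (inverse w) kf)"
  proof (rule fgen_least[OF sfield_fgen])
   show "insert w kf \<subseteq> fgen (insert (inverse w) kf)"
    using fgen_incl[of "insert (inverse w) kf"] sfield_inverse[OF sfield_fgen, of "inverse w" "insert (inverse w) kf"] by auto
  qed
  have "q * k \<le> length bs"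
  proof (rule degree_from_value[OF V(1) iw _ av])
   show "a \<noteq> 0" using y0 X0 by (simp add: a_def)
   show "coprime (int (Suc k)) (int (q * k))" unfolding k by (rule int_half_coprime)
   show "0 < q * k" using q3 k0 by simp
  qed (use irr(1,2) aH in auto)
  then show ?thesis using irr(4) \<open>card T \<le> q\<close> nat_size_half[OF k q(4) q3] by linarith
 qed
qed

end

section \<open>Structure of the automorphism group\<close>

lemma nat_square: "n * n = (n::nat) ^ 2" by (rule power2_eq_square[symmetric])

lemma semidirect_tower:
 fixes G (structure)
 assumes G: "group G" and D: "D \<lhd> G" and C: "subgroup C G" and t: "t \<in> carrier G" "t \<otimes> t = \<one>" "t \<notin> C"
  and conj: "\<And>c. c \<in> C ==> t \<otimes> c \<otimes> t \<in> C"
  and DC: "D \<inter> C \<subseteq> {\<one>}" "\<And>c. c \<in> C ==> c \<otimes> t \<notin> D"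
  and span: "\<And>g. g \<in> carrier G ==> \<exists>d\<in>D. \<exists>c\<in>C. g = d \<otimes> c \<or> g = d \<otimes> c \<otimes> t"
 shows "group.ord G t = 2"
  and "let B = C <#> generate G {t} in
   internal_semidirect (G\<lparr>carrier := B\<rparr>) C (generate G {t}) \<and> internal_semidirect G D B"
proof -
 interpret group G by (rule G)
 note Cc = subgroup.mem_carrier[OF C] and Cm = subgroup.m_closed[OF C] and C1 = subgroup.one_closed[OF C]
 have t1: "t \<noteq> \<one>" using t(3) C1 by blast
 have it: "inv t = t" using t inv_equality by blast
 show "ord t = 2"
 proof (rule ord_unique[THEN iffD2, OF t(1), rule_format])
  fix n :: nat
  show "t [^] n = \<one> \<longleftrightarrow> 2 dvd n"
  proof (induction n rule: nat_less_induct)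
   case (1 n)
   show ?case
   proof (cases "n < 2")
    case True
    then have "n = 0 \<or> n = 1" by auto
    then show ?thesis using t1 t(1) by auto
   next
    case False
    then obtain j where j: "n = Suc (Suc j)" by (metis Suc_le_D add_2_eq_Suc le_add_diff_inverse linorder_not_less)
    have "t [^] n = t [^] j" using t(1,2) by (simp add: j m_assoc)
    then show ?thesis using 1 j by simp
   qed
  qed
 qed
 have tc: "t \<otimes> c = (t \<otimes> c \<otimes> t) \<otimes> t" if "c \<in> C" for c using Cc[OF that] t(1,2) by (simp add: m_assoc)
 have T: "subgroup {\<one>, t} G"
  by (rule subgroupI) (use t(1,2) it in auto)
 have gen: "generate G {t} = {\<one>, t}"
 proof
  show "generate G {t} \<subseteq> {\<one>, t}" by (rule generate_subgroup_incl[OF _ T]) simp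
  show "{\<one>, t} \<subseteq> generate G {t}" by (auto intro: generate.one generate.incl)
 qed
 define B where "B = C <#> {\<one>, t}"
 have Bdef: "B = C \<union> (%c. c \<otimes> t) ` C" using Cc by (auto simp: B_def set_mult_def)
 have CB: "C \<subseteq> B" by (simp add: Bdef)
 have tB: "t \<in> B" using C1 t(1) unfolding Bdef by (intro UnI2 image_eqI[of _ _ \<one>]) auto
 have Ct: "c \<otimes> t \<in> B" if "c \<in> C" for c using that by (simp add: Bdef)
 have B: "subgroup B G"
 proof (rule subgroupI)
  show "B \<subseteq> carrier G" using Cc t(1) by (auto simp: Bdef)
  show "B \<noteq> {}" using tB by blast
 next
  fix a assume "a \<in> B"
  then consider "a \<in> C" | c where "c \<in> C" "a = c \<otimes> t" by (auto simp: Bdef)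
  then show "inv a \<in> B"
  proof cases
   case 1 then show ?thesis using subgroup.m_inv_closed[OF C] CB by blast
  next
   case 2
   have ic: "inv c \<in> C" by (rule subgroup.m_inv_closed[OF C 2(1)])
   have "inv a = t \<otimes> inv c" using 2 t(1) Cc it by (simp add: inv_mult_group)
   also have "... = (t \<otimes> inv c \<otimes> t) \<otimes> t" by (rule tc[OF ic])
   finally show ?thesis using Ct[OF conj[OF ic]] by simp
  qed
 next
  fix a b assume "a \<in> B" "b \<in> B"
  then obtain c d where ab: "c \<in> C" "d \<in> C" "a = c \<or> a = c \<otimes> t" "b = d \<or> b = d \<otimes> t" by (auto simp: Bdef)
  note cd = Cc[OF ab(1)] Cc[OF ab(2)] t(1)
  have "c \<otimes> t \<otimes> d = c \<otimes> (t \<otimes> d \<otimes> t) \<otimes> t" using cd t(2) by (simp add: m_assoc)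
  moreover have "c \<otimes> t \<otimes> (d \<otimes> t) = c \<otimes> (t \<otimes> d \<otimes> t)" "c \<otimes> (d \<otimes> t) = c \<otimes> d \<otimes> t" using cd by (simp_all add: m_assoc)
  moreover have "c \<otimes> d \<in> C" "c \<otimes> (t \<otimes> d \<otimes> t) \<in> C" using Cm conj ab(1,2) by blast+
  ultimately show "a \<otimes> b \<in> B" using ab(3,4) CB Ct by auto
 qed
 let ?B = "G\<lparr>carrier := B\<rparr>"
 interpret B: group ?B by (rule subgroup.subgroup_is_group[OF B G])
 have CsB: "subgroup C ?B" by (rule subgroup_incl[OF C B CB])
 have "internal_semidirect ?B C {\<one>, t}"
  unfolding internal_semidirect_def
 proof (intro conjI)
  show "C \<lhd> ?B"
  proof (rule B.normal_invI[OF CsB])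
   fix x c assume x: "x \<in> carrier ?B" and c: "c \<in> C"
   then obtain d where d: "d \<in> C" "x = d \<or> x = d \<otimes> t" by (auto simp: Bdef)
   have xB: "x \<in> B" using x by simp
   have "x \<otimes> c \<otimes> inv x \<in> C"
    using d(2)
   proof
    assume "x = d" then show ?thesis using Cm subgroup.m_inv_closed[OF C] d(1) c by simp
   next
    assume xd: "x = d \<otimes> t"
    have "x \<otimes> c \<otimes> inv x = d \<otimes> (t \<otimes> c \<otimes> t) \<otimes> inv d"
     unfolding xd using Cc[OF d(1)] Cc[OF c] t(1) it by (simp add: inv_mult_group m_assoc)
    then show ?thesis using Cm[OF Cm[OF d(1) conj[OF c]] subgroup.m_inv_closed[OF C d(1)]] by simp
   qed
   then show "x \<otimes>\<^bsub>?B\<^esub> c \<otimes>\<^bsub>?B\<^esub> inv\<^bsub>?B\<^esub> x \<in> C" using m_inv_consistent[OF B xB] by simp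
  qed
  show "subgroup {\<one>, t} ?B" by (rule subgroup_incl[OF T B]) (use tB CB C1 in auto)
  show "C \<inter> {\<one>, t} = {\<one>\<^bsub>?B\<^esub>}" using C1 t(3) by auto
  show "C <#>\<^bsub>?B\<^esub> {\<one>, t} = carrier ?B" unfolding B_def by (simp add: set_mult_def)
 qed
 moreover have "internal_semidirect G D B"
  unfolding internal_semidirect_def
 proof (intro conjI D B)
  have "\<one> \<in> D" using D by (simp add: normal_def subgroup.one_closed)
  then show "D \<inter> B = {\<one>}" using DC C1 by (auto simp: Bdef)
  have Dc: "D \<subseteq> carrier G" using D by (simp add: normal_def subgroup.subset)
  show "D <#> B = carrier G"
  proof
   show "D <#> B \<subseteq> carrier G" using Dc subgroup.subset[OF B] by (auto simp: set_mult_def)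
   show "carrier G \<subseteq> D <#> B"
   proof
    fix g assume "g \<in> carrier G"
    then obtain d c where dc: "d \<in> D" "c \<in> C" "g = d \<otimes> c \<or> g = d \<otimes> c \<otimes> t" using span by blast
    moreover have "d \<otimes> c \<otimes> t = d \<otimes> (c \<otimes> t)" using dc Dc Cc t(1) by (simp add: m_assoc subsetD)
    ultimately show "g \<in> D <#> B" using CB Ct by (auto simp: set_mult_def)
   qed
  qed
 qed
 ultimately show "let B = C <#> generate G {t} in
   internal_semidirect (G\<lparr>carrier := B\<rparr>) C (generate G {t}) \<and> internal_semidirect G D B"
  by (simp add: gen B_def)
qed

context cfield begin

lemma xx_image: assumes f: "aut f" shows "\<exists>c\<in>kf. f xx = c * xx \<or> f xx = c * tt"
proof -
 obtain x where x: "aut x" "x xx = tt" "x ss = zz" "x zz = ss" by (rule xi_exists)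
 from classification[OF f x] show ?thesis
 proof
  assume "f \<in> Gal" then show ?thesis using muD(1) by (auto simp: Gal_def typ1_def)
 next
  assume "f \<circ> x \<in> Gal"
  then obtain c where c: "c \<in> mu" "f tt = c * xx" using x(2) by (auto simp: Gal_def typ1_def)
  then have "f xx = inverse c * tt" using autD(11)[OF f, of xx] by (metis inverse_inverse_eq inverse_mult_distrib)
  then show ?thesis using sfield_inverse[OF kf muD(1)[OF c(1)]] by blast
 qed
qed

lemma tt_not_multiple: "c \<in> kf ==> tt \<noteq> c * xx"
proof
 assume c: "c \<in> kf" "tt = c * xx"
 have "c * xx ^ 2 = 1" using c(2) xx_nz by (simp add: power2_eq_square flip: mult.assoc) (metis c(2) left_inverse)
 then have "xx ^ 2 = inverse c" by (metis inverse_unique mult.commute)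
 then have "xx ^ 2 \<in> kf" using sfield_inverse[OF kf c(1)] by simp
 then have "xx \<in> kf" by (rule root_in_kf) simp
 then show False using trans_notin[OF trans_xx] by contradiction
qed

text \<open>The group is abstract and acts through P, so that the result applies to automorphisms
 represented as extensional functions.\<close>

lemma automorphism_group_structure:
 fixes G :: "('g, 'h) monoid_scheme" (structure) and P :: "'g => 'a => 'a"
 assumes G: "group G" and P: "inj_on P (carrier G)" "P ` carrier G = {f. aut f}"
  and Pm: "\<And>g h. g \<in> carrier G ==> h \<in> carrier G ==> P (g \<otimes> h) = P g \<circ> P h"
  and D_def: "D = {g \<in> carrier G. \<exists>a\<in>Om. \<exists>b\<in>Om. typ1 (P g) 1 a b}"
 shows "\<exists>C t. elementary_abelian \<p> (G\<lparr>carrier := D\<rparr>) \<and> card D = \<q> ^ 2 \<and>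
   subgroup C G \<and> cyclic_group (G\<lparr>carrier := C\<rparr>) \<and> card C = \<n> \<and>
   t \<in> carrier G \<and> P t xx = tt \<and> P t ss = zz \<and> P t zz = ss \<and> group.ord G t = 2 \<and>
   (let B = C <#> generate G {t} in
    internal_semidirect (G\<lparr>carrier := B\<rparr>) C (generate G {t}) \<and> internal_semidirect G D B)"
proof -
 interpret group G by (rule G)
 have Pa: "aut (P g)" if "g \<in> carrier G" for g using P(2) that by blast
 have ex: "\<exists>g\<in>carrier G. P g = f" if "aut f" for f using P(2) that by (metis (mono_tags) imageE mem_Collect_eq)
 have eqI: "g = h" if "g \<in> carrier G" "h \<in> carrier G" "P g xx = P h xx" "P g ss = P h ss" "P g zz = P h zz" for g h
  using inj_onD[OF P(1) aut_ext[OF Pa Pa]] that by blast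
 have P1: "P \<one> = (%a. a)"
 proof
  fix a
  have "P \<one> (P \<one> a) = P \<one> a" using Pm[OF one_closed one_closed] by (metis comp_apply one_closed r_one)
  then show "P \<one> a = a" using aut_eq_iff[OF Pa[OF one_closed]] by blast
 qed
 have Pi: "P (inv g) (P g a) = a" if "g \<in> carrier G" for g a
  using Pm[OF inv_closed[OF that] that] l_inv[OF that] P1 by (metis comp_apply)
 have t1_eq: "g = h" if "g \<in> carrier G" "h \<in> carrier G" "typ1 (P g) c a b" "typ1 (P h) c a b" for g h c a b
  using that by (intro eqI) (auto simp: typ1_def)
 have t1_ex: "\<exists>g\<in>carrier G. typ1 (P g) c a b" if "c \<in> mu" "a \<in> Om" "b \<in> Om" for c a b
  using typ1_exists[OF that] ex by metis
 have t1_one: "typ1 (P \<one>) 1 0 0" by (simp add: P1 typ1_def)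
 have t1_mult: "typ1 (P (g \<otimes> h)) (c * c') (inverse c' ^ \<m> * a + a') (c' ^ \<m> * b + b')"
  if "g \<in> carrier G" "typ1 (P g) c a b" "h \<in> carrier G" "typ1 (P h) c' a' b'" "c \<in> mu" "c' \<in> mu"
   "a \<in> Om" "b \<in> Om" "a' \<in> Om" "b' \<in> Om" for g h c c' a b a' b'
  unfolding Pm[OF that(1,3)] by (rule typ1_comp(1)[OF Pa[OF that(1)] that(2) Pa[OF that(3)] that(4-10)])
 have DI: "g \<in> D \<longleftrightarrow> g \<in> carrier G \<and> P g xx = xx" for g
 proof
  assume "g \<in> carrier G \<and> P g xx = xx"
  then show "g \<in> D" using fixing_typ1[OF Pa, of g] unfolding D_def by blast
 qed (auto simp: D_def typ1_def)
 have "D \<lhd> G"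
 proof (rule normal_invI)
  show "subgroup D G"
  proof (rule subgroupI)
   show "D \<subseteq> carrier G" using DI by blast
   have "\<one> \<in> D" using DI P1 by simp
   then show "D \<noteq> {}" by blast
   show "inv g \<in> D" if "g \<in> D" for g using that Pi[of g xx] by (simp add: DI)
   show "g \<otimes> h \<in> D" if "g \<in> D" "h \<in> D" for g h using that by (simp add: DI Pm)
  qed
 next
  fix g d assume g: "g \<in> carrier G" and d: "d \<in> D"
  have dc: "d \<in> carrier G" "P d xx = xx" using d by (simp_all add: DI)
  note ad = Pa[OF dc(1)]
  obtain c where c: "c \<in> kf" "P (inv g) xx = c * xx \<or> P (inv g) xx = c * tt" using xx_image[OF Pa[OF inv_closed[OF g]]] by blast
  have "P d (P (inv g) xx) = P (inv g) xx"
   using c(2) autD(3)[OF ad c(1)] dc(2) by (auto simp: autD(5,11)[OF ad])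
  moreover have "P g (P (inv g) xx) = xx" using Pi[OF inv_closed[OF g]] g by simp
  ultimately show "g \<otimes> d \<otimes> inv g \<in> D" using g dc(1) by (simp add: DI Pm)
 qed
 define C where "C = {g \<in> carrier G. \<exists>c\<in>mu. typ1 (P g) c 0 0}"
 have C_mult: "typ1 (P (g \<otimes> h)) (c * c') 0 0"
  if "g \<in> carrier G" "typ1 (P g) c 0 0" "h \<in> carrier G" "typ1 (P h) c' 0 0" "c \<in> mu" "c' \<in> mu" for g h c c'
  using t1_mult[OF that Om_0 Om_0 Om_0 Om_0] by simp
 have C_inv: "typ1 (P (inv g)) (inverse c) 0 0" if g: "g \<in> carrier G" "typ1 (P g) c 0 0" "c \<in> mu" for g c
 proof -
  obtain h where h: "h \<in> carrier G" "typ1 (P h) (inverse c) 0 0" using t1_ex[OF mu_inverse[OF g(3)] Om_0 Om_0] by blast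
  have "typ1 (P (h \<otimes> g)) 1 0 0" using C_mult[OF h g(1,2) mu_inverse[OF g(3)] g(3)] mu_nz[OF g(3)] by simp
  then have "h \<otimes> g = \<one>" using t1_eq[OF _ one_closed _ t1_one] h(1) g(1) by blast
  then have "inv g = h" by (rule inv_equality[OF _ g(1) h(1)])
  then show ?thesis using h(2) by simp
 qed
 have C: "subgroup C G"
 proof (rule subgroupI)
  show "C \<subseteq> carrier G" by (auto simp: C_def)
  have "\<one> \<in> C" using t1_one mu_1 by (auto simp: C_def)
  then show "C \<noteq> {}" by blast
  show "inv g \<in> C" if "g \<in> C" for g using that C_inv mu_inverse unfolding C_def by blast
  show "g \<otimes> h \<in> C" if "g \<in> C" "h \<in> C" for g h using that C_mult mu_mult unfolding C_def by blast
 qed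
 obtain x where x: "aut x" "x xx = tt" "x ss = zz" "x zz = ss" by (rule xi_exists)
 obtain t where t: "t \<in> carrier G" "P t = x" using ex[OF x(1)] by blast
 have xt: "x tt = xx" using autD(11)[OF x(1), of xx] x(2) by simp
 have tt1: "t \<otimes> t = \<one>" using t x xt by (intro eqI) (simp_all add: Pm P1)
 have tC: "t \<notin> C"
 proof
  assume "t \<in> C"
  then obtain c where "c \<in> mu" "tt = c * xx" using t(2) x(2) by (auto simp: C_def typ1_def)
  then show False using tt_not_multiple muD(1) by blast
 qed
 have conj: "t \<otimes> c \<otimes> t \<in> C" if cC: "c \<in> C" for c
 proof -
  obtain e where e: "c \<in> carrier G" "e \<in> mu" "typ1 (P c) e 0 0" using cC by (auto simp: C_def)
  note ac = Pa[OF e(1)]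
  have k: "x e = e" "x (e ^ \<m>) = e ^ \<m>" "x (inverse e ^ \<m>) = inverse e ^ \<m>"
   using autD(3)[OF x(1)] muD(1)[OF e(2)] mu_m_kf[OF e(2)] by auto
  have "P c tt = inverse e * tt" using e(3) autD(11)[OF ac, of xx] by (simp add: typ1_def mult.commute)
  then have "typ1 (P (t \<otimes> c \<otimes> t)) (inverse e) 0 0"
   using e t x xt k by (simp add: Pm typ1_def autD(5,11)[OF x(1)])
  then show ?thesis using e(1) t(1) mu_inverse[OF e(2)] by (auto simp: C_def)
 qed
 have DC: "D \<inter> C \<subseteq> {\<one>}"
 proof
  fix g assume "g \<in> D \<inter> C"
  then obtain c where g: "g \<in> carrier G" "P g xx = xx" "c \<in> mu" "typ1 (P g) c 0 0" by (auto simp: DI C_def)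
  then have "c = 1" using xx_nz by (simp add: typ1_def)
  then show "g \<in> {\<one>}" using t1_eq[OF g(1) one_closed _ t1_one] g(4) by blast
 qed
 have CtD: "c \<otimes> t \<notin> D" if cC: "c \<in> C" for c
 proof
  assume D: "c \<otimes> t \<in> D"
  obtain e where e: "c \<in> carrier G" "e \<in> mu" "typ1 (P c) e 0 0" using cC by (auto simp: C_def)
  have "P c tt = xx" using D e(1) t x by (simp add: DI Pm)
  then have "inverse (e * xx) = xx" using e(3) autD(11)[OF Pa[OF e(1)], of xx] by (simp add: typ1_def)
  then have "inverse e * tt = xx" by (simp add: mult.commute)
  then have "e * (inverse e * tt) = e * xx" by simp
  then have "tt = e * xx" using mu_nz[OF e(2)] by (simp flip: mult.assoc)
  then show False using tt_not_multiple muD(1)[OF e(2)] by blast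
 qed
 have split: "\<exists>d\<in>D. \<exists>c\<in>C. g = d \<otimes> c" if g: "g \<in> carrier G" "P g \<in> Gal" for g
 proof -
  obtain e a b where e: "e \<in> mu" "typ1 (P g) e a b" using g(2) by (auto simp: Gal_def)
  obtain c where c: "c \<in> carrier G" "typ1 (P c) e 0 0" using t1_ex[OF e(1) Om_0 Om_0] by blast
  have "P (inv c) xx = inverse e * xx" using C_inv[OF c e(1)] by (simp add: typ1_def)
  moreover have "P g (inverse e) = inverse e" using autD(3)[OF Pa[OF g(1)] muD(1)[OF mu_inverse[OF e(1)]]] .
  ultimately have "P (g \<otimes> inv c) xx = xx"
   using e(2) mu_nz[OF e(1)] g(1) c(1) by (simp add: Pm autD(5)[OF Pa[OF g(1)]] typ1_def flip: mult.assoc)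
  then have "g \<otimes> inv c \<in> D" using g(1) c(1) by (simp add: DI)
  moreover have "c \<in> C" using c e(1) by (auto simp: C_def)
  moreover have "g = g \<otimes> inv c \<otimes> c" using g(1) c(1) by (simp add: m_assoc)
  ultimately show ?thesis by blast
 qed
 have span: "\<exists>d\<in>D. \<exists>c\<in>C. g = d \<otimes> c \<or> g = d \<otimes> c \<otimes> t" if g: "g \<in> carrier G" for g
  using classification[OF Pa[OF g] x]
 proof
  assume "P g \<in> Gal" then show ?thesis using split[OF g] by blast
 next
  assume "P g \<circ> x \<in> Gal"
  then have "P (g \<otimes> t) \<in> Gal" using Pm[OF g t(1)] t(2) by simp
  then obtain d c where dc: "d \<in> D" "c \<in> C" "g \<otimes> t = d \<otimes> c" using split[of "g \<otimes> t"] g t(1) by auto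
  have "g = g \<otimes> t \<otimes> t" using g t(1) tt1 by (simp add: m_assoc)
  then show ?thesis using dc by metis
 qed
 note tower = semidirect_tower[OF G \<open>D \<lhd> G\<close> C t(1) tt1 tC conj DC CtD span]
 have Ds: "subgroup D G" using \<open>D \<lhd> G\<close> by (simp add: normal_def)
 have t1_D: "typ1 (P (g \<otimes> h)) 1 (a + a') (b + b')"
  if "g \<in> carrier G" "typ1 (P g) 1 a b" "h \<in> carrier G" "typ1 (P h) 1 a' b'" "a \<in> Om" "b \<in> Om" "a' \<in> Om" "b' \<in> Om"
  for g h a b a' b'
  using t1_mult[OF that(1-4) mu_1 mu_1 that(5-8)] by simp
 have "elementary_abelian \<p> (G\<lparr>carrier := D\<rparr>)"
  unfolding elementary_abelian_def
 proof (intro conjI ballI)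
  show "Factorial_Ring.prime \<p>" by (rule prime_chp)
  interpret D: group "G\<lparr>carrier := D\<rparr>" by (rule subgroup.subgroup_is_group[OF Ds G])
  show "comm_group (G\<lparr>carrier := D\<rparr>)"
  proof (rule D.group_comm_groupI)
   fix g h assume "g \<in> carrier (G\<lparr>carrier := D\<rparr>)" "h \<in> carrier (G\<lparr>carrier := D\<rparr>)"
   then obtain a b a' b' where gh: "g \<in> carrier G" "a \<in> Om" "b \<in> Om" "typ1 (P g) 1 a b"
    "h \<in> carrier G" "a' \<in> Om" "b' \<in> Om" "typ1 (P h) 1 a' b'" by (auto simp: D_def)
   have "typ1 (P (g \<otimes> h)) 1 (a + a') (b + b')" using t1_D gh by blast
   moreover have "typ1 (P (h \<otimes> g)) 1 (a + a') (b + b')" using t1_D[OF gh(5,8,1,4,6,7,2,3)] by (simp only: add.commute)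
   ultimately have "g \<otimes> h = h \<otimes> g" using t1_eq gh(1,5) by blast
   then show "g \<otimes>\<^bsub>G\<lparr>carrier := D\<rparr>\<^esub> h = h \<otimes>\<^bsub>G\<lparr>carrier := D\<rparr>\<^esub> g" by simp
  qed
  fix g assume "g \<in> carrier (G\<lparr>carrier := D\<rparr>)"
  then obtain a b where g: "g \<in> carrier G" "a \<in> Om" "b \<in> Om" "typ1 (P g) 1 a b" by (auto simp: D_def)
  have Om_mult: "of_nat n * a \<in> Om" if "a \<in> Om" for n a
   using that by (induction n) (simp_all add: Om_0 Om_add distrib_right)
  have "typ1 (P (g [^] n)) 1 (of_nat n * a) (of_nat n * b)" for n :: nat
  proof (induction n)
   case 0 then show ?case using t1_one by simp
  next
   case (Suc n)
   have "typ1 (P (g [^] n \<otimes> g)) 1 (of_nat n * a + a) (of_nat n * b + b)"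
    by (rule t1_D[OF _ Suc g(1,4) Om_mult[OF g(2)] Om_mult[OF g(3)] g(2,3)]) (use g(1) in simp)
   then show ?case by (simp add: distrib_right add.commute)
  qed
  from this[of \<p>] have "typ1 (P (g [^] \<p>)) 1 0 0" by (simp add: char_chp)
  then have "g [^] \<p> = \<one>" using t1_eq[OF _ one_closed _ t1_one] g(1) by blast
  then show "g [^]\<^bsub>G\<lparr>carrier := D\<rparr>\<^esub> \<p> = \<one>\<^bsub>G\<lparr>carrier := D\<rparr>\<^esub>"
   using nat_pow_consistent[of g \<p> D] by simp
 qed
 moreover have "card D = \<q> ^ 2"
 proof -
  let ?h = "%g. (P g ss - ss, P g zz - zz)"
  have "?h ` D = Om \<times> Om"
  proof
   show "?h ` D \<subseteq> Om \<times> Om" by (auto simp: D_def typ1_def)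
   show "Om \<times> Om \<subseteq> ?h ` D"
   proof
    fix ab assume "ab \<in> Om \<times> Om"
    then obtain a b where ab: "ab = (a, b)" "a \<in> Om" "b \<in> Om" by auto
    obtain g where g: "g \<in> carrier G" "typ1 (P g) 1 a b" using t1_ex[OF mu_1 ab(2,3)] by blast
    have "P g xx = xx" "P g ss = ss + a" "P g zz = zz + b" using g(2) by (simp_all add: typ1_def)
    then have "g \<in> D" "ab = ?h g" using g(1) by (simp_all add: DI ab(1))
    then show "ab \<in> ?h ` D" by (rule rev_image_eqI)
   qed
  qed
  moreover have "inj_on ?h D"
  proof (rule inj_onI)
   fix g h assume gh: "g \<in> D" "h \<in> D" "?h g = ?h h"
   have cancel: "u = v" if "u - w = v - w" for u v w :: 'a
    using arg_cong[OF that, of "%t. t + w"] by (simp only: diff_add_cancel)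
   have "P g ss = P h ss" "P g zz = P h zz" using cancel gh(3) unfolding prod.inject by blast+
   then show "g = h" using gh(1,2) by (intro eqI) (simp_all add: DI)
  qed
  then have "card (?h ` D) = card D" by (rule card_image)
  ultimately have "card D = card (Om \<times> Om)" by (simp only:)
  then show ?thesis by (simp only: card_cartesian_product card_Om(1) nat_square)
 qed
 moreover have "cyclic_group (G\<lparr>carrier := C\<rparr>) \<and> card C = \<n>"
 proof -
  obtain r where r: "r \<in> mu" "mu = (%i. r ^ i) ` {..<\<n>}" "card mu = \<n>" using mu_root by metis
  obtain g where g: "g \<in> carrier G" "typ1 (P g) r 0 0" using t1_ex[OF r(1) Om_0 Om_0] by blast
  have gC: "g \<in> C" using g r(1) by (auto simp: C_def)
  interpret C: group "G\<lparr>carrier := C\<rparr>" by (rule subgroup.subgroup_is_group[OF C G])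
  have pw: "typ1 (P (g [^] n)) (r ^ n) 0 0" for n :: nat
  proof (induction n)
   case 0 then show ?case using t1_one by simp
  next
   case (Suc n)
   have "typ1 (P (g [^] n \<otimes> g)) (r ^ n * r) 0 0"
    by (rule C_mult[OF _ Suc g mu_power[OF r(1)] r(1)]) (use g(1) in simp)
   then show ?case by (simp add: mult.commute)
  qed
  have "C \<subseteq> range (%n::int. g [^]\<^bsub>G\<lparr>carrier := C\<rparr>\<^esub> n)"
  proof
   fix c assume "c \<in> C"
   then obtain e where e: "c \<in> carrier G" "e \<in> mu" "typ1 (P c) e 0 0" by (auto simp: C_def)
   then obtain i where "e = r ^ i" using r(2) by blast
   then have "c = g [^] i" using t1_eq[OF e(1) _ e(3)] pw[of i] g(1) by blast
   then have "c = g [^]\<^bsub>G\<lparr>carrier := C\<rparr>\<^esub> (int i)" using nat_pow_consistent[of g i C] by (simp add: int_pow_int)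
   then show "c \<in> range (%n::int. g [^]\<^bsub>G\<lparr>carrier := C\<rparr>\<^esub> n)" by blast
  qed
  moreover have "g [^]\<^bsub>G\<lparr>carrier := C\<rparr>\<^esub> (n::int) \<in> C" for n using C.int_pow_closed[of g n] gC by simp
  ultimately have "carrier (G\<lparr>carrier := C\<rparr>) = range (%n::int. g [^]\<^bsub>G\<lparr>carrier := C\<rparr>\<^esub> n)" by auto
  then have "cyclic_group (G\<lparr>carrier := C\<rparr>)" using gC unfolding C.cyclic_group by (intro bexI[of _ g]) simp_all
  moreover have "card C = \<n>"
  proof -
   let ?h = "%c. P c xx / xx"
   have "?h ` C = mu"
   proof
    show "?h ` C \<subseteq> mu" using xx_nz by (auto simp: C_def typ1_def)
    show "mu \<subseteq> ?h ` C"
    proof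
     fix e assume e: "e \<in> mu"
     obtain c where c: "c \<in> carrier G" "typ1 (P c) e 0 0" using t1_ex[OF e Om_0 Om_0] by blast
     have "c \<in> C" unfolding C_def using c e by (intro CollectI conjI bexI[of _ e]) simp_all
     moreover have "e = ?h c" using c(2) xx_nz by (simp add: typ1_def)
     ultimately show "e \<in> ?h ` C" by (rule rev_image_eqI)
    qed
   qed
   moreover have "inj_on ?h C"
   proof (rule inj_onI)
    fix c d assume "c \<in> C" "d \<in> C" and eq: "?h c = ?h d"
    then obtain e e' where e: "c \<in> carrier G" "typ1 (P c) e 0 0" "d \<in> carrier G" "typ1 (P d) e' 0 0"
     unfolding C_def by blast
    have "e = e'" using eq e(2,4) xx_nz by (simp add: typ1_def)
    then show "c = d" using t1_eq[OF e(1,3,2)] e(4) by blast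
   qed
   then have "card (?h ` C) = card C" by (rule card_image)
   ultimately show ?thesis using r(3) by (simp only:)
  qed
  ultimately show ?thesis by blast
 qed
 ultimately show ?thesis using C t x tower by (intro exI[of _ C] exI[of _ t]) simp
qed

end

section \<open>Galois extensions and countability\<close>

context Ring.field begin

text \<open>The multiset of roots contains T and is not larger than the degree.\<close>

lemma simple_roots:
 assumes p: "p \<in> carrier (poly_ring R)" "p \<noteq> []"
  and T: "finite T" "T \<subseteq> carrier R" "\<And>b. b \<in> T ==> eval p b = \<zero>" "degree p \<le> card T"
 shows "splitted p" "alg_mult p b \<le> 1"
proof -
 have sub: "mset_set T \<subseteq># roots p"
 proof (rule mset_subset_eqI)
  fix b
  show "count (mset_set T) b \<le> count (roots p) b"
  proof (cases "b \<in> T")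
   case True
   then have "b \<in># roots p" using roots_mem_iff_is_root[OF p(1)] T p(2) by (auto simp: is_root_def)
   then have "1 \<le> count (roots p) b" by (simp add: Suc_le_eq)
   then show ?thesis using True T(1) by simp
  qed (use T(1) in simp)
 qed
 have "size (roots p) \<le> size (mset_set T)" using size_roots_le_degree[OF p(1)] T(4) by simp
 then have eq: "roots p = mset_set T"
  using sub by (metis mset_subset_size subset_mset.le_imp_less_or_eq linorder_not_less)
 show "splitted p" using size_roots_le_degree[OF p(1)] T(4) eq by (simp add: splitted_def)
 show "alg_mult p b \<le> 1" unfolding alg_mult_eq_count_roots[OF p(1)] eq using T(1) by (simp add: count_mset_set')
qed

lemma galois_extensionI:
 assumes H: "subfield H R"
  and *: "\<And>a. a \<in> carrier R ==> \<exists>p T. p \<in> carrier (H[X]) \<and> p \<noteq> [] \<and> eval p a = \<zero> \<and> finite T \<and> T \<subseteq> carrier R \<and>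
   (\<forall>b\<in>T. eval p b = \<zero>) \<and> degree p \<le> card T"
 shows "galois_extension R H"
proof -
 have "(algebraic over H) a \<and> splitted (Irr H a) \<and> (\<forall>b\<in>carrier R. alg_mult (Irr H a) b \<le> 1)" if a: "a \<in> carrier R" for a
 proof -
  obtain p T where p: "p \<in> carrier (H[X])" "p \<noteq> []" "eval p a = \<zero>"
   and T: "finite T" "T \<subseteq> carrier R" "\<And>b. b \<in> T ==> eval p b = \<zero>" "degree p \<le> card T" using *[OF a] by blast
  have al: "(algebraic over H) a" by (rule algebraicI[OF p])
  note HR = subfieldE(1)[OF H]
  have pR: "p \<in> carrier (poly_ring R)" by (rule carrier_polynomial_shell[OF HR p(1)])
  note I = IrrE[OF H a al]
  have IR: "Irr H a \<in> carrier (poly_ring R)" by (rule carrier_polynomial_shell[OF HR I(1)])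
  have dv: "Irr H a pdivides p" by (rule Irr_minimal[OF H a al p(1,3)])
  note S = simple_roots[OF pR p(2) T]
  have "splitted (Irr H a)" by (rule pdivides_imp_splitted[OF IR pR p(2) S(1) dv])
  moreover have "alg_mult (Irr H a) b \<le> 1" for b
  proof -
   have "roots (Irr H a) \<subseteq># roots p" by (rule pdivides_imp_roots_incl[OF IR pR p(2) dv])
   then have "alg_mult (Irr H a) b \<le> alg_mult p b"
    unfolding alg_mult_eq_count_roots[OF IR] alg_mult_eq_count_roots[OF pR] by (rule mset_subset_eq_count)
   then show ?thesis using S(2)[of b] by simp
  qed
  ultimately show ?thesis using al by blast
 qed
 then show ?thesis using H field_axioms by (simp add: galois_extension_def over_def)
qed

lemma galois_extension_conjugates:
 assumes gal: "galois_extension R H" and a: "a \<in> carrier R"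
 obtains p T where "p \<in> carrier (H[X])" "p \<noteq> []" "lead_coeff p = \<one>" "eval p a = \<zero>" "finite T" "T \<subseteq> carrier R" "degree p \<le> card T"
  "\<And>b f. b \<in> T ==> f \<in> carrier (H[X]) ==> eval f a = \<zero> ==> eval f b = \<zero>"
proof -
 have H: "subfield H R" and al: "(algebraic over H) a" and sp: "splitted (Irr H a)"
  and sm: "\<And>b. b \<in> carrier R ==> alg_mult (Irr H a) b \<le> 1"
  using gal a by (auto simp: galois_extension_def over_def)
 note I = IrrE[OF H a al]
 have IR: "Irr H a \<in> carrier (poly_ring R)" by (rule carrier_polynomial_shell[OF subfieldE(1)[OF H] I(1)])
 let ?T = "set_mset (roots (Irr H a))"
 have TR: "b \<in> carrier R \<and> eval (Irr H a) b = \<zero> \<and> Irr H a \<noteq> []" if "b \<in> ?T" for b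
  using that roots_mem_iff_is_root[OF IR] by (simp add: is_root_def)
 have ne: "Irr H a \<noteq> []" using I(2) pirreducibleE(1)[OF subfieldE(1)[OF H] I(1)] by auto
 have "roots (Irr H a) \<subseteq># mset_set ?T"
 proof (rule mset_subset_eqI)
  fix b
  show "count (roots (Irr H a)) b \<le> count (mset_set ?T) b"
  proof (cases "b \<in> ?T")
   case True
   then show ?thesis using sm[of b] TR[OF True] by (simp add: alg_mult_eq_count_roots[OF IR])
  next
   case False
   then show ?thesis by (simp add: not_in_iff)
  qed
 qed
 then have "size (roots (Irr H a)) \<le> card ?T" using size_mset_mono by fastforce
 then have deg: "degree (Irr H a) \<le> card ?T" using sp by (simp add: splitted_def)
 show ?thesis
 proof (rule that[OF I(1) ne I(3,4) _ _ deg])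
  fix b f assume b: "b \<in> ?T" and f: "f \<in> carrier (H[X])" "eval f a = \<zero>"
  show "eval f b = \<zero>"
   using pdivides_imp_root_sharing[OF IR Irr_minimal[OF H a al f]] TR[OF b] by blast
 qed (use TR in auto)
qed

text \<open>There are countably many polynomials, each with finitely many roots.\<close>

lemma algebraic_countable:
 assumes K: "subfield K R" "countable K" and al: "\<And>a. a \<in> carrier R ==> (algebraic over K) a"
 shows "countable (carrier R)"
proof -
 note KR = subfieldE(1)[OF K(1)]
 let ?P = "{p \<in> lists K. p \<in> carrier (K[X]) \<and> p \<noteq> []}"
 have "carrier R \<subseteq> (\<Union>p\<in>?P. {a. is_root p a})"
 proof
  fix a assume a: "a \<in> carrier R"
  obtain p where p: "p \<in> carrier (K[X])" "p \<noteq> []" "eval p a = \<zero>" by (rule algebraicE[OF KR a al[OF a]])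
  have "set p \<subseteq> K" using p(1) by (auto simp: univ_poly_carrier[symmetric] polynomial_def)
  then show "a \<in> (\<Union>p\<in>?P. {a. is_root p a})" using p a by (auto simp: is_root_def in_lists_conv_set)
 qed
 moreover have "countable ?P" using countable_lists[OF K(2)] by (rule countable_subset[rotated]) blast
 moreover have "countable {a. is_root p a}" if "p \<in> ?P" for p
  using finite_number_of_roots[OF carrier_polynomial_shell[OF KR]] that by (auto intro: countable_finite)
 ultimately show ?thesis using countable_subset countable_UN by (metis (no_types, lifting))
qed

text \<open>Close up under the field operations countably often.\<close>

lemma generate_field_countable:
 assumes S: "countable S" "S \<subseteq> carrier R" shows "countable (generate_field R S)"
proof -
 define U where "U A = A \<union> {\<one>} \<union> (%(a, b). a \<oplus> b) ` (A \<times> A) \<union> (%(a, b). a \<otimes> b) ` (A \<times> A) \<union> (%a. \<ominus> a) ` A \<union> (%a. inv a) ` A" for A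
 have c: "countable ((U ^^ n) S)" for n by (induction n) (use S in \<open>simp_all add: U_def\<close>)
 have sub: "A \<subseteq> U A" for A by (auto simp: U_def)
 have mono: "(U ^^ n) S \<subseteq> (U ^^ (n + i)) S" for n i by (induction i) (use sub in auto)
 have "generate_field R S \<subseteq> (\<Union>n. (U ^^ n) S)"
 proof
  fix a assume "a \<in> generate_field R S"
  then show "a \<in> (\<Union>n. (U ^^ n) S)"
  proof (induction rule: generate_field.induct)
   case one
   have "\<one> \<in> (U ^^ Suc 0) S" by (simp add: U_def)
   then show ?case by blast
  next
   case (incl h)
   then have "h \<in> (U ^^ 0) S" by simp
   then show ?case by blast
  next
   case (a_inv h)
   then obtain n where "h \<in> (U ^^ n) S" by blast
   then have "\<ominus> h \<in> (U ^^ Suc n) S" by (simp add: U_def)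
   then show ?case by blast
  next
   case (m_inv h)
   then obtain n where "h \<in> (U ^^ n) S" by blast
   then have "inv h \<in> (U ^^ Suc n) S" by (simp add: U_def)
   then show ?case by blast
  next
   case (eng_add h h')
   then obtain n n' where "h \<in> (U ^^ n) S" "h' \<in> (U ^^ n') S" by blast
   then have "h \<in> (U ^^ (n + n')) S" "h' \<in> (U ^^ (n + n')) S" using mono[of n n'] mono[of n' n] by (auto simp: add.commute)
   then have "h \<oplus> h' \<in> (U ^^ Suc (n + n')) S" by (force simp: U_def)
   then show ?case by blast
  next
   case (eng_mult h h')
   then obtain n n' where "h \<in> (U ^^ n) S" "h' \<in> (U ^^ n') S" by blast
   then have "h \<in> (U ^^ (n + n')) S" "h' \<in> (U ^^ (n + n')) S" using mono[of n n'] mono[of n' n] by (auto simp: add.commute)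
   then have "h \<otimes> h' \<in> (U ^^ Suc (n + n')) S" by (force simp: U_def)
   then show ?case by blast
  qed
 qed
 moreover have "countable (\<Union>n. (U ^^ n) S)" using c by simp
 ultimately show ?thesis by (rule countable_subset)
qed

lemma transcendental_infinite:
 assumes K: "subring K R" and x: "x \<in> carrier R" "transcendental K x" and A: "\<And>n::nat. x [^] n \<in> A"
 shows "infinite A"
proof
 assume "finite A"
 moreover have "inj (%n::nat. x [^] n)"
 proof (rule injI)
  fix i j :: nat assume eq: "x [^] i = x [^] j"
  have "monom \<one> n \<in> carrier (K[X])" for n
   using subringE(2,3)[OF K] one_not_zero by (auto simp: univ_poly_carrier[symmetric] polynomial_def monom_def)
  moreover have "eval (monom \<one> i) x = eval (monom \<one> j) x" using eq x(1) by (simp add: eval_monom)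
  ultimately have "monom \<one> i = monom \<one> j" using x(2) by (simp add: transcendental_def inj_on_def)
  then show "i = j" by (simp add: monom_def)
 qed
 ultimately show False using A finite_imageD[of "%n::nat. x [^] n" UNIV] finite_subset[of "range (%n::nat. x [^] n)" A] by auto
qed

end

section \<open>Transport along an enumeration\<close>

lemma nat_ge2_Suc: "2 \<le> n ==> \<exists>r. n = Suc (Suc r)" by presburger

lemma card_bounded_finite: "(\<And>T. finite T ==> T \<subseteq> A ==> card T \<le> n) ==> finite A"
proof (rule ccontr)
 assume *: "\<And>T. finite T ==> T \<subseteq> A ==> card T \<le> n" and "infinite A"
 then obtain T where "T \<subseteq> A" "finite T" "card T = Suc n" by (metis infinite_arbitrarily_large)
 then show False using *[of T] by simp
qed

context Fields.field begin

text \<open>Translation by 1 permutes the ring.\<close>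

lemma sum_translate: assumes S: "sring S" "finite S" shows "of_nat (card S) = (0::'a)"
proof -
 note D = sringD[OF S(1)]
 have "(\<Sum>a\<in>S. a + 1) = (\<Sum>a\<in>S. a)"
 proof (rule sum.reindex_bij_witness[of _ "%a. a - 1" "%a. a + 1"])
  show "a + 1 \<in> S" if "a \<in> S" for a using D(3)[OF that D(2)] .
  show "a - 1 \<in> S" if "a \<in> S" for a using D(6)[OF that D(2)] .
 qed simp_all
 then have "(\<Sum>a\<in>S. a) + of_nat (card S) = (\<Sum>a\<in>S. a)" by (simp add: sum.distrib)
 then show ?thesis by simp
qed

lemma prod_const: "finite A ==> (\<Prod>x\<in>A. a) = (a::'a) ^ card A"
 by (induction A rule: finite_induct) simp_all

lemma finite_field_power: assumes S: "sfield S" "finite S" and a: "a \<in> S" shows "a ^ card S = a"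
proof (cases "a = 0")
 case True
 have "0 < card S" using S(2) a by (auto simp: card_gt_0_iff)
 then show ?thesis using True by (simp add: power_0_left)
next
 case False
 note D = sringD[OF sfield_sring[OF S(1)]]
 let ?U = "S - {0}"
 have "(\<Prod>b\<in>?U. a * b) = (\<Prod>b\<in>?U. b)"
 proof (rule prod.reindex_bij_witness[of _ "%b. inverse a * b" "%b. a * b"])
  show "a * b \<in> ?U" if "b \<in> ?U" for b using that a False D(5) by simp
  show "inverse a * b \<in> ?U" if "b \<in> ?U" for b using that False D(5)[OF sfield_inverse[OF S(1) a]] by simp
 qed (use False in \<open>simp_all flip: mult.assoc\<close>)
 then have "a ^ card ?U * (\<Prod>b\<in>?U. b) = (\<Prod>b\<in>?U. b)" using S(2) by (simp add: prod.distrib prod_const)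
 moreover have "(\<Prod>b\<in>?U. b) \<noteq> 0" using S(2) by (simp add: prod_zero_iff)
 ultimately have "a ^ card ?U = 1" by simp
 moreover have "card S = Suc (card ?U)" using S(2) D(1) by (metis card.remove)
 ultimately show ?thesis by simp
qed

text \<open>The polynomial t^q - t has at most q roots.\<close>

lemma finite_field_fixed:
 assumes S: "sfield S" "finite S" "S \<subseteq> K" shows "{a \<in> K. a ^ card S = a} = S"
proof -
 let ?A = "{a \<in> K. a ^ card S = a}"
 have sub: "S \<subseteq> ?A" using finite_field_power[OF S(1,2)] S(3) by blast
 have c: "2 \<le> card S"
 proof -
  have "{0, 1} \<subseteq> S" using sringD(1,2)[OF sfield_sring[OF S(1)]] by simp
  then have "card {0, 1::'a} \<le> card S" using S(2) by (rule card_mono[rotated])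
  then show ?thesis by simp
 qed
 obtain r where r: "card S = Suc (Suc r)" using nat_ge2_Suc[OF c] by blast
 let ?as = "0 # (-1) # replicate r 0"
 have "peval (replicate r 0 @ [1]) t = t ^ r" for t by (induction r) simp_all
 then have pe: "peval (?as @ [1]) t = t ^ card S - t" for t unfolding r by (simp add: algebra_simps)
 have small: "card T \<le> card S" if "finite T" "T \<subseteq> ?A" for T
  using monic_roots_le[OF that(1), of ?as] that(2) unfolding pe by (auto simp: r)
 have fin: "finite ?A" by (rule card_bounded_finite[OF small])
 show ?thesis using card_seteq[OF fin sub small[OF fin order_refl]] by simp
qed

end

locale transport = Ring.field L for L :: "('a, 'c) ring_scheme" (structure) +
 fixes \<phi> :: "'b => 'a"
 assumes bij: "bij_betw \<phi> UNIV (carrier L)"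
begin

definition \<psi> :: "'a => 'b" where "\<psi> = inv_into UNIV \<phi>"

lemma phi_carrier [simp]: "\<phi> b \<in> carrier L" using bij by (auto simp: bij_betw_def)
lemma psi_phi [simp]: "\<psi> (\<phi> b) = b" using bij by (simp add: \<psi>_def bij_betw_def)
lemma phi_psi [simp]: "a \<in> carrier L ==> \<phi> (\<psi> a) = a" using bij by (simp add: \<psi>_def bij_betw_def f_inv_into_f)
lemma phi_eq_iff [simp]: "\<phi> b = \<phi> c \<longleftrightarrow> b = c" by (metis psi_phi)
lemma eqI: "\<phi> b = \<phi> c ==> b = c" by simp

definition ze :: 'b where "ze = \<psi> \<zero>"
definition on :: 'b where "on = \<psi> \<one>"
definition ad :: "'b => 'b => 'b" where "ad b c = \<psi> (\<phi> b \<oplus> \<phi> c)"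
definition mt :: "'b => 'b => 'b" where "mt b c = \<psi> (\<phi> b \<otimes> \<phi> c)"
definition um :: "'b => 'b" where "um b = \<psi> (\<ominus> \<phi> b)"
definition mi :: "'b => 'b => 'b" where "mi b c = \<psi> (\<phi> b \<ominus> \<phi> c)"
definition iv :: "'b => 'b" where "iv b = (if \<phi> b = \<zero> then \<psi> \<zero> else \<psi> (inv \<phi> b))"
definition dv :: "'b => 'b => 'b" where "dv b c = mt b (iv c)"

lemma inv_carrier: "a \<in> carrier L ==> a \<noteq> \<zero> ==> inv a \<in> carrier L" by (simp add: field_Units)

lemma phi_ops [simp]:
 "\<phi> ze = \<zero>" "\<phi> on = \<one>" "\<phi> (ad b c) = \<phi> b \<oplus> \<phi> c" "\<phi> (mt b c) = \<phi> b \<otimes> \<phi> c" "\<phi> (um b) = \<ominus> \<phi> b" "\<phi> (mi b c) = \<phi> b \<ominus> \<phi> c"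
 by (simp_all add: ze_def on_def ad_def mt_def um_def mi_def)

lemma phi_iv: "b \<noteq> ze ==> \<phi> (iv b) = inv \<phi> b" "\<phi> (iv ze) = \<zero>"
proof -
 show "\<phi> (iv b) = inv \<phi> b" if "b \<noteq> ze"
 proof -
  have "\<phi> b \<noteq> \<zero>" using that eqI[of b ze] by auto
  then show ?thesis by (simp add: iv_def inv_carrier)
 qed
qed (simp add: iv_def)

lemma class_field: "class.field dv iv mt on ad ze mi um"
proof (unfold_locales)
 fix a b c :: 'b
 show "mt (mt a b) c = mt a (mt b c)" by (rule eqI) (simp add: m_assoc)
 show "mt a b = mt b a" by (rule eqI) (simp add: m_comm)
 show "mt on a = a" by (rule eqI) simp
 show "ad (ad a b) c = ad a (ad b c)" by (rule eqI) (simp add: a_assoc)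
 show "ad a b = ad b a" by (rule eqI) (simp add: a_comm)
 show "ad ze a = a" by (rule eqI) simp
 show "ad (um a) a = ze" by (rule eqI) (simp add: l_neg)
 show "mi a b = ad a (um b)" by (rule eqI) (simp add: a_minus_def)
 show "mt (ad a b) c = ad (mt a c) (mt b c)" by (rule eqI) (simp add: l_distr)
 show "ze \<noteq> on" using one_not_zero by (metis phi_ops(1,2))
 show "dv a b = mt a (iv b)" by (simp add: dv_def)
 show "iv ze = ze" by (rule eqI) (simp add: phi_iv)
 show "mt (iv a) a = on" if "a \<noteq> ze"
 proof (rule eqI)
  have "\<phi> a \<noteq> \<zero>" using that eqI[of a ze] by auto
  then show "\<phi> (mt (iv a) a) = \<phi> on" using that by (simp add: phi_iv field_Units)
 qed
qed

sublocale B: Fields.field dv iv mt on ad ze mi um by (rule class_field)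

lemma phi_nonzero: "b \<noteq> ze \<longleftrightarrow> \<phi> b \<noteq> \<zero>" using eqI[of b ze] by auto

lemma phi_power: "\<phi> (power.power on mt b n) = \<phi> b [^] n"
proof (induction n)
 case (Suc n) then show ?case by (simp add: power.power.power_Suc m_comm)
qed (simp add: power.power.power_0)

lemma sfield_preimage: assumes "subfield K L" shows "B.sfield (\<phi> -` K)"
proof (rule B.sfieldI)
 note D = subringE[OF subfieldE(1)[OF assms]]
 show "B.sring (\<phi> -` K)" by (rule B.sringI) (use D in simp_all)
 show "iv b \<in> \<phi> -` K" if "b \<in> \<phi> -` K" "b \<noteq> ze" for b
  using that subfield_m_inv(1)[OF assms, of "\<phi> b"] by (simp add: phi_iv phi_nonzero)
qed

lemma subfield_image: assumes "B.sfield S" shows "subfield (\<phi> ` S) L"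
proof (rule subfieldI')
 note D = B.sringD[OF B.sfield_sring[OF assms]]
 show "subring (\<phi> ` S) L"
 proof (rule subringI)
  show "\<one> \<in> \<phi> ` S" using D(2) by (rule rev_image_eqI) simp
  show "\<ominus> h \<in> \<phi> ` S" if h: "h \<in> \<phi> ` S" for h
  proof -
   obtain b where "b \<in> S" "h = \<phi> b" using h by blast
   then show ?thesis using D(4)[of b] by (intro image_eqI[of _ _ "um b"]) simp_all
  qed
  show "h \<otimes> h' \<in> \<phi> ` S" if h: "h \<in> \<phi> ` S" "h' \<in> \<phi> ` S" for h h'
  proof -
   obtain b b' where "b \<in> S" "h = \<phi> b" "b' \<in> S" "h' = \<phi> b'" using h by blast
   then show ?thesis using D(5)[of b b'] by (intro image_eqI[of _ _ "mt b b'"]) simp_all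
  qed
  show "h \<oplus> h' \<in> \<phi> ` S" if h: "h \<in> \<phi> ` S" "h' \<in> \<phi> ` S" for h h'
  proof -
   obtain b b' where "b \<in> S" "h = \<phi> b" "b' \<in> S" "h' = \<phi> b'" using h by blast
   then show ?thesis using D(3)[of b b'] by (intro image_eqI[of _ _ "ad b b'"]) simp_all
  qed
 qed auto
 show "inv h \<in> \<phi> ` S" if h: "h \<in> \<phi> ` S - {\<zero>}" for h
 proof -
  obtain b where b: "b \<in> S" "h = \<phi> b" "b \<noteq> ze" using h phi_nonzero by blast
  then show ?thesis using B.sfield_inverse[OF assms b(1)] by (intro image_eqI[of _ _ "iv b"]) (simp_all add: phi_iv)
 qed
qed

lemma fgen_preimage:
 assumes S: "S \<subseteq> carrier L" shows "\<phi> ` B.fgen (\<phi> -` S) = generate_field L S"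
proof
 have SI: "S \<subseteq> \<phi> ` (\<phi> -` S)"
 proof
  fix a assume "a \<in> S"
  then show "a \<in> \<phi> ` (\<phi> -` S)" using S by (intro image_eqI[of _ _ "\<psi> a"]) auto
 qed
 have "generate_field L S \<subseteq> \<phi> ` B.fgen (\<phi> -` S)"
  using SI B.fgen_incl[of "\<phi> -` S"] by (intro generate_field_min_subfield1[OF S] subfield_image B.sfield_fgen) blast
 then show "generate_field L S \<subseteq> \<phi> ` B.fgen (\<phi> -` S)" .
 have "B.fgen (\<phi> -` S) \<subseteq> \<phi> -` generate_field L S"
  using generate_field.incl[of _ S L] by (intro B.fgen_least sfield_preimage generate_field_is_subfield S) auto
 then show "\<phi> ` B.fgen (\<phi> -` S) \<subseteq> generate_field L S" by blast
qed

lemma mem_fgen: "S \<subseteq> carrier L ==> b \<in> B.fgen (\<phi> -` S) \<longleftrightarrow> \<phi> b \<in> generate_field L S"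
proof -
 assume "S \<subseteq> carrier L"
 then have "\<phi> b \<in> generate_field L S \<longleftrightarrow> \<phi> b \<in> \<phi> ` B.fgen (\<phi> -` S)" by (simp only: fgen_preimage)
 also have "... \<longleftrightarrow> b \<in> B.fgen (\<phi> -` S)" by (rule inj_image_mem_iff) (simp add: inj_def)
 finally show ?thesis by simp
qed

lemma phi_peval: "\<phi> (B.peval as t) = eval (rev (map \<phi> as)) (\<phi> t)"
proof (induction as)
 case (Cons a as)
 have "set (rev (map \<phi> as)) \<subseteq> carrier L" by auto
 then show ?case using Cons eval_append_aux[of "rev (map \<phi> as)" "\<phi> a" "\<phi> t"]
  by (simp add: m_comm a_comm eval_in_carrier)
qed simp

lemma map_phi: "set p \<subseteq> carrier L ==> map \<phi> (map \<psi> p) = p"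
 by (induction p) auto

lemma phi_peval_psi: "set p \<subseteq> carrier L ==> \<phi> (B.peval (rev (map \<psi> p)) t) = eval p (\<phi> t)"
 unfolding phi_peval by (simp add: map_phi rev_map[symmetric] del: map_map)

lemma vimage_insert: "a \<in> carrier L ==> \<phi> -` insert a S = insert (\<psi> a) (\<phi> -` S)"
 by auto

end

section \<open>The curve inside an abstract field\<close>

context Fields.field begin

lemma of_nat_power_zero: "of_nat (p ^ h) = (0::'a) ==> of_nat p = (0::'a)"
 by (induction h) auto

end

context ffield begin

lemma AS_difference:
 assumes q: "q = chp TYPE('a) ^ h" "odd (chp TYPE('a))"
  and y: "y ^ q + y = w + w'" and z: "z ^ q + z = w"
 shows "(y - z) ^ q + (y - z) = w'"
proof -
 have "(y - z) ^ q + (y - z) = (y ^ q + y) - (z ^ q + z)"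
  unfolding q(1) frobenius_diff[OF prime_chp char_chp q(2)] by (simp add: algebra_simps)
 then show ?thesis unfolding y z by simp
qed

end

context cfield begin

lemma galois_polynomial_roots:
 obtains T as where "finite T" "a \<in> T" "set as \<subseteq> fgen (insert (xx ^ \<n>) kf)" "length as = card T"
  "\<And>t. t \<in> T ==> peval (as @ [1]) t = 0"
proof -
 obtain T as where T: "finite T" "a \<in> T" "set as \<subseteq> fgen (insert (xx ^ \<n>) kf)" "length as = card T"
  "\<forall>t. peval (as @ [1]) t = (\<Prod>b\<in>T. t - b)" using galois_polynomial by metis
 have "peval (as @ [1]) t = 0" if "t \<in> T" for t using that T(1,5) by (auto intro: prod_zero)
 then show ?thesis by (rule that[OF T(1-4)])
qed

lemma typ1_translation: "typ1 f 1 a b \<longleftrightarrow> f xx = xx \<and> f ss = ss + a \<and> f zz = zz + b"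
 by (simp add: typ1_def)

end

lemma transport_exists:
 fixes R :: "('a, 'c) ring_scheme"
 assumes "Ring.field R" "countable (carrier R)" "infinite (carrier R)"
 shows "\<exists>\<phi> :: nat => 'a. transport R \<phi>"
 using bij_betw_from_nat_into[OF assms(2,3)] assms(1)
 by (auto intro!: transport.intro simp: transport_axioms_def)

context transport begin

lemma subfield_below:
 assumes "subfield K L" "subfield E (L\<lparr>carrier := K\<rparr>)" shows "subfield E L"
proof -
 have KL: "K \<subseteq> carrier L" by (rule subringE(1)[OF subfieldE(1)[OF assms(1)]])
 interpret K: Ring.field "L\<lparr>carrier := K\<rparr>" by (rule subfield_iff(2)[OF assms(1)])
 have "Ring.field (L\<lparr>carrier := E\<rparr>)" using K.subfield_iff(2)[OF assms(2)] by simp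
 moreover have "E \<subseteq> carrier L" using subringE(1)[OF subfieldE(1)[OF assms(2)]] KL by simp
 ultimately show ?thesis by (rule subfield_iff(1))
qed

lemma normalize_eq_Nil: "normalize bs = [] ==> set bs \<subseteq> {\<zero>}"
 by (induction bs) (auto split: if_splits)

lemma poly_of_list:
 assumes K: "set as \<subseteq> \<phi> -` K"
 shows "normalize (rev (map \<phi> as)) \<in> carrier (K[X])" "b \<in> carrier L ==> eval (normalize (rev (map \<phi> as))) b = \<phi> (B.peval as (\<psi> b))"
proof -
 show "normalize (rev (map \<phi> as)) \<in> carrier (K[X])"
  using normalize_gives_polynomial[of "rev (map \<phi> as)" K] K by (auto simp: univ_poly_carrier[symmetric])
 have "set (rev (map \<phi> as)) \<subseteq> carrier L" by auto
 then show "eval (normalize (rev (map \<phi> as))) b = \<phi> (B.peval as (\<psi> b))" if "b \<in> carrier L"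
  using that eval_normalize by (simp add: phi_peval)
qed

context
 fixes k Fq :: "'a set" and p h q m :: nat
 assumes p: "Factorial_Ring.prime p" and q: "q = p ^ h" and k: "subfield k L"
  and clo: "algebraic_closure (L\<lparr>carrier := k\<rparr>) Fq" and cq: "card Fq = q"
begin

lemma finite_Fq: "finite Fq" using p cq q by (metis card.infinite not_prime_0 power_not_zero)

lemma Fq_subfield: "subfield Fq L" "Fq \<subseteq> k"
proof -
 interpret A: algebraic_closure "L\<lparr>carrier := k\<rparr>" Fq by (rule clo)
 show "subfield Fq L" by (rule subfield_below[OF k A.subfield_axioms])
 show "Fq \<subseteq> k" using subringE(1)[OF subfieldE(1)[OF A.subfield_axioms]] by simp
qed

lemma Fq_preimage: "B.sfield (\<phi> -` Fq)" "finite (\<phi> -` Fq)" "\<phi> -` Fq \<subseteq> \<phi> -` k" "card (\<phi> -` Fq) = q"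
proof -
 show "B.sfield (\<phi> -` Fq)" by (rule sfield_preimage[OF Fq_subfield(1)])
 have i: "inj \<phi>" by (simp add: inj_def)
 show "finite (\<phi> -` Fq)" using finite_vimageI[OF finite_Fq i] .
 show "\<phi> -` Fq \<subseteq> \<phi> -` k" using Fq_subfield(2) by blast
 have "Fq \<subseteq> range \<phi>" using subringE(1)[OF subfieldE(1)[OF Fq_subfield(1)]] bij by (simp add: bij_betw_def)
 then show "card (\<phi> -` Fq) = q" using card_vimage_inj[OF i] cq by simp
qed

text \<open>The characteristic is read off from the size of the finite field.\<close>

lemma ffield_instance: "class.ffield dv iv mt on ad ze mi um (\<phi> -` k) (%_. p)"
proof (intro class.ffield.intro class.ffield_axioms.intro class_field)
 show "B.sfield (\<phi> -` k)" by (rule sfield_preimage[OF k])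
 show "Factorial_Ring.prime p" by (rule p)
 have "B.of_nat (p ^ h) = ze" using B.sum_translate[OF B.sfield_sring[OF Fq_preimage(1)] Fq_preimage(2)] Fq_preimage(4) q by simp
 then show "B.of_nat p = ze" by (rule B.of_nat_power_zero)
next
 fix as assume as: "as \<noteq> []" "set as \<subseteq> \<phi> -` k"
 interpret A: algebraic_closure "L\<lparr>carrier := k\<rparr>" Fq by (rule clo)
 note kR = subfieldE(1)[OF k]
 let ?P = "\<one> # rev (map \<phi> as)"
 have "set ?P \<subseteq> k" using as(2) subringE(3)[OF kR] by auto
 then have P: "?P \<in> carrier (poly_ring (L\<lparr>carrier := k\<rparr>))"
  using one_not_zero by (simp add: univ_poly_carrier[symmetric] polynomial_def)
 have "size (A.roots ?P) = length as" using A.roots_over_carrier[OF P] by (simp add: A.splitted_def)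
 then obtain r where "r \<in># A.roots ?P" using as(1) by (metis length_0_conv multiset_nonemptyE size_empty)
 then have r: "r \<in> k" "A.eval ?P r = \<zero>" using A.roots_mem_iff_is_root[OF P] by (simp_all add: A.is_root_def)
 have rL: "r \<in> carrier L" using r(1) subringE(1)[OF kR] by blast
 have "eval ?P r = \<zero>" using r(2) eval_consistent[OF kR] by simp
 then have "\<phi> (B.peval (as @ [on]) (\<psi> r)) = \<phi> ze" using rL by (simp add: phi_peval del: phi_eq_iff)
 then have "B.peval (as @ [on]) (\<psi> r) = ze" by (rule eqI)
 then show "\<exists>r\<in>\<phi> -` k. B.peval (as @ [on]) r = ze" using r(1) rL by (intro bexI[of _ "\<psi> r"]) auto
qed

lemma trans_transport:
 assumes x: "x \<in> carrier L" "transcendental k x" shows "ffield.trans mt ad ze (\<phi> -` k) (\<psi> x)"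
proof -
 interpret C: ffield dv iv mt on ad ze mi um "\<phi> -` k" "%_. p" by (rule ffield_instance)
 show "C.trans (\<psi> x)" unfolding C.trans_def
 proof (intro allI impI)
  fix as assume as: "set as \<subseteq> \<phi> -` k" "B.peval as (\<psi> x) = ze"
  let ?f = "normalize (rev (map \<phi> as))"
  have "eval ?f x = \<zero>" using poly_of_list(2)[OF as(1) x(1)] as(2) by simp
  then have "?f = []" using algebraicI[OF poly_of_list(1)[OF as(1)]] x(2) by (auto simp: over_def)
  then have "\<phi> ` set as \<subseteq> {\<zero>}" using normalize_eq_Nil by fastforce
  then show "set as \<subseteq> {ze}" using phi_nonzero by auto
 qed
qed

lemma power_psi: "x \<in> carrier L ==> power.power on mt (\<psi> x) n = \<psi> (x [^] n)"
 by (rule eqI) (simp add: phi_power)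

lemma kL: "k \<subseteq> carrier L" by (rule subringE(1)[OF subfieldE(1)[OF k]])

lemma base_preimage: "x \<in> carrier L ==> insert (power.power on mt (\<psi> x) n) (\<phi> -` k) = \<phi> -` (k \<union> {x [^] n})"
 using vimage_insert[of "x [^] n" k] by (simp add: power_psi)

lemma artin_schreier_root_exists:
 assumes odd: "odd p" and h: "1 \<le> h" and q3: "q \<noteq> 3" and m: "1 \<le> m"
  and x: "x \<in> carrier L" "transcendental k x" and y: "y \<in> carrier L" "y [^] q \<oplus> y = x [^] m \<oplus> inv (x [^] m)"
  and gal: "galois_extension L (generate_field L (k \<union> {x [^] (m * (q - 1))}))"
 shows "\<exists>z\<in>carrier L. z [^] q \<oplus> z = x [^] m"
proof -
 interpret C: ffield dv iv mt on ad ze mi um "\<phi> -` k" "%_. p" by (rule ffield_instance)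
 let ?H = "generate_field L (k \<union> {x [^] (m * (q - 1))})"
 let ?H' = "B.fgen (insert (power.power on mt (\<psi> x) (m * (q - Suc 0))) (\<phi> -` k))"
 have S: "k \<union> {x [^] (m * (q - 1))} \<subseteq> carrier L" using kL x(1) by simp
 have mem: "b \<in> ?H' \<longleftrightarrow> \<phi> b \<in> ?H" for b
  using mem_fgen[OF S, of b] base_preimage[OF x(1)] by simp
 have a: "y \<otimes> x [^] m \<in> carrier L" using x y by simp
 have aa: "\<psi> (y \<otimes> x [^] m) = mt (\<psi> y) (power.power on mt (\<psi> x) m)" by (rule eqI) (use x y in \<open>simp add: phi_power\<close>)
 obtain f T where f: "f \<in> carrier (?H[X])" "f \<noteq> []" "lead_coeff f = \<one>" "eval f (y \<otimes> x [^] m) = \<zero>"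
  and T: "finite T" "T \<subseteq> carrier L" "degree f \<le> card T"
   "\<And>b g. b \<in> T ==> g \<in> carrier (?H[X]) ==> eval g (y \<otimes> x [^] m) = \<zero> ==> eval g b = \<zero>"
  by (rule galois_extension_conjugates[OF gal a]) (rule that)
 obtain f' where f': "f = \<one> # f'" using f(2,3) by (cases f) auto
 have fH: "set f' \<subseteq> ?H" using f(1) f' by (simp add: univ_poly_carrier[symmetric] polynomial_def)
 have HL: "?H \<subseteq> carrier L" by (rule generate_field_incl[OF S])
 have fL: "set f \<subseteq> carrier L" using fH HL f' by auto
 have "\<exists>z. ad (power.power on mt z q) z = power.power on mt (\<psi> x) m"
 proof (rule C.split_off_root[of "\<psi> x" q h m "\<psi> y" "rev (map \<psi> f')" "\<psi> ` T"])
  show "C.trans (\<psi> x)" by (rule trans_transport[OF x])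
  have x0: "\<psi> (x [^] m) \<noteq> ze"
  proof -
   have "\<psi> x \<noteq> ze" by (rule C.trans_nonzero[OF trans_transport[OF x]])
   then show ?thesis using x(1) B.power_not_zero[of "\<psi> x" m] by (simp add: power_psi)
  qed
  show "ad (power.power on mt (\<psi> y) q) (\<psi> y) = ad (power.power on mt (\<psi> x) m) (iv (power.power on mt (\<psi> x) m))"
   unfolding power_psi[OF x(1)] using x y phi_iv(1)[OF x0] by (intro eqI) (simp add: phi_power)
  show "set (rev (map \<psi> f')) \<subseteq> ?H'"
  proof
   fix c assume "c \<in> set (rev (map \<psi> f'))"
   then obtain e where e: "e \<in> set f'" "c = \<psi> e" by auto
   then have "e \<in> ?H" "e \<in> carrier L" using fH HL by blast+
   then show "c \<in> ?H'" unfolding mem e(2) by simp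
  qed
  have "B.peval (rev (map \<psi> f)) (\<psi> (y \<otimes> x [^] m)) = ze"
   by (rule eqI) (use phi_peval_psi[OF fL] f(4) a in simp)
  then show "B.peval (rev (map \<psi> f') @ [on]) (mt (\<psi> y) (power.power on mt (\<psi> x) m)) = ze"
   by (simp add: f' aa on_def)
  have "inj_on \<psi> T" using T(2) by (intro inj_onI) (metis phi_psi subsetD)
  then show "length (rev (map \<psi> f')) \<le> card (\<psi> ` T)" using T(3) f' by (simp add: card_image)
 next
  fix b cs assume b: "b \<in> \<psi> ` T" and cs: "set cs \<subseteq> ?H'" "B.peval cs (mt (\<psi> y) (power.power on mt (\<psi> x) m)) = ze"
  obtain b' where b': "b' \<in> T" "b = \<psi> b'" using b by blast
  have cs': "set cs \<subseteq> \<phi> -` ?H" using cs(1) mem by auto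
  have "eval (normalize (rev (map \<phi> cs))) b' = \<zero>"
   by (rule T(4)[OF b'(1) poly_of_list(1)[OF cs']]) (use poly_of_list(2)[OF cs' a] cs(2) aa in simp)
  then have "\<phi> (B.peval cs b) = \<phi> ze" using poly_of_list(2)[OF cs'] b' T(2) by (simp add: subsetD del: phi_eq_iff)
  then show "B.peval cs b = ze" by (rule eqI)
 qed (use q odd h q3 m T(1) in auto)
 then obtain z where z: "ad (power.power on mt z q) z = power.power on mt (\<psi> x) m" by blast
 have "\<phi> z [^] q \<oplus> \<phi> z = x [^] m" using arg_cong[OF z, of \<phi>] x(1) by (simp add: phi_power)
 then show ?thesis using phi_carrier by blast
qed

lemma difference_root:
 assumes odd: "odd p" and y: "y \<in> carrier L" "y [^] q \<oplus> y = w \<oplus> w'" and z: "z \<in> carrier L" "z [^] q \<oplus> z = w" and w: "w \<in> carrier L" "w' \<in> carrier L"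
 shows "(y \<ominus> z) [^] q \<oplus> (y \<ominus> z) = w'"
proof -
 interpret C: ffield dv iv mt on ad ze mi um "\<phi> -` k" "%_. p" by (rule ffield_instance)
 have "ad (power.power on mt (mi (\<psi> y) (\<psi> z)) q) (mi (\<psi> y) (\<psi> z)) = \<psi> w'"
 proof (rule C.AS_difference[of q h])
  show "ad (power.power on mt (\<psi> y) q) (\<psi> y) = ad (\<psi> w) (\<psi> w')" by (rule eqI) (use y w in \<open>simp add: phi_power\<close>)
  show "ad (power.power on mt (\<psi> z) q) (\<psi> z) = \<psi> w" by (rule eqI) (use z w in \<open>simp add: phi_power\<close>)
 qed (use q odd in auto)
 then have "\<phi> (ad (power.power on mt (mi (\<psi> y) (\<psi> z)) q) (mi (\<psi> y) (\<psi> z))) = w'" using w(2) by simp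
 then show ?thesis using y(1) z(1) by (simp add: phi_power)
qed

context
 fixes x s z :: 'a
 assumes odd: "odd p" and h: "1 \<le> h" and m: "1 \<le> m" and cop: "coprime m p"
  and x: "x \<in> carrier L" "transcendental k x" and s: "s \<in> carrier L" "(s [^] q \<oplus> s) \<otimes> x [^] m = \<one>"
  and z: "z \<in> carrier L" "z [^] q \<oplus> z = x [^] m" and gen: "generate_field L (k \<union> {x, s, z}) = carrier L"
begin

lemma cfield_instance: "class.cfield dv iv mt on ad ze mi um (\<phi> -` k) (%_. p) (\<psi> x) (\<psi> s) (\<psi> z) (%_. h) (%_. m)"
proof (intro class.cfield.intro class.cfield_axioms.intro ffield_instance)
 show "card {a \<in> \<phi> -` k. power.power on mt a (p ^ h) = a} = p ^ h"
  using B.finite_field_fixed[OF Fq_preimage(1-3)] Fq_preimage(4) q by simp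
 show "ffield.trans mt ad ze (\<phi> -` k) (\<psi> x)" by (rule trans_transport[OF x])
 have xs: "mt (power.power on mt (\<psi> x) m) (ad (power.power on mt (\<psi> s) q) (\<psi> s)) = on"
  by (rule eqI) (use x s m_comm in \<open>simp add: phi_power\<close>)
 show "ad (power.power on mt (\<psi> s) (p ^ h)) (\<psi> s) = power.power on mt (iv (\<psi> x)) m"
  using B.inverse_unique[OF xs] by (simp add: B.power_inverse q)
 show "ad (power.power on mt (\<psi> z) (p ^ h)) (\<psi> z) = power.power on mt (\<psi> x) m"
  by (rule eqI) (use x z q in \<open>simp add: phi_power\<close>)
 have S: "k \<union> {x, s, z} \<subseteq> carrier L" using kL x s z by simp
 have "\<phi> -` (k \<union> {x, s, z}) = \<phi> -` k \<union> {\<psi> x, \<psi> s, \<psi> z}" using x s z by (simp add: vimage_insert insert_commute)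
 then show "B.fgen (\<phi> -` k \<union> {\<psi> x, \<psi> s, \<psi> z}) = UNIV" using mem_fgen[OF S] gen by auto
qed (use odd h m cop in auto)

lemma galois_over_base: "galois_extension L (generate_field L (k \<union> {x [^] (m * (q - 1))}))"
proof -
 interpret C: cfield dv iv mt on ad ze mi um "\<phi> -` k" "%_. p" "\<psi> x" "\<psi> s" "\<psi> z" "%_. h" "%_. m"
  by (rule cfield_instance)
 let ?H = "generate_field L (k \<union> {x [^] (m * (q - 1))})"
 have S: "k \<union> {x [^] (m * (q - 1))} \<subseteq> carrier L" using kL x(1) by simp
 show ?thesis
 proof (rule galois_extensionI)
  show HF: "subfield ?H L" by (rule generate_field_is_subfield[OF S])
  fix a assume a: "a \<in> carrier L"
  obtain T as where T: "finite T" "\<psi> a \<in> T"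
   and as: "set as \<subseteq> B.fgen (insert (power.power on mt (\<psi> x) (m * (p ^ h - Suc 0))) (\<phi> -` k))" "length as = card T"
   and root: "\<And>t. t \<in> T ==> B.peval (as @ [on]) t = ze"
   by (rule C.galois_polynomial_roots[of "\<psi> a"]) (rule that)
  let ?f = "\<one> # rev (map \<phi> as)"
  have "set (map \<phi> as) \<subseteq> ?H" using as(1) mem_fgen[OF S] base_preimage[OF x(1)] q by auto
  then have fH: "?f \<in> carrier (?H[X])"
   using one_not_zero subringE(3)[OF subfieldE(1)[OF HF]] by (simp add: univ_poly_carrier[symmetric] polynomial_def)
  have ev: "eval ?f (\<phi> t) = \<zero>" if "t \<in> T" for t
   using arg_cong[OF root[OF that], of \<phi>] by (simp add: phi_peval del: phi_eq_iff)
  have "card (\<phi> ` T) = card T" by (intro card_image inj_onI) simp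
  then have "degree ?f \<le> card (\<phi> ` T)" using as(2) by simp
  moreover have "eval ?f a = \<zero>" using ev[OF T(2)] a by simp
  ultimately show "\<exists>f T. f \<in> carrier (?H[X]) \<and> f \<noteq> [] \<and> eval f a = \<zero> \<and> finite T \<and> T \<subseteq> carrier L \<and>
    (\<forall>b\<in>T. eval f b = \<zero>) \<and> degree f \<le> card T"
   using fH T(1) ev by (intro exI[of _ ?f] exI[of _ "\<phi> ` T"]) auto
 qed
qed

definition to_aut :: "('a => 'a) => 'b => 'b" where "to_aut u = \<psi> \<circ> u \<circ> \<phi>"
definition from_aut :: "('b => 'b) => 'a => 'a" where "from_aut f = restrict (\<phi> \<circ> f \<circ> \<psi>) (carrier L)"

lemma automorphism_group:
 defines "G \<equiv> field_aut_group L k"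
 shows "\<exists>C \<xi>. elementary_abelian p (G\<lparr>carrier := translation_group L k q x s z\<rparr>) \<and> card (translation_group L k q x s z) = q ^ 2 \<and>
  subgroup C G \<and> cyclic_group (G\<lparr>carrier := C\<rparr>) \<and> card C = m * (q - 1) \<and>
  \<xi> \<in> carrier G \<and> \<xi> x = inv x \<and> \<xi> s = z \<and> \<xi> z = s \<and> group.ord G \<xi> = 2 \<and>
  (let B = C <#>\<^bsub>G\<^esub> generate G {\<xi>}
   in internal_semidirect (G\<lparr>carrier := B\<rparr>) C (generate G {\<xi>}) \<and>
    internal_semidirect G (translation_group L k q x s z) B)"
proof -
 interpret C: cfield dv iv mt on ad ze mi um "\<phi> -` k" "%_. p" "\<psi> x" "\<psi> s" "\<psi> z" "%_. h" "%_. m"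
  by (rule cfield_instance)
 have psi_bij: "bij_betw \<psi> (carrier L) UNIV" unfolding \<psi>_def by (rule bij_betw_inv_into[OF bij])
 have GD: "u \<in> carrier G \<longleftrightarrow> u \<in> ring_hom L L \<and> u \<in> Bij (carrier L) \<and> (\<forall>a\<in>k. u a = a)" for u
  by (auto simp: G_def field_aut_group_def)
 have Gm: "u \<otimes>\<^bsub>G\<^esub> v = compose (carrier L) u v" if "u \<in> carrier G" "v \<in> carrier G" for u v
  using that GD by (simp add: G_def field_aut_group_def BijGroup_def)
 have G1: "\<one>\<^bsub>G\<^esub> = (\<lambda>a\<in>carrier L. a)" by (simp add: G_def field_aut_group_def BijGroup_def)
 have in_L: "u a \<in> carrier L" if "u \<in> carrier G" "a \<in> carrier L" for u a
  using that GD by (auto simp: ring_hom_closed)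
 have aut_to: "C.aut (to_aut u)" if u: "u \<in> carrier G" for u
 proof -
  have hom: "u \<in> ring_hom L L" and bj: "bij_betw u (carrier L) (carrier L)" and fx: "\<forall>a\<in>k. u a = a"
   using u GD by (auto simp: Bij_def)
  have "bij (to_aut u)"
   using bij_betw_trans[OF bij_betw_trans[OF bij bj] psi_bij] by (simp add: to_aut_def comp_assoc)
  moreover have "C.homon UNIV (to_aut u)" unfolding C.homon_def
  proof (intro conjI ballI)
   show "to_aut u on = on" by (rule eqI) (simp add: to_aut_def ring_hom_one[OF hom])
   fix b c
   show "to_aut u (ad b c) = ad (to_aut u b) (to_aut u c)"
    by (rule eqI) (simp add: to_aut_def ring_hom_add[OF hom] in_L[OF u])
   show "to_aut u (mt b c) = mt (to_aut u b) (to_aut u c)"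
    by (rule eqI) (simp add: to_aut_def ring_hom_mult[OF hom] in_L[OF u])
  qed
  moreover have "\<forall>c\<in>\<phi> -` k. to_aut u c = c" using fx by (simp add: to_aut_def)
  ultimately show ?thesis unfolding C.aut_def by blast
 qed
 have from_val: "from_aut f (\<phi> b) = \<phi> (f b)" for f b by (simp add: from_aut_def)
 have from_in: "from_aut f \<in> carrier G" if f: "C.aut f" for f
  unfolding GD
 proof (intro conjI ballI)
  note A = C.autD[OF f]
  show "from_aut f \<in> ring_hom L L"
  proof (rule ring_hom_memI)
   fix a b assume ab: "a \<in> carrier L" "b \<in> carrier L"
   obtain a' b' where e: "a = \<phi> a'" "b = \<phi> b'" using ab phi_psi by metis
   show "from_aut f a \<in> carrier L" unfolding e from_val by simp
   show "from_aut f (a \<otimes> b) = from_aut f a \<otimes> from_aut f b"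
    unfolding e using from_val[of f "mt a' b'"] A(5)[of a' b'] by (simp add: from_val)
   show "from_aut f (a \<oplus> b) = from_aut f a \<oplus> from_aut f b"
    unfolding e using from_val[of f "ad a' b'"] A(4)[of a' b'] by (simp add: from_val)
  next
   show "from_aut f \<one> = \<one>" using from_val[of f on] A(7) by simp
  qed
  have "bij_betw (\<phi> \<circ> f \<circ> \<psi>) (carrier L) (carrier L)"
   using bij_betw_trans[OF psi_bij bij_betw_trans[OF A(1) bij]] by simp
  then have "bij_betw (from_aut f) (carrier L) (carrier L)" by (rule bij_betw_cong[THEN iffD1, rotated]) (simp add: from_aut_def)
  then show "from_aut f \<in> Bij (carrier L)" by (simp add: Bij_def from_aut_def)
  fix a assume a: "a \<in> k"
  then have "a \<in> carrier L" using kL by blast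
  then show "from_aut f a = a" using A(3)[of "\<psi> a"] a by (simp add: from_aut_def)
 qed
 have to_from: "to_aut (from_aut f) = f" for f by (rule ext) (simp add: to_aut_def from_val)
 have from_to: "from_aut (to_aut u) = u" if u: "u \<in> carrier G" for u
 proof
  fix a
  show "from_aut (to_aut u) a = u a"
  proof (cases "a \<in> carrier L")
   case True then show ?thesis by (simp add: from_aut_def to_aut_def in_L[OF u])
  next
   case False
   have "u \<in> Bij (carrier L)" using u GD by blast
   then have "u a = undefined" using extensional_arb[OF Bij_imp_extensional False] by blast
   then show ?thesis using False by (simp add: from_aut_def)
  qed
 qed
 have comp: "compose (carrier L) (from_aut f) (from_aut g) = from_aut (f \<circ> g)" for f g
 proof
  fix a show "compose (carrier L) (from_aut f) (from_aut g) a = from_aut (f \<circ> g) a"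
   by (cases "a \<in> carrier L") (simp_all add: compose_def from_aut_def)
 qed
 have mult: "from_aut f \<otimes>\<^bsub>G\<^esub> from_aut g = from_aut (f \<circ> g)" if "C.aut f" "C.aut g" for f g
  using Gm[OF from_in[OF that(1)] from_in[OF that(2)]] comp by simp
 have one: "\<one>\<^bsub>G\<^esub> = from_aut (%b. b)" unfolding G1 from_aut_def by (auto simp: fun_eq_iff)
 have fromE: "\<exists>f. C.aut f \<and> u = from_aut f" if "u \<in> carrier G" for u using aut_to[OF that] from_to[OF that, symmetric] by blast
 have G: "group G"
 proof (rule groupI)
  show "\<one>\<^bsub>G\<^esub> \<in> carrier G" unfolding one by (rule from_in[OF C.aut_id])
  fix u assume "u \<in> carrier G"
  then obtain f where f: "C.aut f" "u = from_aut f" using fromE by blast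
  show "\<one>\<^bsub>G\<^esub> \<otimes>\<^bsub>G\<^esub> u = u" unfolding one f(2) mult[OF C.aut_id f(1)] by (simp add: comp_def)
  have "inv_into UNIV f \<circ> f = (%b. b)" using C.autD(1)[OF f(1)] by (simp add: fun_eq_iff bij_is_inj)
  then have "from_aut (inv_into UNIV f) \<otimes>\<^bsub>G\<^esub> u = \<one>\<^bsub>G\<^esub>" unfolding one f(2) mult[OF C.aut_inv[OF f(1)] f(1)] by simp
  then show "\<exists>v\<in>carrier G. v \<otimes>\<^bsub>G\<^esub> u = \<one>\<^bsub>G\<^esub>" using from_in[OF C.aut_inv[OF f(1)]] by blast
  fix v assume "v \<in> carrier G"
  then obtain g where g: "C.aut g" "v = from_aut g" using fromE by blast
  show "u \<otimes>\<^bsub>G\<^esub> v \<in> carrier G" unfolding f(2) g(2) mult[OF f(1) g(1)] by (rule from_in[OF C.aut_comp[OF f(1) g(1)]])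
  fix w assume "w \<in> carrier G"
  then obtain r where r: "C.aut r" "w = from_aut r" using fromE by blast
  show "u \<otimes>\<^bsub>G\<^esub> v \<otimes>\<^bsub>G\<^esub> w = u \<otimes>\<^bsub>G\<^esub> (v \<otimes>\<^bsub>G\<^esub> w)"
   unfolding f(2) g(2) r(2)
   by (simp only: mult[OF f(1) g(1)] mult[OF g(1) r(1)] mult[OF C.aut_comp[OF f(1) g(1)] r(1)] mult[OF f(1) C.aut_comp[OF g(1) r(1)]] comp_assoc)
 qed
 have inj: "inj_on to_aut (carrier G)" by (rule inj_on_inverseI[of _ from_aut]) (rule from_to)
 have img: "to_aut ` carrier G = {f. C.aut f}"
 proof
  show "to_aut ` carrier G \<subseteq> {f. C.aut f}" using aut_to by blast
  show "{f. C.aut f} \<subseteq> to_aut ` carrier G"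
  proof
   fix f assume "f \<in> {f. C.aut f}"
   then show "f \<in> to_aut ` carrier G" using from_in[of f] to_from[of f] by (intro image_eqI[of _ _ "from_aut f"]) auto
  qed
 qed
 have Pm: "to_aut (u \<otimes>\<^bsub>G\<^esub> v) = to_aut u \<circ> to_aut v" if uv: "u \<in> carrier G" "v \<in> carrier G" for u v
 proof -
  obtain f g where fg: "C.aut f" "u = from_aut f" "C.aut g" "v = from_aut g" using fromE[OF uv(1)] fromE[OF uv(2)] by blast
  show ?thesis unfolding fg(2,4) mult[OF fg(1,3)] to_from ..
 qed
 have pt: "to_aut u (\<psi> a) = c \<longleftrightarrow> u a = \<phi> c" if "u \<in> carrier G" "a \<in> carrier L" for u a c
  using that in_L[OF that] by (auto simp: to_aut_def)
 have D: "translation_group L k q x s z = {u \<in> carrier G. \<exists>a\<in>C.Om. \<exists>b\<in>C.Om. C.typ1 (to_aut u) on a b}"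
 proof -
  have Om: "a \<in> C.Om \<longleftrightarrow> \<phi> a \<in> k \<and> \<phi> a [^] q \<oplus> \<phi> a = \<zero>" for a
   using phi_eq_iff[of "ad (power.power on mt a q) a" ze] by (simp add: C.Om_def phi_power q del: phi_eq_iff)
  have OmE: "(\<exists>a\<in>C.Om. Q (\<phi> a)) \<longleftrightarrow> (\<exists>\<alpha>\<in>k. \<alpha> [^] q \<oplus> \<alpha> = \<zero> \<and> Q \<alpha>)" for Q
  proof
   assume "\<exists>\<alpha>\<in>k. \<alpha> [^] q \<oplus> \<alpha> = \<zero> \<and> Q \<alpha>"
   then obtain \<alpha> where al: "\<alpha> \<in> k" "\<alpha> [^] q \<oplus> \<alpha> = \<zero>" "Q \<alpha>" by blast
   then have "\<phi> (\<psi> \<alpha>) = \<alpha>" using kL by auto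
   then show "\<exists>a\<in>C.Om. Q (\<phi> a)" using al Om[of "\<psi> \<alpha>"] by (intro bexI[of _ "\<psi> \<alpha>"]) auto
  qed (auto simp: Om)
  have t: "C.typ1 (to_aut u) on a b \<longleftrightarrow> u x = x \<and> u s = s \<oplus> \<phi> a \<and> u z = z \<oplus> \<phi> b" if "u \<in> carrier G" for u a b
   unfolding C.typ1_translation using that x(1) s(1) z(1) by (simp add: pt)
  have "(\<exists>a\<in>C.Om. \<exists>b\<in>C.Om. C.typ1 (to_aut u) on a b) \<longleftrightarrow> (\<exists>\<alpha>\<in>k. \<exists>\<beta>\<in>k. \<alpha> [^] q \<oplus> \<alpha> = \<zero> \<and> \<beta> [^] q \<oplus> \<beta> = \<zero> \<and>
    u x = x \<and> u s = s \<oplus> \<alpha> \<and> u z = z \<oplus> \<beta>)" if "u \<in> carrier G" for u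
  proof -
   let ?E = "%\<alpha>. \<alpha> [^] q \<oplus> \<alpha> = \<zero>" and ?Q = "%\<alpha> \<beta>. u x = x \<and> u s = s \<oplus> \<alpha> \<and> u z = z \<oplus> \<beta>"
   have 1: "(\<exists>b\<in>C.Om. ?Q (\<phi> a) (\<phi> b)) \<longleftrightarrow> (\<exists>\<beta>\<in>k. ?E \<beta> \<and> ?Q (\<phi> a) \<beta>)" for a by (rule OmE)
   have 2: "(\<exists>a\<in>C.Om. \<exists>\<beta>\<in>k. ?E \<beta> \<and> ?Q (\<phi> a) \<beta>) \<longleftrightarrow> (\<exists>\<alpha>\<in>k. ?E \<alpha> \<and> (\<exists>\<beta>\<in>k. ?E \<beta> \<and> ?Q \<alpha> \<beta>))"
    by (rule OmE)
   show ?thesis unfolding t[OF that] 1 2 by blast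
  qed
  then show ?thesis unfolding translation_group_def G_def[symmetric] by blast
 qed
 obtain C' t where S: "elementary_abelian p (G\<lparr>carrier := translation_group L k q x s z\<rparr>)"
   "card (translation_group L k q x s z) = (p ^ h) ^ 2" "subgroup C' G" "cyclic_group (G\<lparr>carrier := C'\<rparr>)"
   "card C' = m * (p ^ h - Suc 0)"
  and t: "t \<in> carrier G" "to_aut t (\<psi> x) = iv (\<psi> x)" "to_aut t (\<psi> s) = \<psi> z" "to_aut t (\<psi> z) = \<psi> s"
  and rest: "group.ord G t = 2" "let B = C' <#>\<^bsub>G\<^esub> generate G {t}
   in internal_semidirect (G\<lparr>carrier := B\<rparr>) C' (generate G {t}) \<and> internal_semidirect G (translation_group L k q x s z) B"
  using C.automorphism_group_structure[OF G inj img Pm D] by blast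
 have "t x = inv x" "t s = z" "t z = s"
  using t x(1) s(1) z(1) phi_iv(1)[of "\<psi> x"] C.xx_nz by (simp_all add: pt)
 then show ?thesis using S t(1) rest q by (intro exI[of _ C'] exI[of _ t]) simp
qed

end
end
end

section \<open>The automorphism group of the Galois closure\<close>

theorem theorem5p1:
  fixes L :: "('a, 'b) ring_scheme" and k Fq F H :: "'a set" and x y :: 'a
    and p h q m :: nat
  assumes "Factorial_Ring.prime p" and "odd p" and "h \<ge> 1" and "q = p ^ h"
    and "m \<ge> 1" and "coprime m p"
    and "field L" and "subfield k L"
    and "algebraic_closure (L\<lparr>carrier := k\<rparr>) Fq" and "card Fq = q"
    and "x \<in> carrier L" and "ring.transcendental L k x"
    and "y \<in> carrier L"
    and "y [^]\<^bsub>L\<^esub> q \<oplus>\<^bsub>L\<^esub> y = x [^]\<^bsub>L\<^esub> m \<oplus>\<^bsub>L\<^esub> inv\<^bsub>L\<^esub> (x [^]\<^bsub>L\<^esub> m)"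
    and "F = generate_field L (k \<union> {x, y})"
    and "H = generate_field L (k \<union> {x [^]\<^bsub>L\<^esub> (m * (q - 1))})"
    and "galois_closure L F H"
  shows "(q \<noteq> 3 \<longrightarrow> (\<exists>z\<in>carrier L. z [^]\<^bsub>L\<^esub> q \<oplus>\<^bsub>L\<^esub> z = x [^]\<^bsub>L\<^esub> m)) \<and>
    (\<forall>z\<in>carrier L. z [^]\<^bsub>L\<^esub> q \<oplus>\<^bsub>L\<^esub> z = x [^]\<^bsub>L\<^esub> m \<longrightarrow>
      carrier L = generate_field L (k \<union> {x, y, z}) \<and>
      (let G = field_aut_group L k;
           s = y \<ominus>\<^bsub>L\<^esub> z;
           \<Delta> = translation_group L k q x s z
       in \<exists>C \<xi>.
            elementary_abelian p (G\<lparr>carrier := \<Delta>\<rparr>) \<and> card \<Delta> = q ^ 2 \<and>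
            subgroup C G \<and> cyclic_group (G\<lparr>carrier := C\<rparr>) \<and> card C = m * (q - 1) \<and>
            \<xi> \<in> carrier G \<and> \<xi> x = inv\<^bsub>L\<^esub> x \<and> \<xi> s = z \<and> \<xi> z = s \<and> group.ord G \<xi> = 2 \<and>
            (let B = C <#>\<^bsub>G\<^esub> generate G {\<xi>}
             in internal_semidirect (G\<lparr>carrier := B\<rparr>) C (generate G {\<xi>}) \<and>
                internal_semidirect G \<Delta> B)))"
proof -
 note p = assms(1) and odd = assms(2) and h = assms(3) and q = assms(4) and m = assms(5) and cop = assms(6)
  and k = assms(8) and clo = assms(9) and cq = assms(10) and x = assms(11,12) and y = assms(13,14)
 interpret L: Ring.field L by (rule assms(7))
 have kL: "k \<subseteq> carrier L" by (rule subringE(1)[OF subfieldE(1)[OF k]])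
 have gal: "galois_extension L H" and HF: "H \<subseteq> F"
  and minimal: "\<And>M. subfield M L ==> F \<subseteq> M ==> galois_extension (L\<lparr>carrier := M\<rparr>) H ==> M = carrier L"
  using assms(17) by (auto simp: galois_closure_def)
 have SH: "k \<union> {x [^]\<^bsub>L\<^esub> (m * (q - 1))} \<subseteq> carrier L" using kL x(1) by simp
 have subH: "subfield H L" unfolding assms(16) by (rule L.generate_field_is_subfield[OF SH])
 interpret K: Ring.field "L\<lparr>carrier := k\<rparr>" by (rule L.subfield_iff(2)[OF k])
 interpret A: algebraic_closure "L\<lparr>carrier := k\<rparr>" Fq by (rule clo)
 have "finite Fq" using p cq q by (metis card.infinite not_prime_0 power_not_zero)
 then have "countable (carrier (L\<lparr>carrier := k\<rparr>))"
  by (intro K.algebraic_countable[OF A.subfield_axioms] countable_finite A.algebraic_extension)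
 then have "countable H" unfolding assms(16) by (intro L.generate_field_countable SH) simp
 then have cL: "countable (carrier L)"
  using gal by (intro L.algebraic_countable[OF subH]) (auto simp: galois_extension_def over_def)
 have infL: "infinite (carrier L)" using L.transcendental_infinite[OF subfieldE(1)[OF k] x] x(1) by simp
 obtain \<phi> :: "nat => 'a" where "transport L \<phi>" using transport_exists[OF assms(7) cL infL] by blast
 then interpret T: transport L \<phi> .
 have part1: "q \<noteq> 3 --> (\<exists>z\<in>carrier L. z [^]\<^bsub>L\<^esub> q \<oplus>\<^bsub>L\<^esub> z = x [^]\<^bsub>L\<^esub> m)"
  using T.artin_schreier_root_exists[OF p q k clo cq odd h _ m x y gal[unfolded assms(16)]] by blast
 have part2: "carrier L = generate_field L (k \<union> {x, y, z}) \<and>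
   generate_field L (k \<union> {x, y \<ominus>\<^bsub>L\<^esub> z, z}) = carrier L \<and>
   ((y \<ominus>\<^bsub>L\<^esub> z) [^]\<^bsub>L\<^esub> q \<oplus>\<^bsub>L\<^esub> (y \<ominus>\<^bsub>L\<^esub> z)) \<otimes>\<^bsub>L\<^esub> x [^]\<^bsub>L\<^esub> m = \<one>\<^bsub>L\<^esub>"
  if z: "z \<in> carrier L" "z [^]\<^bsub>L\<^esub> q \<oplus>\<^bsub>L\<^esub> z = x [^]\<^bsub>L\<^esub> m" for z
 proof -
  define s where "s = y \<ominus>\<^bsub>L\<^esub> z"
  have sL: "s \<in> carrier L" using y z by (simp add: s_def)
  have x0: "x \<noteq> \<zero>\<^bsub>L\<^esub>"
  proof
   assume "x = \<zero>\<^bsub>L\<^esub>"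
   then show False using L.zero_is_algebraic[OF subfieldE(1)[OF k]] x(2) by (simp add: over_def)
  qed
  then have xm: "x [^]\<^bsub>L\<^esub> m \<in> Units L" using x(1) L.field_Units L.Units_pow_closed by auto
  then have ixm: "inv\<^bsub>L\<^esub> (x [^]\<^bsub>L\<^esub> m) \<in> carrier L" by simp
  have "s [^]\<^bsub>L\<^esub> q \<oplus>\<^bsub>L\<^esub> s = inv\<^bsub>L\<^esub> (x [^]\<^bsub>L\<^esub> m)"
   unfolding s_def by (rule T.difference_root[OF p q k clo cq odd y z]) (use x(1) ixm in simp_all)
  then have s: "(s [^]\<^bsub>L\<^esub> q \<oplus>\<^bsub>L\<^esub> s) \<otimes>\<^bsub>L\<^esub> x [^]\<^bsub>L\<^esub> m = \<one>\<^bsub>L\<^esub>" using xm by simp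
  define M where "M = generate_field L (k \<union> {x, y, z})"
  have SM: "k \<union> {x, y, z} \<subseteq> carrier L" using kL x y z by simp
  have M: "subfield M L" unfolding M_def by (rule L.generate_field_is_subfield[OF SM])
  have SsubM: "k \<union> {x, y, z} \<subseteq> M" unfolding M_def by (rule generate_field.incl[THEN subsetI])
  note MD = subringE[OF subfieldE(1)[OF M]]
  let ?M = "L\<lparr>carrier := M\<rparr>"
  interpret M: Ring.field ?M by (rule L.subfield_iff(2)[OF M])
  have pw: "a [^]\<^bsub>?M\<^esub> i = a [^]\<^bsub>L\<^esub> i" for a and i :: nat by (simp add: nat_pow_def)
  have sM: "s \<in> M" unfolding s_def a_minus_def using MD(5,7) SsubM by simp
  have below: "subfield E ?M" if "subfield E L" "E \<subseteq> M" for E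
   by (rule M.subfield_iff(1)) (use L.subfield_iff(2)[OF that(1)] that(2) in simp_all)
  have kM: "subfield k ?M" by (rule below[OF k]) (use SsubM in simp)
  have SsM: "k \<union> {x, s, z} \<subseteq> carrier ?M" using SsubM sM by simp
  have genM: "generate_field ?M (k \<union> {x, s, z}) = carrier ?M"
  proof
   let ?E = "generate_field ?M (k \<union> {x, s, z})"
   show "?E \<subseteq> carrier ?M" by (rule M.generate_field_incl[OF SsM])
   have E: "subfield ?E L" by (rule T.subfield_below[OF M M.generate_field_is_subfield[OF SsM]])
   have inc: "k \<union> {x, s, z} \<subseteq> ?E" by (rule generate_field.incl[THEN subsetI])
   have "y = s \<oplus>\<^bsub>L\<^esub> z" unfolding s_def a_minus_def using y(1) z(1) by (simp add: L.a_assoc L.l_neg)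
   moreover have "s \<oplus>\<^bsub>L\<^esub> z \<in> ?E" using inc by (intro subringE(7)[OF subfieldE(1)[OF E]]) auto
   ultimately have "k \<union> {x, y, z} \<subseteq> ?E" using inc by simp
   then show "carrier ?M \<subseteq> ?E" using L.generate_field_min_subfield1[OF SM E] by (simp add: M_def)
  qed
  have xM: "x \<in> carrier ?M" "ring.transcendental ?M k x"
   using SsubM x(2) L.transcendental_consistent[OF subfieldE(1)[OF M]] by (simp_all add: over_def)
  have "infinite (carrier ?M)" using M.transcendental_infinite[OF subfieldE(1)[OF kM] xM] xM(1) by (metis M.nat_pow_closed)
  moreover have "countable (carrier ?M)" using countable_subset[OF MD(1) cL] by simp
  ultimately obtain \<phi>' :: "nat => 'a" where "transport ?M \<phi>'" using transport_exists[OF M.field_axioms] by blast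
  then interpret TM: transport ?M \<phi>' .
  have "galois_extension ?M (generate_field ?M (k \<union> {x [^]\<^bsub>?M\<^esub> (m * (q - 1))}))"
   by (rule TM.galois_over_base[OF p q kM _ cq odd h m cop xM _ _ _ _ genM]) (use clo s z sM SsubM in \<open>simp_all add: pw\<close>)
  moreover have "generate_field ?M (k \<union> {x [^]\<^bsub>?M\<^esub> (m * (q - 1))}) = H"
  proof
   have SHM: "k \<union> {x [^]\<^bsub>?M\<^esub> (m * (q - 1))} \<subseteq> carrier ?M" using SsubM M.nat_pow_closed[OF xM(1)] by simp
   let ?E = "generate_field ?M (k \<union> {x [^]\<^bsub>?M\<^esub> (m * (q - 1))})"
   have inH: "k \<union> {x [^]\<^bsub>?M\<^esub> (m * (q - 1))} \<subseteq> H" unfolding assms(16) pw by (rule generate_field.incl[THEN subsetI])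
   have "H \<subseteq> M" unfolding assms(16)
    by (rule L.generate_field_min_subfield1[OF SH M]) (use SHM pw in simp)
   then show "?E \<subseteq> H" by (intro M.generate_field_min_subfield1[OF SHM below[OF subH]] inH)
   have "subfield ?E L" by (rule T.subfield_below[OF M M.generate_field_is_subfield[OF SHM]])
   moreover have "k \<union> {x [^]\<^bsub>L\<^esub> (m * (q - 1))} \<subseteq> ?E" unfolding pw[symmetric] by (rule generate_field.incl[THEN subsetI])
   ultimately show "H \<subseteq> ?E" unfolding assms(16) by (rule L.generate_field_min_subfield1[OF SH])
  qed
  moreover have "F \<subseteq> M" unfolding assms(15)
   by (rule L.generate_field_min_subfield1[OF _ M]) (use kL x y SsubM in auto)
  ultimately have M_all: "M = carrier L" using minimal[OF M] by simp
  then have "generate_field L (k \<union> {x, s, z}) = carrier L" using genM by simp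
  then show ?thesis using M_all s by (simp add: M_def s_def)
 qed
 show ?thesis
 proof (intro conjI part1 ballI impI)
  fix z assume z: "z \<in> carrier L" "z [^]\<^bsub>L\<^esub> q \<oplus>\<^bsub>L\<^esub> z = x [^]\<^bsub>L\<^esub> m"
  note P = part2[OF z]
  show "carrier L = generate_field L (k \<union> {x, y, z})" using P by blast
  have "y \<ominus>\<^bsub>L\<^esub> z \<in> carrier L" using y z by simp
  from T.automorphism_group[OF p q k clo cq odd h m cop x this _ z] P
  show "let G = field_aut_group L k; s = y \<ominus>\<^bsub>L\<^esub> z; \<Delta> = translation_group L k q x s z
    in \<exists>C \<xi>.
      elementary_abelian p (G\<lparr>carrier := \<Delta>\<rparr>) \<and> card \<Delta> = q ^ 2 \<and>
      subgroup C G \<and> cyclic_group (G\<lparr>carrier := C\<rparr>) \<and> card C = m * (q - 1) \<and>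
      \<xi> \<in> carrier G \<and> \<xi> x = inv\<^bsub>L\<^esub> x \<and> \<xi> s = z \<and> \<xi> z = s \<and> group.ord G \<xi> = 2 \<and>
      (let B = C <#>\<^bsub>G\<^esub> generate G {\<xi>}
       in internal_semidirect (G\<lparr>carrier := B\<rparr>) C (generate G {\<xi>}) \<and>
        internal_semidirect G \<Delta> B)"
   unfolding Let_def by blast
 qed
qed

end
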